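(* Let $L$ be a normalized positive left Pieri state on $\mathcal G$. The following conditions are equivalent: (i) $L(F_{C_m}F_\tau)=L(F_{C_m})$ for every $m\ge3$ (chain identities); (ii) $L(xF_\tau)=L(x)$ for every $x\in\mathcal G$; (iii) $L(xy)=L(yx)$ for every $x,y\in\mathcal G$; (iv) $L(\mathcal I_{\mathrm{pf}})=0$; (v) there is a unique $\rho\in\mathcal P(\nabla_\infty)$ such that $L(x)=\int_{\nabla_\infty}\psi_p(x)\,\rho(dp)$ for all $x\in\mathcal G$. The central laws $\mu_L$ of the states $L$ satisfying these equivalent conditions are exactly the central laws supported on the path-forest subgraph, i.e. those in $$\mathscr C_{\mathrm{pf}}=\{\mu\in\mathscr C(\Gamma):\mu(X_n\text{ is path-forest})=1\text{ for every }n\ge1\}.$$ The set $\mathscr C_{\mathrm{pf}}$ is a proper exposed face of $\mathscr C(\Gamma)$ and a Bauer simplex, it is affinely homeomorphic to $\mathcal P(\nabla_\infty)$, and its extreme points are the laws $\mu^p:=\mu_{\psi_p}$, $p\in\nabla_\infty$. The face is exposed by a positive weighted sum of the chain commutator values, namely by $$\mu_L\longmapsto\sum_{m\ge3}2^{-m}\,L\big(F_\tau F_{C_m}-F_{C_m}F_\tau\big).$$ Moreover, for each $m\ge3$, there exists a normalized positive left Pieri state satisfying the identity $L(F_{C_k}F_\tau)=L(F_{C_k})$ for all $k\ge3$ with $k\ne m$ but not for $k=m$.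
   Context: Rooted trees are finite, unlabelled and non-plane (considered up to root-preserving isomorphism). $\mathcal T_n$ is the set of those with $n$ vertices, $\mathcal T=\bigsqcup_{n\ge1}\mathcal T_n$; $V(t)$ is the vertex set of (a representative of) $t$. $\bullet$ is the one-vertex tree, $C_m$ is the chain (path rooted at an end) with $m$ vertices, and $\tau=C_2$. The real Grossman--Larson algebra $\mathcal G$ has basis $(F_t)_{t\in\mathcal T}$ and product $F_sF_t=\sum_{f:\{1,\dots,k\}\to V(t)}F_{t\circ_f(s_1,\dots,s_k)}$, where $s_1,\dots,s_k$ are the root branches of $s$ (the trees left after deleting the root of $s$, rooted at the children of that root, treated as distinct occurrences) and $t\circ_f(s_1,\dots,s_k)$ is the tree, with the root of $t$ as root, obtained by joining the root of each $s_i$ by an edge to $f(i)$. It is associative with unit $F_\bullet$. A normalized positive left Pieri state is a linear functional $L:\mathcal G\to\mathbb R$ with $L(F_\bullet)=1$, $L(F_t)\ge0$ for all $t\in\mathcal T$, and $L(F_\tau x)=L(x)$ for all $x\in\mathcal G$. A tree is path-forest if every non-root vertex has at most one child. For an integer partition $\lambda$, $P_\lambda$ is the path-forest tree whose root branches are chains with $\lambda_1,\lambda_2,\dots$ vertices. $\mathcal I_{\mathrm{pf}}$ is the linear span of the $F_t$ with $t$ not path-forest. $\Lambda=\mathbb R[\mathsf p_1,\mathsf p_2,\dots]$ is the algebra of symmetric functions ($\mathsf p_k$ the power sums), $m_\lambda$ the monomial symmetric function, $\widetilde m_\lambda=\big(\prod_{j\ge1}r_j(\lambda)!\big)m_\lambda$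 with $r_j(\lambda)$ the multiplicity of the part $j$. $\nabla_\infty=\{p_1\ge p_2\ge\cdots\ge0:\sum_ip_i\le1\}$ with the product topology; $\mathcal P(E)$ is the space of Borel probability measures on $E$ with the weak topology. For $p\in\nabla_\infty$, $\chi_p:\Lambda\to\mathbb R$ is the unital algebra homomorphism with $\chi_p(\mathsf p_1)=1$, $\chi_p(\mathsf p_k)=\sum_ip_i^k$ ($k\ge2$), and $\psi_p:\mathcal G\to\mathbb R$ is the linear functional with $\psi_p(F_{P_\lambda})=\chi_p(\widetilde m_\lambda)$ and $\psi_p(F_t)=0$ for $t$ not path-forest (it is a character of $\mathcal G$ and a normalized positive left Pieri state). For trees $s,t$, $n(s;t)$ is the number of $v\in V(s)$ such that attaching a new leaf at $v$ yields $t$. The Hoffman graph $\Gamma$ has vertex set $\mathcal T$ and $n(s;t)$ edge copies from $s$ to $t$; $u(t)$ is the number of paths of edge copies from $\bullet$ to $t$. $\mathcal X_\Gamma$ is the space of infinite paths $(e_n)_{n\ge1}$ of edge copies starting at $\bullet$ ($e_n$ going from $\mathcal T_n$ to $\mathcal T_{n+1}$), a closed subspace of a product of finite discrete sets; $X_n\in\mathcal T_n$ is the $n$-th vertex of the path; $C_\gamma$ is the cylinder of paths with finite prefix $\gamma$ starting at $\bullet$. A Borel probability measure $\mu$ on $\mathcal X_\Gamma$ is central if $\mu(C_\gamma)=\mu(X_n=t)/u(t)$ for every prefix $\gamma$ ending at $t\in\mathcal T_n$. $\mathscr C(\Gamma)$ is the compact convex set of central measures with the weak topology. The map $L\mapsto\mu_L$,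 $\mu_L(C_\gamma)=L(F_t)$ for $\gamma$ ending at $t$, is an affine homeomorphism from normalized positive left Pieri states (with pointwise convergence on the tree basis) onto $\mathscr C(\Gamma)$. An exposed face of a compact convex set is the set of minimizers of a continuous affine functional. A Bauer simplex is a compact convex set whose extreme points form a closed set and each of whose points is the barycentre of a unique probability measure on that set. *)

theory Defs
  imports "HOL-Probability.Probability" "HOL-Library.Poly_Mapping"
begin

section \<open>Rooted trees\<close>

text \<open>Elements of this type are equal iff they are isomorphic as rooted trees, so the type
  itself is the set of finite, unlabelled, non-plane rooted trees.\<close>

datatype rtree = Node (branches: "rtree multiset")

text \<open>Plane trees serve only as representatives with an honest vertex set: a vertex is
  the list of child indices leading to it from the root, and the root is the empty list.\<close>

datatype ptree = PNode "ptree list"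

primrec shape :: "ptree \<Rightarrow> rtree" where
  "shape (PNode ts) = Node (mset (map shape ts))"

lemma shape_surj: "\<exists>p. shape p = t"
proof (induction t)
  case (Node B)
  obtain ts where ts: "mset ts = B" by (metis ex_mset)
  have "\<forall>b\<in>set ts. \<exists>p. shape p = b" using Node ts by auto
  then obtain r where "\<forall>b\<in>set ts. shape (r b) = b" by metis
  then have "map (\<lambda>b. shape (r b)) ts = ts" by (simp add: map_idI)
  then have "shape (PNode (map r ts)) = Node B" using ts by (simp add: o_def flip: mset_map)
  then show ?case by blast
qed

definition rep :: "rtree \<Rightarrow> ptree" where
  "rep t = (SOME p. shape p = t)"

lemma shape_rep [simp]: "shape (rep t) = t"
  unfolding rep_def by (rule someI_ex) (rule shape_surj)

type_synonym vertex = "nat list"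

inductive_set pverts :: "(ptree \<times> vertex) set" where
  root: "(p, []) \<in> pverts"
| child: "i < length ts \<Longrightarrow> (ts ! i, v) \<in> pverts \<Longrightarrow> (PNode ts, i # v) \<in> pverts"

definition verts :: "rtree \<Rightarrow> vertex set" where
  "verts t = {v. (rep t, v) \<in> pverts}"

text \<open>\<open>pgraft p g\<close> is the tree obtained from \<open>p\<close> by joining, for every vertex \<open>v\<close> of \<open>p\<close>, the
  root of each tree in the multiset \<open>g v\<close> by an edge to \<open>v\<close>.\<close>

function pgraft :: "ptree \<Rightarrow> (vertex \<Rightarrow> rtree multiset) \<Rightarrow> rtree" where
  "pgraft (PNode ts) g =
     Node (g [] + mset (map (\<lambda>(i, s). pgraft s (\<lambda>v. g (i # v))) (List.enumerate 0 ts)))"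
  by pat_completeness auto
termination
  by (relation "Wellfounded.measure (\<lambda>(p, _). size p)")
     (auto simp: in_set_enumerate_eq less_Suc_eq_le intro!: size_list_estimation' nth_mem)

abbreviation graft :: "rtree \<Rightarrow> (vertex \<Rightarrow> rtree multiset) \<Rightarrow> rtree" where
  "graft t \<equiv> pgraft (rep t)"

abbreviation leaf :: rtree where
  "leaf \<equiv> Node {#}"

text \<open>The chain with \<open>m\<close> vertices, for \<open>m \<ge> 1\<close>.\<close>

definition chain_tree :: "nat \<Rightarrow> rtree" where
  "chain_tree m = ((\<lambda>t. Node {#t#}) ^^ (m - 1)) leaf"

abbreviation tau :: rtree (\<open>\<tau>\<close>) where
  "\<tau> \<equiv> chain_tree 2"

definition path_forest :: "rtree \<Rightarrow> bool" where
  "path_forest t \<longleftrightarrow> (\<forall>v\<in>verts t. v \<noteq> [] \<longrightarrow> card {i. v @ [i] \<in> verts t} \<le> 1)"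

text \<open>Integer partitions are multisets of positive integers.\<close>

definition is_partition :: "nat multiset \<Rightarrow> bool" where
  "is_partition l \<longleftrightarrow> 0 \<notin># l"

definition path_forest_tree :: "nat multiset \<Rightarrow> rtree" where
  "path_forest_tree l = Node (image_mset chain_tree l)"


section \<open>The Grossman--Larson algebra\<close>

instantiation poly_mapping :: (type, real_vector) real_vector
begin

lift_definition scaleR_poly_mapping :: "real \<Rightarrow> ('a \<Rightarrow>\<^sub>0 'b) \<Rightarrow> ('a \<Rightarrow>\<^sub>0 'b)"
  is "\<lambda>c f a. c *\<^sub>R f a"
  by (rule finite_subset[rotated]) auto

instance
  by standard (transfer; simp add: scaleR_right_distrib scaleR_left_distrib fun_eq_iff)+

end

type_synonym gl_algebra = "rtree \<Rightarrow>\<^sub>0 real"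

definition basis :: "rtree \<Rightarrow> gl_algebra" (\<open>\<F>\<close>) where
  "\<F> t = Poly_Mapping.single t 1"

definition branch_list :: "rtree \<Rightarrow> rtree list" where
  "branch_list s = (SOME ss. mset ss = branches s)"

definition circ :: "rtree \<Rightarrow> rtree list \<Rightarrow> (nat \<Rightarrow> vertex) \<Rightarrow> rtree" where
  "circ t ss f = graft t (\<lambda>v. image_mset ((!) ss) (mset_set {i. i < length ss \<and> f i = v}))"

definition gl_basis_mult :: "rtree \<Rightarrow> rtree \<Rightarrow> gl_algebra" where
  "gl_basis_mult s t =
     (\<Sum>f\<in>{..<length (branch_list s)} \<rightarrow>\<^sub>E verts t. \<F> (circ t (branch_list s) f))"

definition gl_mult :: "gl_algebra \<Rightarrow> gl_algebra \<Rightarrow> gl_algebra" (infixl \<open>\<circledast>\<close> 70) where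
  "x \<circledast> y = (\<Sum>s\<in>Poly_Mapping.keys x. \<Sum>t\<in>Poly_Mapping.keys y.
     (Poly_Mapping.lookup x s * Poly_Mapping.lookup y t) *\<^sub>R gl_basis_mult s t)"

definition pieri_state :: "(gl_algebra \<Rightarrow> real) \<Rightarrow> bool" where
  "pieri_state L \<longleftrightarrow> linear L \<and> L (\<F> leaf) = 1 \<and> (\<forall>t. 0 \<le> L (\<F> t)) \<and> (\<forall>x. L (\<F> \<tau> \<circledast> x) = L x)"

definition I_pf :: "gl_algebra set" where
  "I_pf = span {\<F> t | t. \<not> path_forest t}"


section \<open>Symmetric functions\<close>

text \<open>A monomial in the variables \<open>x\<^sub>0, x\<^sub>1, \<dots>\<close> is the multiset of the indices of its factors, and a
  formal power series is given by its coefficients. \<open>Sym\<close> is the set of symmetric series of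
  bounded degree.\<close>

type_synonym series = "nat multiset \<Rightarrow> real"

definition ser_add :: "series \<Rightarrow> series \<Rightarrow> series" where
  "ser_add f g = (\<lambda>M. f M + g M)"

definition ser_scale :: "real \<Rightarrow> series \<Rightarrow> series" where
  "ser_scale c f = (\<lambda>M. c * f M)"

definition ser_mult :: "series \<Rightarrow> series \<Rightarrow> series" where
  "ser_mult f g = (\<lambda>M. \<Sum>A\<in>{A. A \<subseteq># M}. f A * g (M - A))"

definition ser_one :: series where
  "ser_one = (\<lambda>M. if M = {#} then 1 else 0)"

definition Sym :: "series set" where
  "Sym = {f. (\<forall>\<pi> M. bij \<pi> \<longrightarrow> f (image_mset \<pi> M) = f M) \<and> (\<exists>d. \<forall>M. f M \<noteq> 0 \<longrightarrow> size M \<le> d)}"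

definition power_sum :: "nat \<Rightarrow> series" where
  "power_sum k = (\<lambda>M. if \<exists>i. M = replicate_mset k i then 1 else 0)"

definition exponents :: "nat multiset \<Rightarrow> nat multiset" where
  "exponents M = image_mset (count M) (mset_set (set_mset M))"

definition mono_sym :: "nat multiset \<Rightarrow> series" where
  "mono_sym l = (\<lambda>M. if exponents M = l then 1 else 0)"

definition aug_mono_sym :: "nat multiset \<Rightarrow> series" where
  "aug_mono_sym l = ser_scale (\<Prod>j\<in>set_mset l. fact (count l j)) (mono_sym l)"

definition sym_hom :: "(series \<Rightarrow> real) \<Rightarrow> bool" where
  "sym_hom h \<longleftrightarrow> h ser_one = 1 \<and>
     (\<forall>c. \<forall>f\<in>Sym. h (ser_scale c f) = c * h f) \<and>
     (\<forall>f\<in>Sym. \<forall>g\<in>Sym. h (ser_add f g) = h f + h g \<and> h (ser_mult f g) = h f * h g)"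

text \<open>The coordinates \<open>p\<^sub>1 \<ge> p\<^sub>2 \<ge> \<dots>\<close> are indexed from 0.\<close>

definition nabla :: "(nat \<Rightarrow> real) set" where
  "nabla = {p. decseq p \<and> (\<forall>i. 0 \<le> p i) \<and> summable p \<and> suminf p \<le> 1}"

text \<open>Extensionality on \<open>Sym\<close> only removes the arbitrary values outside \<open>Sym\<close>, so that the
  homomorphism is determined as a function on the whole type.\<close>

definition chi :: "(nat \<Rightarrow> real) \<Rightarrow> series \<Rightarrow> real" where
  "chi p = (THE h. h \<in> extensional Sym \<and> sym_hom h \<and> h (power_sum 1) = 1 \<and>
     (\<forall>k\<ge>2. h (power_sum k) = suminf (\<lambda>i. p i ^ k)))"

definition psi_basis :: "(nat \<Rightarrow> real) \<Rightarrow> rtree \<Rightarrow> real" where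
  "psi_basis p t =
     (if path_forest t
      then chi p (aug_mono_sym (THE l. is_partition l \<and> t = path_forest_tree l))
      else 0)"

definition psi :: "(nat \<Rightarrow> real) \<Rightarrow> gl_algebra \<Rightarrow> real" where
  "psi p x = (\<Sum>t\<in>Poly_Mapping.keys x. Poly_Mapping.lookup x t * psi_basis p t)"


section \<open>Convex sets of probability measures\<close>

definition borel_of :: "'a topology \<Rightarrow> 'a measure" where
  "borel_of X = sigma (topspace X) {U. openin X U}"

definition prob_measures :: "'a topology \<Rightarrow> 'a measure set" where
  "prob_measures X = {\<mu>. prob_space \<mu> \<and> sets \<mu> = sets (borel_of X)}"

text \<open>The coarsest topology on \<open>prob_measures X\<close> making the integral of every bounded continuous
  function continuous.\<close>

definition weak_topology :: "'a topology \<Rightarrow> 'a measure topology" where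
  "weak_topology X = topology_generated_by
     {{\<mu>\<in>prob_measures X. (\<integral>x. f x \<partial>\<mu>) \<in> U} | f U.
        continuous_map X euclideanreal f \<and> bounded (f ` topspace X) \<and> open U}"

text \<open>The convex combination \<open>(1 - c) \<mu> + c \<nu>\<close> of two measures on the same \<open>\<sigma>\<close>-algebra.\<close>

definition mix :: "real \<Rightarrow> 'a measure \<Rightarrow> 'a measure \<Rightarrow> 'a measure" where
  "mix c \<mu> \<nu> = measure_of (space \<mu>) (sets \<mu>)
     (\<lambda>A. ennreal (1 - c) * emeasure \<mu> A + ennreal c * emeasure \<nu> A)"

text \<open>In the following, \<open>K\<close> is a set of probability measures on \<open>X\<close>, carrying the weak topology.\<close>

definition convex_laws :: "'a measure set \<Rightarrow> bool" where
  "convex_laws K \<longleftrightarrow> (\<forall>\<mu>\<in>K. \<forall>\<nu>\<in>K. \<forall>c\<in>{0..1}. mix c \<mu> \<nu> \<in> K)"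

definition cont_affine :: "'a topology \<Rightarrow> 'a measure set \<Rightarrow> ('a measure \<Rightarrow> real) \<Rightarrow> bool" where
  "cont_affine X K \<phi> \<longleftrightarrow>
     continuous_map (subtopology (weak_topology X) K) euclideanreal \<phi> \<and>
     (\<forall>\<mu>\<in>K. \<forall>\<nu>\<in>K. \<forall>c\<in>{0..1}. \<phi> (mix c \<mu> \<nu>) = (1 - c) * \<phi> \<mu> + c * \<phi> \<nu>)"

definition exposes ::
  "'a topology \<Rightarrow> 'a measure set \<Rightarrow> ('a measure \<Rightarrow> real) \<Rightarrow> 'a measure set \<Rightarrow> bool" where
  "exposes X K \<phi> F \<longleftrightarrow> cont_affine X K \<phi> \<and> F = {\<mu>\<in>K. \<forall>\<nu>\<in>K. \<phi> \<mu> \<le> \<phi> \<nu>}"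

definition exposed_face :: "'a topology \<Rightarrow> 'a measure set \<Rightarrow> 'a measure set \<Rightarrow> bool" where
  "exposed_face X K F \<longleftrightarrow> (\<exists>\<phi>. exposes X K \<phi> F)"

definition extreme_laws :: "'a measure set \<Rightarrow> 'a measure set" where
  "extreme_laws K =
     {\<mu>\<in>K. \<forall>\<nu>\<in>K. \<forall>\<kappa>\<in>K. \<forall>c\<in>{0<..<1}. \<mu> = mix c \<nu> \<kappa> \<longrightarrow> \<nu> = \<mu> \<and> \<kappa> = \<mu>}"

definition barycentre ::
  "'a topology \<Rightarrow> 'a measure set \<Rightarrow> 'a measure measure \<Rightarrow> 'a measure \<Rightarrow> bool" where
  "barycentre X K Q \<mu> \<longleftrightarrow>
     (\<forall>\<phi>. cont_affine X K \<phi> \<longrightarrow> has_bochner_integral Q \<phi> (\<phi> \<mu>))"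

definition bauer_simplex :: "'a topology \<Rightarrow> 'a measure set \<Rightarrow> bool" where
  "bauer_simplex X K \<longleftrightarrow>
     compactin (weak_topology X) K \<and> convex_laws K \<and>
     closedin (subtopology (weak_topology X) K) (extreme_laws K) \<and>
     (\<forall>\<mu>\<in>K. \<exists>!Q. Q \<in> prob_measures (subtopology (weak_topology X) (extreme_laws K)) \<and>
        barycentre X K Q \<mu>)"

definition affinely_homeomorphic ::
  "'a topology \<Rightarrow> 'a measure set \<Rightarrow> 'b topology \<Rightarrow> 'b measure set \<Rightarrow> bool" where
  "affinely_homeomorphic X K Y K' \<longleftrightarrow>
     (\<exists>h. homeomorphic_map (subtopology (weak_topology X) K) (subtopology (weak_topology Y) K') h \<and>
        (\<forall>\<mu>\<in>K. \<forall>\<nu>\<in>K. \<forall>c\<in>{0..1}. h (mix c \<mu> \<nu>) = mix c (h \<mu>) (h \<nu>)))"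


section \<open>The Hoffman graph and central measures\<close>

definition attach_leaf :: "rtree \<Rightarrow> vertex \<Rightarrow> rtree" where
  "attach_leaf s v = graft s (\<lambda>w. if w = v then {#leaf#} else {#})"

definition edge_mult :: "rtree \<Rightarrow> rtree \<Rightarrow> nat" where
  "edge_mult s t = card {v\<in>verts s. attach_leaf s v = t}"

datatype edge = Edge (src: rtree) (copy: nat) (tgt: rtree)

definition edges :: "edge set" where
  "edges = {e. copy e < edge_mult (src e) (tgt e)}"

primrec hpath :: "rtree \<Rightarrow> edge list \<Rightarrow> rtree \<Rightarrow> bool" where
  "hpath s [] t \<longleftrightarrow> s = t"
| "hpath s (e # es) t \<longleftrightarrow> e \<in> edges \<and> src e = s \<and> hpath (tgt e) es t"

definition num_paths :: "rtree \<Rightarrow> nat" where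
  "num_paths t = card {es. hpath leaf es t}"

text \<open>The edge \<open>e\<^sub>n\<close> of an infinite path \<open>(e\<^sub>n)\<^sub>n\<^sub>\<ge>\<^sub>1\<close> is \<open>\<omega> (n - 1)\<close>; correspondingly \<open>X\<^sub>n\<close> is the source
  of \<open>\<omega> (n - 1)\<close>, for \<open>n \<ge> 1\<close>.\<close>

definition inf_paths :: "(nat \<Rightarrow> edge) set" where
  "inf_paths = {\<omega>. src (\<omega> 0) = leaf \<and> (\<forall>n. \<omega> n \<in> edges \<and> tgt (\<omega> n) = src (\<omega> (Suc n)))}"

definition path_topology :: "(nat \<Rightarrow> edge) topology" where
  "path_topology = subtopology (product_topology (\<lambda>_. discrete_topology UNIV) UNIV) inf_paths"

definition nth_vertex :: "nat \<Rightarrow> (nat \<Rightarrow> edge) \<Rightarrow> rtree" where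
  "nth_vertex n \<omega> = src (\<omega> (n - 1))"

definition cylinder :: "edge list \<Rightarrow> (nat \<Rightarrow> edge) set" where
  "cylinder es = {\<omega>\<in>inf_paths. \<forall>i<length es. \<omega> i = es ! i}"

text \<open>A prefix with \<open>k\<close> edges ends in a tree with \<open>k + 1\<close> vertices.\<close>

definition central_measures :: "(nat \<Rightarrow> edge) measure set" where
  "central_measures = {\<mu>\<in>prob_measures path_topology. \<forall>es t. hpath leaf es t \<longrightarrow>
     measure \<mu> (cylinder es) =
       measure \<mu> {\<omega>\<in>inf_paths. nth_vertex (length es + 1) \<omega> = t} / real (num_paths t)}"

definition central_law :: "(gl_algebra \<Rightarrow> real) \<Rightarrow> (nat \<Rightarrow> edge) measure" where
  "central_law L = (THE \<mu>. \<mu> \<in> prob_measures path_topology \<and>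
     (\<forall>es t. hpath leaf es t \<longrightarrow> measure \<mu> (cylinder es) = L (\<F> t)))"

definition central_pf :: "(nat \<Rightarrow> edge) measure set" where
  "central_pf = {\<mu>\<in>central_measures. \<forall>n\<ge>1.
     measure \<mu> {\<omega>\<in>inf_paths. path_forest (nth_vertex n \<omega>)} = 1}"

definition chain_identity :: "(gl_algebra \<Rightarrow> real) \<Rightarrow> nat \<Rightarrow> bool" where
  "chain_identity L m \<longleftrightarrow> L (\<F> (chain_tree m) \<circledast> \<F> \<tau>) = L (\<F> (chain_tree m))"

definition nabla_representing :: "(gl_algebra \<Rightarrow> real) \<Rightarrow> (nat \<Rightarrow> real) measure \<Rightarrow> bool" where
  "nabla_representing L \<rho> \<longleftrightarrow> \<rho> \<in> prob_measures (top_of_set nabla) \<and>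
     (\<forall>x. has_bochner_integral \<rho> (\<lambda>p. psi p x) (L x))"

end

theory Submission
  imports Defs
begin

text \<open>
  A state is determined by \<open>h t = L (\<F> t)\<close>, a nonnegative function that is harmonic on the Hoffman
  graph. Expanding the two products shows that the \<open>m\<close>-th chain commutator value is a sum of
  values of \<open>h\<close> at trees that are not path-forest, and that the smallest ones, a chain of at least
  two vertices with two leaves at its end, all occur for some \<open>m\<close>. Every tree that is not path-forest
  is grown from one of these, and \<open>h\<close> decreases along growth; hence the chain identities hold iff
  \<open>h\<close> vanishes off the path forests. Modulo the other trees the product of two path forests merges
  parts of the two partitions and is commutative, which gives traciality.

  A harmonic function on path forests is a function on partitions obeying the recurrence of
  multiplication of augmented monomials by the first power sum. Iterating the recurrence \<open>N\<close> times
  writes \<open>h\<close>, up to an error vanishing as \<open>N\<close> grows, as a convex combination of values at the normalised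
  parts of partitions of size \<open>N\<close>. So \<open>h\<close> lies in the compact set of mixtures of the functionals
  \<open>\<psi>\<^sub>p\<close>, and since the evaluations of symmetric functions are dense in the continuous functions on
  the Kingman simplex, the mixing measure is unique. The map from mixing measures to central laws is
  therefore an affine homeomorphism, and the geometry of the face is that of a simplex of
  probability measures.

  A single chain identity is violated by spreading the mass over the trees that grow a chain first
  and then a star at its end.
\<close>

section \<open>Symmetric functions\<close>

text \<open>\<open>chi p\<close> is a definite description, so its existence has to be proved too.
  The obstacle is that the first power sum must be 1 while \<Sum>p_i may be smaller and is not
  continuous on \<open>nabla\<close>; points are therefore approximated by finitely many variables
  of total mass 1, the missing mass being cut into equal tiny pieces. Augmented monomials are the
  right basis because they are sums over placements of the parts at distinct variables: a power sum
  puts a new part alone or onto an old one, the same rule by which a leaf is attached to a path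
  forest. The error after \<open>N\<close> iterations is that between sampling without and with
  replacement, falling factorials against powers, hence of order \<open>1/N\<close>. Consistent
  prefix weights define a process; this one construction gives both the central law of a harmonic
  function and the weak limits on the simplex. The weights \<open>2^(-m)\<close> serve convergence:
  commutator values lie between 0 and 1, so any positive summable weights would expose the face. The
  barycentre formula is first proved for finitely supported mixing measures, where atoms are split
  off one by one.\<close>

lemma finite_bounded_msets:
  assumes "finite X" shows "finite {M. set_mset M \<subseteq> X \<and> size M \<le> d}"
proof (rule finite_subset)
  show "{M. set_mset M \<subseteq> X \<and> size M \<le> d} \<subseteq> mset ` {xs. set xs \<subseteq> X \<and> length xs \<le> d}"
  proof
    fix M assume M: "M \<in> {M. set_mset M \<subseteq> X \<and> size M \<le> d}"
    obtain xs where "mset xs = M" using ex_mset by blast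
    with M show "M \<in> mset ` {xs. set xs \<subseteq> X \<and> length xs \<le> d}" by auto
  qed
qed (simp add: finite_lists_length_le assms)

lemma finite_submsets: "finite {A. A \<subseteq># (M::'a multiset)}"
  by (rule finite_subset[OF _ finite_bounded_msets[of "set_mset M" "size M"]])
     (auto dest: mset_subset_eqD size_mset_mono)

section \<open>Augmented monomials and their products with power sums\<close>

definition symfac :: "nat multiset \<Rightarrow> real" where
  "symfac l = (\<Prod>j\<in>set_mset l. fact (count l j))"

lemma symfac_superset:
  assumes "finite X" "set_mset l \<subseteq> X"
  shows "symfac l = (\<Prod>j\<in>X. fact (count l j))"
  unfolding symfac_def using assms
  by (intro prod.mono_neutral_left) (auto simp: not_in_iff)

lemma symfac_pos: "symfac l > 0"
  unfolding symfac_def by (simp add: prod_pos)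

lemma symfac_nz [simp]: "symfac l \<noteq> 0"
  using symfac_pos[of l] by simp

lemma symfac_add: "symfac (add_mset k l) = symfac l * real (count l k + 1)"
proof -
  let ?X = "insert k (set_mset l)"
  have "symfac (add_mset k l) = (\<Prod>j\<in>?X. fact (count (add_mset k l) j))"
    by (rule symfac_superset) auto
  also have "\<dots> = fact (count l k + 1) * (\<Prod>j\<in>?X - {k}. fact (count l j))"
    by (subst prod.remove[of _ k]) (auto intro!: prod.cong)
  also have "\<dots> = real (count l k + 1) * (fact (count l k) * (\<Prod>j\<in>?X - {k}. fact (count l j)))"
    by (simp add: algebra_simps)
  also have "fact (count l k) * (\<Prod>j\<in>?X - {k}. fact (count l j)) = (\<Prod>j\<in>?X. fact (count l j) :: real)"
    by (subst (2) prod.remove[of _ k]) auto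
  also have "\<dots> = symfac l" by (rule symfac_superset[symmetric]) auto
  finally show ?thesis by simp
qed

lemma aug_mono_sym_alt: "aug_mono_sym l M = symfac l * of_bool (exponents M = l)"
  by (simp add: aug_mono_sym_def ser_scale_def mono_sym_def symfac_def)

lemma is_partition_exponents: "is_partition (exponents M)"
  by (auto simp: is_partition_def exponents_def count_eq_zero_iff)

lemma sum_exponents: "sum_mset (exponents M) = size M"
  unfolding exponents_def size_multiset_overloaded_eq sum_unfold_sum_mset[symmetric] by simp

lemma count_exponents:
  assumes "v > 0" shows "count (exponents M) v = card {i. count M i = v}"
proof -
  have *: "count M -` {v} \<inter> set_mset M = {i. count M i = v}"
    using assms by (auto simp flip: count_greater_zero_iff)
  have "count (exponents M) v = (\<Sum>y\<in>{i. count M i = v}. count (mset_set (set_mset M)) y)"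
    unfolding exponents_def count_image_mset using * by simp
  also have "\<dots> = (\<Sum>y\<in>{i. count M i = v}. 1)"
  proof (intro sum.cong refl)
    fix y assume "y \<in> {i. count M i = v}"
    then have "y \<in># M" using * by blast
    then show "count (mset_set (set_mset M)) y = 1" by simp
  qed
  finally show ?thesis by simp
qed

text \<open>Deleting \<open>k\<close> copies of a variable replaces its exponent by the lowered one,
  or removes it if nothing is left. The old exponent is added on the left so that no multiset
  subtraction has to be cancelled.\<close>

lemma exponents_remove:
  assumes "k > 0" "k \<le> count M i"
  shows "add_mset (count M i) (exponents (M - replicate_mset k i)) =
    exponents M + (if count M i = k then {#} else {#count M i - k#})"
proof -
  let ?R = "image_mset (count M) (mset_set (set_mset M - {i}))"
  have iM: "i \<in># M" using assms by (metis count_greater_zero_iff gr_zeroI leD)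
  have E: "exponents M = add_mset (count M i) ?R"
    unfolding exponents_def using iM by (subst mset_set.remove[of _ i]) auto
  let ?M = "M - replicate_mset k i"
  have R: "image_mset (count ?M) (mset_set (set_mset M - {i})) = ?R"
    by (rule image_mset_cong) auto
  show ?thesis
  proof (cases "count M i = k")
    case True
    have "x \<in># ?M \<longleftrightarrow> x \<in> set_mset M - {i}" for x
      using True by (cases "x = i") (simp_all flip: count_greater_zero_iff)
    then have "set_mset ?M = set_mset M - {i}" by blast
    then show ?thesis using True E R by (simp add: exponents_def)
  next
    case False
    have "x \<in># ?M \<longleftrightarrow> x \<in># M" for x
      using False assms by (cases "x = i") (simp_all flip: count_greater_zero_iff)
    then have s: "set_mset ?M = set_mset M" by blast
    have "exponents ?M = add_mset (count M i - k) ?R"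
      unfolding exponents_def s using iM R by (subst mset_set.remove[of _ i]) auto
    then show ?thesis using False E by simp
  qed
qed

text \<open>Among the submonomials of \<open>M\<close>, the power sum sees only the pure powers
  \<open>x_i^k\<close>, which for \<open>k > 0\<close> are distinct for distinct
  \<open>i\<close>.\<close>

lemma ser_mult_power_sum:
  assumes "k > 0"
  shows "ser_mult (power_sum k) f M =
    (\<Sum>i\<in>{i\<in>set_mset M. k \<le> count M i}. f (M - replicate_mset k i))"
proof -
  let ?S = "{i\<in>set_mset M. k \<le> count M i}"
  have inj: "inj_on (replicate_mset k) ?S"
    using assms by (auto simp: inj_on_def) (metis in_replicate_mset less_irrefl neq0_conv)
  have sub: "replicate_mset k ` ?S \<subseteq> {A. A \<subseteq># M}"
    by (auto simp flip: count_le_replicate_mset_subset_eq)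
  have "ser_mult (power_sum k) f M = (\<Sum>A\<in>replicate_mset k ` ?S. power_sum k A * f (M - A))"
    unfolding ser_mult_def
  proof (rule sum.mono_neutral_right[OF finite_submsets sub], safe)
    fix A assume A: "A \<subseteq># M" "A \<notin> replicate_mset k ` ?S"
    have "power_sum k A = 0"
    proof (rule ccontr)
      assume "power_sum k A \<noteq> 0"
      then obtain i where i: "A = replicate_mset k i" by (auto simp: power_sum_def split: if_splits)
      then have "k \<le> count M i" using A(1) by (simp add: count_le_replicate_mset_subset_eq)
      moreover from this have "i \<in># M" using assms by (metis count_greater_zero_iff gr_zeroI leD)
      ultimately show False using A(2) i by blast
    qed
    then show "power_sum k A * f (M - A) = 0" by simp
  qed
  also have "\<dots> = (\<Sum>i\<in>?S. f (M - replicate_mset k i))"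
    by (subst sum.reindex[OF inj]) (auto simp: power_sum_def intro!: sum.cong)
  finally show ?thesis .
qed

text \<open>The exponent type before the removal is recovered from the type \<open>l\<close> after
  it: either \<open>x_i\<close> was used up, and a part \<open>k\<close> joins \<open>l\<close>, or
  an exponent \<open>w > 0\<close> remains, and the part \<open>w\<close> of \<open>l\<close> comes
  from \<open>w + k\<close>. The alternatives exclude each other, so the indicator splits as a
  sum.\<close>

lemma exponents_remove_eq_iff:
  assumes k: "k > 0" "k \<le> count M i" and l: "is_partition l"
  shows "of_bool (exponents (M - replicate_mset k i) = l) =
     (of_bool (count M i = k \<and> exponents M = add_mset k l) :: real) +
     (\<Sum>j\<in>set_mset l. of_bool (count M i = j + k \<and> exponents M = add_mset (j + k) (l - {#j#})))"
proof -
  let ?v = "count M i" and ?E = "exponents (M - replicate_mset k i)"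
  have e: "add_mset ?v ?E = exponents M + (if ?v = k then {#} else {#?v - k#})"
    by (rule exponents_remove[OF k])
  have l0: "0 \<notin># l" using l by (simp add: is_partition_def)
  show ?thesis
  proof (cases "?v = k")
    case True
    then have "?E = l \<longleftrightarrow> exponents M = add_mset k l" using e by auto
    moreover have "(\<Sum>j\<in>set_mset l. of_bool (?v = j + k \<and> exponents M = add_mset (j + k) (l - {#j#}))) = (0::real)"
      using l0 True by (intro sum.neutral) auto
    ultimately show ?thesis using True by simp
  next
    case False
    define w where "w = ?v - k"
    have w: "?v = w + k" "w > 0" using False k by (auto simp: w_def)
    have e': "add_mset (w + k) ?E = add_mset w (exponents M)" using e False w by simp
    have iff: "?E = l \<longleftrightarrow> w \<in># l \<and> exponents M = add_mset (w + k) (l - {#w#})"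
    proof
      assume "?E = l"
      then have a: "add_mset (w + k) l = add_mset w (exponents M)" using e' by simp
      have "w \<in># add_mset (w + k) l" by (simp add: a)
      then have "w \<in># l" using k by simp
      moreover have "exponents M = add_mset (w + k) l - {#w#}" unfolding a by (rule add_mset_remove_trivial[symmetric])
      ultimately show "w \<in># l \<and> exponents M = add_mset (w + k) (l - {#w#})"
        using k \<open>w \<in># l\<close> diff_add_mset_swap[of "w + k" "{#w#}" l] by auto
    next
      assume a: "w \<in># l \<and> exponents M = add_mset (w + k) (l - {#w#})"
      then have "add_mset (w + k) ?E = add_mset (w + k) l" using e' by (simp add: add_mset_commute)
      then show "?E = l" by simp
    qed
    have "(\<Sum>j\<in>set_mset l. of_bool (?v = j + k \<and> exponents M = add_mset (j + k) (l - {#j#}))) =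
       (\<Sum>j\<in>set_mset l. if j = w then of_bool (exponents M = add_mset (w + k) (l - {#w#})) else (0::real))"
      by (intro sum.cong) (auto simp: w)
    also have "\<dots> = of_bool (?E = l)" by (simp add: iff)
    finally show ?thesis using False by simp
  qed
qed

text \<open>An augmented monomial places its parts at distinct variables; a further factor
  \<open>x_i^k\<close> either meets a new variable or raises the exponent at one already used. The
  factor \<open>symfac\<close> turns the numbers of eligible variables into the multiplicities in
  \<open>l\<close>.\<close>

lemma power_sum_mult_aug_mono_sym:
  assumes k: "k > 0" and l: "is_partition l"
  shows "ser_mult (power_sum k) (aug_mono_sym l) M = aug_mono_sym (add_mset k l) M +
    (\<Sum>j\<in>set_mset l. real (count l j) * aug_mono_sym (add_mset (j + k) (l - {#j#})) M)"
proof -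
  let ?S = "{i\<in>set_mset M. k \<le> count M i}" and ?E = "exponents M"
  \<comment> \<open>Every variable of exponent \<open>v\<close> lies in \<open>?S\<close> because
    \<open>v \<ge> k > 0\<close>, so their number is a multiplicity in \<open>?E\<close>.\<close>
  have cnt: "(\<Sum>i\<in>?S. of_bool (count M i = v \<and> Q)) = real (count ?E v) * of_bool Q" if "v \<ge> k" for v Q
  proof -
    have "{i\<in>?S. count M i = v} = {i. count M i = v}" using that k
      by (auto simp flip: count_greater_zero_iff)
    then have c: "card {i\<in>?S. count M i = v} = count ?E v" using that k by (simp add: count_exponents)
    have "(\<Sum>i\<in>?S. of_bool (count M i = v \<and> Q)) = (\<Sum>i\<in>?S. of_bool (count M i = v)) * (of_bool Q :: real)"
      by (cases Q) auto
    also have "(\<Sum>i\<in>?S. of_bool (count M i = v)) = real (card {i\<in>?S. count M i = v})"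
      by (simp add: Int_def)
    finally show ?thesis using c by simp
  qed
  have "ser_mult (power_sum k) (aug_mono_sym l) M =
     (\<Sum>i\<in>?S. symfac l * of_bool (exponents (M - replicate_mset k i) = l))"
    unfolding ser_mult_power_sum[OF k] aug_mono_sym_alt ..
  also have "\<dots> = symfac l * (\<Sum>i\<in>?S. of_bool (count M i = k \<and> ?E = add_mset k l)) +
      symfac l * (\<Sum>j\<in>set_mset l. \<Sum>i\<in>?S. of_bool (count M i = j + k \<and> ?E = add_mset (j + k) (l - {#j#})))"
  proof -
    have "(\<Sum>i\<in>?S. symfac l * of_bool (exponents (M - replicate_mset k i) = l)) =
       symfac l * (\<Sum>i\<in>?S. of_bool (count M i = k \<and> ?E = add_mset k l) +
       (\<Sum>j\<in>set_mset l. of_bool (count M i = j + k \<and> ?E = add_mset (j + k) (l - {#j#}))))"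
      unfolding sum_distrib_left by (intro sum.cong refl arg_cong2[where f="(*)"] exponents_remove_eq_iff[OF k _ l]) auto
    then show ?thesis by (simp only: sum.distrib distrib_left sum.swap[of _ "set_mset l"])
  qed
  also have "\<dots> = symfac l * (real (count ?E k) * of_bool (?E = add_mset k l)) +
      (\<Sum>j\<in>set_mset l. symfac l * (real (count ?E (j + k)) * of_bool (?E = add_mset (j + k) (l - {#j#}))))"
  proof -
    have "(\<Sum>i\<in>?S. of_bool (count M i = k \<and> ?E = add_mset k l)) = real (count ?E k) * of_bool (?E = add_mset k l)"
      by (rule cnt) simp
    moreover have "(\<Sum>i\<in>?S. of_bool (count M i = j + k \<and> ?E = add_mset (j + k) (l - {#j#}))) =
        real (count ?E (j + k)) * of_bool (?E = add_mset (j + k) (l - {#j#}))" for j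
      by (rule cnt) simp
    ultimately show ?thesis by (simp only: sum_distrib_left)
  qed
  also have "symfac l * (real (count ?E k) * of_bool (?E = add_mset k l)) = aug_mono_sym (add_mset k l) M"
    by (auto simp: aug_mono_sym_alt symfac_add)
  also have "(\<Sum>j\<in>set_mset l. symfac l * (real (count ?E (j + k)) * of_bool (?E = add_mset (j + k) (l - {#j#})))) =
     (\<Sum>j\<in>set_mset l. real (count l j) * aug_mono_sym (add_mset (j + k) (l - {#j#})) M)"
  proof (intro sum.cong refl)
    fix j assume j: "j \<in># l"
    have "symfac l = symfac (l - {#j#}) * real (count l j)"
      using symfac_add[of j "l - {#j#}"] j by (simp add: Suc_diff_1)
    then show "symfac l * (real (count ?E (j + k)) * of_bool (?E = add_mset (j + k) (l - {#j#}))) =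
        real (count l j) * aug_mono_sym (add_mset (j + k) (l - {#j#})) M"
      by (auto simp: aug_mono_sym_alt symfac_add)
  qed
  finally show ?thesis .
qed

lemma count_image_mset_inj:
  assumes "inj f" shows "count (image_mset f M) (f x) = count M x"
proof -
  have "f -` {f x} \<inter> set_mset M = (if x \<in># M then {x} else {})"
    using assms by (auto dest: injD)
  then show ?thesis by (simp add: count_image_mset not_in_iff)
qed

text \<open>The complements of finite sets of naturals are countably infinite, hence in bijection
  with each other.\<close>

lemma finite_bij_extends:
  fixes A B :: "nat set"
  assumes "finite A" "finite B" "bij_betw f A B"
  shows "\<exists>\<pi>. bij \<pi> \<and> (\<forall>x\<in>A. \<pi> x = f x)"
proof -
  have iA: "infinite (-A)" and iB: "infinite (-B)" using assms by (auto simp: Compl_eq_Diff_UNIV)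
  obtain a b where "bij_betw (a::nat\<Rightarrow>nat) (-A) UNIV" "bij_betw (b::nat\<Rightarrow>nat) (-B) UNIV"
    using iA iB by (metis countableI_type to_nat_on_infinite)
  then have g: "bij_betw (inv_into (-B) b \<circ> a) (-A) (-B)"
    using bij_betw_inv_into bij_betw_trans by blast
  define \<pi> where "\<pi> = (\<lambda>x. if x \<in> A then f x else (inv_into (-B) b \<circ> a) x)"
  have "bij_betw \<pi> (A \<union> -A) (B \<union> -B)"
    unfolding \<pi>_def by (intro bij_betw_disjoint_Un assms g) auto
  then have "bij \<pi>" by simp
  then show ?thesis by (auto simp: \<pi>_def)
qed

text \<open>Equal exponent types mean equally many variables at each positive exponent; the
  bijections between these level sets are glued and extended to a permutation of all
  indices.\<close>

lemma exponents_eq_imp_bij: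
  assumes "exponents M = exponents M'"
  shows "\<exists>\<pi>. bij \<pi> \<and> image_mset \<pi> M = M'"
proof -
  have "\<exists>f. bij_betw f (set_mset M) (set_mset M') \<and> (\<forall>x\<in>set_mset M. count M' (f x) = count M x)"
  proof -
    have fin: "finite {i. count N i = v}" if "v > 0" for N :: "nat multiset" and v
      by (rule finite_subset[of _ "set_mset N"]) (use that in \<open>auto simp flip: count_greater_zero_iff\<close>)
    have "\<exists>f. bij_betw f {i. count M i = v} {i. count M' i = v}" if "v > 0" for v
      using count_exponents[OF that, of M] count_exponents[OF that, of M'] assms fin[OF that]
      by (metis finite_same_card_bij)
    then obtain F where F: "\<And>v. v > 0 \<Longrightarrow> bij_betw (F v) {i. count M i = v} {i. count M' i = v}" by metis
    define f where "f = (\<lambda>x. F (count M x) x)"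
    have cnt: "count M' (f x) = count M x" if "x \<in># M" for x
      using F[of "count M x"] that by (auto simp: f_def bij_betw_def)
    have "bij_betw f (set_mset M) (set_mset M')"
    proof (rule bij_betw_imageI)
      show "inj_on f (set_mset M)"
      proof
        fix x y assume xy: "x \<in># M" "y \<in># M" "f x = f y"
        then have "count M x = count M y" using cnt by metis
        then show "x = y" using xy F[of "count M x"] by (auto simp: f_def bij_betw_def inj_on_def)
      qed
      show "f ` set_mset M = set_mset M'"
      proof safe
        fix x assume "x \<in># M"
        then show "f x \<in># M'" using cnt by (metis count_greater_zero_iff)
      next
        fix y assume y: "y \<in># M'"
        then have "y \<in> F (count M' y) ` {i. count M i = count M' y}"
          using F[of "count M' y"] by (auto simp: bij_betw_def)
        then obtain x where x: "count M x = count M' y" "y = F (count M' y) x" by auto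
        then have "x \<in># M" using y by (metis count_greater_zero_iff)
        moreover have "y = f x" using x by (simp add: f_def)
        ultimately show "y \<in> f ` set_mset M" by blast
      qed
    qed
    then show ?thesis using cnt by blast
  qed
  then obtain f where f: "bij_betw f (set_mset M) (set_mset M')" "\<And>x. x \<in># M \<Longrightarrow> count M' (f x) = count M x"
    by auto
  obtain \<pi> where \<pi>: "bij \<pi>" "\<forall>x\<in>set_mset M. \<pi> x = f x"
    using finite_bij_extends[OF _ _ f(1)] by auto
  have "image_mset \<pi> M = M'"
  proof (rule multiset_eqI)
    fix y
    obtain x where x: "y = \<pi> x" using \<pi>(1) by (metis bij_pointE)
    have "count (image_mset \<pi> M) y = count M x"
      using \<pi>(1) x by (simp add: count_image_mset_inj bij_is_inj)
    moreover have "count M' y = count M x"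
    proof (cases "x \<in># M")
      case True then show ?thesis using f(2) \<pi>(2) x by auto
    next
      case False
      have "y \<notin># M'"
      proof
        assume "y \<in># M'"
        then obtain x' where "x' \<in># M" "y = f x'" using f(1) by (auto simp: bij_betw_def)
        then have "\<pi> x' = \<pi> x" using \<pi>(2) x by auto
        then show False using \<pi>(1) False \<open>x' \<in># M\<close> by (metis bij_is_inj injD)
      qed
      then show ?thesis using False by (simp add: not_in_iff)
    qed
    ultimately show "count (image_mset \<pi> M) y = count M' y" by simp
  qed
  then show ?thesis using \<pi>(1) by blast
qed

lemma exponents_image_bij:
  assumes "bij \<pi>" shows "exponents (image_mset \<pi> M) = exponents M"
proof -
  have inj: "inj \<pi>" using assms by (rule bij_is_inj)
  have "mset_set (\<pi> ` set_mset M) = image_mset \<pi> (mset_set (set_mset M))"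
    by (rule image_mset_mset_set[symmetric]) (use inj in \<open>auto simp: inj_on_def\<close>)
  then show ?thesis
    by (simp add: exponents_def multiset.map_comp o_def count_image_mset_inj[OF inj])
qed

lemma ex_canonical_monomial:
  assumes "is_partition l"
  shows "\<exists>M. exponents M = l \<and> decseq (count M) \<and> set_mset M = {..<size l}"
proof -
  define ls where "ls = rev (sorted_list_of_multiset l)"
  have ls: "mset ls = l" "sorted (rev ls)" by (auto simp: ls_def)
  have pos: "ls ! i > 0" if "i < length ls" for i
    using assms ls that by (metis gr_zeroI is_partition_def nth_mem set_mset_mset)
  define M where "M = (\<Sum>i<length ls. replicate_mset (ls ! i) i)"
  have c: "count M i = (if i < length ls then ls ! i else 0)" for i
    by (simp add: M_def count_sum)
  have "x \<in># M \<longleftrightarrow> x < length ls" for x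
    using pos[of x] by (simp add: c flip: count_greater_zero_iff)
  then have s: "set_mset M = {..<length ls}" by blast
  have "exponents M = image_mset (\<lambda>i. ls ! i) (mset_set {..<length ls})"
    unfolding exponents_def s by (rule image_mset_cong) (auto simp: c)
  also have "\<dots> = mset ls"
    by (metis map_nth mset_map mset_upt lessThan_atLeast0)
  finally have "exponents M = l" by (simp add: ls)
  moreover have "decseq (count M)"
    unfolding decseq_def
  proof (intro allI impI)
    fix i j :: nat assume "i \<le> j"
    then show "count M j \<le> count M i" using sorted_rev_nth_mono[OF ls(2)] by (auto simp: c)
  qed
  ultimately show ?thesis using s ls(1) by (metis size_mset)
qed

text \<open>The exponents are placed in decreasing order so that, divided by the degree, they form a
  point of \<open>nabla\<close>; see \<open>freq\<close>.\<close>

definition canon :: "nat multiset \<Rightarrow> nat multiset" where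
  "canon l = (SOME M. exponents M = l \<and> decseq (count M) \<and> set_mset M = {..<size l})"

lemma canon:
  assumes "is_partition l"
  shows "exponents (canon l) = l" "decseq (count (canon l))" "set_mset (canon l) = {..<size l}"
  using someI_ex[OF ex_canonical_monomial[OF assms]] by (auto simp: canon_def)

lemma SymD: "f \<in> Sym \<Longrightarrow> bij \<pi> \<Longrightarrow> f (image_mset \<pi> M) = f M"
  by (auto simp: Sym_def)

lemma SymE:
  assumes "f \<in> Sym" obtains d where "\<And>M. f M \<noteq> 0 \<Longrightarrow> size M \<le> d"
  using assms by (auto simp: Sym_def)

lemma SymI:
  assumes "\<And>\<pi> M. bij \<pi> \<Longrightarrow> f (image_mset \<pi> M) = f M" "\<And>M. f M \<noteq> 0 \<Longrightarrow> size M \<le> d"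
  shows "f \<in> Sym"
  using assms by (auto simp: Sym_def)

lemma aug_mono_sym_Sym: "aug_mono_sym l \<in> Sym"
  by (rule SymI[of _ "sum_mset l"])
     (auto simp: aug_mono_sym_alt exponents_image_bij of_bool_def sum_exponents split: if_splits)

lemma ser_add_Sym: assumes "f \<in> Sym" "g \<in> Sym" shows "ser_add f g \<in> Sym"
proof -
  obtain d d' where d: "\<And>M. f M \<noteq> 0 \<Longrightarrow> size M \<le> d" "\<And>M. g M \<noteq> 0 \<Longrightarrow> size M \<le> d'"
    using assms by (meson SymE)
  show ?thesis
  proof (rule SymI[of _ "max d d'"])
    fix M assume "ser_add f g M \<noteq> 0"
    then have "f M \<noteq> 0 \<or> g M \<noteq> 0" by (auto simp: ser_add_def)
    then show "size M \<le> max d d'" using d by fastforce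
  qed (auto simp: ser_add_def SymD[OF assms(1)] SymD[OF assms(2)])
qed

lemma ser_scale_Sym: assumes "f \<in> Sym" shows "ser_scale c f \<in> Sym"
proof -
  obtain d where d: "\<And>M. f M \<noteq> 0 \<Longrightarrow> size M \<le> d" using assms by (meson SymE)
  show ?thesis by (rule SymI[of _ d]) (auto simp: ser_scale_def SymD[OF assms] intro: d)
qed

lemma ser_mult_bound:
  assumes "\<And>M. f M \<noteq> 0 \<Longrightarrow> size M \<le> d" "\<And>M. g M \<noteq> 0 \<Longrightarrow> size M \<le> d'" "ser_mult f g M \<noteq> 0"
  shows "size M \<le> d + d'"
proof -
  obtain A where A: "A \<subseteq># M" "f A * g (M - A) \<noteq> 0"
    using assms(3) unfolding ser_mult_def by (metis (mono_tags, lifting) mem_Collect_eq sum.neutral)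
  then have "size A \<le> d" "size (M - A) \<le> d'" using assms by auto
  then show ?thesis using A(1) by (simp add: size_Diff_submset)
qed

lemma ser_mult_Sym: assumes "f \<in> Sym" "g \<in> Sym" shows "ser_mult f g \<in> Sym"
proof -
  obtain d d' where d: "\<And>M. f M \<noteq> 0 \<Longrightarrow> size M \<le> d" "\<And>M. g M \<noteq> 0 \<Longrightarrow> size M \<le> d'"
    using assms by (meson SymE)
  show ?thesis
  proof (rule SymI[of _ "d + d'"])
    fix \<pi> :: "nat \<Rightarrow> nat" and M assume pi: "bij \<pi>"
    have inv: "image_mset (inv \<pi>) (image_mset \<pi> A) = A" "image_mset \<pi> (image_mset (inv \<pi>) A) = A" for A
      using pi by (auto simp: multiset.map_comp o_def bij_is_inj bij_is_surj surj_f_inv_f)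
    have diff: "image_mset \<pi> (M - A) = image_mset \<pi> M - image_mset \<pi> A" if "A \<subseteq># M" for A
      using that by (simp add: image_mset_Diff)
    show "ser_mult f g (image_mset \<pi> M) = ser_mult f g M"
      unfolding ser_mult_def
    proof (rule sum.reindex_bij_witness[of _ "image_mset \<pi>" "image_mset (inv \<pi>)"])
      fix A assume "A \<in> {A. A \<subseteq># image_mset \<pi> M}"
      then show "image_mset (inv \<pi>) A \<in> {A. A \<subseteq># M}" by (metis image_mset_subseteq_mono inv(1) mem_Collect_eq)
      then have "image_mset \<pi> (M - image_mset (inv \<pi>) A) = image_mset \<pi> M - A" using diff inv by auto
      then show "f (image_mset (inv \<pi>) A) * g (M - image_mset (inv \<pi>) A) = f A * g (image_mset \<pi> M - A)"
        using SymD[OF assms(1) pi] SymD[OF assms(2) pi] inv by metis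
    qed (auto simp: inv intro: image_mset_subseteq_mono)
  qed (rule ser_mult_bound[OF d])
qed

lemma power_sum_eq_aug: assumes "k > 0" shows "power_sum k = aug_mono_sym {#k#}"
proof
  fix M
  have "exponents M = {#k#} \<longleftrightarrow> (\<exists>i. M = replicate_mset k i)"
  proof
    assume E: "exponents M = {#k#}"
    then have "size (mset_set (set_mset M)) = 1" by (metis exponents_def size_image_mset size_single)
    then obtain i where i: "set_mset M = {i}" by (auto simp: card_1_singleton_iff)
    then have "count M i = k" using E by (simp add: exponents_def)
    then have "M = replicate_mset k i"
      using i by (metis set_mset_subset_singletonD subset_refl count_replicate_mset)
    then show "\<exists>i. M = replicate_mset k i" ..
  next
    assume "\<exists>i. M = replicate_mset k i"
    then show "exponents M = {#k#}" using assms by (auto simp: exponents_def)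
  qed
  then show "power_sum k M = aug_mono_sym {#k#} M"
    by (simp add: power_sum_def aug_mono_sym_alt symfac_def)
qed

lemma ser_one_eq_aug: "ser_one = aug_mono_sym {#}"
proof
  fix M
  have "exponents M = {#} \<longleftrightarrow> M = {#}" by (simp add: exponents_def mset_set_empty_iff)
  then show "ser_one M = aug_mono_sym {#} M"
    by (simp add: ser_one_def aug_mono_sym_alt symfac_def)
qed

lemma size_le_sum_partition: "is_partition l \<Longrightarrow> size l \<le> sum_mset l"
proof (induction l)
  case (add x l)
  then show ?case by (cases x) (auto simp: is_partition_def)
qed simp

lemma finite_partitions: "finite {l. is_partition l \<and> sum_mset l \<le> d}"
proof (rule finite_subset[OF _ finite_bounded_msets[of "{..d}" d]])
  have "x \<le> d" if "x \<in># l" "sum_mset l \<le> d" for x l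
    using that sum_mset.remove[of x l] by simp
  then show "{l. is_partition l \<and> sum_mset l \<le> d} \<subseteq> {M. set_mset M \<subseteq> {..d} \<and> size M \<le> d}"
    using size_le_sum_partition order_trans by blast
qed simp

text \<open>Symmetry makes a coefficient depend on the exponent type alone, so it can be read off at
  \<open>canon l\<close>; the degree bound leaves finitely many types.\<close>

lemma Sym_expansion:
  assumes f: "f \<in> Sym" and d: "\<And>M. f M \<noteq> 0 \<Longrightarrow> size M \<le> d"
  shows "f = (\<lambda>M. \<Sum>l\<in>{l. is_partition l \<and> sum_mset l \<le> d}. f (canon l) / symfac l * aug_mono_sym l M)"
proof
  fix M
  let ?P = "{l. is_partition l \<and> sum_mset l \<le> d}" and ?E = "exponents M"
  have "(\<Sum>l\<in>?P. f (canon l) / symfac l * aug_mono_sym l M) = (\<Sum>l\<in>?P. if l = ?E then f (canon ?E) else 0)"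
  proof (intro sum.cong refl)
    fix l
    show "f (canon l) / symfac l * aug_mono_sym l M = (if l = ?E then f (canon ?E) else 0)"
      by (cases "l = ?E") (simp_all add: aug_mono_sym_alt)
  qed
  also have "\<dots> = (if size M \<le> d then f (canon ?E) else 0)"
    using finite_partitions[of d] by (simp add: is_partition_exponents sum_exponents)
  also have "f (canon ?E) = f M"
    using exponents_eq_imp_bij[of M "canon ?E"] canon(1)[OF is_partition_exponents] SymD[OF f] by metis
  also have "(if size M \<le> d then f M else 0) = f M" using d by auto
  finally show "f M = (\<Sum>l\<in>?P. f (canon l) / symfac l * aug_mono_sym l M)" by simp
qed

lemma sym_hom_lincomb:
  assumes h: "sym_hom h" and "finite A" "\<And>l. l \<in> A \<Longrightarrow> g l \<in> Sym"
  shows "(\<lambda>M. \<Sum>l\<in>A. c l * g l M) \<in> Sym \<and> h (\<lambda>M. \<Sum>l\<in>A. c l * g l M) = (\<Sum>l\<in>A. c l * h (g l))"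
  using assms(2,3)
proof (induction A rule: finite_induct)
  case empty
  have s: "ser_scale 0 ser_one = (\<lambda>M. 0)" by (simp add: ser_scale_def)
  have o: "ser_one \<in> Sym" by (simp add: ser_one_eq_aug aug_mono_sym_Sym)
  have "h (ser_scale 0 ser_one) = 0" using h o by (simp add: sym_hom_def)
  then show ?case using ser_scale_Sym[OF o, of 0] by (simp add: s)
next
  case (insert x A)
  let ?r = "\<lambda>M. \<Sum>l\<in>A. c l * g l M"
  have eq: "(\<lambda>M. \<Sum>l\<in>insert x A. c l * g l M) = ser_add (ser_scale (c x) (g x)) ?r"
    using insert.hyps by (simp add: ser_add_def ser_scale_def)
  have r: "?r \<in> Sym" "h ?r = (\<Sum>l\<in>A. c l * h (g l))" using insert by auto
  have s: "ser_scale (c x) (g x) \<in> Sym" using insert by (simp add: ser_scale_Sym)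
  have "h (ser_add (ser_scale (c x) (g x)) ?r) = c x * h (g x) + h ?r"
    using h r s insert.prems by (simp add: sym_hom_def)
  then show ?case unfolding eq using r s insert.hyps by (simp add: ser_add_Sym)
qed

lemma sym_hom_recurrence:
  assumes h: "sym_hom h" and k: "k > 0" and l: "is_partition l"
  shows "h (power_sum k) * h (aug_mono_sym l) = h (aug_mono_sym (add_mset k l)) +
    (\<Sum>j\<in>set_mset l. real (count l j) * h (aug_mono_sym (add_mset (j + k) (l - {#j#}))))"
proof -
  let ?r = "\<lambda>M. \<Sum>j\<in>set_mset l. real (count l j) * aug_mono_sym (add_mset (j + k) (l - {#j#})) M"
  have r: "?r \<in> Sym" "h ?r = (\<Sum>j\<in>set_mset l. real (count l j) * h (aug_mono_sym (add_mset (j + k) (l - {#j#}))))"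
    using sym_hom_lincomb[OF h, of "set_mset l" "\<lambda>j. aug_mono_sym (add_mset (j + k) (l - {#j#}))" "\<lambda>j. real (count l j)"]
      aug_mono_sym_Sym by blast+
  have "ser_mult (power_sum k) (aug_mono_sym l) = ser_add (aug_mono_sym (add_mset k l)) ?r"
    by (rule ext) (simp add: power_sum_mult_aug_mono_sym[OF k l] ser_add_def)
  moreover have "h (ser_add (aug_mono_sym (add_mset k l)) ?r) = h (aug_mono_sym (add_mset k l)) + h ?r"
    using h r(1) aug_mono_sym_Sym by (simp add: sym_hom_def)
  moreover have "h (ser_mult (power_sum k) (aug_mono_sym l)) = h (power_sum k) * h (aug_mono_sym l)"
    using h aug_mono_sym_Sym by (simp add: sym_hom_def power_sum_eq_aug[OF k])
  ultimately show ?thesis using r(2) by simp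
qed

text \<open>Merging a new part into an old one keeps the number of parts, so that the recurrence for the
  product with a power sum determines the values on the augmented monomials by induction on it.\<close>

lemma partition_parts_induct [consumes 1, case_names empty add]:
  assumes "is_partition l" "P {#}"
    and "\<And>k l. k > 0 \<Longrightarrow> is_partition l \<Longrightarrow> (\<And>l'. is_partition l' \<Longrightarrow> size l' = size l \<Longrightarrow> P l') \<Longrightarrow> P (add_mset k l)"
  shows "P l"
  using assms(1)
proof (induction "size l" arbitrary: l)
  case 0 then show ?case using assms(2) by simp
next
  case (Suc n)
  obtain k l' where l: "l = add_mset k l'" by (metis Suc.hyps(2) size_eq_Suc_imp_eq_union)
  then have "k > 0" "is_partition l'" "size l' = n" using Suc by (auto simp: is_partition_def)
  then show ?case unfolding l using Suc.hyps(1) by (intro assms(3)) auto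
qed

lemma merge_partition:
  "is_partition l \<Longrightarrow> k > 0 \<Longrightarrow> is_partition (add_mset (j + k) (l - {#j#}))"
  by (auto simp: is_partition_def dest: in_diffD)

lemma size_merge: "j \<in># l \<Longrightarrow> size (add_mset (j + k) (l - {#j#})) = size l"
  by (drule multi_member_split) auto

lemma recurrence_unique:
  assumes "F {#} = (G {#} :: real)"
   "\<And>k l. k > 0 \<Longrightarrow> is_partition l \<Longrightarrow> q k * F l = F (add_mset k l) + (\<Sum>j\<in>set_mset l. real (count l j) * F (add_mset (j + k) (l - {#j#})))"
   "\<And>k l. k > 0 \<Longrightarrow> is_partition l \<Longrightarrow> q k * G l = G (add_mset k l) + (\<Sum>j\<in>set_mset l. real (count l j) * G (add_mset (j + k) (l - {#j#})))"
   "is_partition l"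
 shows "F l = G l"
  using assms(4)
proof (induction l rule: partition_parts_induct)
  case (add k l)
  have "(\<Sum>j\<in>set_mset l. real (count l j) * F (add_mset (j + k) (l - {#j#}))) =
     (\<Sum>j\<in>set_mset l. real (count l j) * G (add_mset (j + k) (l - {#j#})))"
  proof (intro sum.cong refl arg_cong2[where f="(*)"])
    fix j assume "j \<in># l"
    then show "F (add_mset (j + k) (l - {#j#})) = G (add_mset (j + k) (l - {#j#}))"
      using add(3)[OF merge_partition[OF add(2,1)] size_merge] by blast
  qed
  then have "q k * F l - (F (add_mset k l)) = q k * G l - G (add_mset k l)"
    unfolding assms(2,3)[OF add(1,2)] by linarith
  then show ?case unfolding add(3)[OF add(2) refl] by linarith
qed (rule assms(1))

lemma sym_hom_expand:
  assumes h: "sym_hom h" and f: "f \<in> Sym" and d: "\<And>M. f M \<noteq> 0 \<Longrightarrow> size M \<le> d"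
  shows "h f = (\<Sum>l\<in>{l. is_partition l \<and> sum_mset l \<le> d}. f (canon l) / symfac l * h (aug_mono_sym l))"
proof -
  have "f = (\<lambda>M. \<Sum>l\<in>{l. is_partition l \<and> sum_mset l \<le> d}. f (canon l) / symfac l * aug_mono_sym l M)"
    by (rule Sym_expansion[OF f]) (rule d)
  then have "h f = h (\<lambda>M. \<Sum>l\<in>{l. is_partition l \<and> sum_mset l \<le> d}. f (canon l) / symfac l * aug_mono_sym l M)"
    by (rule arg_cong[where f=h])
  also have "\<dots> = (\<Sum>l\<in>{l. is_partition l \<and> sum_mset l \<le> d}. f (canon l) / symfac l * h (aug_mono_sym l))"
    by (rule conjunct2[OF sym_hom_lincomb[OF h finite_partitions, of d aug_mono_sym "\<lambda>l. f (canon l) / symfac l"]])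
       (rule aug_mono_sym_Sym)
  finally show ?thesis .
qed

text \<open>The recurrence determines the values on the augmented monomials, and these span
  \<open>Sym\<close>. This is the uniqueness half of the description in \<open>chi\<close>.\<close>

lemma sym_hom_unique:
  assumes "sym_hom h" "sym_hom h'" "\<And>k. k > 0 \<Longrightarrow> h (power_sum k) = h' (power_sum k)" "f \<in> Sym"
  shows "h f = h' f"
proof -
  have aug: "h (aug_mono_sym l) = h' (aug_mono_sym l)" if "is_partition l" for l
  proof (rule recurrence_unique[of "\<lambda>l. h (aug_mono_sym l)" "\<lambda>l. h' (aug_mono_sym l)" "\<lambda>k. h (power_sum k)", OF _ _ _ that])
    show "h (aug_mono_sym {#}) = h' (aug_mono_sym {#})"
      using assms(1,2) by (simp add: ser_one_eq_aug[symmetric] sym_hom_def)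
    fix k l assume kl: "(k::nat) > 0" "is_partition l"
    show "h (power_sum k) * h (aug_mono_sym l) = h (aug_mono_sym (add_mset k l)) +
      (\<Sum>j\<in>set_mset l. real (count l j) * h (aug_mono_sym (add_mset (j + k) (l - {#j#}))))"
      by (rule sym_hom_recurrence[OF assms(1) kl])
    show "h (power_sum k) * h' (aug_mono_sym l) = h' (aug_mono_sym (add_mset k l)) +
      (\<Sum>j\<in>set_mset l. real (count l j) * h' (aug_mono_sym (add_mset (j + k) (l - {#j#}))))"
      unfolding assms(3)[OF kl(1)] by (rule sym_hom_recurrence[OF assms(2) kl])
  qed
  obtain d where d: "\<And>M. f M \<noteq> 0 \<Longrightarrow> size M \<le> d" using assms(4) by (meson SymE)
  have "h f = (\<Sum>l\<in>{l. is_partition l \<and> sum_mset l \<le> d}. f (canon l) / symfac l * h (aug_mono_sym l))"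
    by (rule sym_hom_expand[OF assms(1,4)]) (rule d)
  also have "\<dots> = (\<Sum>l\<in>{l. is_partition l \<and> sum_mset l \<le> d}. f (canon l) / symfac l * h' (aug_mono_sym l))"
    by (intro sum.cong refl) (simp add: aug)
  also have "\<dots> = h' f"
    by (rule sym_hom_expand[OF assms(2,4), symmetric]) (rule d)
  finally show ?thesis .
qed


section \<open>Evaluation in finitely many variables\<close>

definition ev :: "nat \<Rightarrow> (nat \<Rightarrow> real) \<Rightarrow> series \<Rightarrow> real" where
  "ev N x f = (\<Sum>M\<in>{M. set_mset M \<subseteq> {..<N} \<and> f M \<noteq> 0}. f M * prod_mset (image_mset x M))"

abbreviation msets_upto :: "nat \<Rightarrow> nat \<Rightarrow> nat multiset set" where
  "msets_upto N d \<equiv> {M. set_mset M \<subseteq> {..<N} \<and> size M \<le> d}"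

text \<open>The support condition in \<open>ev\<close> keeps the index set finite for series of
  bounded degree; a common degree bound gives several series a common index set.\<close>

lemma ev_alt:
  assumes "\<And>M. f M \<noteq> 0 \<Longrightarrow> size M \<le> d"
  shows "ev N x f = (\<Sum>M\<in>msets_upto N d. f M * prod_mset (image_mset x M))"
  unfolding ev_def
  by (rule sum.mono_neutral_left[OF finite_bounded_msets]) (auto dest: assms)

text \<open>A monomial with a chosen factor \<open>A\<close> is the same as the pair of
  complementary factors \<open>(A, M - A)\<close>. Pairs outside the product of the two index sets
  contribute zero.\<close>

lemma ev_mult:
  assumes f: "\<And>M. f M \<noteq> 0 \<Longrightarrow> size M \<le> d" and g: "\<And>M. g M \<noteq> 0 \<Longrightarrow> size M \<le> d'"
  shows "ev N x (ser_mult f g) = ev N x f * ev N x g"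
proof -
  let ?p = "\<lambda>M. prod_mset (image_mset x M)"
  let ?T = "Sigma (msets_upto N (d + d')) (\<lambda>M. {A. A \<subseteq># M})"
  let ?T' = "{(A, B). set_mset (A + B) \<subseteq> {..<N} \<and> size (A + B) \<le> d + d'}"
  let ?h = "\<lambda>(A, B). f A * g B * (?p A * ?p B)"
  have fin: "finite (msets_upto N m)" for m by (rule finite_bounded_msets) simp
  have finT': "finite ?T'"
    by (rule finite_subset[OF _ finite_cartesian_product[OF fin[of "d + d'"] fin[of "d + d'"]]]) auto
  have "ev N x (ser_mult f g) = (\<Sum>M\<in>msets_upto N (d + d'). ser_mult f g M * ?p M)"
    by (rule ev_alt) (rule ser_mult_bound, rule f, assumption, rule g)
  also have "\<dots> = (\<Sum>M\<in>msets_upto N (d + d'). \<Sum>A\<in>{A. A \<subseteq># M}. f A * g (M - A) * ?p M)"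
    by (simp add: ser_mult_def sum_distrib_right)
  also have "\<dots> = (\<Sum>(M, A)\<in>?T. f A * g (M - A) * ?p M)"
    by (rule sum.Sigma) (auto simp: fin finite_submsets)
  also have "\<dots> = (\<Sum>q\<in>?T'. ?h q)"
  proof (rule sum.reindex_bij_witness[of _ "\<lambda>(A, B). (A + B, A)" "\<lambda>(M, A). (A, M - A)"])
    fix q assume "q \<in> ?T"
    then obtain M A where q: "q = (M, A)" "A \<subseteq># M" "M \<in> msets_upto N (d + d')" by auto
    then have MA: "A + (M - A) = M" by simp
    show "(case case q of (M, A) \<Rightarrow> (A, M - A) of (A, B) \<Rightarrow> (A + B, A)) = q" using q MA by simp
    show "(case q of (M, A) \<Rightarrow> (A, M - A)) \<in> ?T'" using q MA by (simp del: set_mset_union size_union)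
    have "?p A * ?p (M - A) = ?p (A + (M - A))" by simp
    then show "?h (case q of (M, A) \<Rightarrow> (A, M - A)) = (case q of (M, A) \<Rightarrow> f A * g (M - A) * ?p M)"
      using q MA by simp
  qed auto
  also have "\<dots> = (\<Sum>q\<in>msets_upto N d \<times> msets_upto N d'. ?h q)"
  proof (rule sum.mono_neutral_right[OF finT'])
    show "msets_upto N d \<times> msets_upto N d' \<subseteq> ?T'" by auto
    show "\<forall>q\<in>?T' - msets_upto N d \<times> msets_upto N d'. ?h q = 0"
    proof
      fix q assume q: "q \<in> ?T' - msets_upto N d \<times> msets_upto N d'"
      obtain A B where AB: "q = (A, B)" by fastforce
      with q have "f A = 0 \<or> g B = 0" using f[of A] g[of B] by auto
      then show "?h q = 0" using AB by auto
    qed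
  qed
  also have "\<dots> = (\<Sum>A\<in>msets_upto N d. f A * ?p A) * (\<Sum>B\<in>msets_upto N d'. g B * ?p B)"
    unfolding sum_product sum.cartesian_product by (intro sum.cong refl) (auto simp: mult_ac)
  also have "\<dots> = ev N x f * ev N x g"
    by (intro arg_cong2[where f="(*)"] ev_alt[symmetric] f g)
  finally show ?thesis .
qed

lemma sym_hom_ev: "sym_hom (ev N x)"
  unfolding sym_hom_def
proof (intro conjI ballI allI)
  have "{M. set_mset M \<subseteq> {..<N} \<and> ser_one M \<noteq> 0} = {{#}}" by (auto simp: ser_one_def)
  then show "ev N x ser_one = 1" by (simp add: ev_def ser_one_def)
next
  fix c f assume "f \<in> Sym"
  then obtain d where d: "\<And>M. f M \<noteq> 0 \<Longrightarrow> size M \<le> d" by (meson SymE)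
  have "ev N x (ser_scale c f) = (\<Sum>M\<in>msets_upto N d. ser_scale c f M * prod_mset (image_mset x M))"
    by (rule ev_alt) (auto simp: ser_scale_def d)
  moreover have "ev N x f = (\<Sum>M\<in>msets_upto N d. f M * prod_mset (image_mset x M))"
    by (rule ev_alt) (rule d)
  ultimately show "ev N x (ser_scale c f) = c * ev N x f"
    by (simp add: ser_scale_def sum_distrib_left mult_ac)
next
  fix f g assume "f \<in> Sym" "g \<in> Sym"
  then obtain d d' where d: "\<And>M. f M \<noteq> 0 \<Longrightarrow> size M \<le> d" "\<And>M. g M \<noteq> 0 \<Longrightarrow> size M \<le> d'"
    by (meson SymE)
  show "ev N x (ser_mult f g) = ev N x f * ev N x g" by (rule ev_mult[OF d])
  have d2: "\<And>M. f M \<noteq> 0 \<Longrightarrow> size M \<le> max d d'" "\<And>M. g M \<noteq> 0 \<Longrightarrow> size M \<le> max d d'"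
    "\<And>M. ser_add f g M \<noteq> 0 \<Longrightarrow> size M \<le> max d d'"
    using d by (auto simp: ser_add_def le_max_iff_disj) (metis add.right_neutral)
  show "ev N x (ser_add f g) = ev N x f + ev N x g"
  proof -
    have "ev N x f = (\<Sum>M\<in>msets_upto N (max d d'). f M * prod_mset (image_mset x M))"
      by (rule ev_alt) (rule d2(1))
    moreover have "ev N x g = (\<Sum>M\<in>msets_upto N (max d d'). g M * prod_mset (image_mset x M))"
      by (rule ev_alt) (rule d2(2))
    moreover have "ev N x (ser_add f g) = (\<Sum>M\<in>msets_upto N (max d d'). ser_add f g M * prod_mset (image_mset x M))"
      by (rule ev_alt) (rule d2(3))
    ultimately show ?thesis by (simp add: ser_add_def sum.distrib distrib_right)
  qed
qed

lemma ev_power_sum: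
  assumes "k > 0" shows "ev N x (power_sum k) = (\<Sum>i<N. x i ^ k)"
proof -
  have inj: "inj_on (replicate_mset k) {..<N}"
    using assms by (auto simp: inj_on_def) (metis in_replicate_mset less_irrefl neq0_conv)
  have "set_mset M \<subseteq> {..<N} \<and> power_sum k M \<noteq> 0 \<longleftrightarrow> M \<in> replicate_mset k ` {..<N}" for M
    using assms by (cases "\<exists>i. M = replicate_mset k i") (auto simp: power_sum_def)
  then have "{M. set_mset M \<subseteq> {..<N} \<and> power_sum k M \<noteq> 0} = replicate_mset k ` {..<N}" by blast
  then show ?thesis
    unfolding ev_def by (simp add: sum.reindex[OF inj]) (auto simp: power_sum_def intro!: sum.cong)
qed

lemma ev_nonneg:
  assumes "\<And>i. i < N \<Longrightarrow> 0 \<le> x i" "\<And>M. 0 \<le> f M"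
  shows "0 \<le> ev N x f"
proof -
  have "0 \<le> prod_mset (image_mset x M)" if "set_mset M \<subseteq> {..<N}" for M
    using that by (induction M) (auto simp: assms(1))
  then show ?thesis unfolding ev_def by (intro sum_nonneg mult_nonneg_nonneg assms(2)) auto
qed

text \<open>The mass missing from a point of \<open>nabla\<close> is spread over many tiny variables, which
  contribute to the first power sum but in the limit to no other.\<close>

definition spread :: "(nat \<Rightarrow> real) \<Rightarrow> nat \<Rightarrow> nat \<Rightarrow> real" where
  "spread p N i = (if i < N then p i else (1 - sum p {..<N}) / real N)"

text \<open>The value 1 at \<open>k = 1\<close> counts the missing mass as well; unlike \<Sum>p_i it
  is continuous on \<open>nabla\<close>.\<close>

definition ext_power_sum :: "(nat \<Rightarrow> real) \<Rightarrow> nat \<Rightarrow> real" where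
  "ext_power_sum p k = (if k = 1 then 1 else suminf (\<lambda>i. p i ^ k))"

text \<open>The fourth bound, \<open>p_i \<le> 1/(i+1)\<close> by monotonicity, is uniform in
  \<open>p\<close>. It controls the tails of power sums, and later leaves only finitely many
  truncated points.\<close>

lemma nabla_props:
  assumes "p \<in> nabla"
  shows "0 \<le> p i" "p i \<le> 1" "sum p {..<n} \<le> 1" "real (Suc i) * p i \<le> 1" "i \<le> j \<Longrightarrow> p j \<le> p i" "k > 0 \<Longrightarrow> p i ^ k \<le> p i"
    "k > 0 \<Longrightarrow> summable (\<lambda>i. p i ^ k)"
proof -
  have p: "decseq p" "\<And>i. 0 \<le> p i" "summable p" "suminf p \<le> 1" using assms by (auto simp: nabla_def)
  show s: "sum p {..<n} \<le> 1" for n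
    using sum_le_suminf[OF p(3), of "{..<n}"] p by (meson finite_lessThan order_trans)
  show "0 \<le> p i" by (rule p)
  show "i \<le> j \<Longrightarrow> p j \<le> p i" for j using p(1) by (simp add: decseq_def)
  have "real (Suc i) * p i = (\<Sum>j<Suc i. p i)" by simp
  also have "\<dots> \<le> (\<Sum>j<Suc i. p j)" by (rule sum_mono) (use p(1) in \<open>auto simp: decseq_def\<close>)
  also have "\<dots> \<le> 1" by (rule s)
  finally show "real (Suc i) * p i \<le> 1" .
  show l1: "p i \<le> 1" for i
    using s[of "Suc i"] sum_nonneg[of "{..<i}" p] p(2) by simp
  show le: "p i ^ k \<le> p i" if "k > 0" for i
    using power_decreasing[of 1 k "p i"] l1 p(2) that by simp
  then show "summable (\<lambda>i. p i ^ k)" if "k > 0"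
    using that by (intro summable_comparison_test'[OF p(3), of 0]) (simp add: p(2) zero_le_power)
qed

lemma ev_spread_power_sum:
  assumes p: "p \<in> nabla" and k: "k > 0"
  shows "(\<lambda>N. ev (2 * N) (spread p N) (power_sum k)) \<longlonglongrightarrow> ext_power_sum p k"
proof -
  let ?r = "\<lambda>N. 1 - sum p {..<N}"
  have eq: "ev (2 * N) (spread p N) (power_sum k) = (\<Sum>i<N. p i ^ k) + real N * (?r N / real N) ^ k" for N
  proof -
    have "{..<2 * N} = {..<N} \<union> {N..<2 * N}" by auto
    then have "(\<Sum>i<2 * N. spread p N i ^ k) = (\<Sum>i<N. spread p N i ^ k) + (\<Sum>i\<in>{N..<2 * N}. spread p N i ^ k)"
      by (simp add: sum.union_disjoint ivl_disj_int)
    then show ?thesis by (simp add: ev_power_sum[OF k] spread_def)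
  qed
  show ?thesis
  proof (cases "k = 1")
    case True
    have "\<forall>\<^sub>F N in sequentially. ev (2 * N) (spread p N) (power_sum k) = 1"
      using eventually_gt_at_top[of 0] by eventually_elim (use eq True in simp)
    then show ?thesis unfolding True ext_power_sum_def by (simp add: tendsto_eventually)
  next
    case False
    then have k2: "k \<ge> 2" using k by simp
    have "(\<lambda>N. \<Sum>i<N. p i ^ k) \<longlonglongrightarrow> suminf (\<lambda>i. p i ^ k)"
      using summable_LIMSEQ[OF nabla_props(7)[OF p k]] .
    \<comment> \<open>The missing mass contributes at most \<open>N\<close> times
      \<open>(1/N)^2\<close>, since \<open>k \<ge> 2\<close>.\<close>
    moreover have "(\<lambda>N. real N * (?r N / real N) ^ k) \<longlonglongrightarrow> 0"
    proof (rule tendsto_sandwich[OF _ _ tendsto_const lim_1_over_n])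
      have r: "0 \<le> ?r N" "?r N \<le> 1" for N
        using nabla_props(1,3)[OF p] by (auto intro: sum_nonneg)
      show "\<forall>\<^sub>F N in sequentially. 0 \<le> real N * (?r N / real N) ^ k"
        using r by (intro always_eventually allI mult_nonneg_nonneg zero_le_power divide_nonneg_nonneg) auto
      show "\<forall>\<^sub>F N in sequentially. real N * (?r N / real N) ^ k \<le> 1 / real N"
        using eventually_gt_at_top[of 0]
      proof eventually_elim
        case (elim N)
        have "(?r N / real N) ^ k \<le> (?r N / real N) ^ 2"
          using r[of N] elim k2 by (intro power_decreasing) (auto simp: divide_le_eq)
        also have "\<dots> \<le> (1 / real N) ^ 2"
          using r[of N] elim by (intro power_mono divide_right_mono) auto
        finally have "real N * (?r N / real N) ^ k \<le> real N * (1 / real N) ^ 2"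
          by (intro mult_left_mono) auto
        also have "\<dots> = 1 / real N" using elim by (simp add: power2_eq_square)
        finally show ?case .
      qed
    qed
    ultimately have "(\<lambda>N. (\<Sum>i<N. p i ^ k) + real N * (?r N / real N) ^ k) \<longlonglongrightarrow> suminf (\<lambda>i. p i ^ k) + 0"
      by (rule tendsto_add)
    then show ?thesis using False by (simp add: eq ext_power_sum_def)
  qed
qed

section \<open>Characters of the symmetric functions at points of the Kingman simplex\<close>

definition ext_eval :: "(nat \<Rightarrow> real) \<Rightarrow> series \<Rightarrow> real" where
  "ext_eval p f = lim (\<lambda>N. ev (2 * N) (spread p N) f)"

text \<open>Convergence is at first known for power sums only. The recurrence carries it to the
  augmented monomials, and the finite expansion to all of \<open>Sym\<close>.\<close>

lemma ext_eval_limit: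
  assumes p: "p \<in> nabla" and f: "f \<in> Sym"
  shows "(\<lambda>N. ev (2 * N) (spread p N) f) \<longlonglongrightarrow> ext_eval p f"
proof -
  let ?e = "\<lambda>N. ev (2 * N) (spread p N)"
  have aug: "convergent (\<lambda>N. ?e N (aug_mono_sym l))" if "is_partition l" for l
    using that
  proof (induction l rule: partition_parts_induct)
    case empty
    have "?e N (aug_mono_sym {#}) = 1" for N
      using sym_hom_ev by (simp add: sym_hom_def ser_one_eq_aug)
    then show ?case by (simp add: convergent_const)
  next
    case (add k l)
    have "?e N (aug_mono_sym (add_mset k l)) = ?e N (power_sum k) * ?e N (aug_mono_sym l) -
       (\<Sum>j\<in>set_mset l. real (count l j) * ?e N (aug_mono_sym (add_mset (j + k) (l - {#j#}))))" for N
      using sym_hom_recurrence[OF sym_hom_ev add(1,2), of "2 * N" "spread p N"] by linarith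
    moreover have "convergent (\<lambda>N. ?e N (power_sum k))"
      using ev_spread_power_sum[OF p add(1)] by (auto simp: convergent_def)
    moreover have "convergent (\<lambda>N. ?e N (aug_mono_sym l))" using add by blast
    moreover have "convergent (\<lambda>N. ?e N (aug_mono_sym (add_mset (j + k) (l - {#j#}))))" if "j \<in># l" for j
      using add(3)[OF merge_partition[OF add(2,1)] size_merge[OF that]] .
    ultimately show ?case by (simp add: convergent_diff convergent_mult convergent_sum convergent_mult_const_iff convergent_const)
  qed
  obtain d where d: "\<And>M. f M \<noteq> 0 \<Longrightarrow> size M \<le> d" using f by (meson SymE)
  have "?e N f = (\<Sum>l | is_partition l \<and> sum_mset l \<le> d. f (canon l) / symfac l * ?e N (aug_mono_sym l))" for N
    by (rule sym_hom_expand[OF sym_hom_ev f]) (rule d)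
  moreover have "convergent (\<lambda>N. \<Sum>l | is_partition l \<and> sum_mset l \<le> d. f (canon l) / symfac l * ?e N (aug_mono_sym l))"
    by (intro convergent_sum convergent_mult convergent_const aug) auto
  ultimately show ?thesis by (simp add: ext_eval_def convergent_LIMSEQ_iff)
qed

lemma sym_hom_ext_eval:
  assumes p: "p \<in> nabla" shows "sym_hom (ext_eval p)"
proof -
  note hom = sym_hom_ev[unfolded sym_hom_def] and lim = ext_eval_limit[OF p]
  have one: "ser_one \<in> Sym" by (simp add: ser_one_eq_aug aug_mono_sym_Sym)
  show ?thesis
    unfolding sym_hom_def
  proof (intro conjI ballI allI)
    have "(\<lambda>N. 1) \<longlonglongrightarrow> ext_eval p ser_one" using lim[OF one] hom by simp
    then show "ext_eval p ser_one = 1" by (rule LIMSEQ_unique) (rule tendsto_const)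
  next
    fix c f assume f: "f \<in> Sym"
    have "(\<lambda>N. c * ev (2 * N) (spread p N) f) \<longlonglongrightarrow> ext_eval p (ser_scale c f)"
      using lim[OF ser_scale_Sym[OF f]] hom f by simp
    moreover have "(\<lambda>N. c * ev (2 * N) (spread p N) f) \<longlonglongrightarrow> c * ext_eval p f"
      by (intro tendsto_intros lim f)
    ultimately show "ext_eval p (ser_scale c f) = c * ext_eval p f" by (rule LIMSEQ_unique)
  next
    fix f g assume fg: "f \<in> Sym" "g \<in> Sym"
    have "(\<lambda>N. ev (2 * N) (spread p N) f + ev (2 * N) (spread p N) g) \<longlonglongrightarrow> ext_eval p (ser_add f g)"
      using lim[OF ser_add_Sym[OF fg]] hom fg by simp
    moreover have "(\<lambda>N. ev (2 * N) (spread p N) f + ev (2 * N) (spread p N) g) \<longlonglongrightarrow> ext_eval p f + ext_eval p g"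
      by (intro tendsto_intros lim fg)
    ultimately show "ext_eval p (ser_add f g) = ext_eval p f + ext_eval p g" by (rule LIMSEQ_unique)
    have "(\<lambda>N. ev (2 * N) (spread p N) f * ev (2 * N) (spread p N) g) \<longlonglongrightarrow> ext_eval p (ser_mult f g)"
      using lim[OF ser_mult_Sym[OF fg]] hom fg by simp
    moreover have "(\<lambda>N. ev (2 * N) (spread p N) f * ev (2 * N) (spread p N) g) \<longlonglongrightarrow> ext_eval p f * ext_eval p g"
      by (intro tendsto_intros lim fg)
    ultimately show "ext_eval p (ser_mult f g) = ext_eval p f * ext_eval p g" by (rule LIMSEQ_unique)
  qed
qed

lemma power_sum_Sym: "k > 0 \<Longrightarrow> power_sum k \<in> Sym"
  by (simp add: power_sum_eq_aug aug_mono_sym_Sym)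

lemma ext_eval_power_sum:
  assumes "p \<in> nabla" "k > 0" shows "ext_eval p (power_sum k) = ext_power_sum p k"
  using LIMSEQ_unique[OF ext_eval_limit[OF assms(1) power_sum_Sym[OF assms(2)]] ev_spread_power_sum[OF assms]] .

text \<open>The definite description denotes: \<open>ext_eval p\<close> supplies existence,
  \<open>sym_hom_unique\<close> uniqueness on \<open>Sym\<close>, and \<open>extensional\<close>
  fixes the values elsewhere.\<close>

lemma chi_eq_ext_eval:
  assumes p: "p \<in> nabla" shows "chi p = restrict (ext_eval p) Sym"
  unfolding chi_def
proof (rule the_equality)
  have r: "restrict (ext_eval p) Sym f = ext_eval p f" if "f \<in> Sym" for f using that by simp
  have one: "ser_one \<in> Sym" by (simp add: ser_one_eq_aug aug_mono_sym_Sym)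
  have "sym_hom (restrict (ext_eval p) Sym)"
    using sym_hom_ext_eval[OF p] one ser_add_Sym ser_scale_Sym ser_mult_Sym by (simp add: sym_hom_def r)
  moreover have "restrict (ext_eval p) Sym (power_sum k) = ext_power_sum p k" if "k > 0" for k
    using that by (simp add: r power_sum_Sym ext_eval_power_sum[OF p])
  ultimately show "restrict (ext_eval p) Sym \<in> extensional Sym \<and> sym_hom (restrict (ext_eval p) Sym) \<and>
     restrict (ext_eval p) Sym (power_sum 1) = 1 \<and>
     (\<forall>k\<ge>2. restrict (ext_eval p) Sym (power_sum k) = suminf (\<lambda>i. p i ^ k))"
    by (auto simp: ext_power_sum_def simp del: restrict_apply)
next
  fix h assume h: "h \<in> extensional Sym \<and> sym_hom h \<and> h (power_sum 1) = 1 \<and>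
     (\<forall>k\<ge>2. h (power_sum k) = suminf (\<lambda>i. p i ^ k))"
  have q: "h (power_sum k) = ext_eval p (power_sum k)" if "k > 0" for k
  proof (cases "k = 1")
    case True
    then show ?thesis using h ext_eval_power_sum[OF p that] by (simp add: ext_power_sum_def)
  next
    case False
    then have "k \<ge> 2" using that by simp
    then show ?thesis using h ext_eval_power_sum[OF p that] by (simp add: ext_power_sum_def)
  qed
  show "h = restrict (ext_eval p) Sym"
  proof
    fix f show "h f = restrict (ext_eval p) Sym f"
    proof (cases "f \<in> Sym")
      case True
      then show ?thesis using sym_hom_unique[OF _ sym_hom_ext_eval[OF p] q] h by auto
    next
      case False
      then show ?thesis using h by (auto simp: extensional_def)
    qed
  qed
qed

definition aug_value :: "(nat \<Rightarrow> real) \<Rightarrow> nat multiset \<Rightarrow> real" where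
  "aug_value p l = chi p (aug_mono_sym l)"

lemma aug_value_eq: "p \<in> nabla \<Longrightarrow> aug_value p l = ext_eval p (aug_mono_sym l)"
  by (simp add: aug_value_def chi_eq_ext_eval aug_mono_sym_Sym)

lemma aug_value_empty: "p \<in> nabla \<Longrightarrow> aug_value p {#} = 1"
  using sym_hom_ext_eval[of p] by (simp add: aug_value_eq ser_one_eq_aug[symmetric] sym_hom_def)

lemma aug_value_recurrence:
  assumes "p \<in> nabla" "k > 0" "is_partition l"
  shows "ext_power_sum p k * aug_value p l = aug_value p (add_mset k l) +
    (\<Sum>j\<in>set_mset l. real (count l j) * aug_value p (add_mset (j + k) (l - {#j#})))"
  using sym_hom_recurrence[OF sym_hom_ext_eval[OF assms(1)] assms(2,3)]
  by (simp add: aug_value_eq[OF assms(1)] ext_eval_power_sum[OF assms(1,2)])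

text \<open>The variables of \<open>spread\<close> are nonnegative because the partial sums of
  \<open>p\<close> are at most 1, and augmented monomials have nonnegative coefficients.\<close>

lemma aug_value_nonneg:
  assumes p: "p \<in> nabla" shows "0 \<le> aug_value p l"
  unfolding aug_value_eq[OF p]
proof (rule LIMSEQ_le_const[OF ext_eval_limit[OF p aug_mono_sym_Sym]], intro exI allI impI)
  fix N
  have "0 \<le> spread p N i" for i
    using nabla_props(1,3)[OF p] by (auto simp: spread_def)
  then show "0 \<le> ev (2 * N) (spread p N) (aug_mono_sym l)"
    using symfac_pos[of l] by (intro ev_nonneg) (auto simp: aug_mono_sym_alt)
qed

section \<open>Sums over tuples of distinct indices\<close>

primrec dsum :: "('a \<Rightarrow> real) list \<Rightarrow> 'a set \<Rightarrow> real" where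
  "dsum [] I = 1"
| "dsum (F # Fs) I = (\<Sum>i\<in>I. F i * dsum Fs (I - {i}))"

lemma dsum_cong:
  assumes "list_all2 (\<lambda>F G. \<forall>i\<in>I. F i = G i) Fs Gs" shows "dsum Fs I = dsum Gs I"
  using assms
proof (induction Fs arbitrary: Gs I)
  case Nil
  then show ?case by simp
next
  case (Cons F Fs)
  then obtain G Gs' where G: "Gs = G # Gs'" "\<forall>i\<in>I. F i = G i" "list_all2 (\<lambda>F G. \<forall>i\<in>I. F i = G i) Fs Gs'"
    by (auto simp: list_all2_Cons1)
  have "dsum Fs (I - {i}) = dsum Gs' (I - {i})" for i
    by (rule Cons.IH, rule list_all2_mono[OF G(3)]) blast
  then show ?case unfolding G(1) dsum.simps
    by (intro sum.cong refl arg_cong2[where f="(*)"] G(2)[rule_format])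
qed

lemma dsum_swap:
  assumes "finite I" shows "dsum (F # G # Fs) I = dsum (G # F # Fs) I"
proof -
  have exp: "dsum (F # G # Fs) I = (\<Sum>i\<in>I. \<Sum>j\<in>I. if i = j then 0 else F i * G j * dsum Fs (I - {i, j}))" for F G
  proof -
    have "(\<Sum>j\<in>I - {i}. G j * dsum Fs (I - {i} - {j})) = (\<Sum>j\<in>I. if i = j then 0 else G j * dsum Fs (I - {i, j}))" for i
    proof -
      have "(\<Sum>j\<in>I - {i}. G j * dsum Fs (I - {i} - {j})) = (\<Sum>j\<in>I - {i}. if i = j then 0 else G j * dsum Fs (I - {i, j}))"
      proof (intro sum.cong refl)
        fix j assume j: "j \<in> I - {i}"
        have d: "I - {i} - {j} = I - {i, j}" by blast
        show "G j * dsum Fs (I - {i} - {j}) = (if i = j then 0 else G j * dsum Fs (I - {i, j}))"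
          unfolding d using j by (metis Diff_iff insertCI)
      qed
      also have "\<dots> = (\<Sum>j\<in>I. if i = j then 0 else G j * dsum Fs (I - {i, j}))"
        using assms by (intro sum.mono_neutral_left) auto
      finally show ?thesis .
    qed
    then show ?thesis by (auto simp: sum_distrib_left intro!: sum.cong)
  qed
  show ?thesis
    unfolding exp[of F G] exp[of G F]
    by (subst sum.swap) (auto intro!: sum.cong simp: insert_commute mult_ac)
qed

text \<open>In a tuple of distinct indices at most one part \<open>c\<close> can sit at
  \<open>i\<close>, and only there is \<open>f\<close> replaced by \<open>f'\<close>; the tuples
  that avoid \<open>i\<close> form the first summand. For powers \<open>f' = f\<close>; for falling
  factorials \<open>f'\<close> is evaluated at the count lowered by the units already drawn.\<close>

lemma dsum_mult_modified:
  assumes "finite I"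
  shows "(\<Sum>i\<in>I. G i * dsum (map (\<lambda>l. (f l)(i := f' l i)) ls) I) =
    dsum (G # map f ls) I + (\<Sum>c<length ls. dsum ((map f ls)[c := (\<lambda>i. G i * f' (ls ! c) i)]) I)"
  using assms
proof (induction ls arbitrary: I)
  case Nil
  then show ?case by simp
next
  case (Cons l ls)
  let ?m = "\<lambda>i. map (\<lambda>l. (f l)(i := f' l i)) ls" and ?g = "\<lambda>c i. G i * f' (ls ! c) i"
  \<comment> \<open>If the first part sits at \<open>i\<close>, the remaining ones avoid
    \<open>i\<close> and do not see the modification.\<close>
  have split: "(\<Sum>m\<in>I. ((f l)(i := f' l i)) m * dsum (?m i) (I - {m})) =
      f' l i * dsum (map f ls) (I - {i}) + (\<Sum>m\<in>I - {i}. f l m * dsum (?m i) (I - {m}))" if "i \<in> I" for i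
  proof -
    have "dsum (?m i) (I - {i}) = dsum (map f ls) (I - {i})"
      by (rule dsum_cong) (simp add: list_all2_conv_all_nth)
    then show ?thesis using that Cons.prems by (simp add: sum.remove[of I i])
  qed
  have "(\<Sum>i\<in>I. G i * dsum (map (\<lambda>l. (f l)(i := f' l i)) (l # ls)) I) =
     (\<Sum>i\<in>I. G i * (f' l i * dsum (map f ls) (I - {i}))) + (\<Sum>i\<in>I. \<Sum>m\<in>I - {i}. G i * (f l m * dsum (?m i) (I - {m})))"
    using split by (simp add: distrib_left sum.distrib sum_distrib_left cong: sum.cong)
  also have "(\<Sum>i\<in>I. \<Sum>m\<in>I - {i}. G i * (f l m * dsum (?m i) (I - {m}))) =
      (\<Sum>m\<in>I. f l m * (\<Sum>i\<in>I - {m}. G i * dsum (?m i) (I - {m})))"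
  proof -
    have "(\<Sum>i\<in>I. \<Sum>m\<in>I - {i}. G i * (f l m * dsum (?m i) (I - {m}))) =
       (\<Sum>i\<in>I. \<Sum>m\<in>I. if i = m then 0 else G i * (f l m * dsum (?m i) (I - {m})))"
      using Cons.prems by (intro sum.cong refl sum.mono_neutral_cong_left) auto
    also have "\<dots> = (\<Sum>m\<in>I. \<Sum>i\<in>I. if i = m then 0 else G i * (f l m * dsum (?m i) (I - {m})))"
      by (rule sum.swap)
    also have "\<dots> = (\<Sum>m\<in>I. \<Sum>i\<in>I - {m}. G i * (f l m * dsum (?m i) (I - {m})))"
      using Cons.prems by (intro sum.cong refl sum.mono_neutral_cong_right) auto
    finally show ?thesis by (simp add: sum_distrib_left mult_ac)
  qed
  also have "(\<Sum>m\<in>I. f l m * (\<Sum>i\<in>I - {m}. G i * dsum (?m i) (I - {m}))) =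
     (\<Sum>m\<in>I. f l m * (dsum (G # map f ls) (I - {m}) + (\<Sum>c<length ls. dsum ((map f ls)[c := ?g c]) (I - {m}))))"
    using Cons.prems by (intro sum.cong refl arg_cong2[where f="(*)"] Cons.IH) simp
  also have "\<dots> = dsum (f l # G # map f ls) I + (\<Sum>c<length ls. dsum (f l # (map f ls)[c := ?g c]) I)"
    by (simp add: distrib_left sum.distrib sum_distrib_left sum.swap[of _ I "{..<length ls}"] del: dsum.simps(2))
       (simp add: sum.swap[of _ I "{..<length ls}"])
  also have "dsum (f l # G # map f ls) I = dsum (G # f l # map f ls) I" by (rule dsum_swap) fact
  also have "(\<Sum>i\<in>I. G i * (f' l i * dsum (map f ls) (I - {i}))) = dsum ((\<lambda>i. G i * f' l i) # map f ls) I"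
    by (simp add: mult_ac)
  finally show ?case by (simp add: sum.lessThan_Suc_shift del: dsum.simps(2) sum.lessThan_Suc)
qed

lemma dsum_mult:
  assumes "finite I"
  shows "(\<Sum>i\<in>I. G i) * dsum (map f ls) I =
    dsum (G # map f ls) I + (\<Sum>c<length ls. dsum ((map f ls)[c := (\<lambda>i. G i * f (ls ! c) i)]) I)"
  using dsum_mult_modified[OF assms, of G f f ls] by (simp add: sum_distrib_right del: dsum.simps(2))

lemma dsum_bounds:
  assumes "finite I" "\<And>F. F \<in> set Fs \<Longrightarrow> (\<forall>i\<in>I. 0 \<le> F i) \<and> sum F I \<le> 1"
  shows "0 \<le> dsum Fs I \<and> dsum Fs I \<le> 1"
  using assms
proof (induction Fs arbitrary: I)
  case Nil
  then show ?case by simp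
next
  case (Cons F Fs)
  have IH: "0 \<le> dsum Fs (I - {i}) \<and> dsum Fs (I - {i}) \<le> 1" for i
  proof (rule Cons.IH)
    fix G assume "G \<in> set Fs"
    then have G: "\<forall>i\<in>I. 0 \<le> G i" "sum G I \<le> 1" using Cons.prems(2) by auto
    moreover have "sum G (I - {i}) \<le> sum G I" using G Cons.prems(1) by (intro sum_mono2) auto
    ultimately show "(\<forall>i\<in>I - {i}. 0 \<le> G i) \<and> sum G (I - {i}) \<le> 1" by auto
  qed (use Cons.prems in simp)
  have F: "\<forall>i\<in>I. 0 \<le> F i" "sum F I \<le> 1" using Cons.prems(2) by auto
  have "(\<Sum>i\<in>I. F i * dsum Fs (I - {i})) \<le> (\<Sum>i\<in>I. F i * 1)"
    using F IH by (intro sum_mono mult_left_mono) auto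
  moreover have "0 \<le> (\<Sum>i\<in>I. F i * dsum Fs (I - {i}))"
    using F IH by (intro sum_nonneg mult_nonneg_nonneg) auto
  ultimately show ?case using F(2) by simp
qed

text \<open>The factors are exchanged one after another; all others have sums at most 1, so each
  exchange costs at most the sum of its own difference.\<close>

lemma dsum_diff_bound:
  assumes "finite I"
    and "\<And>l. l \<in> set ls \<Longrightarrow> (\<forall>i\<in>I. 0 \<le> g l i \<and> g l i \<le> f l i) \<and> sum (f l) I \<le> 1"
  shows "\<bar>dsum (map f ls) I - dsum (map g ls) I\<bar> \<le> (\<Sum>l\<leftarrow>ls. \<Sum>i\<in>I. f l i - g l i)"
  using assms
proof (induction ls arbitrary: I)
  case Nil
  then show ?case by simp
next
  case (Cons l ls)
  have gf: "\<forall>i\<in>I. 0 \<le> g l i \<and> g l i \<le> f l i" "sum (f l) I \<le> 1" using Cons.prems(2) by auto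
  have sub: "(\<forall>j\<in>I - {i}. 0 \<le> g l' j \<and> g l' j \<le> f l' j) \<and> sum (f l') (I - {i}) \<le> 1" if "l' \<in> set ls" for i l'
  proof -
    have *: "\<forall>j\<in>I. 0 \<le> g l' j \<and> g l' j \<le> f l' j" "sum (f l') I \<le> 1" using Cons.prems(2) that by auto
    moreover have "sum (f l') (I - {i}) \<le> sum (f l') I"
      using * Cons.prems(1) by (intro sum_mono2) (auto intro: order_trans)
    ultimately show ?thesis by auto
  qed
  let ?E = "\<lambda>I. \<Sum>l\<leftarrow>ls. \<Sum>i\<in>I. f l i - g l i"
  have f1: "0 \<le> dsum (map f ls) (I - {i})" "dsum (map f ls) (I - {i}) \<le> 1" for i
  proof -
    have "0 \<le> dsum (map f ls) (I - {i}) \<and> dsum (map f ls) (I - {i}) \<le> 1"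
    proof (rule dsum_bounds)
      fix F assume "F \<in> set (map f ls)"
      then obtain l' where l': "l' \<in> set ls" "F = f l'" by auto
      have "0 \<le> f l' j" if "j \<in> I - {i}" for j
        using sub[OF l'(1), of i] that by (meson order_trans)
      then show "(\<forall>j\<in>I - {i}. 0 \<le> F j) \<and> sum F (I - {i}) \<le> 1"
        using sub[OF l'(1), of i] l'(2) by blast
    qed (use Cons.prems(1) in simp)
    then show "0 \<le> dsum (map f ls) (I - {i})" "dsum (map f ls) (I - {i}) \<le> 1" by auto
  qed
  have IH: "\<bar>dsum (map f ls) (I - {i}) - dsum (map g ls) (I - {i})\<bar> \<le> ?E I" if "i \<in> I" for i
  proof -
    have "\<bar>dsum (map f ls) (I - {i}) - dsum (map g ls) (I - {i})\<bar> \<le> ?E (I - {i})"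
      using sub Cons.prems(1) by (intro Cons.IH) auto
    also have "\<dots> \<le> ?E I"
      using Cons.prems by (intro sum_list_mono sum_mono2) auto
    finally show ?thesis .
  qed
  have E0: "0 \<le> ?E I" using Cons.prems by (intro sum_list_nonneg) (auto intro!: sum_nonneg)
  have "dsum (map f (l # ls)) I - dsum (map g (l # ls)) I =
    (\<Sum>i\<in>I. (f l i - g l i) * dsum (map f ls) (I - {i})) + (\<Sum>i\<in>I. g l i * (dsum (map f ls) (I - {i}) - dsum (map g ls) (I - {i})))"
    by (simp add: sum_subtractf[symmetric] sum.distrib[symmetric] algebra_simps)
  also have "\<bar>\<dots>\<bar> \<le> (\<Sum>i\<in>I. \<bar>(f l i - g l i) * dsum (map f ls) (I - {i})\<bar>) + (\<Sum>i\<in>I. \<bar>g l i * (dsum (map f ls) (I - {i}) - dsum (map g ls) (I - {i}))\<bar>)"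
    by (intro order_trans[OF abs_triangle_ineq] add_mono sum_abs)
  also have "\<dots> \<le> (\<Sum>i\<in>I. f l i - g l i) + (\<Sum>i\<in>I. g l i * ?E I)"
  proof (intro add_mono sum_mono)
    fix i assume i: "i \<in> I"
    have "(f l i - g l i) * dsum (map f ls) (I - {i}) \<le> (f l i - g l i) * 1"
      using gf i f1 by (intro mult_left_mono) auto
    then show "\<bar>(f l i - g l i) * dsum (map f ls) (I - {i})\<bar> \<le> f l i - g l i"
      using gf i f1(1)[of i] by (simp add: abs_mult)
    show "\<bar>g l i * (dsum (map f ls) (I - {i}) - dsum (map g ls) (I - {i}))\<bar> \<le> g l i * ?E I"
      unfolding abs_mult using gf i IH[OF i] by (intro mult_mono) auto
  qed
  also have "(\<Sum>i\<in>I. g l i * ?E I) \<le> 1 * ?E I"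
  proof -
    have "sum (g l) I \<le> sum (f l) I" using gf by (intro sum_mono) auto
    then have "sum (g l) I * ?E I \<le> 1 * ?E I" using gf(2) E0 by (intro mult_right_mono) auto
    then show ?thesis by (simp add: sum_distrib_right)
  qed
  finally show ?case by simp
qed

lemma sum_list_eq_sum_count:
  assumes "finite X" "set ls \<subseteq> X"
  shows "(\<Sum>l\<leftarrow>ls. g l :: real) = (\<Sum>j\<in>X. real (count (mset ls) j) * g j)"
  using assms(2)
proof (induction ls)
  case (Cons a ls)
  have "(\<Sum>j\<in>X. real (count (mset (a # ls)) j) * g j) = (\<Sum>j\<in>X. real (count (mset ls) j) * g j + (if j = a then g a else 0))"
    by (intro sum.cong) (auto simp: algebra_simps)
  also have "\<dots> = (\<Sum>j\<in>X. real (count (mset ls) j) * g j) + g a"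
    using Cons.prems assms(1) by (simp add: sum.distrib)
  finally show ?case using Cons by simp
qed simp

text \<open>Distinct parts with multiplicity become positions in a list, the form in which the
  recurrence can be compared with \<open>dsum\<close>.\<close>

lemma sum_merge_list:
  "(\<Sum>j\<in>set_mset (mset ls). real (count (mset ls) j) * g (add_mset (j + k) (mset ls - {#j#}))) =
   (\<Sum>c<length ls. g (mset (ls[c := ls ! c + k])))"
proof -
  have "(\<Sum>j\<in>set_mset (mset ls). real (count (mset ls) j) * g (add_mset (j + k) (mset ls - {#j#}))) =
     (\<Sum>l\<leftarrow>ls. g (add_mset (l + k) (mset ls - {#l#})))"
    by (rule sum_list_eq_sum_count[symmetric]) auto
  also have "\<dots> = (\<Sum>c<length ls. g (add_mset (ls ! c + k) (mset ls - {#ls ! c#})))"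
    by (simp add: sum_list_sum_nth atLeast0LessThan)
  also have "\<dots> = (\<Sum>c<length ls. g (mset (ls[c := ls ! c + k])))"
    by (intro sum.cong) (auto simp: mset_update)
  finally show ?thesis .
qed

text \<open>The recurrence determines the values, since merging keeps the number of parts; on a finitely
  supported point of total mass 1 they are sums over distinct indices.\<close>

lemma aug_value_eq_dsum:
  assumes p: "p \<in> nabla" and I: "finite I" "\<And>k. k > 0 \<Longrightarrow> ext_power_sum p k = (\<Sum>i\<in>I. p i ^ k)"
    and ls: "0 \<notin> set ls"
  shows "aug_value p (mset ls) = dsum (map (\<lambda>l i. p i ^ l) ls) I"
  using ls
proof (induction "length ls" arbitrary: ls)
  case 0
  then show ?case by (simp add: aug_value_empty[OF p])
next
  case (Suc n)
  then obtain k ls' where ls: "ls = k # ls'" "length ls' = n" by (cases ls) auto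
  have k: "k > 0" "0 \<notin> set ls'" using Suc.prems ls by auto
  then have part: "is_partition (mset ls')" by (simp add: is_partition_def)
  let ?f = "\<lambda>l i. p i ^ l"
  have upd: "aug_value p (mset (ls'[c := ls' ! c + k])) = dsum ((map ?f ls')[c := (\<lambda>i. p i ^ k * ?f (ls' ! c) i)]) I"
    if "c < length ls'" for c
  proof -
    have "0 \<notin> set (ls'[c := ls' ! c + k])"
      using k set_update_subset_insert[of ls' c "ls' ! c + k"] by auto
    then have "aug_value p (mset (ls'[c := ls' ! c + k])) = dsum (map ?f (ls'[c := ls' ! c + k])) I"
      using ls by (intro Suc.hyps(1)) auto
    then show ?thesis by (simp add: map_update power_add mult.commute)
  qed
  have "aug_value p (mset ls) = ext_power_sum p k * aug_value p (mset ls') - (\<Sum>c<length ls'. aug_value p (mset (ls'[c := ls' ! c + k])))"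
    using aug_value_recurrence[OF p k(1) part] sum_merge_list[of ls' "aug_value p" k] ls by simp
  also have "\<dots> = (\<Sum>i\<in>I. p i ^ k) * dsum (map ?f ls') I - (\<Sum>c<length ls'. dsum ((map ?f ls')[c := (\<lambda>i. p i ^ k * ?f (ls' ! c) i)]) I)"
    using Suc.hyps(1)[of ls'] k ls by (simp add: I(2) upd)
  also have "\<dots> = dsum ((\<lambda>i. p i ^ k) # map ?f ls') I"
    using dsum_mult[OF I(1), of "\<lambda>i. p i ^ k" ?f ls'] by linarith
  finally show ?case using ls by simp
qed

section \<open>Finite approximation of harmonic functions on partitions\<close>

text \<open>The falling factorial \<open>m (m - 1) ... (m - l + 1)\<close>, the number of ordered
  samples of size \<open>l\<close> without replacement.\<close>

definition ffact :: "nat \<Rightarrow> nat \<Rightarrow> real" where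
  "ffact m l = (if l \<le> m then fact m / fact (m - l) else 0)"

lemma ffact_0 [simp]: "ffact m 0 = 1"
  by (simp add: ffact_def)

lemma ffact_add: "ffact m (k + l) = ffact m k * ffact (m - k) l"
  by (auto simp: ffact_def)

lemma ffact_Suc: "ffact m (Suc l) = ffact m l * (real m - real l)"
proof (cases "Suc l \<le> m")
  case True
  then obtain d where "m = Suc (l + d)" using le_Suc_ex[OF True] by auto
  then have "ffact m (Suc l) = fact m / fact d" "ffact m l = fact m / ((real d + 1) * fact d)"
    "real m - real l = real d + 1"
    by (simp_all add: ffact_def Suc_diff_le algebra_simps)
  then show ?thesis by simp
next
  case False
  then show ?thesis by (cases "l = m") (auto simp: ffact_def)
qed

lemma ffact_nonneg: "0 \<le> ffact m l"
  by (simp add: ffact_def)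

text \<open>\<open>fact (size M) / mfact M\<close> is the multinomial coefficient of the monomial
  \<open>M\<close>.\<close>

definition mfact :: "nat multiset \<Rightarrow> real" where
  "mfact M = (\<Prod>i\<in>set_mset M. fact (count M i))"

lemma mfact_superset:
  assumes "finite J" "set_mset M \<subseteq> J"
  shows "mfact M = (\<Prod>i\<in>J. fact (count M i))"
  unfolding mfact_def using assms by (intro prod.mono_neutral_left) (auto simp: not_in_iff)

lemma mfact_pos: "0 < mfact M"
  unfolding mfact_def by (intro prod_pos) auto

lemma mfact_remove:
  assumes "k \<le> count M i" "i \<in># M"
  shows "mfact M = mfact (M - replicate_mset k i) * ffact (count M i) k"
proof -
  let ?M = "M - replicate_mset k i"
  have "mfact ?M = (\<Prod>j\<in>set_mset M. fact (count ?M j))"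
    by (rule mfact_superset) (auto dest: in_diffD)
  also have "\<dots> = fact (count M i - k) * (\<Prod>j\<in>set_mset M - {i}. fact (count M j))"
    using assms(2) by (subst prod.remove[of _ i]) (auto intro!: prod.cong)
  finally have "mfact ?M * ffact (count M i) k = fact (count M i) * (\<Prod>j\<in>set_mset M - {i}. fact (count M j))"
    using assms(1) by (simp add: ffact_def)
  also have "\<dots> = mfact M"
    unfolding mfact_def using assms(2) by (subst (2) prod.remove[of _ i]) auto
  finally show ?thesis by simp
qed

abbreviation mult_p1 :: "series \<Rightarrow> series" where
  "mult_p1 \<equiv> ser_mult (power_sum 1)"

lemma mult_p1_lincomb:
  "(mult_p1 ^^ j) (\<lambda>M. f M + (\<Sum>a\<in>A. c a * g a M)) =
   (\<lambda>M. (mult_p1 ^^ j) f M + (\<Sum>a\<in>A. c a * (mult_p1 ^^ j) (g a) M))"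
proof (induction j arbitrary: f g)
  case (Suc j)
  have step: "mult_p1 (\<lambda>M. f M + (\<Sum>a\<in>A. c a * g a M)) = (\<lambda>M. mult_p1 f M + (\<Sum>a\<in>A. c a * mult_p1 (g a) M))"
    for f :: series and g
    unfolding ser_mult_def
    by (simp add: distrib_left sum.distrib sum_distrib_left mult_ac sum.swap[of _ A])
  show ?case unfolding funpow_swap1 o_apply funpow.simps(2) Suc.IH step ..
qed simp

text \<open>Removing \<open>k\<close> copies of one variable and \<open>l\<close> copies of another,
  possibly the same, is possible in one order exactly when it is possible in the other.\<close>

lemma mult_power_sum_commute:
  assumes "k > 0" "l > 0"
  shows "ser_mult (power_sum k) (ser_mult (power_sum l) f) = ser_mult (power_sum l) (ser_mult (power_sum k) f)"
proof
  fix M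
  let ?S = "\<lambda>k M. {i\<in>set_mset M. k \<le> count M i}"
  have S: "i \<in> ?S k M \<longleftrightarrow> k \<le> count M i" if "k > 0" for i k and M :: "nat multiset"
    using that by (auto simp flip: count_greater_zero_iff)
  have fin: "finite (?S k M)" for k and M :: "nat multiset" by simp
  have "(\<Sum>i\<in>?S k M. \<Sum>j\<in>?S l (M - replicate_mset k i). f (M - replicate_mset k i - replicate_mset l j)) =
     (\<Sum>j\<in>?S l M. \<Sum>i\<in>?S k (M - replicate_mset l j). f (M - replicate_mset l j - replicate_mset k i))"
    unfolding sum.Sigma[OF fin ballI[OF fin]]
  proof (rule sum.reindex_bij_witness[of _ prod.swap prod.swap])
    have cond: "i \<in> ?S k M \<and> j \<in> ?S l (M - replicate_mset k i) \<longleftrightarrow> j \<in> ?S l M \<and> i \<in> ?S k (M - replicate_mset l j)" for i j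
      unfolding S[OF assms(1)] S[OF assms(2)] by (cases "i = j") auto
    fix q
    show "q \<in> Sigma (?S k M) (\<lambda>i. ?S l (M - replicate_mset k i)) \<Longrightarrow> prod.swap q \<in> Sigma (?S l M) (\<lambda>j. ?S k (M - replicate_mset l j))"
      using cond by (cases q) (simp only: mem_Sigma_iff swap_simp)
    show "q \<in> Sigma (?S l M) (\<lambda>j. ?S k (M - replicate_mset l j)) \<Longrightarrow> prod.swap q \<in> Sigma (?S k M) (\<lambda>i. ?S l (M - replicate_mset k i))"
      using cond by (cases q) (simp only: mem_Sigma_iff swap_simp)
    show "(case prod.swap q of (j, i) \<Rightarrow> f (M - replicate_mset l j - replicate_mset k i)) =
        (case q of (i, j) \<Rightarrow> f (M - replicate_mset k i - replicate_mset l j))"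
      by (cases q) (simp add: diff_diff_add_mset add.commute)
  qed simp_all
  then show "ser_mult (power_sum k) (ser_mult (power_sum l) f) M = ser_mult (power_sum l) (ser_mult (power_sum k) f) M"
    by (simp add: ser_mult_power_sum assms)
qed

lemma mult_p1_funpow_commute:
  assumes "k > 0"
  shows "(mult_p1 ^^ j) (ser_mult (power_sum k) f) = ser_mult (power_sum k) ((mult_p1 ^^ j) f)"
  by (induction j) (simp_all add: mult_power_sum_commute[OF _ assms])

lemma ser_mult_power_sum_superset:
  assumes "k > 0" "finite J" "set_mset M \<subseteq> J"
  shows "ser_mult (power_sum k) f M = (\<Sum>i\<in>J. of_bool (k \<le> count M i) * f (M - replicate_mset k i))"
  unfolding ser_mult_power_sum[OF assms(1)]
proof (rule sum.mono_neutral_cong_left)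
  show "\<forall>i\<in>J - {i \<in> set_mset M. k \<le> count M i}. of_bool (k \<le> count M i) * f (M - replicate_mset k i) = 0"
    using assms(1) by (auto simp flip: count_greater_zero_iff)
qed (use assms in auto)

text \<open>The multinomial theorem for \<open>p_1^j\<close>, by removing one variable at a
  time.\<close>

lemma mult_p1_funpow_one:
  assumes "size M = j"
  shows "(mult_p1 ^^ j) ser_one M = fact j / mfact M"
  using assms
proof (induction j arbitrary: M)
  case 0
  then show ?case by (simp add: ser_one_def mfact_def)
next
  case (Suc j)
  have "(mult_p1 ^^ Suc j) ser_one M = (\<Sum>i\<in>{i\<in>set_mset M. 1 \<le> count M i}. (mult_p1 ^^ j) ser_one (M - replicate_mset 1 i))"
    by (simp only: funpow.simps o_apply ser_mult_power_sum[OF zero_less_one])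
  also have "\<dots> = (\<Sum>i\<in>set_mset M. real (count M i) * (fact j / mfact M))"
  proof (intro sum.cong)
    show "{i\<in>set_mset M. 1 \<le> count M i} = set_mset M" by (auto simp: Suc_le_eq)
    fix i assume i: "i \<in># M"
    then have "size (M - {#i#}) = j" using Suc.prems by (simp add: size_Diff_singleton)
    then have "(mult_p1 ^^ j) ser_one (M - replicate_mset 1 i) = fact j / mfact (M - {#i#})"
      using Suc.IH by simp
    moreover have "mfact M = mfact (M - {#i#}) * real (count M i)"
      using mfact_remove[of 1 M i] i by (simp add: Suc_le_eq ffact_Suc[of _ 0, simplified])
    ultimately show "(mult_p1 ^^ j) ser_one (M - replicate_mset 1 i) = real (count M i) * (fact j / mfact M)"
      using i by simp
  qed
  also have "\<dots> = real (size M) * (fact j / mfact M)"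
    unfolding size_multiset_overloaded_eq of_nat_sum sum_distrib_right ..
  finally show ?case using Suc.prems by (simp add: algebra_simps)
qed

text \<open>If parts \<open>l_i\<close> are drawn from distinct variables of \<open>M\<close>, the
  rest of \<open>M\<close> has multinomial coefficient j! / \<Prod>(M_i - l_i)!, which is
  \<open>fact j / mfact M\<close> times a product of falling factorials. The induction runs over the
  number of parts by the power-sum recurrence, with \<open>j\<close> kept fixed.\<close>

lemma mult_p1_funpow_aug:
  assumes "0 \<notin> set ls" "finite J" "set_mset M \<subseteq> J" "size M = j + sum_list ls"
  shows "(mult_p1 ^^ j) (aug_mono_sym (mset ls)) M = fact j / mfact M * dsum (map (\<lambda>l i. ffact (count M i) l) ls) J"
  using assms
proof (induction "length ls" arbitrary: ls M)
  case 0
  then show ?case using mult_p1_funpow_one[of M j] by (simp add: ser_one_eq_aug[symmetric])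
next
  case (Suc n)
  then obtain k ls' where ls: "ls = k # ls'" "length ls' = n" by (cases ls) auto
  have k: "k > 0" "0 \<notin> set ls'" using Suc.prems ls by auto
  then have part: "is_partition (mset ls')" by (simp add: is_partition_def)
  let ?f = "\<lambda>l i. ffact (count M i) l" and ?C = "fact j / mfact M"
  let ?T = "\<lambda>l. (mult_p1 ^^ j) (aug_mono_sym l)"
  let ?G = "\<lambda>i. ffact (count M i) k" and ?f' = "\<lambda>l i. ffact (count M i - k) l"
  have "ser_mult (power_sum k) (aug_mono_sym (mset ls')) = (\<lambda>M. aug_mono_sym (mset ls) M +
     (\<Sum>a\<in>set_mset (mset ls'). real (count (mset ls') a) * aug_mono_sym (add_mset (a + k) (mset ls' - {#a#})) M))"
    by (rule ext) (use power_sum_mult_aug_mono_sym[OF k(1) part] ls in simp)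
  then have "ser_mult (power_sum k) (?T (mset ls')) M = ?T (mset ls) M +
     (\<Sum>a\<in>set_mset (mset ls'). real (count (mset ls') a) * ?T (add_mset (a + k) (mset ls' - {#a#})) M)"
    by (simp only: mult_p1_funpow_commute[OF k(1), symmetric] mult_p1_lincomb)
  also have "(\<Sum>a\<in>set_mset (mset ls'). real (count (mset ls') a) * ?T (add_mset (a + k) (mset ls' - {#a#})) M) =
     (\<Sum>c<length ls'. ?T (mset (ls'[c := ls' ! c + k])) M)"
    by (rule sum_merge_list[of ls' "\<lambda>l. ?T l M"])
  also have "\<dots> = (\<Sum>c<length ls'. ?C * dsum ((map ?f ls')[c := (\<lambda>i. ?G i * ?f' (ls' ! c) i)]) J)"
  proof (intro sum.cong refl)
    fix c assume "c \<in> {..<length ls'}"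
    then have c: "c < length ls'" by simp
    have "0 \<notin> set (ls'[c := ls' ! c + k])"
      using k set_update_subset_insert[of ls' c "ls' ! c + k"] by auto
    moreover have "sum_list (ls'[c := ls' ! c + k]) = sum_list ls"
      using c ls by (simp add: sum_list_update elem_le_sum_list)
    ultimately have "?T (mset (ls'[c := ls' ! c + k])) M = ?C * dsum (map ?f (ls'[c := ls' ! c + k])) J"
      using ls Suc.prems by (intro Suc.hyps(1)) auto
    then show "?T (mset (ls'[c := ls' ! c + k])) M = ?C * dsum ((map ?f ls')[c := (\<lambda>i. ?G i * ?f' (ls' ! c) i)]) J"
      by (simp add: map_update ffact_add[symmetric] add.commute)
  qed
  \<comment> \<open>Drawing \<open>k\<close> copies of \<open>x_i\<close> lowers one count only,
    which is the modification treated in \<open>dsum_mult_modified\<close>; the factor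
    \<open>ffact (count M i) k\<close> comes from the change of \<open>mfact\<close>.\<close>
  also have "ser_mult (power_sum k) (?T (mset ls')) M = ?C * (\<Sum>i\<in>J. ?G i * dsum (map (\<lambda>l. (?f l)(i := ?f' l i)) ls') J)"
    unfolding ser_mult_power_sum_superset[OF k(1) Suc.prems(2,3)] sum_distrib_left
  proof (intro sum.cong refl)
    fix i assume i: "i \<in> J"
    show "of_bool (k \<le> count M i) * ?T (mset ls') (M - replicate_mset k i) =
       ?C * (?G i * dsum (map (\<lambda>l. (?f l)(i := ?f' l i)) ls') J)"
    proof (cases "k \<le> count M i")
      case True
      let ?M = "M - replicate_mset k i"
      have iM: "i \<in># M" using True k by (metis count_greater_zero_iff gr_zeroI leD)
      have "replicate_mset k i \<subseteq># M" using True by (simp add: count_le_replicate_mset_subset_eq)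
      then have "size ?M = j + sum_list ls'" using Suc.prems(4) ls by (simp add: size_Diff_submset)
      moreover have "set_mset ?M \<subseteq> J" using Suc.prems(3) by (auto dest: in_diffD)
      ultimately have "?T (mset ls') ?M = fact j / mfact ?M * dsum (map (\<lambda>l i. ffact (count ?M i) l) ls') J"
        using k ls Suc.prems(2) by (intro Suc.hyps(1)) auto
      moreover have "(\<lambda>l i. ffact (count ?M i) l) = (\<lambda>l. (?f l)(i := ?f' l i))" by (auto simp: fun_eq_iff)
      moreover have "fact j / mfact ?M = ?C * ?G i"
        using mfact_remove[OF True iM] mfact_pos[of M] mfact_pos[of ?M] by (auto simp: divide_simps)
      ultimately show ?thesis using True by simp
    next
      case False
      then show ?thesis by (simp add: ffact_def)
    qed
  qed
  also have "\<dots> = ?C * (dsum (?G # map ?f ls') J + (\<Sum>c<length ls'. dsum ((map ?f ls')[c := (\<lambda>i. ?G i * ?f' (ls' ! c) i)]) J))"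
    by (simp only: dsum_mult_modified[OF Suc.prems(2)])
  finally have "?T (mset ls) M = ?C * dsum (?G # map ?f ls') J"
    by (simp only: distrib_left sum_distrib_left)
  then show ?case by (simp add: ls)
qed

text \<open>Harmonicity on Kingman's branching graph in the augmented normalisation: the linear
  functional that sends each augmented monomial to its \<phi>-value is invariant under
  multiplication by \<open>p_1\<close>.\<close>

definition harmonic_pf :: "(nat multiset \<Rightarrow> real) \<Rightarrow> bool" where
  "harmonic_pf \<phi> \<longleftrightarrow> (\<forall>l. is_partition l \<longrightarrow> \<phi> l = \<phi> (add_mset 1 l) +
     (\<Sum>j\<in>set_mset l. real (count l j) * \<phi> (add_mset (j + 1) (l - {#j#}))))"

abbreviation parts_of :: "nat \<Rightarrow> nat multiset set" where
  "parts_of n \<equiv> {l. is_partition l \<and> sum_mset l = n}"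

lemma finite_parts_of: "finite (parts_of n)"
  by (rule finite_subset[OF _ finite_partitions[of n]]) auto

lemma sum_canon: "is_partition l \<Longrightarrow> size (canon l) = sum_mset l"
  using canon(1) sum_exponents by metis

text \<open>By this invariance the augmented monomial of \<open>m\<close> may be replaced by its
  product with \<open>p_1^j\<close>. There the coefficient of the augmented monomial of
  \<open>l\<close> is the one at \<open>canon l\<close> divided by \<open>symfac l\<close>.\<close>

lemma harmonic_pf_expand:
  assumes \<phi>: "harmonic_pf \<phi>" and m: "is_partition m"
  shows "\<phi> m = (\<Sum>l\<in>parts_of (sum_mset m + j). \<phi> l / symfac l * (mult_p1 ^^ j) (aug_mono_sym m) (canon l))"
  using m
proof (induction j arbitrary: m)
  case 0
  have "(\<Sum>l\<in>parts_of (sum_mset m). \<phi> l / symfac l * aug_mono_sym m (canon l)) =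
     (\<Sum>l\<in>parts_of (sum_mset m). if l = m then \<phi> m else 0)"
  proof (intro sum.cong refl)
    fix l assume "l \<in> parts_of (sum_mset m)"
    then have "exponents (canon l) = l" by (simp add: canon)
    then show "\<phi> l / symfac l * aug_mono_sym m (canon l) = (if l = m then \<phi> m else 0)"
      by (cases "l = m") (simp_all add: aug_mono_sym_alt)
  qed
  then show ?case using 0 finite_parts_of by simp
next
  case (Suc j)
  let ?m = "\<lambda>a. add_mset (a + 1) (m - {#a#})" and ?n = "sum_mset m + Suc j"
  let ?T = "\<lambda>m l. (mult_p1 ^^ j) (aug_mono_sym m) (canon l)"
  have IH: "\<phi> m' = (\<Sum>l\<in>parts_of ?n. \<phi> l / symfac l * ?T m' l)" if "is_partition m'" "sum_mset m' = Suc (sum_mset m)" for m'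
    using Suc.IH[OF that(1)] that(2) by simp
  have m1: "\<phi> (add_mset 1 m) = (\<Sum>l\<in>parts_of ?n. \<phi> l / symfac l * ?T (add_mset 1 m) l)"
    using Suc.prems by (intro IH) (auto simp: is_partition_def)
  have ma: "\<phi> (?m a) = (\<Sum>l\<in>parts_of ?n. \<phi> l / symfac l * ?T (?m a) l)" if "a \<in># m" for a
    using Suc.prems sum_mset.remove[OF that] by (intro IH merge_partition) simp_all
  have "\<phi> m = \<phi> (add_mset 1 m) + (\<Sum>a\<in>set_mset m. real (count m a) * \<phi> (?m a))"
    using \<phi> Suc.prems by (simp add: harmonic_pf_def)
  also have "\<dots> = (\<Sum>l\<in>parts_of ?n. \<phi> l / symfac l * ?T (add_mset 1 m) l) +
     (\<Sum>a\<in>set_mset m. real (count m a) * (\<Sum>l\<in>parts_of ?n. \<phi> l / symfac l * ?T (?m a) l))"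
    unfolding m1 by (intro arg_cong2[where f="(+)"] refl sum.cong arg_cong2[where f="(*)"] ma)
  also have "\<dots> = (\<Sum>l\<in>parts_of ?n. \<phi> l / symfac l * (?T (add_mset 1 m) l + (\<Sum>a\<in>set_mset m. real (count m a) * ?T (?m a) l)))"
    unfolding sum_distrib_left distrib_left sum.distrib
    by (subst sum.swap) (simp add: mult_ac)
  also have "\<dots> = (\<Sum>l\<in>parts_of ?n. \<phi> l / symfac l * (mult_p1 ^^ Suc j) (aug_mono_sym m) (canon l))"
  proof -
    have "mult_p1 (aug_mono_sym m) = (\<lambda>M. aug_mono_sym (add_mset 1 m) M + (\<Sum>a\<in>set_mset m. real (count m a) * aug_mono_sym (?m a) M))"
      by (rule ext) (rule power_sum_mult_aug_mono_sym[OF zero_less_one Suc.prems])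
    then have "(mult_p1 ^^ Suc j) (aug_mono_sym m) (canon l) =
      ?T (add_mset 1 m) l + (\<Sum>a\<in>set_mset m. real (count m a) * ?T (?m a) l)" for l
      by (simp only: funpow_Suc_right o_apply mult_p1_lincomb)
    then show ?thesis by simp
  qed
  finally show ?case .
qed

text \<open>Sampling without against sampling with replacement. A factor \<open>m/n\<close> is kept
  in the error: summed over the parts of a partition of \<open>n\<close> it gives 1, so the total
  error stays of order \<open>1/n\<close> however many parts there are.\<close>

lemma ffact_power_diff:
  assumes "n > 0" "m \<le> n" "l > 0"
  shows "ffact m l / real n ^ l \<le> (real m / real n) ^ l"
    "(real m / real n) ^ l - ffact m l / real n ^ l \<le> real (l * l) / real n * (real m / real n)"
proof -
  let ?y = "real m / real n" and ?z = "\<lambda>l. ffact m l / real n ^ l"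
  have y: "0 \<le> ?y" "?y \<le> 1" using assms by (auto simp: divide_le_eq)
  have z0: "0 \<le> ?z l" for l by (simp add: ffact_nonneg)
  have rec: "?z (Suc l) = ?z l * (?y - real l / real n)" for l
    using assms(1) by (simp add: ffact_Suc field_simps)
  have le: "?z l \<le> ?y ^ l" for l
  proof (induction l)
    case (Suc l)
    have "?z (Suc l) \<le> ?z l * ?y" unfolding rec using z0 by (intro mult_left_mono) auto
    also have "\<dots> \<le> ?y ^ l * ?y" using Suc y by (intro mult_right_mono)
    finally show ?case by (simp add: mult.commute)
  qed simp
  then show "?z l \<le> ?y ^ l" .
  have "?y ^ Suc d - ?z (Suc d) \<le> real (Suc d * Suc d) / real n * ?y" for d
  proof (induction d)
    case 0
    then show ?case using y by (simp add: ffact_Suc[of m 0, simplified])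
  next
    case (Suc d)
    have zy: "?z (Suc d) \<le> ?y"
      using le[of "Suc d"] power_decreasing[of 1 "Suc d" ?y] y by (simp del: power_Suc)
    \<comment> \<open>One more draw multiplies by \<open>?y - (d + 1)/n\<close> instead of
      \<open>?y\<close>; with \<open>?z (Suc d) \<le> ?y\<close> the error grows by at most
      \<open>(d + 1)/n\<close> times \<open>?y\<close>.\<close>
    have "?y ^ Suc (Suc d) - ?z (Suc (Suc d)) = ?y * (?y ^ Suc d - ?z (Suc d)) + ?z (Suc d) * (real (Suc d) / real n)"
      unfolding rec[of "Suc d"] power_Suc[of ?y "Suc d"] by (simp add: algebra_simps)
    also have "\<dots> \<le> 1 * (real (Suc d * Suc d) / real n * ?y) + ?y * (real (Suc d) / real n)"
      using Suc y zy le[of "Suc d"] by (intro add_mono mult_mono) (auto simp del: power_Suc)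
    also have "\<dots> = (real (Suc d * Suc d) + real (Suc d)) / real n * ?y"
      using assms(1) by (simp add: field_simps)
    also have "\<dots> \<le> real (Suc (Suc d) * Suc (Suc d)) / real n * ?y"
      using y assms(1) by (intro mult_right_mono divide_right_mono) auto
    finally show ?case .
  qed
  from this[of "l - 1"] assms(3) show "?y ^ l - ?z l \<le> real (l * l) / real n * ?y" by simp
qed

lemma dsum_scale:
  "dsum (map (\<lambda>l i. f l i / c ^ l) ls) I = dsum (map f ls) I / c ^ sum_list ls"
proof (induction ls arbitrary: I)
  case (Cons l ls)
  then show ?case by (simp add: sum_divide_distrib power_add)
qed simp

definition freq :: "nat \<Rightarrow> nat multiset \<Rightarrow> nat \<Rightarrow> real" where
  "freq n l i = real (count (canon l) i) / real n"

lemma sum_count_canon: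
  assumes "l \<in> parts_of n" shows "(\<Sum>i<size l. real (count (canon l) i)) = real n"
  using sum_canon[of l] canon(3)[of l] assms by (auto simp: size_multiset_overloaded_eq simp flip: of_nat_sum)

text \<open>Total mass 1 leaves no missing mass, so \<open>ext_power_sum\<close> is a finite sum of
  powers for \<open>k = 1\<close> too.\<close>

lemma freq_props:
  assumes n: "n > 0" and l: "l \<in> parts_of n"
  shows "freq n l \<in> nabla" "k > 0 \<Longrightarrow> ext_power_sum (freq n l) k = (\<Sum>i<size l. freq n l i ^ k)"
    "(\<Sum>i<size l. freq n l i) = 1"
proof -
  have part: "is_partition l" using l by simp
  have z: "freq n l i = 0" if "i \<notin> {..<size l}" for i
    using that canon(3)[OF part] by (metis count_eq_zero_iff div_0 freq_def of_nat_0)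
  show s1: "(\<Sum>i<size l. freq n l i) = 1"
    using sum_count_canon[OF l] n by (simp add: freq_def sum_divide_distrib[symmetric])
  have sums: "(\<lambda>i. freq n l i ^ k) sums (\<Sum>i<size l. freq n l i ^ k)" if "k > 0" for k
    by (rule sums_finite) (use z that in auto)
  show "freq n l \<in> nabla"
    unfolding nabla_def
  proof (intro CollectI conjI allI)
    show "decseq (freq n l)"
      using canon(2)[OF part] by (auto simp: freq_def decseq_def intro!: divide_right_mono)
    show "0 \<le> freq n l i" for i by (simp add: freq_def)
    show "summable (freq n l)" "suminf (freq n l) \<le> 1"
      using sums[of 1] s1 by (auto simp: sums_iff)
  qed
  show "ext_power_sum (freq n l) k = (\<Sum>i<size l. freq n l i ^ k)" if "k > 0"
  proof (cases "k = 1")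
    case True
    then show ?thesis using s1 by (simp add: ext_power_sum_def)
  next
    case False
    then show ?thesis using sums[OF that] by (simp add: ext_power_sum_def sums_iff)
  qed
qed

text \<open>\<open>fact n / (symfac l * mfact (canon l))\<close> counts the set partitions of an
  \<open>n\<close>-set with block sizes \<open>l\<close>; \<open>\<phi> l\<close> is the probability
  of each of them in the exchangeable random partition that belongs to a normalised nonnegative
  \<phi>.\<close>

definition part_weight :: "(nat multiset \<Rightarrow> real) \<Rightarrow> nat \<Rightarrow> nat multiset \<Rightarrow> real" where
  "part_weight \<phi> n l = \<phi> l / symfac l * (fact n / mfact (canon l))"

text \<open>Expansion in degree \<open>n\<close> with the coefficients from
  \<open>mult_p1_funpow_aug\<close>; the ratio of \<open>fact n\<close> to
  \<open>fact (n - ?k)\<close> is the factor \<open>ffact n ?k\<close>, where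
  \<open>?k = sum_list ls\<close>.\<close>

lemma harmonic_pf_sampling:
  assumes \<phi>: "harmonic_pf \<phi>" and ls: "0 \<notin> set ls" "sum_list ls \<le> n"
  shows "\<phi> (mset ls) * ffact n (sum_list ls) =
    (\<Sum>l\<in>parts_of n. part_weight \<phi> n l * dsum (map (\<lambda>k i. ffact (count (canon l) i) k) ls) {..<size l})"
proof -
  let ?k = "sum_list ls"
  have "\<phi> (mset ls) = (\<Sum>l\<in>parts_of (sum_mset (mset ls) + (n - ?k)). \<phi> l / symfac l * (mult_p1 ^^ (n - ?k)) (aug_mono_sym (mset ls)) (canon l))"
    by (rule harmonic_pf_expand[OF \<phi>]) (use ls in \<open>simp add: is_partition_def\<close>)
  also have "parts_of (sum_mset (mset ls) + (n - ?k)) = parts_of n"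
    using ls by (simp add: sum_mset_sum_list)
  finally have "\<phi> (mset ls) = (\<Sum>l\<in>parts_of n. \<phi> l / symfac l * (mult_p1 ^^ (n - ?k)) (aug_mono_sym (mset ls)) (canon l))" .
  also have "\<dots> = (\<Sum>l\<in>parts_of n. \<phi> l / symfac l * (fact (n - ?k) / mfact (canon l) * dsum (map (\<lambda>k i. ffact (count (canon l) i) k) ls) {..<size l}))"
  proof (intro sum.cong refl arg_cong2[where f="(*)"] mult_p1_funpow_aug)
    fix l assume l: "l \<in> parts_of n"
    then show "set_mset (canon l) \<subseteq> {..<size l}" "size (canon l) = n - ?k + ?k"
      using canon(3)[of l] sum_canon[of l] ls by auto
  qed (use ls in auto)
  finally show ?thesis
    using ls by (simp add: sum_distrib_right sum_distrib_left part_weight_def ffact_def mult_ac)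
qed

lemma ffact_ratio_tendsto: "(\<lambda>n. ffact n k / real n ^ k) \<longlonglongrightarrow> 1"
proof (induction k)
  case (Suc k)
  have "(\<lambda>n. ffact n k / real n ^ k * (1 - real k / real n)) \<longlonglongrightarrow> 1 * (1 - 0)"
    by (intro tendsto_intros Suc lim_const_over_n)
  moreover have "\<forall>\<^sub>F n in sequentially. ffact n k / real n ^ k * (1 - real k / real n) = ffact n (Suc k) / real n ^ Suc k"
    using eventually_gt_at_top[of 0] by eventually_elim (simp add: ffact_Suc field_simps)
  ultimately show ?case by (simp add: Lim_transform_eventually)
qed simp

text \<open>At level \<open>n\<close> the sampling formula is exact with falling factorials; powers
  in their place give \<open>aug_value\<close> at the normalised partitions. The exchange costs
  \<open>?C / n\<close> uniformly over the partitions of \<open>n\<close>, and the weights sum to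
  1.\<close>

theorem harmonic_pf_approx:
  assumes \<phi>: "harmonic_pf \<phi>" "\<phi> {#} = 1" "\<And>l. is_partition l \<Longrightarrow> 0 \<le> \<phi> l"
  shows part_weight_nonneg: "\<And>l. l \<in> parts_of n \<Longrightarrow> 0 \<le> part_weight \<phi> n l"
    and part_weight_sum: "(\<Sum>l\<in>parts_of n. part_weight \<phi> n l) = 1"
    and "is_partition m \<Longrightarrow> (\<lambda>n. \<Sum>l\<in>parts_of n. part_weight \<phi> n l * aug_value (freq n l) m) \<longlonglongrightarrow> \<phi> m"
proof -
  show w0: "0 \<le> part_weight \<phi> n l" if "l \<in> parts_of n" for n l
    using \<phi>(3)[of l] symfac_pos[of l] mfact_pos[of "canon l"] that by (simp add: part_weight_def)
  \<comment> \<open>The sampling formula for the empty list of parts.\<close>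
  show w1: "(\<Sum>l\<in>parts_of n. part_weight \<phi> n l) = 1" for n
    using harmonic_pf_sampling[OF \<phi>(1), of "[]" n] \<phi>(2) by simp
  assume m: "is_partition m"
  obtain ls where ls: "mset ls = m" using ex_mset by blast
  have pos: "0 \<notin> set ls" using m ls by (auto simp: is_partition_def)
  let ?C = "\<Sum>k\<leftarrow>ls. real (k * k)" and ?k = "sum_list ls"
  let ?D = "\<lambda>n l. dsum (map (\<lambda>k i. ffact (count (canon l) i) k) ls) {..<size l} / real n ^ ?k"
  have est: "\<bar>aug_value (freq n l) m - ?D n l\<bar> \<le> ?C / real n" if n: "n > 0" and l: "l \<in> parts_of n" for n l
  proof -
    let ?I = "{..<size l}" and ?f = "\<lambda>k i. freq n l i ^ k" and ?g = "\<lambda>k i. ffact (count (canon l) i) k / real n ^ k"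
    have cn: "count (canon l) i \<le> n" for i
      using sum_canon[of l] l count_le_size[of "canon l" i] by simp
    have k0: "k > 0" if "k \<in> set ls" for k using that pos by (metis gr_zeroI)
    have "\<bar>dsum (map ?f ls) ?I - dsum (map ?g ls) ?I\<bar> \<le> (\<Sum>k\<leftarrow>ls. \<Sum>i\<in>?I. ?f k i - ?g k i)"
    proof (rule dsum_diff_bound)
      fix k assume k: "k \<in> set ls"
      have "(\<Sum>i\<in>?I. ?f k i) \<le> (\<Sum>i\<in>?I. freq n l i)"
        using nabla_props(6)[OF freq_props(1)[OF n l] k0[OF k]] by (intro sum_mono)
      then show "(\<forall>i\<in>?I. 0 \<le> ?g k i \<and> ?g k i \<le> ?f k i) \<and> sum (?f k) ?I \<le> 1"
        using ffact_power_diff(1)[OF n cn k0[OF k]] freq_props(3)[OF n l] by (simp add: freq_def ffact_nonneg)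
    qed simp
    also have "\<dots> \<le> (\<Sum>k\<leftarrow>ls. real (k * k) / real n)"
    proof (rule sum_list_mono)
      fix k assume k: "k \<in> set ls"
      have "(\<Sum>i\<in>?I. ?f k i - ?g k i) \<le> (\<Sum>i\<in>?I. real (k * k) / real n * freq n l i)"
        using ffact_power_diff(2)[OF n cn k0[OF k]] by (intro sum_mono) (simp add: freq_def)
      then show "(\<Sum>i\<in>?I. ?f k i - ?g k i) \<le> real (k * k) / real n"
        unfolding sum_distrib_left[symmetric] freq_props(3)[OF n l] by simp
    qed
    also have "\<dots> = ?C / real n" by (induction ls) (simp_all add: add_divide_distrib)
    also have "dsum (map ?f ls) ?I = aug_value (freq n l) m"
      unfolding ls[symmetric] using freq_props[OF n l] pos by (intro aug_value_eq_dsum[symmetric]) auto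
    finally show ?thesis by (simp add: dsum_scale)
  qed
  let ?E = "\<lambda>n. \<Sum>l\<in>parts_of n. part_weight \<phi> n l * aug_value (freq n l) m"
  have diff: "\<bar>?E n - \<phi> m * (ffact n ?k / real n ^ ?k)\<bar> \<le> ?C / real n" if n: "n > 0" "n \<ge> ?k" for n
  proof -
    have "\<phi> m * (ffact n ?k / real n ^ ?k) = (\<Sum>l\<in>parts_of n. part_weight \<phi> n l * ?D n l)"
      using harmonic_pf_sampling[OF \<phi>(1) pos n(2)] ls by (simp add: sum_divide_distrib[symmetric])
    then have "\<bar>?E n - \<phi> m * (ffact n ?k / real n ^ ?k)\<bar> = \<bar>\<Sum>l\<in>parts_of n. part_weight \<phi> n l * (aug_value (freq n l) m - ?D n l)\<bar>"
      by (simp only: right_diff_distrib sum_subtractf)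
    also have "\<dots> \<le> (\<Sum>l\<in>parts_of n. \<bar>part_weight \<phi> n l * (aug_value (freq n l) m - ?D n l)\<bar>)"
      by (rule sum_abs)
    also have "\<dots> \<le> (\<Sum>l\<in>parts_of n. part_weight \<phi> n l * (?C / real n))"
    proof (rule sum_mono)
      fix l assume l: "l \<in> parts_of n"
      show "\<bar>part_weight \<phi> n l * (aug_value (freq n l) m - ?D n l)\<bar> \<le> part_weight \<phi> n l * (?C / real n)"
        unfolding abs_mult abs_of_nonneg[OF w0[OF l]] by (rule mult_left_mono[OF est[OF n(1) l] w0[OF l]])
    qed
    also have "\<dots> = ?C / real n" unfolding sum_distrib_right[symmetric] w1 by simp
    finally show ?thesis .
  qed
  have "(\<lambda>n. ?E n - \<phi> m * (ffact n ?k / real n ^ ?k)) \<longlonglongrightarrow> 0"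
  proof (rule Lim_null_comparison[OF _ lim_const_over_n[of ?C]])
    show "\<forall>\<^sub>F n in sequentially. norm (?E n - \<phi> m * (ffact n ?k / real n ^ ?k)) \<le> ?C / real n"
      using eventually_gt_at_top[of 0] eventually_ge_at_top[of ?k]
      by eventually_elim (use diff in simp)
  qed
  moreover have "(\<lambda>n. \<phi> m * (ffact n ?k / real n ^ ?k)) \<longlonglongrightarrow> \<phi> m * 1"
    by (intro tendsto_intros ffact_ratio_tendsto)
  ultimately have "(\<lambda>n. (?E n - \<phi> m * (ffact n ?k / real n ^ ?k)) + \<phi> m * (ffact n ?k / real n ^ ?k)) \<longlonglongrightarrow> 0 + \<phi> m * 1"
    by (rule tendsto_add)
  then show "?E \<longlonglongrightarrow> \<phi> m" by simp
qed

section \<open>Processes with prescribed prefix probabilities\<close>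

text \<open>A consistent family of prefix probabilities with finite branching: \<open>A\<close>
  contains all letters that can follow \<open>es\<close>.\<close>

definition tree_weight :: "('a list \<Rightarrow> real) \<Rightarrow> bool" where
  "tree_weight w \<longleftrightarrow> w [] = 1 \<and> (\<forall>es. 0 \<le> w es) \<and>
     (\<forall>es. \<exists>A. finite A \<and> (\<forall>a. a \<notin> A \<longrightarrow> w (es @ [a]) = 0) \<and> (\<Sum>a\<in>A. w (es @ [a])) = w es)"

primrec chosen_prefix :: "('a list \<Rightarrow> 'a) \<Rightarrow> nat \<Rightarrow> 'a list" where
  "chosen_prefix x 0 = []"
| "chosen_prefix x (Suc n) = chosen_prefix x n @ [x (chosen_prefix x n)]"

lemma length_chosen_prefix [simp]: "length (chosen_prefix x n) = n"
  by (induction n) auto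

lemma nth_chosen_prefix: "i < n \<Longrightarrow> chosen_prefix x n ! i = x (chosen_prefix x i)"
  by (induction n) (auto simp: nth_append less_Suc_eq)

lemma chosen_prefix_eq_iff:
  "chosen_prefix x (length es) = es \<longleftrightarrow> (\<forall>i<length es. x (take i es) = es ! i)"
proof (induction es rule: rev_induct)
  case (snoc a es)
  have "chosen_prefix x (length (es @ [a])) = es @ [a] \<longleftrightarrow> chosen_prefix x (length es) = es \<and> x es = a"
    by auto
  also have "\<dots> \<longleftrightarrow> (\<forall>i<length (es @ [a]). x (take i (es @ [a])) = (es @ [a]) ! i)"
    by (auto simp: snoc.IH less_Suc_eq nth_append)
  finally show ?case .
qed simp

text \<open>One independent choice of a continuation is made for every finite prefix, so that the
  probability of a prefix is a finite product of independent factors.\<close>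

lemma tree_weight_process:
  fixes w :: "'a::countable list \<Rightarrow> real"
  assumes w: "tree_weight w"
  obtains M :: "('a list \<Rightarrow> 'a) measure" and Y :: "nat \<Rightarrow> ('a list \<Rightarrow> 'a) \<Rightarrow> 'a" where
    "prob_space M" "\<And>n. Y n \<in> measurable M (count_space UNIV)"
    "\<And>es. measure M {x\<in>space M. \<forall>i<length es. Y i x = es ! i} = w es"
proof -
  have w1: "w [] = 1" and w0: "\<And>es. 0 \<le> w es"
    and wA: "\<And>es. \<exists>A. finite A \<and> (\<forall>a. a \<notin> A \<longrightarrow> w (es @ [a]) = 0) \<and> (\<Sum>a\<in>A. w (es @ [a])) = w es"
    using w by (auto simp: tree_weight_def)
  \<comment> \<open>The conditional law of the next letter; after a prefix of weight zero it is
    arbitrary.\<close>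
  have "\<exists>K::'a pmf. w es > 0 \<longrightarrow> (\<forall>a. pmf K a = w (es @ [a]) / w es)" for es
  proof (cases "w es > 0")
    case True
    obtain A where A: "finite A" "\<And>a. a \<notin> A \<Longrightarrow> w (es @ [a]) = 0" "(\<Sum>a\<in>A. w (es @ [a])) = w es"
      using wA by blast
    let ?f = "\<lambda>a. w (es @ [a]) / w es"
    have "(\<integral>\<^sup>+a. ennreal (?f a) \<partial>count_space UNIV) = (\<Sum>a\<in>A. ennreal (?f a))"
      by (rule nn_integral_count_space') (use A in auto)
    also have "\<dots> = ennreal (\<Sum>a\<in>A. ?f a)" using w0 by (intro sum_ennreal) auto
    also have "(\<Sum>a\<in>A. ?f a) = 1" using A(3) True by (simp add: sum_divide_distrib[symmetric])
    finally have "pmf (embed_pmf ?f) a = ?f a" for a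
      using w0 by (intro pmf_embed_pmf) auto
    then show ?thesis by blast
  qed auto
  then obtain K :: "'a list \<Rightarrow> 'a pmf" where K: "\<And>es a. w es > 0 \<Longrightarrow> pmf (K es) a = w (es @ [a]) / w es"
    by metis
  define M where "M = PiM UNIV (\<lambda>es. measure_pmf (K es))"
  interpret P: product_prob_space "\<lambda>es. measure_pmf (K es)" "UNIV :: 'a list set"
    by unfold_locales
  have M: "prob_space M" unfolding M_def by (rule P.prob_space_axioms)
  define Y where "Y = (\<lambda>n x. x (chosen_prefix x n) :: 'a)"
  have spM: "space M = UNIV" by (auto simp: M_def space_PiM)
  have comp: "(\<lambda>x. x es) \<in> measurable M (count_space UNIV)" for es
    using measurable_component_singleton[of es UNIV "\<lambda>es. measure_pmf (K es)"]
    unfolding measurable_cong_sets[OF refl sets_measure_pmf_count_space] M_def by simp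
  have pre: "(\<lambda>x. chosen_prefix x n) \<in> measurable M (count_space UNIV)" for n
  proof (induction n)
    case (Suc n)
    have "(\<lambda>x. es @ [x es]) \<in> measurable M (count_space UNIV)" for es
      by (rule measurable_compose[OF comp]) simp
    then have "(\<lambda>x. chosen_prefix x n @ [x (chosen_prefix x n)]) \<in> measurable M (count_space UNIV)"
      by (rule measurable_compose_countable[OF _ Suc])
    then show ?case by simp
  qed simp
  have Y: "Y n \<in> measurable M (count_space UNIV)" for n
    unfolding Y_def by (rule measurable_compose_countable[OF comp pre])
  have prod_w: "(\<Prod>i<length es. pmf (K (take i es)) (es ! i)) = w es" for es
  proof (induction es rule: rev_induct)
    case Nil
    then show ?case using w1 by simp
  next
    case (snoc a es)
    have "(\<Prod>i<length (es @ [a]). pmf (K (take i (es @ [a]))) ((es @ [a]) ! i)) =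
       (\<Prod>i<length es. pmf (K (take i es)) (es ! i)) * pmf (K es) a"
      by (simp add: nth_append cong: prod.cong_simp)
    also have "\<dots> = w es * pmf (K es) a" by (simp add: snoc)
    also have "\<dots> = w (es @ [a])"
    proof (cases "w es > 0")
      case True
      then show ?thesis using K by simp
    next
      \<comment> \<open>A prefix of weight zero has only continuations of weight zero, so the
        arbitrary choice of \<open>K\<close> does no harm.\<close>
      case False
      then have z: "w es = 0" using w0[of es] by simp
      obtain A where A: "finite A" "\<And>a. a \<notin> A \<Longrightarrow> w (es @ [a]) = 0" "(\<Sum>a\<in>A. w (es @ [a])) = 0"
        using wA z by metis
      then have "\<forall>a\<in>A. w (es @ [a]) = 0" using w0 by (subst (asm) sum_nonneg_eq_0_iff) auto
      then show ?thesis using z A(2) by (metis mult_zero_left)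
    qed
    finally show ?case .
  qed
  have "measure M {x\<in>space M. \<forall>i<length es. Y i x = es ! i} = w es" for es
  proof -
    \<comment> \<open>The event fixes one coordinate for each proper prefix of \<open>es\<close>.
      These prefixes have different lengths, so the coordinates are distinct and
      independent.\<close>
    let ?J = "(\<lambda>i. take i es) ` {..<length es}" and ?X = "\<lambda>fs. {es ! length fs}"
    have inj: "inj_on (\<lambda>i. take i es) {..<length es}"
      by (rule inj_on_inverseI[of _ length]) auto
    have "(\<forall>i<length es. Y i x = es ! i) \<longleftrightarrow> (\<forall>i<length es. x (take i es) = es ! i)" for x
    proof -
      have "(\<forall>i<length es. Y i x = es ! i) \<longleftrightarrow> chosen_prefix x (length es) = es"
        by (auto simp: list_eq_iff_nth_eq nth_chosen_prefix Y_def)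
      then show ?thesis by (simp add: chosen_prefix_eq_iff)
    qed
    then have "{x\<in>space M. \<forall>i<length es. Y i x = es ! i} =
       prod_emb UNIV (\<lambda>es. measure_pmf (K es)) ?J (PiE ?J ?X)"
      by (auto simp: prod_emb_def spM PiE_iff space_PiM restrict_def)
    then have "measure M {x\<in>space M. \<forall>i<length es. Y i x = es ! i} = (\<Prod>j\<in>?J. measure (measure_pmf (K j)) (?X j))"
      unfolding M_def by (simp add: P.measure_PiM_emb)
    also have "\<dots> = (\<Prod>i<length es. pmf (K (take i es)) (es ! i))"
      by (subst prod.reindex[OF inj]) (auto simp: pmf.rep_eq intro!: prod.cong)
    finally show ?thesis using prod_w by simp
  qed
  with M Y show thesis by (rule that)
qed

section \<open>Weak limits on compact sets\<close>

lemma compact_function_box: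
  fixes K :: "'i \<Rightarrow> 'b::topological_space set"
  assumes "\<And>i. compact (K i)" shows "compact {f. \<forall>i. f i \<in> K i}"
proof -
  have "compactin (product_topology (\<lambda>i::'i. euclidean :: 'b topology) UNIV) (PiE UNIV K)"
    unfolding compactin_PiE using assms by auto
  moreover have "PiE UNIV K = {f. \<forall>i. f i \<in> K i}" by auto
  ultimately show ?thesis by (simp add: euclidean_product_topology)
qed

text \<open>The cube is compact by Tychonoff; countability of the index set makes it first
  countable, hence sequentially compact.\<close>

lemma pointwise_convergent_subsequence:
  fixes u :: "nat \<Rightarrow> 'a::countable \<Rightarrow> real"
  assumes "\<And>n a. u n a \<in> {0..1}"
  obtains r v where "strict_mono (r :: nat \<Rightarrow> nat)" "\<And>a. (\<lambda>n. u (r n) a) \<longlonglongrightarrow> v a"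
proof -
  have "seq_compact {f::'a \<Rightarrow> real. \<forall>i. f i \<in> {0..1}}"
    by (intro compact_imp_seq_compact compact_function_box) simp
  moreover have "\<forall>n. u n \<in> {f. \<forall>i. f i \<in> {0..1}}" using assms by blast
  ultimately obtain v r where v: "strict_mono r" "(u \<circ> r) \<longlonglongrightarrow> v"
    unfolding seq_compact_def by blast
  have "(\<lambda>n. u (r n) a) \<longlonglongrightarrow> v a" for a
    using continuous_on_tendsto_compose[OF continuous_on_product_coordinates[of a] v(2)] by simp
  then show thesis using that v(1) by blast
qed

text \<open>Points of \<open>S\<close> are encoded by sequences of indices into finite
  \<open>(1/2)^j\<close>-nets. The scales are chosen independently of each other; a point is
  recovered as the limit of its net points.\<close>

locale finite_net_coding =
  fixes S :: "'a::metric_space set" and net :: "nat \<Rightarrow> nat \<Rightarrow> 'a" and code :: "nat \<Rightarrow> 'a \<Rightarrow> nat" and A :: "nat \<Rightarrow> nat set"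
  assumes S: "compact S" and A: "finite (A j)"
    and code: "p \<in> S \<Longrightarrow> code j p \<in> A j" "p \<in> S \<Longrightarrow> dist (net j (code j p)) p < (1/2)^j"
    and net: "a \<in> A j \<Longrightarrow> net j a \<in> S"

lemma ex_finite_net_coding:
  fixes S :: "'a::metric_space set" assumes "compact S"
  shows "\<exists>net code A. finite_net_coding S net code A"
proof -
  have "\<exists>k. finite k \<and> k \<subseteq> S \<and> S \<subseteq> (\<Union>x\<in>k. ball x ((1/2)^j))" for j :: nat
    using seq_compact_imp_totally_bounded[OF compact_imp_seq_compact[OF assms]] by simp
  then obtain k where k: "\<And>j. finite (k j)" "\<And>j. k j \<subseteq> S" "\<And>j::nat. S \<subseteq> (\<Union>x\<in>k j. ball x ((1/2)^j))"
    by metis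
  have "\<forall>j p. \<exists>c. p \<in> S \<longrightarrow> c \<in> k j \<and> dist c p < (1/2)^j" using k(3) by (fastforce simp: subset_iff)
  then obtain c where c: "\<And>j p. p \<in> S \<Longrightarrow> c j p \<in> k j \<and> dist (c j p) p < (1/2)^j" by metis
  have cnt: "countable (k j)" for j using k(1) by (rule countable_finite)
  have "finite_net_coding S (\<lambda>j. from_nat_into (k j)) (\<lambda>j p. to_nat_on (k j) (c j p)) (\<lambda>j. to_nat_on (k j) ` k j)"
  proof
    fix j p assume p: "p \<in> S"
    show "dist (from_nat_into (k j) (to_nat_on (k j) (c j p))) p < (1/2)^j"
      using c[OF p, of j] cnt by simp
    show "to_nat_on (k j) (c j p) \<in> to_nat_on (k j) ` k j" using c[OF p] by blast
  next
    fix j a assume "a \<in> to_nat_on (k j) ` k j"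
    then show "from_nat_into (k j) a \<in> S" using cnt[of j] k(2)[of j] by auto
  qed (use k(1) assms in simp_all)
  then show ?thesis by blast
qed

text \<open>Along a subsequence the probabilities of all code prefixes converge, the limits form a
  \<open>tree_weight\<close>, and the net points named by the resulting random code converge almost
  surely to a random point of \<open>S\<close>, whose law is \<rho>.\<close>

theorem compact_weak_limit:
  fixes S :: "'a::metric_space set" and X :: "nat \<Rightarrow> 'b \<Rightarrow> 'a"
  assumes S: "compact S" and P: "\<And>n. finite (P n)" and W0: "\<And>n i. i \<in> P n \<Longrightarrow> 0 \<le> W n i"
    and W1: "\<And>n. (\<Sum>i\<in>P n. W n i) = 1" and X: "\<And>n i. i \<in> P n \<Longrightarrow> X n i \<in> S"
  obtains r \<rho> where "strict_mono (r :: nat \<Rightarrow> nat)" "prob_space \<rho>" "sets \<rho> = sets (restrict_space borel S)"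
    "\<And>f. continuous_on S f \<Longrightarrow> (\<lambda>n. \<Sum>i\<in>P (r n). W (r n) i * f (X (r n) i)) \<longlonglongrightarrow> (\<integral>x. f x \<partial>\<rho> :: real)"
proof -
  obtain net code A where "finite_net_coding S net code A" using ex_finite_net_coding[OF S] by blast
  then interpret C: finite_net_coding S net code A .
  define pre where "pre = (\<lambda>p es. \<forall>i<length es. code i p = es ! i)"
  define u where "u = (\<lambda>n es. \<Sum>i\<in>P n. W n i * of_bool (pre (X n i) es))"
  have u01: "u n es \<in> {0..1}" for n es
  proof -
    have "u n es \<le> (\<Sum>i\<in>P n. W n i)" unfolding u_def using W0 by (intro sum_mono) (auto simp: of_bool_def)
    moreover have "0 \<le> u n es" unfolding u_def using W0 by (intro sum_nonneg) (auto simp: of_bool_def)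
    ultimately show ?thesis using W1 by simp
  qed
  obtain r w where r: "strict_mono r" and w: "\<And>es. (\<lambda>n. u (r n) es) \<longlonglongrightarrow> w es"
    by (rule pointwise_convergent_subsequence[of u, OF u01]) (rule that)
  have u_out: "u n (es @ [a]) = 0" if "a \<notin> A (length es)" for n es a
    unfolding u_def
  proof (intro sum.neutral ballI)
    fix i assume "i \<in> P n"
    then have "code (length es) (X n i) \<noteq> a" using that C.code(1) X by metis
    then have "\<not> pre (X n i) (es @ [a])" unfolding pre_def by (metis length_append_singleton lessI nth_append_length)
    then show "W n i * of_bool (pre (X n i) (es @ [a])) = 0" by simp
  qed
  have pre_snoc: "pre p (es @ [a]) \<longleftrightarrow> pre p es \<and> code (length es) p = a" for p es a
    unfolding pre_def length_append_singleton by (simp add: less_Suc_eq nth_append) blast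
  have u_sum: "(\<Sum>a\<in>A (length es). u n (es @ [a])) = u n es" for n es
  proof -
    have "(\<Sum>a\<in>A (length es). u n (es @ [a])) =
       (\<Sum>i\<in>P n. \<Sum>a\<in>A (length es). W n i * of_bool (pre (X n i) (es @ [a])))"
      unfolding u_def by (rule sum.swap)
    also have "\<dots> = (\<Sum>i\<in>P n. \<Sum>a\<in>A (length es). if a = code (length es) (X n i) then W n i * of_bool (pre (X n i) es) else 0)"
      by (intro sum.cong refl) (simp add: pre_snoc)
    also have "\<dots> = (\<Sum>i\<in>P n. W n i * of_bool (pre (X n i) es))"
      using C.A C.code(1) X by (intro sum.cong refl) simp
    finally show ?thesis by (simp add: u_def)
  qed
  have tw: "tree_weight w"
    unfolding tree_weight_def
  proof (intro conjI allI)
    have "u n [] = 1" for n by (simp add: u_def pre_def W1)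
    then show "w [] = 1" using LIMSEQ_unique[OF w[of "[]"]] by simp
    show "0 \<le> w es" for es using u01 by (intro LIMSEQ_le_const[OF w]) auto
    fix es
    have "w (es @ [a]) = 0" if "a \<notin> A (length es)" for a
      using LIMSEQ_unique[OF w[of "es @ [a]"]] by (simp add: u_out that)
    moreover have "(\<Sum>a\<in>A (length es). w (es @ [a])) = w es"
    proof (rule LIMSEQ_unique)
      show "(\<lambda>n. \<Sum>a\<in>A (length es). u (r n) (es @ [a])) \<longlonglongrightarrow> (\<Sum>a\<in>A (length es). w (es @ [a]))"
        by (intro tendsto_sum w)
      show "(\<lambda>n. \<Sum>a\<in>A (length es). u (r n) (es @ [a])) \<longlonglongrightarrow> w es"
        unfolding u_sum by (rule w)
    qed
    ultimately show "\<exists>A. finite A \<and> (\<forall>a. a \<notin> A \<longrightarrow> w (es @ [a]) = 0) \<and> (\<Sum>a\<in>A. w (es @ [a])) = w es"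
      using C.A by blast
  qed
  obtain M :: "(nat list \<Rightarrow> nat) measure" and Y where M: "prob_space M"
    and Y: "\<And>n. Y n \<in> measurable M (count_space UNIV)"
    and MY: "\<And>es. measure M {x\<in>space M. \<forall>i<length es. Y i x = es ! i} = w es"
    by (rule tree_weight_process[OF tw]) (rule that)
  interpret M: prob_space M by fact
  note Y[measurable]
  obtain s0 where s0: "s0 \<in> S"
  proof -
    have "P 0 \<noteq> {}" using W1[of 0] by auto
    then show thesis using X that by blast
  qed
  \<comment> \<open>Almost surely every prefix that occurs has positive weight, since there are only
    countably many prefixes.\<close>
  define G where "G = {x\<in>space M. \<forall>es\<in>{es. w es = 0}. \<not> (\<forall>i<length es. Y i x = es ! i)}"
  have G[measurable]: "G \<in> sets M" unfolding G_def by measurable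
  have AEG: "AE x in M. x \<in> G"
  proof -
    have "AE x in M. \<not> (\<forall>i<length es. Y i x = es ! i)" if "w es = 0" for es
    proof (rule AE_I[OF _ _ ])
      show "{x\<in>space M. \<not> \<not> (\<forall>i<length es. Y i x = es ! i)} \<subseteq> {x\<in>space M. \<forall>i<length es. Y i x = es ! i}" by auto
      show "emeasure M {x\<in>space M. \<forall>i<length es. Y i x = es ! i} = 0"
        using MY[of es] that by (simp add: M.emeasure_eq_measure)
    qed measurable
    then have "AE x in M. \<forall>es\<in>{es. w es = 0}. \<not> (\<forall>i<length es. Y i x = es ! i)"
      by (subst AE_ball_countable) auto
    then show ?thesis by (auto simp: G_def)
  qed
  \<comment> \<open>\<open>s0\<close> is a default value on the null set outside
    \<open>G\<close>.\<close>
  define z where "z = (\<lambda>t x. if x \<in> G then net t (Y t x) else s0)"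
  have z_meas[measurable]: "z t \<in> borel_measurable M" for t
    unfolding z_def by measurable
  have lim: "\<exists>l\<in>S. (\<lambda>t. z t x) \<longlonglongrightarrow> l \<and> (x \<in> G \<longrightarrow> (\<forall>t. Y t x \<in> A t \<and> dist (z t x) l \<le> (1/2)^t))" for x
  proof (cases "x \<in> G")
    case False
    then show ?thesis using s0 by (auto simp: z_def)
  next
    case True
    \<comment> \<open>A prefix of positive limiting weight has positive weight in some approximating
      measure, hence is the code of an actual point of \<open>S\<close>.\<close>
    have "\<exists>p\<in>S. \<forall>t<n. code t p = Y t x" for n
    proof -
      let ?es = "map (\<lambda>t. Y t x) [0..<n]"
      have "w ?es \<noteq> 0" using True by (auto simp: G_def)
      have "\<exists>k. u (r k) ?es \<noteq> 0"
      proof (rule ccontr)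
        assume "\<nexists>k. u (r k) ?es \<noteq> 0"
        then have "(\<lambda>k. u (r k) ?es) \<longlonglongrightarrow> 0" by simp
        then show False using \<open>w ?es \<noteq> 0\<close> LIMSEQ_unique[OF w[of ?es]] by blast
      qed
      then obtain k where "u (r k) ?es \<noteq> 0" by blast
      then obtain i where i: "i \<in> P (r k)" "W (r k) i * of_bool (pre (X (r k) i) ?es) \<noteq> 0"
        unfolding u_def by (meson sum.neutral)
      then have "pre (X (r k) i) ?es" by (cases "pre (X (r k) i) ?es") simp_all
      then show ?thesis using X[OF i(1)] by (intro bexI[of _ "X (r k) i"]) (simp_all add: pre_def)
    qed
    then obtain p where p: "\<And>n. p n \<in> S" "\<And>n t. t < n \<Longrightarrow> code t (p n) = Y t x" by metis
    obtain l q where l: "l \<in> S" "strict_mono (q::nat\<Rightarrow>nat)" "(p \<circ> q) \<longlonglongrightarrow> l"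
      using compact_imp_seq_compact[OF S] p(1) unfolding seq_compact_def by blast
    \<comment> \<open>For large \<open>n\<close> the point \<open>p (q n)\<close> has the code
      \<open>Y t x\<close> at scale \<open>t\<close> and so lies within \<open>(1/2)^t\<close> of
      \<open>z t x\<close>; the bound passes to the limit \<open>l\<close>.\<close>
    have d: "dist (z t x) l \<le> (1/2)^t" for t
    proof (rule LIMSEQ_le_const2)
      show "(\<lambda>n. dist (z t x) ((p \<circ> q) n)) \<longlonglongrightarrow> dist (z t x) l" by (intro tendsto_intros l)
      show "\<exists>N. \<forall>n\<ge>N. dist (z t x) ((p \<circ> q) n) \<le> (1/2)^t"
      proof (intro exI allI impI)
        fix n assume "n \<ge> Suc t"
        then have "t < q n" using seq_suble[OF l(2), of n] by linarith
        then show "dist (z t x) ((p \<circ> q) n) \<le> (1/2)^t"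
          using C.code(2)[OF p(1), of t "q n"] p(2) True by (simp add: z_def)
      qed
    qed
    moreover have "(\<lambda>t. z t x) \<longlonglongrightarrow> l"
    proof (rule metric_LIMSEQ_I)
      fix e :: real assume "e > 0"
      then obtain N where N: "(1/2::real)^N < e" using real_arch_pow_inv[of e "1/2"] by auto
      have "dist (z t x) l < e" if "t \<ge> N" for t
      proof -
        have "(1/2::real)^t \<le> (1/2)^N" by (intro power_decreasing that) auto
        then show ?thesis using d[of t] N by linarith
      qed
      then show "\<exists>N. \<forall>t\<ge>N. dist (z t x) l < e" by blast
    qed
    moreover have "Y t x \<in> A t" for t using p(2)[of t "Suc t"] C.code(1)[OF p(1)] by (metis lessI)
    ultimately show ?thesis using l(1) by blast
  qed
  then obtain Z where Z: "\<And>x. Z x \<in> S" "\<And>x. (\<lambda>t. z t x) \<longlonglongrightarrow> Z x"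
    "\<And>x t. x \<in> G \<Longrightarrow> Y t x \<in> A t \<and> dist (z t x) (Z x) \<le> (1/2)^t" by metis
  have Zb: "Z \<in> borel_measurable M" by (rule borel_measurable_LIMSEQ_metric[OF z_meas Z(2)])
  have Zm: "Z \<in> measurable M (restrict_space borel S)"
    by (rule measurable_restrict_space2[OF _ Zb]) (use Z(1) in auto)
  define \<rho> where "\<rho> = distr M (restrict_space borel S) Z"
  have conv: "(\<lambda>n. \<Sum>i\<in>P (r n). W (r n) i * f (X (r n) i)) \<longlonglongrightarrow> (\<integral>x. f x \<partial>\<rho>)"
    if f: "continuous_on S f" for f :: "'a \<Rightarrow> real"
  proof (rule LIMSEQ_I)
    fix e :: real assume e: "e > 0"
    have fm: "f \<in> borel_measurable (restrict_space borel S)"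
      using f by (rule borel_measurable_continuous_on_restrict)
    have "uniformly_continuous_on S f" by (rule compact_uniformly_continuous[OF f S])
    then obtain d where d: "d > 0" "\<And>x y. x \<in> S \<Longrightarrow> y \<in> S \<Longrightarrow> dist x y < d \<Longrightarrow> dist (f x) (f y) < e / 4"
      using e unfolding uniformly_continuous_on_def by (metis zero_less_divide_iff zero_less_numeral)
    obtain t where t: "(1/2::real)^t < d" using real_arch_pow_inv[of d "1/2"] d(1) by auto
    \<comment> \<open>Code words of length \<open>Suc t\<close>, whose last letter, at scale
      \<open>t\<close>, names a net point closer than \<open>d\<close>.\<close>
    define L where "L = {es. length es = Suc t \<and> (\<forall>i<Suc t. es ! i \<in> A i)}"
    have finL: "finite L"
    proof (rule finite_subset)
      show "L \<subseteq> {es. set es \<subseteq> (\<Union>i<Suc t. A i) \<and> length es = Suc t}"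
        by (force simp: L_def in_set_conv_nth)
      show "finite {es. set es \<subseteq> (\<Union>i<Suc t. A i) \<and> length es = Suc t}"
        using C.A by (intro finite_lists_length_eq) auto
    qed
    let ?g = "\<lambda>es. f (net t (es ! t))"
    let ?E = "\<lambda>n. \<Sum>i\<in>P n. W n i * f (X n i)" and ?F = "\<lambda>n. \<Sum>es\<in>L. u n es * ?g es" and ?I = "\<Sum>es\<in>L. w es * ?g es"
    \<comment> \<open>Averages of \<open>f\<close>, before and after the limit, are within
      \<open>e/4\<close> of the same linear form in the prefix probabilities, and these
      converge.\<close>
    have EF: "\<bar>?E n - ?F n\<bar> \<le> e / 4" for n
    proof -
      have ex1: "(\<Sum>es\<in>L. of_bool (pre (X n i) es) * ?g es) = f (net t (code t (X n i)))" if i: "i \<in> P n" for i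
      proof -
        let ?c = "map (\<lambda>j. code j (X n i)) [0..<Suc t]"
        have cL: "?c \<in> L" using C.code(1) X[OF i] by (auto simp: L_def nth_append simp del: upt_Suc)
        have "(\<Sum>es\<in>L. of_bool (pre (X n i) es) * ?g es) = (\<Sum>es\<in>L. if es = ?c then ?g ?c else 0)"
        proof (intro sum.cong refl)
          fix es assume "es \<in> L"
          then have "pre (X n i) es \<longleftrightarrow> es = ?c"
            by (auto simp: L_def pre_def list_eq_iff_nth_eq simp del: upt_Suc)
          then show "of_bool (pre (X n i) es) * ?g es = (if es = ?c then ?g ?c else 0)" by simp
        qed
        also have "\<dots> = ?g ?c" using finL cL by simp
        finally show ?thesis by (simp add: nth_append)
      qed
      have "?F n = (\<Sum>es\<in>L. \<Sum>i\<in>P n. W n i * (of_bool (pre (X n i) es) * ?g es))"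
        unfolding u_def by (simp add: sum_distrib_right mult.assoc)
      also have "\<dots> = (\<Sum>i\<in>P n. \<Sum>es\<in>L. W n i * (of_bool (pre (X n i) es) * ?g es))"
        by (rule sum.swap)
      also have "\<dots> = (\<Sum>i\<in>P n. W n i * f (net t (code t (X n i))))"
        by (intro sum.cong refl) (simp add: sum_distrib_left[symmetric] ex1)
      finally have "?E n - ?F n = (\<Sum>i\<in>P n. W n i * (f (X n i) - f (net t (code t (X n i)))))"
        by (simp add: sum_subtractf right_diff_distrib)
      also have "\<bar>\<dots>\<bar> \<le> (\<Sum>i\<in>P n. W n i * (e / 4))"
      proof (rule order_trans[OF sum_abs sum_mono])
        fix i assume i: "i \<in> P n"
        have "dist (f (net t (code t (X n i)))) (f (X n i)) < e / 4"
          using d(2)[OF C.net[OF C.code(1)[OF X[OF i]]] X[OF i]] C.code(2)[OF X[OF i], of t] t by simp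
        then have "\<bar>f (X n i) - f (net t (code t (X n i)))\<bar> \<le> e / 4" unfolding dist_real_def by linarith
        then show "\<bar>W n i * (f (X n i) - f (net t (code t (X n i))))\<bar> \<le> W n i * (e / 4)"
          unfolding abs_mult abs_of_nonneg[OF W0[OF i]] using W0[OF i] by (rule mult_left_mono)
      qed
      also have "\<dots> = e / 4" by (simp only: sum_distrib_right[symmetric] W1 mult_1)
      finally show ?thesis .
    qed
    have I: "\<bar>(\<integral>x. f x \<partial>\<rho>) - ?I\<bar> \<le> e / 4"
    proof -
      have bnd: "\<exists>B. \<forall>x\<in>S. \<bar>f x\<bar> \<le> B"
        using compact_imp_bounded[OF compact_continuous_image[OF f S]] by (auto simp: bounded_iff)
      then obtain B where B: "\<And>x. x \<in> S \<Longrightarrow> \<bar>f x\<bar> \<le> B" by blast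
      have int1: "integrable M (\<lambda>x. f (Z x))"
        by (rule M.integrable_const_bound[of _ B]) (use B Z(1) measurable_compose[OF Zm fm] in auto)
      let ?h = "\<lambda>x. \<Sum>es\<in>L. indicator {x\<in>space M. \<forall>i<length es. Y i x = es ! i} x * ?g es"
      have int2: "integrable M ?h" by (intro Bochner_Integration.integrable_sum integrable_mult_left M.integrable_const_bound[of _ 1]) auto
      have "(\<integral>x. ?h x \<partial>M) = ?I"
        by (subst Bochner_Integration.integral_sum)
          (auto simp: MY intro!: integrable_mult_left M.integrable_const_bound[of _ 1])
      moreover have "(\<integral>x. f x \<partial>\<rho>) = (\<integral>x. f (Z x) \<partial>M)"
        unfolding \<rho>_def by (rule integral_distr[OF Zm fm])
      ultimately have eq: "(\<integral>x. f x \<partial>\<rho>) - ?I = (\<integral>x. f (Z x) - ?h x \<partial>M)"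
        by (simp only: Bochner_Integration.integral_diff[OF int1 int2])
      have "\<bar>(\<integral>x. f x \<partial>\<rho>) - ?I\<bar> \<le> (\<integral>x. \<bar>f (Z x) - ?h x\<bar> \<partial>M)"
        unfolding eq by (rule integral_abs_bound)
      also have "\<dots> \<le> (\<integral>x. e / 4 \<partial>M)"
      proof (rule integral_mono_AE)
        show "AE x in M. \<bar>f (Z x) - ?h x\<bar> \<le> e / 4"
          using AEG
        proof eventually_elim
          case (elim x)
          let ?c = "map (\<lambda>j. Y j x) [0..<Suc t]"
          have xM: "x \<in> space M" using elim by (simp add: G_def)
          have cL: "?c \<in> L" using Z(3)[OF elim] by (auto simp: L_def simp del: upt_Suc)
          have "?h x = (\<Sum>es\<in>L. if es = ?c then ?g ?c else 0)"
          proof (intro sum.cong refl)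
            fix es assume "es \<in> L"
            then have "(\<forall>i<length es. Y i x = es ! i) \<longleftrightarrow> es = ?c"
              by (auto simp: L_def list_eq_iff_nth_eq simp del: upt_Suc)
            then show "indicator {x\<in>space M. \<forall>i<length es. Y i x = es ! i} x * ?g es = (if es = ?c then ?g ?c else 0)"
              using xM by (simp add: indicator_def)
          qed
          also have "\<dots> = ?g ?c" using finL cL by simp
          also have "\<dots> = f (z t x)" using elim by (simp add: z_def nth_append)
          finally have h: "?h x = f (z t x)" .
          have "z t x \<in> S" using elim Z(3)[OF elim] C.net by (simp add: z_def)
          moreover have "dist (z t x) (Z x) < d" using Z(3)[OF elim, of t] t by simp
          ultimately have "dist (f (z t x)) (f (Z x)) < e / 4" using d(2) Z(1) by blast
          then show ?case unfolding h by (simp add: dist_real_def abs_minus_commute)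
        qed
      qed (auto intro!: integrable_abs Bochner_Integration.integrable_diff int1 int2)
      finally show ?thesis by (simp add: M.prob_space)
    qed
    have "(\<lambda>n. ?F (r n)) \<longlonglongrightarrow> ?I" by (intro tendsto_intros w)
    moreover have "0 < e / 4" using e by simp
    ultimately have "\<exists>N. \<forall>n\<ge>N. norm (?F (r n) - ?I) < e / 4" by (rule LIMSEQ_D)
    then have "\<exists>N. \<forall>n\<ge>N. \<bar>?F (r n) - ?I\<bar> < e / 4" unfolding real_norm_def .
    then obtain N where N: "\<And>n. n \<ge> N \<Longrightarrow> \<bar>?F (r n) - ?I\<bar> < e / 4" by blast
    have "norm (?E (r n) - (\<integral>x. f x \<partial>\<rho>)) < e" if "n \<ge> N" for n
      using EF[of "r n"] I N[OF that] e unfolding real_norm_def by linarith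
    then show "\<exists>N. \<forall>n\<ge>N. norm (?E (r n) - (\<integral>x. f x \<partial>\<rho>)) < e" by blast
  qed
  have "prob_space \<rho>" unfolding \<rho>_def by (rule M.prob_space_distr[OF Zm])
  then show thesis using that[OF r _ _ conv] by (simp add: \<rho>_def)
qed

section \<open>Probability measures and the weak topology\<close>

lemma sets_restrict_borel_closed:
  fixes S :: "'a::topological_space set"
  assumes "closed S" shows "sets (restrict_space borel S) = sigma_sets S {C. closed C \<and> C \<subseteq> S}"
proof -
  have b: "sets (borel :: 'a measure) = sigma_sets UNIV {C. closed C}"
    by (simp add: borel_eq_closed)
  have "sets (restrict_space borel S) = (\<inter>) S ` sigma_sets UNIV {C. closed C}"
    by (simp add: sets_restrict_space b)
  also have "\<dots> = sigma_sets S ((\<inter>) S ` {C. closed C})"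
    by (rule sigma_sets_Int) (use assms in \<open>auto intro: sigma_sets.Basic\<close>)
  also have "(\<inter>) S ` {C. closed C} = {C. closed C \<and> C \<subseteq> S}"
    using assms by (auto simp: image_iff intro: exI[of _ "_ \<inter> S"])
  finally show ?thesis .
qed

text \<open>The continuous functions \<open>max 0 (1 - n * infdist x C)\<close> tend to the
  indicator of a nonempty closed \<open>C\<close>, and the closed subsets of \<open>S\<close> are an
  intersection-stable generator.\<close>

lemma prob_eqI_continuous:
  fixes S :: "'a::metric_space set"
  assumes S: "compact S" and \<mu>: "prob_space \<mu>" "sets \<mu> = sets (restrict_space borel S)"
    and \<nu>: "prob_space \<nu>" "sets \<nu> = sets (restrict_space borel S)"
    and eq: "\<And>f. continuous_on S f \<Longrightarrow> (\<integral>x. f x \<partial>\<mu>) = (\<integral>x. f x \<partial>\<nu> :: real)"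
  shows "\<mu> = \<nu>"
proof -
  have cS: "closed S" using S by (rule compact_imp_closed)
  have gen: "emeasure N C = ennreal (lim (\<lambda>n. \<integral>x. max 0 (1 - real n * infdist x C) \<partial>N))"
    if N: "prob_space N" "sets N = sets (restrict_space borel S)" and C: "closed C" "C \<subseteq> S" "C \<noteq> {}" for N C
  proof -
    interpret prob_space N by fact
    have sp: "space N = S" using sets_eq_imp_space_eq[OF N(2)] by (simp add: space_restrict_space)
    have CN: "C \<in> sets N" unfolding N(2) sets_restrict_borel_closed[OF cS] using C by (auto intro: sigma_sets.Basic)
    have meas: "(\<lambda>x. max 0 (1 - real n * infdist x C)) \<in> borel_measurable N" for n
      unfolding measurable_cong_sets[OF N(2) refl]
      by (intro borel_measurable_continuous_on_restrict continuous_intros)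
    have "(\<lambda>n. \<integral>x. max 0 (1 - real n * infdist x C) \<partial>N) \<longlonglongrightarrow> (\<integral>x. indicator C x \<partial>N)"
    proof (rule integral_dominated_convergence[where w="\<lambda>_. 1"])
      show "AE x in N. (\<lambda>n. max 0 (1 - real n * infdist x C)) \<longlonglongrightarrow> indicator C x"
      proof (rule AE_I2)
        fix x
        show "(\<lambda>n. max 0 (1 - real n * infdist x C)) \<longlonglongrightarrow> indicator C x"
        proof (cases "x \<in> C")
          case True
          then show ?thesis by simp
        next
          case False
          then have p: "infdist x C > 0"
            using C in_closed_iff_infdist_zero[of C x] infdist_nonneg[of x C] by linarith
          obtain N where "1 / infdist x C < real N" using reals_Archimedean2 by blast
          then have N: "1 < real N * infdist x C" using p by (simp add: field_simps)
          have "max 0 (1 - real n * infdist x C) = indicator C x" if "n \<ge> N" for n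
          proof -
            have "real N * infdist x C \<le> real n * infdist x C" using that p by (intro mult_right_mono) auto
            then show ?thesis using N False by simp
          qed
          then show ?thesis by (intro tendsto_eventually) (auto simp: eventually_sequentially)
        qed
      qed
      show "AE x in N. norm (max 0 (1 - real n * infdist x C)) \<le> 1" for n by (intro AE_I2) (auto simp: infdist_nonneg)
    qed (use meas CN in auto)
    then have "lim (\<lambda>n. \<integral>x. max 0 (1 - real n * infdist x C) \<partial>N) = measure N C"
      using CN by (simp add: limI)
    then show ?thesis by (simp add: emeasure_eq_measure)
  qed
  show ?thesis
  proof (rule measure_eqI_generator_eq[where E="{C. closed C \<and> C \<subseteq> S}" and \<Omega>=S and A="\<lambda>_. S"])
    show "Int_stable {C. closed C \<and> C \<subseteq> S}" by (auto simp: Int_stable_def)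
    show "emeasure \<mu> C = emeasure \<nu> C" if "C \<in> {C. closed C \<and> C \<subseteq> S}" for C
    \<comment> \<open>\<open>infdist x {}\<close> is 0, so the approximation of the indicator fails
      for the empty set.\<close>
    proof (cases "C = {}")
      case False
      have "(\<integral>x. max 0 (1 - real n * infdist x C) \<partial>\<mu>) = (\<integral>x. max 0 (1 - real n * infdist x C) \<partial>\<nu>)" for n
        by (intro eq continuous_intros)
      then show ?thesis using that False by (simp add: gen[OF \<mu>] gen[OF \<nu>])
    qed simp
    show "sets \<mu> = sigma_sets S {C. closed C \<and> C \<subseteq> S}" "sets \<nu> = sigma_sets S {C. closed C \<and> C \<subseteq> S}"
      using \<mu>(2) \<nu>(2) sets_restrict_borel_closed[OF cS] by simp_all
    show "emeasure \<mu> S \<noteq> \<infinity>" using \<mu>(1) by (simp add: prob_space_def finite_measure.emeasure_finite)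
  qed (use cS in auto)
qed

lemma sets_borel_of: "sets (borel_of X) = sigma_sets (topspace X) {U. openin X U}"
  unfolding borel_of_def by (rule sets_measure_of) (auto dest: openin_subset)

lemma space_borel_of [simp]: "space (borel_of X) = topspace X"
  unfolding borel_of_def by (rule space_measure_of) (auto dest: openin_subset)

lemma sets_borel_of_top_of_set:
  assumes "S \<in> sets borel" shows "sets (borel_of (top_of_set S)) = sets (restrict_space borel S)"
proof -
  have "sets (restrict_space borel S) = (\<inter>) S ` sigma_sets UNIV {U. open U}"
    by (simp add: sets_restrict_space borel_def)
  also have "\<dots> = sigma_sets S ((\<inter>) S ` {U. open U})"
    by (rule sigma_sets_Int) (use assms in \<open>auto simp: borel_def\<close>)
  also have "(\<inter>) S ` {U. open U} = {U. openin (top_of_set S) U}"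
    by (auto simp: openin_open)
  finally show ?thesis by (simp add: sets_borel_of)
qed

lemma measurable_borel_of_continuous_map:
  assumes "continuous_map X Y f" shows "f \<in> measurable (borel_of X) (borel_of Y)"
proof -
  have "f \<in> measurable (borel_of X) (sigma (topspace Y) {U. openin Y U})"
  proof (rule measurable_measure_of)
    show "f \<in> space (borel_of X) \<rightarrow> topspace Y"
      using continuous_map_image_subset_topspace[OF assms] by auto
    fix U assume "U \<in> {U. openin Y U}"
    then have "openin X {x \<in> topspace X. f x \<in> U}" using assms by (simp add: continuous_map_def)
    moreover have "f -` U \<inter> space (borel_of X) = {x \<in> topspace X. f x \<in> U}" by auto
    ultimately show "f -` U \<inter> space (borel_of X) \<in> sets (borel_of X)"
      by (simp add: sets_borel_of sigma_sets.Basic)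
  qed (auto dest: openin_subset)
  then show ?thesis by (simp add: borel_of_def)
qed

lemma borel_measurable_continuous_map:
  assumes "continuous_map X euclideanreal f" shows "f \<in> borel_measurable (borel_of X)"
proof -
  have "f \<in> measurable (borel_of X) (borel_of euclideanreal)" by (rule measurable_borel_of_continuous_map) fact
  moreover have "sets (borel_of euclideanreal) = sets borel" by (simp add: sets_borel_of borel_def)
  ultimately show ?thesis using measurable_cong_sets[OF refl] by blast
qed

lemma prob_measuresD:
  assumes "\<mu> \<in> prob_measures X"
  shows "prob_space \<mu>" "sets \<mu> = sets (borel_of X)" "space \<mu> = topspace X"
  using assms sets_eq_imp_space_eq[of \<mu> "borel_of X"] by (auto simp: prob_measures_def)

lemma integrable_bounded_prob:
  assumes "prob_space \<mu>" "f \<in> borel_measurable \<mu>" "\<And>x. x \<in> space \<mu> \<Longrightarrow> \<bar>f x :: real\<bar> \<le> B"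
  shows "integrable \<mu> f"
proof -
  interpret prob_space \<mu> by fact
  show ?thesis by (rule integrable_const_bound[of _ B]) (use assms in auto)
qed

context
  fixes \<mu> \<nu> :: "'a measure" and c :: real
  assumes \<mu>: "prob_space \<mu>" and \<nu>: "prob_space \<nu>" and sets_eq: "sets \<nu> = sets \<mu>" and c: "0 \<le> c" "c \<le> 1"
begin

lemma sets_mix: "sets (mix c \<mu> \<nu>) = sets \<mu>"
  unfolding mix_def by (simp add: sets.space_closed)

lemma space_mix: "space (mix c \<mu> \<nu>) = space \<mu>"
  unfolding mix_def by (simp add: sets.space_closed space_measure_of)

lemma emeasure_mix:
  assumes A: "A \<in> sets \<mu>"
  shows "emeasure (mix c \<mu> \<nu>) A = ennreal (1 - c) * emeasure \<mu> A + ennreal c * emeasure \<nu> A"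
proof (rule emeasure_measure_of[OF mix_def])
  show "countably_additive (sets (mix c \<mu> \<nu>)) (\<lambda>A. ennreal (1 - c) * emeasure \<mu> A + ennreal c * emeasure \<nu> A)"
    unfolding sets_mix countably_additive_def
  proof (intro allI impI)
    fix A :: "nat \<Rightarrow> 'a set" assume A: "range A \<subseteq> sets \<mu>" "disjoint_family A"
    have "suminf (\<lambda>i. ennreal (1 - c) * emeasure \<mu> (A i) + ennreal c * emeasure \<nu> (A i)) =
      suminf (\<lambda>i. ennreal (1 - c) * emeasure \<mu> (A i)) + suminf (\<lambda>i. ennreal c * emeasure \<nu> (A i))"
      by (rule suminf_add[symmetric]) auto
    then show "suminf (\<lambda>i. ennreal (1 - c) * emeasure \<mu> (A i) + ennreal c * emeasure \<nu> (A i)) =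
       ennreal (1 - c) * emeasure \<mu> (\<Union>i. A i) + ennreal c * emeasure \<nu> (\<Union>i. A i)"
      using A by (simp add: ennreal_suminf_cmult suminf_emeasure sets_eq)
  qed
qed (use A in \<open>auto simp: positive_def sets_mix sets.space_closed dest: sets.sets_into_space\<close>)

lemma measure_mix:
  assumes A: "A \<in> sets \<mu>"
  shows "measure (mix c \<mu> \<nu>) A = (1 - c) * measure \<mu> A + c * measure \<nu> A"
proof -
  interpret m: prob_space \<mu> by (rule \<mu>)
  interpret n: prob_space \<nu> by (rule \<nu>)
  show ?thesis
    unfolding measure_def[of "mix c \<mu> \<nu>"] emeasure_mix[OF A] m.emeasure_eq_measure n.emeasure_eq_measure
    using c by (simp add: ennreal_mult[symmetric] ennreal_plus[symmetric] del: ennreal_plus)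
qed

lemma prob_space_mix: "prob_space (mix c \<mu> \<nu>)"
proof
  have "space \<nu> = space \<mu>" by (rule sets_eq_imp_space_eq[OF sets_eq])
  then have "emeasure \<mu> (space \<mu>) = 1" "emeasure \<nu> (space \<mu>) = 1"
    using prob_space.emeasure_space_1[OF \<mu>] prob_space.emeasure_space_1[OF \<nu>] by simp_all
  then show "emeasure (mix c \<mu> \<nu>) (space (mix c \<mu> \<nu>)) = 1"
    using c by (simp add: space_mix emeasure_mix ennreal_plus[symmetric] del: ennreal_plus)
qed

lemma nn_integral_mix:
  assumes f: "f \<in> borel_measurable \<mu>"
  shows "(\<integral>\<^sup>+x. f x \<partial>mix c \<mu> \<nu>) = ennreal (1 - c) * (\<integral>\<^sup>+x. f x \<partial>\<mu>) + ennreal c * (\<integral>\<^sup>+x. f x \<partial>\<nu>)"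
  using f
proof (induction rule: borel_measurable_induct)
  case (cong f g)
  have "space \<nu> = space \<mu>" by (rule sets_eq_imp_space_eq[OF sets_eq])
  then have "(\<integral>\<^sup>+x. g x \<partial>N) = (\<integral>\<^sup>+x. f x \<partial>N)" if "N \<in> {\<mu>, \<nu>, mix c \<mu> \<nu>}" for N
    using that cong(3) by (intro nn_integral_cong) (auto simp: space_mix)
  then show ?case using cong(4) by simp
next
  case (set A)
  then show ?case by (simp add: nn_integral_indicator sets_mix sets_eq emeasure_mix)
next
  case (mult u v)
  then have "u \<in> borel_measurable (mix c \<mu> \<nu>)" "u \<in> borel_measurable \<nu>"
    by (simp_all add: measurable_cong_sets[OF sets_mix refl] measurable_cong_sets[OF sets_eq refl])
  then show ?case using mult by (simp add: nn_integral_cmult distrib_left mult_ac)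
next
  case (add u v)
  then have "u \<in> borel_measurable (mix c \<mu> \<nu>)" "u \<in> borel_measurable \<nu>" "v \<in> borel_measurable (mix c \<mu> \<nu>)" "v \<in> borel_measurable \<nu>"
    by (simp_all add: measurable_cong_sets[OF sets_mix refl] measurable_cong_sets[OF sets_eq refl])
  then show ?case using add by (simp add: nn_integral_add distrib_left add_ac)
next
  case (seq U)
  have m: "U i \<in> borel_measurable (mix c \<mu> \<nu>)" "U i \<in> borel_measurable \<nu>" for i
    using seq(1) by (simp_all add: measurable_cong_sets[OF sets_mix refl] measurable_cong_sets[OF sets_eq refl])
  have inc: "incseq (\<lambda>i. \<integral>\<^sup>+x. U i x \<partial>N)" for N :: "'a measure"
    using seq(3) by (auto simp: incseq_def le_fun_def intro!: nn_integral_mono)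
  have sup: "(SUP i. U i) = (\<lambda>x. SUP i. U i x)"
    by (rule ext) (simp add: image_comp o_def)
  have s: "(\<integral>\<^sup>+x. (SUP i. U i x) \<partial>N) = (SUP i. \<integral>\<^sup>+x. U i x \<partial>N)" if "N \<in> {\<mu>, \<nu>, mix c \<mu> \<nu>}" for N
    using that seq(1,3) m by (intro nn_integral_monotone_convergence_SUP) auto
  have "(SUP i. \<integral>\<^sup>+x. U i x \<partial>mix c \<mu> \<nu>) =
     (SUP i. ennreal (1 - c) * (\<integral>\<^sup>+x. U i x \<partial>\<mu>) + ennreal c * (\<integral>\<^sup>+x. U i x \<partial>\<nu>))"
    by (intro SUP_cong refl seq.IH)
  also have "\<dots> = (SUP i. ennreal (1 - c) * (\<integral>\<^sup>+x. U i x \<partial>\<mu>)) + (SUP i. ennreal c * (\<integral>\<^sup>+x. U i x \<partial>\<nu>))"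
    by (rule ennreal_SUP_add) (auto intro!: incseq_SucI mult_left_mono incseq_SucD[OF inc])
  also have "\<dots> = ennreal (1 - c) * (SUP i. \<integral>\<^sup>+x. U i x \<partial>\<mu>) + ennreal c * (SUP i. \<integral>\<^sup>+x. U i x \<partial>\<nu>)"
    by (simp only: SUP_mult_left_ennreal)
  finally show ?case unfolding sup by (simp only: s insert_iff refl simp_thms)
qed

text \<open>Adding the bound \<open>B\<close> makes the integrand nonnegative and reduces the claim
  to \<open>nn_integral_mix\<close>.\<close>

lemma integral_mix:
  assumes f: "f \<in> borel_measurable \<mu>" and B: "\<And>x. x \<in> space \<mu> \<Longrightarrow> \<bar>f x :: real\<bar> \<le> B"
  shows "(\<integral>x. f x \<partial>mix c \<mu> \<nu>) = (1 - c) * (\<integral>x. f x \<partial>\<mu>) + c * (\<integral>x. f x \<partial>\<nu>)"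
proof -
  have sp: "space \<nu> = space \<mu>" by (rule sets_eq_imp_space_eq[OF sets_eq])
  have f2: "f \<in> borel_measurable (mix c \<mu> \<nu>)" "f \<in> borel_measurable \<nu>"
    using f by (simp_all add: measurable_cong_sets[OF sets_mix refl] measurable_cong_sets[OF sets_eq refl])
  have eq: "ennreal ((\<integral>x. f x \<partial>N) + B) = (\<integral>\<^sup>+x. ennreal (f x + B) \<partial>N) \<and> 0 \<le> (\<integral>x. f x \<partial>N) + B"
    if N: "prob_space N" "f \<in> borel_measurable N" "space N = space \<mu>" for N
  proof -
    interpret prob_space N by fact
    have i: "integrable N f" using N B by (intro integrable_bounded_prob) auto
    have nn: "AE x in N. 0 \<le> f x + B" using B N(3) by (intro AE_I2) fastforce
    have "(\<integral>\<^sup>+x. ennreal (f x + B) \<partial>N) = ennreal (\<integral>x. f x + B \<partial>N)"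
      using i nn by (intro nn_integral_eq_integral) auto
    moreover have "(\<integral>x. f x + B \<partial>N) = (\<integral>x. f x \<partial>N) + B" using i by (simp add: prob_space)
    moreover have "0 \<le> (\<integral>x. f x + B \<partial>N)" using nn by (rule integral_nonneg_AE)
    ultimately show ?thesis by simp
  qed
  note e1 = eq[OF prob_space_mix f2(1) space_mix] and e2 = eq[OF \<mu> f refl] and e3 = eq[OF \<nu> f2(2) sp]
  have "ennreal ((\<integral>x. f x \<partial>mix c \<mu> \<nu>) + B) =
     ennreal (1 - c) * ennreal ((\<integral>x. f x \<partial>\<mu>) + B) + ennreal c * ennreal ((\<integral>x. f x \<partial>\<nu>) + B)"
    using e1 e2 e3 nn_integral_mix[of "\<lambda>x. ennreal (f x + B)"] f by (simp del: ennreal_plus)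
  also have "\<dots> = ennreal ((1 - c) * ((\<integral>x. f x \<partial>\<mu>) + B) + c * ((\<integral>x. f x \<partial>\<nu>) + B))"
    using c conjunct2[OF e2] conjunct2[OF e3] by (simp add: ennreal_mult[symmetric] ennreal_plus[symmetric] del: ennreal_plus)
  finally have "(\<integral>x. f x \<partial>mix c \<mu> \<nu>) + B = (1 - c) * ((\<integral>x. f x \<partial>\<mu>) + B) + c * ((\<integral>x. f x \<partial>\<nu>) + B)"
    using c e1 e2 e3 by (subst (asm) ennreal_inj) auto
  then show ?thesis by (simp add: algebra_simps)
qed

end

lemma mix_prob_measures:
  assumes "\<mu> \<in> prob_measures X" "\<nu> \<in> prob_measures X" "c \<in> {0..1}"
  shows "mix c \<mu> \<nu> \<in> prob_measures X"
  using assms prob_space_mix[of \<mu> \<nu> c] sets_mix[of \<mu> \<nu> c] by (simp add: prob_measures_def)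

text \<open>Conditioning on an event of intermediate probability and on its complement. This serves
  twice: to show that extreme laws have 0-1 mixing measures, and to split off atoms.\<close>

lemma mix_uniform_measure:
  assumes \<mu>: "prob_space \<mu>" and A: "A \<in> sets \<mu>" "0 < measure \<mu> A" "measure \<mu> A < 1"
  shows "\<mu> = mix (measure \<mu> A) (uniform_measure \<mu> (space \<mu> - A)) (uniform_measure \<mu> A)"
    "prob_space (uniform_measure \<mu> A)" "prob_space (uniform_measure \<mu> (space \<mu> - A))"
proof -
  interpret prob_space \<mu> by fact
  let ?B = "space \<mu> - A"
  have mB: "measure \<mu> ?B = 1 - measure \<mu> A" using A(1) by (rule prob_compl)
  have e: "emeasure \<mu> A \<noteq> 0" "emeasure \<mu> ?B \<noteq> 0"
    using A mB by (simp_all add: emeasure_eq_measure)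
  show p: "prob_space (uniform_measure \<mu> A)" "prob_space (uniform_measure \<mu> ?B)"
    using e emeasure_finite by (auto intro!: prob_space_uniform_measure)
  show "\<mu> = mix (measure \<mu> A) (uniform_measure \<mu> ?B) (uniform_measure \<mu> A)"
  proof (rule measure_eqI)
    note mixs = p(2) p(1) _ measure_nonneg less_imp_le[OF A(3)]
    show "sets \<mu> = sets (mix (measure \<mu> A) (uniform_measure \<mu> ?B) (uniform_measure \<mu> A))"
      by (subst sets_mix[OF mixs]) auto
    fix X assume X: "X \<in> sets \<mu>"
    have "measure (mix (measure \<mu> A) (uniform_measure \<mu> ?B) (uniform_measure \<mu> A)) X =
       (1 - measure \<mu> A) * (measure \<mu> (?B \<inter> X) / measure \<mu> ?B) + measure \<mu> A * (measure \<mu> (A \<inter> X) / measure \<mu> A)"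
      using X A e by (subst measure_mix[OF mixs]) (auto simp: emeasure_eq_measure)
    also have "\<dots> = measure \<mu> (?B \<inter> X) + measure \<mu> (A \<inter> X)" using A mB by simp
    also have "\<dots> = measure \<mu> (?B \<inter> X \<union> A \<inter> X)" using A X by (intro finite_measure_Union[symmetric]) auto
    also have "?B \<inter> X \<union> A \<inter> X = X" using sets.sets_into_space[OF X] by auto
    finally have "measure \<mu> X = measure (mix (measure \<mu> A) (uniform_measure \<mu> ?B) (uniform_measure \<mu> A)) X" ..
    moreover have "prob_space (mix (measure \<mu> A) (uniform_measure \<mu> ?B) (uniform_measure \<mu> A))"
      by (rule prob_space_mix[OF mixs]) auto
    ultimately show "emeasure \<mu> X = emeasure (mix (measure \<mu> A) (uniform_measure \<mu> ?B) (uniform_measure \<mu> A)) X"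
      by (simp add: emeasure_eq_measure finite_measure.emeasure_eq_measure prob_space_def)
  qed
qed

lemma topspace_weak_topology [simp]: "topspace (weak_topology X) = prob_measures X"
proof -
  have "prob_measures X \<in> {{\<mu>\<in>prob_measures X. (\<integral>x. f x \<partial>\<mu>) \<in> U} | f U.
        continuous_map X euclideanreal f \<and> bounded (f ` topspace X) \<and> open (U::real set)}"
    by (rule CollectI, rule exI[of _ "\<lambda>_. 0"], rule exI[of _ UNIV]) (auto intro: finite_imp_bounded finite_subset[of _ "{0}"])
  then show ?thesis unfolding weak_topology_def topology_generated_by_topspace by blast
qed

lemma continuous_map_weak_integral:
  assumes "continuous_map X euclideanreal f" "bounded (f ` topspace X)"
  shows "continuous_map (weak_topology X) euclideanreal (\<lambda>\<mu>. \<integral>x. f x \<partial>\<mu>)"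
  unfolding continuous_map_def
proof (intro conjI allI impI)
  fix U :: "real set" assume "openin euclidean U"
  then show "openin (weak_topology X) {\<mu> \<in> topspace (weak_topology X). (\<integral>x. f x \<partial>\<mu>) \<in> U}"
    unfolding topspace_weak_topology unfolding weak_topology_def using assms
    by (intro topology_generated_by_Basis) auto
qed auto

lemma continuous_map_into_weak:
  assumes "\<And>z. z \<in> topspace Z \<Longrightarrow> F z \<in> prob_measures X"
    and "\<And>f. continuous_map X euclideanreal f \<Longrightarrow> bounded (f ` topspace X) \<Longrightarrow> continuous_map Z euclideanreal (\<lambda>z. \<integral>x. f x \<partial>F z)"
  shows "continuous_map Z (weak_topology X) F"
  unfolding weak_topology_def
proof (rule continuous_on_generated_topo)
  fix V assume "V \<in> {{\<mu>\<in>prob_measures X. (\<integral>x. f x \<partial>\<mu>) \<in> U} | f U.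
        continuous_map X euclideanreal f \<and> bounded (f ` topspace X) \<and> open U}"
  then obtain f and U :: "real set" where V: "V = {\<mu>\<in>prob_measures X. (\<integral>x. f x \<partial>\<mu>) \<in> U}"
    "continuous_map X euclideanreal f" "bounded (f ` topspace X)" "open U" by blast
  have "F -` V \<inter> topspace Z = {z \<in> topspace Z. (\<integral>x. f x \<partial>F z) \<in> U}" using V(1) assms(1) by auto
  then show "openin Z (F -` V \<inter> topspace Z)"
    using assms(2)[OF V(2,3)] V(4) by (simp add: continuous_map_def)
next
  show "F ` topspace Z \<subseteq> \<Union>{{\<mu>\<in>prob_measures X. (\<integral>x. f x \<partial>\<mu>) \<in> U} | f U.
        continuous_map X euclideanreal f \<and> bounded (f ` topspace X) \<and> open U}"
    using assms(1) topspace_weak_topology[of X] unfolding weak_topology_def topology_generated_by_topspace by blast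
qed

section \<open>Grafting on rooted trees\<close>

instance ptree :: countable
  by countable_datatype

instance rtree :: countable
proof
  have "inj rep" by (rule inj_on_inverseI[of _ shape]) simp
  then have "inj (to_nat \<circ> rep)" by (intro inj_compose) auto
  then show "\<exists>f::rtree \<Rightarrow> nat. inj f" by blast
qed

definition pv :: "ptree \<Rightarrow> vertex set" where
  "pv p = {v. (p, v) \<in> pverts}"

lemma verts_eq: "verts t = pv (rep t)"
  by (simp add: verts_def pv_def)

lemma Nil_in_pv [simp]: "[] \<in> pv p"
  by (simp add: pv_def pverts.root)

lemma Cons_in_pv [simp]: "i # v \<in> pv (PNode ts) \<longleftrightarrow> i < length ts \<and> v \<in> pv (ts ! i)"
  unfolding pv_def by (auto elim: pverts.cases intro: pverts.child)

lemma pv_PNode: "pv (PNode ts) = insert [] (\<Union>i<length ts. (#) i ` pv (ts ! i))"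
proof (rule set_eqI)
  fix v show "v \<in> pv (PNode ts) \<longleftrightarrow> v \<in> insert [] (\<Union>i<length ts. (#) i ` pv (ts ! i))"
    by (cases v) auto
qed

lemma finite_pv [simp]: "finite (pv p)"
proof (induction p)
  case (PNode ts)
  then show ?case by (auto simp: pv_PNode)
qed

lemma finite_verts [simp]: "finite (verts t)"
  by (simp add: verts_eq)

lemma sum_pv_PNode:
  "(\<Sum>v\<in>pv (PNode ts). h v) = h [] + (\<Sum>i<length ts. \<Sum>v\<in>pv (ts ! i). h (i # v))"
proof -
  have "(\<Sum>v\<in>pv (PNode ts). h v) = h [] + (\<Sum>v\<in>(\<Union>i<length ts. (#) i ` pv (ts ! i)). h v)"
    unfolding pv_PNode by (rule sum.insert) auto
  also have "(\<Sum>v\<in>(\<Union>i<length ts. (#) i ` pv (ts ! i)). h v) = (\<Sum>i<length ts. \<Sum>v\<in>(#) i ` pv (ts ! i). h v)"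
    by (rule sum.UNION_disjoint) auto
  also have "\<dots> = (\<Sum>i<length ts. \<Sum>v\<in>pv (ts ! i). h (i # v))"
    by (intro sum.cong[OF refl] sum.reindex_cong[where l="(#) _"]) (auto simp: inj_on_def)
  finally show ?thesis .
qed

lemma pgraft_PNode:
  "pgraft (PNode ts) g = Node (g [] + mset (map (\<lambda>i. pgraft (ts ! i) (\<lambda>v. g (i # v))) [0..<length ts]))"
proof -
  have "map (\<lambda>(i, s). pgraft s (\<lambda>v. g (i # v))) (List.enumerate 0 ts) = map (\<lambda>i. pgraft (ts ! i) (\<lambda>v. g (i # v))) [0..<length ts]"
    by (rule nth_equalityI) (simp_all add: nth_enumerate_eq)
  then show ?thesis by simp
qed

declare pgraft.simps [simp del]

lemma pgraft_empty: "(\<And>v. v \<in> pv p \<Longrightarrow> g v = {#}) \<Longrightarrow> pgraft p g = shape p"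
proof (induction p arbitrary: g)
  case (PNode ts)
  have "map (\<lambda>i. pgraft (ts ! i) (\<lambda>v. g (i # v))) [0..<length ts] = map shape ts"
    by (rule nth_equalityI) (auto intro!: PNode)
  then show ?case using PNode.prems by (simp add: pgraft_PNode)
qed

definition at_vertex :: "vertex \<Rightarrow> 'b multiset \<Rightarrow> vertex \<Rightarrow> 'b multiset" where
  "at_vertex v X = (\<lambda>w. if w = v then X else {#})"

lemma at_vertex_simps [simp]: "at_vertex v X v = X" "w \<noteq> v \<Longrightarrow> at_vertex v X w = {#}"
  by (auto simp: at_vertex_def)

lemma pgraft_root: "pgraft (PNode ts) (at_vertex [] X) = Node (X + mset (map shape ts))"
proof -
  have "map (\<lambda>i. pgraft (ts ! i) (\<lambda>v. at_vertex [] X (i # v))) [0..<length ts] = map shape ts"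
    by (rule nth_equalityI) (auto intro!: pgraft_empty)
  then show ?thesis by (simp add: pgraft_PNode)
qed

lemma pgraft_child:
  assumes "i < length ts"
  shows "pgraft (PNode ts) (at_vertex (i # v) X) =
    Node (add_mset (pgraft (ts ! i) (at_vertex v X)) (mset (map shape ts) - {#shape (ts ! i)#}))"
proof -
  have "map (\<lambda>j. pgraft (ts ! j) (\<lambda>w. at_vertex (i # v) X (j # w))) [0..<length ts] =
     (map shape ts)[i := pgraft (ts ! i) (at_vertex v X)]"
  proof (rule nth_equalityI)
    fix j assume "j < length (map (\<lambda>j. pgraft (ts ! j) (\<lambda>w. at_vertex (i # v) X (j # w))) [0..<length ts])"
    then have j: "j < length ts" by simp
    show "map (\<lambda>j. pgraft (ts ! j) (\<lambda>w. at_vertex (i # v) X (j # w))) [0..<length ts] ! j =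
       (map shape ts)[i := pgraft (ts ! i) (at_vertex v X)] ! j"
    proof (cases "j = i")
      case True
      have "(\<lambda>w. at_vertex (i # v) X (i # w)) = at_vertex v X" by (auto simp: at_vertex_def)
      then show ?thesis using True assms by simp
    next
      case False
      then show ?thesis using j by (auto intro!: pgraft_empty)
    qed
  qed simp
  then show ?thesis using assms by (simp add: pgraft_PNode mset_update)
qed

primrec nv :: "rtree \<Rightarrow> nat" where
  "nv (Node B) = Suc (sum_mset (image_mset nv B))"

text \<open>Adding one leaf, described on isomorphism types, which frees inductions on growth from
  the chosen representative \<open>rep\<close>.\<close>

inductive att :: "rtree \<Rightarrow> rtree \<Rightarrow> bool" where
  root: "att (Node B) (Node (add_mset leaf B))"
| sub: "att b b' \<Longrightarrow> att (Node (add_mset b B)) (Node (add_mset b' B))"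

lemma att_pgraft: "v \<in> pv p \<Longrightarrow> att (shape p) (pgraft p (at_vertex v {#leaf#}))"
proof (induction p arbitrary: v)
  case (PNode ts)
  show ?case
  proof (cases v)
    case Nil
    then show ?thesis using att.root[of "mset (map shape ts)"] by (simp add: pgraft_root)
  next
    case (Cons i w)
    then have i: "i < length ts" "w \<in> pv (ts ! i)" using PNode.prems by auto
    then have "att (shape (ts ! i)) (pgraft (ts ! i) (at_vertex w {#leaf#}))" by (intro PNode.IH) auto
    then have "att (Node (add_mset (shape (ts ! i)) (mset (map shape ts) - {#shape (ts ! i)#}))) (pgraft (PNode ts) (at_vertex v {#leaf#}))"
      unfolding Cons pgraft_child[OF i(1)] by (rule att.sub)
    moreover have "shape (ts ! i) \<in># mset (map shape ts)" using i(1) by auto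
    ultimately show ?thesis by (simp del: mset_map)
  qed
qed

text \<open>Any plane representative will do, since each branch occurs at some position among the
  children.\<close>

lemma att_imp_pgraft: "att s t \<Longrightarrow> shape p = s \<Longrightarrow> \<exists>v\<in>pv p. pgraft p (at_vertex v {#leaf#}) = t"
proof (induction arbitrary: p rule: att.induct)
  case (root B)
  then obtain ts where "p = PNode ts" "mset (map shape ts) = B" by (cases p) auto
  then show ?case by (intro bexI[of _ "[]"]) (auto simp: pgraft_root)
next
  case (sub b b' B)
  then obtain ts where ts: "p = PNode ts" "mset (map shape ts) = add_mset b B" by (cases p) auto
  then have "b \<in> set (map shape ts)" by (metis set_mset_mset union_single_eq_member)
  then obtain i where i: "i < length ts" "shape (ts ! i) = b" by (auto simp: in_set_conv_nth)
  then obtain v where v: "v \<in> pv (ts ! i)" "pgraft (ts ! i) (at_vertex v {#leaf#}) = b'" using sub.IH by blast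
  then have "pgraft p (at_vertex (i # v) {#leaf#}) = Node (add_mset b' B)"
    using ts i pgraft_child[OF i(1), of v "{#leaf#}"] by (simp del: mset_map)
  then show ?case using i v ts by (intro bexI[of _ "i # v"]) auto
qed

lemma attach_leaf_eq: "attach_leaf s v = pgraft (rep s) (at_vertex v {#leaf#})"
  by (simp add: attach_leaf_def at_vertex_def)

lemma att_iff_attach: "att s t \<longleftrightarrow> (\<exists>v\<in>verts s. attach_leaf s v = t)"
  using att_imp_pgraft[of s t "rep s"] att_pgraft[of _ "rep s"] by (auto simp: verts_eq attach_leaf_eq)

lemma nv_att: "att s t \<Longrightarrow> nv t = Suc (nv s)"
  by (induction rule: att.induct) auto

abbreviation reach :: "rtree \<Rightarrow> rtree \<Rightarrow> bool" where
  "reach \<equiv> att\<^sup>*\<^sup>*"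

lemma reach_sub: "reach b b' \<Longrightarrow> reach (Node (add_mset b B)) (Node (add_mset b' B))"
  by (induction rule: rtranclp_induct) (auto intro: rtranclp.rtrancl_into_rtrancl att.sub)

lemma reach_leaf: "reach leaf t"
proof (induction t)
  case (Node B)
  then show ?case
  proof (induction B)
    case (add b B)
    have "reach leaf (Node B)" using add by simp
    moreover have "att (Node B) (Node (add_mset leaf B))" by (rule att.root)
    moreover have "reach (Node (add_mset leaf B)) (Node (add_mset b B))" using add.prems by (intro reach_sub) simp
    ultimately show ?case by (meson rtranclp.rtrancl_into_rtrancl rtranclp_trans)
  qed simp
qed

text \<open>Each new branch is started as a leaf at the root and then grown in place.\<close>

lemma reach_add: "reach (Node B) (Node (B + C))"
proof (induction C)
  case (add c C)
  have "att (Node (B + C)) (Node (add_mset leaf (B + C)))" by (rule att.root)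
  moreover have "reach (Node (add_mset leaf (B + C))) (Node (add_mset c (B + C)))" by (intro reach_sub reach_leaf)
  ultimately have "reach (Node B) (Node (add_mset c (B + C)))"
    using add by (meson rtranclp.rtrancl_into_rtrancl rtranclp_trans)
  then show ?case by simp
qed simp

section \<open>Chains and path forests\<close>

abbreviation stem :: "nat \<Rightarrow> rtree \<Rightarrow> rtree" where
  "stem n t \<equiv> ((\<lambda>t. Node {#t#}) ^^ n) t"

lemma chain_tree_Suc: "chain_tree (Suc n) = stem n leaf"
  by (simp add: chain_tree_def)

lemma nv_stem: "nv (stem n t) = n + nv t"
  by (induction n) auto

lemma nv_chain: "k > 0 \<Longrightarrow> nv (chain_tree k) = k"
  by (cases k) (auto simp: chain_tree_Suc nv_stem)

definition is_chain :: "rtree \<Rightarrow> bool" where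
  "is_chain t \<longleftrightarrow> (\<exists>n. t = stem n leaf)"

lemma is_chain_Node: "is_chain (Node B) \<longleftrightarrow> B = {#} \<or> (\<exists>b. B = {#b#} \<and> is_chain b)"
proof
  assume "is_chain (Node B)"
  then obtain n where "Node B = stem n leaf" by (auto simp: is_chain_def)
  then show "B = {#} \<or> (\<exists>b. B = {#b#} \<and> is_chain b)" by (cases n) (auto simp: is_chain_def)
next
  assume "B = {#} \<or> (\<exists>b. B = {#b#} \<and> is_chain b)"
  then show "is_chain (Node B)"
  proof
    assume "B = {#}"
    then show ?thesis unfolding is_chain_def by (intro exI[of _ 0]) simp
  next
    assume "\<exists>b. B = {#b#} \<and> is_chain b"
    then obtain n where "B = {#stem n leaf#}" by (auto simp: is_chain_def)
    then show ?thesis unfolding is_chain_def by (intro exI[of _ "Suc n"]) simp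
  qed
qed

lemma is_chain_iff_chain_tree: "is_chain t \<longleftrightarrow> (\<exists>k>0. t = chain_tree k)"
proof
  assume "is_chain t"
  then obtain n where "t = chain_tree (Suc n)" by (auto simp: is_chain_def chain_tree_Suc)
  then show "\<exists>k>0. t = chain_tree k" by blast
next
  assume "\<exists>k>0. t = chain_tree k"
  then obtain n where "t = chain_tree (Suc n)" by (metis gr0_conv_Suc)
  then show "is_chain t" by (auto simp: is_chain_def chain_tree_Suc)
qed

text \<open>The original tree and everything grafted onto it sit inside the result, and a chain
  contains only chains.\<close>

lemma is_chain_pgraft:
  "is_chain (pgraft p g) \<Longrightarrow> is_chain (shape p) \<and> (\<forall>v\<in>pv p. \<forall>b\<in>#g v. is_chain b)"
proof (induction p arbitrary: g)
  case (PNode ts)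
  show ?case
  proof (cases "ts = []")
    case True
    then show ?thesis using PNode.prems by (auto simp: pgraft_PNode is_chain_Node pv_PNode)
  next
    case False
    let ?C = "mset (map (\<lambda>i. pgraft (ts ! i) (\<lambda>v. g (i # v))) [0..<length ts])"
    have ch: "g [] + ?C = {#} \<or> (\<exists>b. g [] + ?C = {#b#} \<and> is_chain b)"
      using PNode.prems unfolding pgraft_PNode is_chain_Node .
    have szC: "size ?C = length ts" by simp
    have "size (g [] + ?C) \<le> 1"
      using ch
    proof (elim disjE exE conjE)
      assume "g [] + ?C = {#}"
      then have "size (g [] + ?C) = size ({#} :: rtree multiset)" by (rule arg_cong[where f=size])
      then show ?thesis by (simp del: mset_map size_union)
    next
      fix b assume "g [] + ?C = {#b#}"
      then have "size (g [] + ?C) = size {#b#}" by (rule arg_cong[where f=size])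
      then show ?thesis by (simp del: mset_map size_union)
    qed
    then have "size (g []) + length ts \<le> 1" unfolding size_union szC .
    then have len: "length ts = 1" and g0: "g [] = {#}" using False by (cases ts; simp)+
    then obtain q where q: "ts = [q]" by (metis One_nat_def length_0_conv length_Suc_conv)
    have "is_chain (pgraft q (\<lambda>v. g (0 # v)))" using ch g0 q by auto
    then have IH: "is_chain (shape q)" "\<forall>v\<in>pv q. \<forall>b\<in>#g (0 # v). is_chain b" using PNode.IH[of q] q by auto
    have "is_chain (shape (PNode ts))" using IH(1) q by (auto simp: is_chain_Node)
    moreover have "\<forall>v\<in>pv (PNode ts). \<forall>b\<in>#g v. is_chain b"
    proof
      fix v assume v: "v \<in> pv (PNode ts)"
      show "\<forall>b\<in>#g v. is_chain b"
        using v IH(2) g0 q by (cases v) auto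
    qed
    ultimately show ?thesis by simp
  qed
qed

lemma narrow_iff_chain: "(\<forall>v\<in>pv p. card {j. v @ [j] \<in> pv p} \<le> 1) \<longleftrightarrow> is_chain (shape p)"
proof (induction p)
  case (PNode ts)
  have root: "{j. [] @ [j] \<in> pv (PNode ts)} = {..<length ts}" by auto
  have "(\<forall>v\<in>pv (PNode ts). card {j. v @ [j] \<in> pv (PNode ts)} \<le> 1) \<longleftrightarrow>
     length ts \<le> 1 \<and> (\<forall>i<length ts. \<forall>v\<in>pv (ts ! i). card {j. v @ [j] \<in> pv (ts ! i)} \<le> 1)"
    (is "?l \<longleftrightarrow> ?r")
  proof
    assume l: ?l
    show ?r
    proof (intro conjI allI impI ballI)
      show "length ts \<le> 1" using l[rule_format, of "[]"] root by simp
      fix i v assume iv: "i < length ts" "v \<in> pv (ts ! i)"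
      show "card {j. v @ [j] \<in> pv (ts ! i)} \<le> 1" using l[rule_format, of "i # v"] iv by simp
    qed
  next
    assume r: ?r
    show ?l
    proof
      fix v assume v: "v \<in> pv (PNode ts)"
      show "card {j. v @ [j] \<in> pv (PNode ts)} \<le> 1"
        using r v root by (cases v) auto
    qed
  qed
  also have "\<dots> \<longleftrightarrow> length ts \<le> 1 \<and> (\<forall>i<length ts. is_chain (shape (ts ! i)))"
    using PNode.IH by (metis nth_mem)
  also have "\<dots> \<longleftrightarrow> is_chain (shape (PNode ts))"
  proof -
    consider "ts = []" | q where "ts = [q]" | q q' ts' where "ts = q # q' # ts'"
      by (metis list.exhaust)
    then show ?thesis by cases (auto simp: is_chain_Node)
  qed
  finally show ?case .
qed

text \<open>With the root exempt, the degree condition splits into one condition per branch, where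
  \<open>narrow_iff_chain\<close> applies.\<close>

lemma path_forest_iff: "path_forest t \<longleftrightarrow> (\<forall>b\<in>#branches t. is_chain b)"
proof -
  obtain ts where ts: "rep t = PNode ts" by (cases "rep t") auto
  then have br: "branches t = mset (map shape ts)" by (metis rtree.sel shape.simps shape_rep)
  have "path_forest t \<longleftrightarrow> (\<forall>i<length ts. \<forall>v\<in>pv (ts ! i). card {j. v @ [j] \<in> pv (ts ! i)} \<le> 1)"
    (is "?l \<longleftrightarrow> ?r")
  proof
    assume l: ?l
    show ?r
    proof (intro allI impI ballI)
      fix i v assume iv: "i < length ts" "v \<in> pv (ts ! i)"
      show "card {j. v @ [j] \<in> pv (ts ! i)} \<le> 1"
        using l[unfolded path_forest_def verts_eq ts, rule_format, of "i # v"] iv by simp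
    qed
  next
    assume r: ?r
    show ?l
      unfolding path_forest_def verts_eq ts
    proof (intro ballI impI)
      fix v assume v: "v \<in> pv (PNode ts)" "v \<noteq> []"
      then show "card {i. v @ [i] \<in> pv (PNode ts)} \<le> 1" using r by (cases v) auto
    qed
  qed
  also have "\<dots> \<longleftrightarrow> (\<forall>i<length ts. is_chain (shape (ts ! i)))" by (simp only: narrow_iff_chain)
  also have "\<dots> \<longleftrightarrow> (\<forall>b\<in>#branches t. is_chain b)" unfolding br by (simp add: all_set_conv_all_nth)
  finally show ?thesis .
qed

text \<open>The partition is recovered as the multiset of vertex counts of the branches.\<close>

lemma path_forest_iff_partition: "path_forest t \<longleftrightarrow> (\<exists>l. is_partition l \<and> t = path_forest_tree l)"
proof
  assume "path_forest t"
  then have ch: "\<forall>b\<in>#branches t. \<exists>k>0. b = chain_tree k" by (simp add: path_forest_iff is_chain_iff_chain_tree)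
  have "b = chain_tree (nv b) \<and> nv b > 0" if "b \<in># branches t" for b
    using ch that nv_chain by (metis)
  then have b: "chain_tree (nv b) = b" "nv b \<noteq> 0" if "b \<in># branches t" for b using that by (metis, metis less_irrefl)
  have "image_mset chain_tree (image_mset nv (branches t)) = branches t"
    unfolding multiset.map_comp by (rule multiset.map_ident_strong) (simp add: b)
  moreover have "is_partition (image_mset nv (branches t))" unfolding is_partition_def by (metis b(2) imageE set_image_mset)
  ultimately show "\<exists>l. is_partition l \<and> t = path_forest_tree l"
    unfolding path_forest_tree_def by (intro exI[of _ "image_mset nv (branches t)"]) simp
next
  assume "\<exists>l. is_partition l \<and> t = path_forest_tree l"
  then show "path_forest t"
    by (auto simp: path_forest_iff is_chain_iff_chain_tree path_forest_tree_def is_partition_def) (metis gr_zeroI)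
qed

lemma path_forest_tree_inverse: "is_partition l \<Longrightarrow> image_mset nv (branches (path_forest_tree l)) = l"
  unfolding path_forest_tree_def is_partition_def
  by (auto simp: multiset.map_comp intro!: multiset.map_ident_strong nv_chain) (metis gr_zeroI)

lemma psi_basis_path_forest:
  assumes "is_partition l" shows "psi_basis p (path_forest_tree l) = aug_value p l"
proof -
  have "(THE l'. is_partition l' \<and> path_forest_tree l = path_forest_tree l') = l"
    using assms path_forest_tree_inverse by (intro the_equality) metis+
  moreover have "path_forest (path_forest_tree l)" using assms path_forest_iff_partition by blast
  ultimately show ?thesis by (simp add: psi_basis_def aug_value_def)
qed

lemma att_path_forest: "att s t \<Longrightarrow> path_forest t \<Longrightarrow> path_forest s"
proof (induction rule: att.induct)
  case (sub b b' B)
  obtain p where p: "shape p = b" using shape_surj by blast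
  then obtain v where "pgraft p (at_vertex v {#leaf#}) = b'" using att_imp_pgraft[OF sub.hyps] by blast
  then have "is_chain b" using is_chain_pgraft[of p] sub.prems p by (auto simp: path_forest_iff)
  then show ?case using sub.prems by (auto simp: path_forest_iff)
qed (auto simp: path_forest_iff)

text \<open>The minimal trees with a branching vertex other than the root.\<close>

abbreviation cherry :: "nat \<Rightarrow> rtree" where
  "cherry j \<equiv> stem j (Node {#leaf, leaf#})"

text \<open>Descend through only children until a vertex with at least two children appears; its
  depth is \<open>j\<close>. Everything below that vertex can be grown from its two leaf
  children.\<close>

lemma reach_cherry: "\<not> is_chain b \<Longrightarrow> \<exists>j. reach (cherry j) b"
proof (induction b)
  case (Node B)
  consider "B = {#}" | b where "B = {#b#}" | b c C where "B = {#b, c#} + C"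
    by (metis add_mset_add_single multiset_cases union_mset_add_mset_left empty_neutral(1))
  then show ?case
  proof cases
    case 1
    then show ?thesis using Node.prems by (simp add: is_chain_Node)
  next
    case (2 b)
    then have "\<not> is_chain b" using Node.prems by (auto simp: is_chain_Node)
    then obtain j where "reach (cherry j) b" using Node.IH 2 by auto
    then have "reach (cherry (Suc j)) (Node B)" using reach_sub[of _ b "{#}"] 2 by simp
    then show ?thesis ..
  next
    case (3 b c C)
    have "reach (Node {#leaf, leaf#}) (Node {#b, leaf#})" by (intro reach_sub reach_leaf)
    moreover have "reach (Node {#leaf, b#}) (Node {#c, b#})" by (intro reach_sub reach_leaf)
    moreover have "reach (Node {#b, c#}) (Node B)" using reach_add[of "{#b, c#}" C] 3 by simp
    ultimately have "reach (Node {#leaf, leaf#}) (Node B)" by (metis add_mset_commute rtranclp_trans)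
    then have "reach (cherry 0) (Node B)" by simp
    then show ?thesis ..
  qed
qed

text \<open>The bad branch hangs below the root, which lengthens the stem by one; branching at the
  root itself is allowed.\<close>

lemma reach_cherry_path_forest:
  assumes "\<not> path_forest t" shows "\<exists>j. reach (cherry (Suc j)) t"
proof -
  obtain B where t: "t = Node B" by (cases t) auto
  then obtain b where b: "b \<in># B" "\<not> is_chain b" using assms by (auto simp: path_forest_iff)
  then obtain C where C: "B = add_mset b C" by (meson multi_member_split)
  obtain j where "reach (cherry j) b" using reach_cherry[OF b(2)] by blast
  then have "reach (cherry (Suc j)) (Node {#b#})" using reach_sub[of _ b "{#}"] by simp
  moreover have "reach (Node {#b#}) t" using reach_add[of "{#b#}" C] t C by simp
  ultimately show ?thesis by (meson rtranclp_trans)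
qed

section \<open>The Grossman--Larson product\<close>

lemma gl_algebra_expand: "(x::gl_algebra) = (\<Sum>t\<in>Poly_Mapping.keys x. Poly_Mapping.lookup x t *\<^sub>R \<F> t)"
proof (rule poly_mapping_eqI)
  fix s
  have "Poly_Mapping.lookup (\<Sum>t\<in>Poly_Mapping.keys x. Poly_Mapping.lookup x t *\<^sub>R \<F> t) s =
     (\<Sum>t\<in>Poly_Mapping.keys x. if t = s then Poly_Mapping.lookup x s else 0)"
    unfolding lookup_sum by (intro sum.cong refl) (auto simp: scaleR_poly_mapping.rep_eq basis_def lookup_single)
  also have "\<dots> = Poly_Mapping.lookup x s" by (simp add: in_keys_iff)
  finally show "Poly_Mapping.lookup x s = Poly_Mapping.lookup (\<Sum>t\<in>Poly_Mapping.keys x. Poly_Mapping.lookup x t *\<^sub>R \<F> t) s" ..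
qed

lemma linear_expand:
  assumes "linear L" shows "L x = (\<Sum>t\<in>Poly_Mapping.keys x. Poly_Mapping.lookup x t * L (\<F> t) :: real)"
  using assms by (subst gl_algebra_expand) (simp add: linear_sum linear_scale)

definition lin_ext :: "(rtree \<Rightarrow> real) \<Rightarrow> gl_algebra \<Rightarrow> real" where
  "lin_ext h x = (\<Sum>t\<in>Poly_Mapping.keys x. Poly_Mapping.lookup x t * h t)"

lemma lin_ext_superset:
  assumes "finite A" "Poly_Mapping.keys x \<subseteq> A"
  shows "lin_ext h x = (\<Sum>t\<in>A. Poly_Mapping.lookup x t * h t)"
  unfolding lin_ext_def using assms by (intro sum.mono_neutral_left) (auto simp: in_keys_iff)

lemma linear_lin_ext: "linear (lin_ext h)"
proof (rule linearI)
  fix x y :: gl_algebra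
  let ?A = "Poly_Mapping.keys x \<union> Poly_Mapping.keys y"
  have "lin_ext h (x + y) = (\<Sum>t\<in>?A. Poly_Mapping.lookup (x + y) t * h t)"
    by (rule lin_ext_superset) (auto simp: in_keys_iff lookup_add)
  moreover have "lin_ext h x = (\<Sum>t\<in>?A. Poly_Mapping.lookup x t * h t)" "lin_ext h y = (\<Sum>t\<in>?A. Poly_Mapping.lookup y t * h t)"
    by (rule lin_ext_superset; auto)+
  ultimately show "lin_ext h (x + y) = lin_ext h x + lin_ext h y"
    by (simp add: lookup_add distrib_right sum.distrib)
next
  fix c :: real and x :: gl_algebra
  have "Poly_Mapping.keys (c *\<^sub>R x) \<subseteq> Poly_Mapping.keys x"
    by (auto simp: in_keys_iff scaleR_poly_mapping.rep_eq)
  then have "lin_ext h (c *\<^sub>R x) = (\<Sum>t\<in>Poly_Mapping.keys x. Poly_Mapping.lookup (c *\<^sub>R x) t * h t)"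
    by (intro lin_ext_superset) auto
  then show "lin_ext h (c *\<^sub>R x) = c *\<^sub>R lin_ext h x"
    by (simp add: scaleR_poly_mapping.rep_eq lin_ext_def sum_distrib_left mult.assoc)
qed

lemma lin_ext_basis [simp]: "lin_ext h (\<F> t) = h t"
  by (simp add: lin_ext_def basis_def)

lemma lin_ext_unique: "linear L \<Longrightarrow> L = lin_ext (\<lambda>t. L (\<F> t))"
  by (rule ext, unfold lin_ext_def, rule linear_expand)

lemma psi_eq_lin_ext: "psi p = lin_ext (psi_basis p)"
  by (rule ext) (simp add: psi_def lin_ext_def)

lemma gl_mult_basis: "\<F> s \<circledast> \<F> t = gl_basis_mult s t"
  by (simp add: gl_mult_def basis_def)

lemma linear_gl_mult:
  assumes "linear L"
  shows "L (x \<circledast> y) = (\<Sum>s\<in>Poly_Mapping.keys x. \<Sum>t\<in>Poly_Mapping.keys y.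
     Poly_Mapping.lookup x s * Poly_Mapping.lookup y t * (L (gl_basis_mult s t) :: real))"
  using assms unfolding gl_mult_def by (simp add: linear_sum linear_scale)

lemma mset_branch_list: "mset (branch_list s) = branches s"
  unfolding branch_list_def by (rule someI_ex) (rule ex_mset)

text \<open>The branches of the left factor are attached one at a time, and \<open>g\<close> records
  what has been attached before. This turns the sum over maps into nested sums over
  vertices.\<close>

primrec graft_sum :: "(rtree \<Rightarrow> real) \<Rightarrow> ptree \<Rightarrow> rtree list \<Rightarrow> (vertex \<Rightarrow> rtree multiset) \<Rightarrow> real" where
  "graft_sum h p [] g = h (pgraft p g)"
| "graft_sum h p (s # ss) g = (\<Sum>v\<in>pv p. graft_sum h p ss (\<lambda>w. g w + at_vertex v {#s#} w))"

text \<open>Splitting off the value of \<open>f\<close> at the last index peels the list from its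
  end, hence the reversal.\<close>

lemma graft_sum_eq:
  "(\<Sum>f\<in>{..<length ss} \<rightarrow>\<^sub>E pv p. h (pgraft p (\<lambda>v. g v + image_mset ((!) ss) (mset_set {i. i < length ss \<and> f i = v})))) =
   graft_sum h p (rev ss) g"
proof (induction ss arbitrary: g rule: rev_induct)
  case Nil
  then show ?case by (simp add: PiE_empty_domain)
next
  case (snoc s ss)
  let ?n = "length ss" and ?V = "pv p"
  let ?H = "\<lambda>f. h (pgraft p (\<lambda>v. g v + image_mset ((!) (ss @ [s])) (mset_set {i. i < length (ss @ [s]) \<and> f i = v})))"
  let ?u = "\<lambda>(y, f). f(?n := y)"
  have dom: "{..<length (ss @ [s])} = insert ?n {..<?n}" by auto
  have inj: "inj_on ?u (?V \<times> ({..<?n} \<rightarrow>\<^sub>E ?V))"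
    by (rule inj_combinator) simp
  have "(\<Sum>f\<in>{..<length (ss @ [s])} \<rightarrow>\<^sub>E ?V. ?H f) = (\<Sum>yf\<in>?V \<times> ({..<?n} \<rightarrow>\<^sub>E ?V). ?H (?u yf))"
    unfolding dom PiE_insert_eq by (subst sum.reindex[OF inj]) simp
  also have "\<dots> = (\<Sum>y\<in>?V. \<Sum>f\<in>{..<?n} \<rightarrow>\<^sub>E ?V. ?H (f(?n := y)))"
    by (subst sum.cartesian_product) (simp add: case_prod_beta')
  also have "\<dots> = (\<Sum>y\<in>?V. \<Sum>f\<in>{..<?n} \<rightarrow>\<^sub>E ?V.
      h (pgraft p (\<lambda>v. (g v + at_vertex y {#s#} v) + image_mset ((!) ss) (mset_set {i. i < ?n \<and> f i = v}))))"
  proof (intro sum.cong refl arg_cong[where f=h] arg_cong2[where f=pgraft] ext)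
    fix y :: vertex and f :: "nat \<Rightarrow> vertex" and v :: vertex
    let ?I = "{i. i < ?n \<and> f i = v}"
    have I: "{i. i < length (ss @ [s]) \<and> (f(?n := y)) i = v} = (if v = y then insert ?n ?I else ?I)"
      by (auto simp: less_Suc_eq)
    have "image_mset ((!) (ss @ [s])) (mset_set ?I) = image_mset ((!) ss) (mset_set ?I)"
      by (rule image_mset_cong) (auto simp: nth_append)
    then show "g v + image_mset ((!) (ss @ [s])) (mset_set {i. i < length (ss @ [s]) \<and> (f(?n := y)) i = v}) =
       (g v + at_vertex y {#s#} v) + image_mset ((!) ss) (mset_set ?I)"
      unfolding I by (cases "v = y") (simp_all add: at_vertex_def)
  qed
  also have "\<dots> = (\<Sum>y\<in>?V. graft_sum h p (rev ss) (\<lambda>w. g w + at_vertex y {#s#} w))"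
    by (simp only: snoc.IH)
  finally show ?case by simp
qed

lemma linear_gl_basis_mult:
  fixes L :: "gl_algebra \<Rightarrow> real"
  assumes "linear L"
  shows "L (gl_basis_mult s t) = graft_sum (\<lambda>t. L (\<F> t)) (rep t) (rev (branch_list s)) (\<lambda>_. {#})"
  unfolding gl_basis_mult_def linear_sum[OF assms]
  using graft_sum_eq[where ss="branch_list s" and p="rep t" and g="\<lambda>_. {#}" and h="\<lambda>t. L (\<F> t)"]
  by (simp add: circ_def verts_eq)

lemma linear_gl_basis_mult_single:
  fixes L :: "gl_algebra \<Rightarrow> real"
  assumes "linear L" "branches s = {#b#}"
  shows "L (gl_basis_mult s t) = (\<Sum>v\<in>verts t. L (\<F> (pgraft (rep t) (at_vertex v {#b#}))))"
proof -
  have "branch_list s = [b]" using mset_branch_list[of s] assms(2) by (metis mset_single_iff)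
  then show ?thesis by (simp add: linear_gl_basis_mult[OF assms(1)] verts_eq)
qed

lemma branches_tau: "branches \<tau> = {#leaf#}"
  by (simp add: chain_tree_def)

lemma linear_tau_mult:
  fixes L :: "gl_algebra \<Rightarrow> real"
  assumes "linear L"
  shows "L (gl_basis_mult \<tau> t) = (\<Sum>v\<in>verts t. L (\<F> (attach_leaf t v)))"
  unfolding linear_gl_basis_mult_single[OF assms branches_tau] attach_leaf_eq ..

definition harmonic :: "(rtree \<Rightarrow> real) \<Rightarrow> bool" where
  "harmonic h \<longleftrightarrow> h leaf = 1 \<and> (\<forall>t. 0 \<le> h t) \<and> (\<forall>t. h t = (\<Sum>v\<in>verts t. h (attach_leaf t v)))"

lemma harmonicD:
  assumes "harmonic h"
  shows "h leaf = 1" "0 \<le> h t" "h t = (\<Sum>v\<in>verts t. h (attach_leaf t v))"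
  using assms unfolding harmonic_def by blast+

text \<open>By linearity the Pieri condition can be tested on the basis, where multiplication by
  \<open>\<F> \<tau>\<close> attaches one leaf in all possible ways.\<close>

lemma pieri_state_iff_harmonic: "pieri_state L \<longleftrightarrow> linear L \<and> harmonic (\<lambda>t. L (\<F> t))"
proof -
  have "(\<forall>x. L (\<F> \<tau> \<circledast> x) = L x) \<longleftrightarrow> (\<forall>t. L (\<F> t) = (\<Sum>v\<in>verts t. L (\<F> (attach_leaf t v))))" if L: "linear L"
  proof
    assume a: "\<forall>x. L (\<F> \<tau> \<circledast> x) = L x"
    show "\<forall>t. L (\<F> t) = (\<Sum>v\<in>verts t. L (\<F> (attach_leaf t v)))"
    proof
      fix t show "L (\<F> t) = (\<Sum>v\<in>verts t. L (\<F> (attach_leaf t v)))"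
        using a[rule_format, of "\<F> t"] by (simp add: gl_mult_basis linear_tau_mult[OF L])
    qed
  next
    assume a: "\<forall>t. L (\<F> t) = (\<Sum>v\<in>verts t. L (\<F> (attach_leaf t v)))"
    show "\<forall>x. L (\<F> \<tau> \<circledast> x) = L x"
    proof
      fix x
      have b: "L (gl_basis_mult \<tau> t) = L (\<F> t)" for t
        unfolding linear_tau_mult[OF L] by (rule a[rule_format, symmetric])
      have k: "Poly_Mapping.keys (\<F> \<tau>) = {\<tau>}" "Poly_Mapping.lookup (\<F> \<tau>) \<tau> = 1" by (simp_all add: basis_def)
      show "L (\<F> \<tau> \<circledast> x) = L x"
        unfolding linear_gl_mult[OF L] linear_expand[OF L, of x] k(1)
        by (simp add: k(2) b)
    qed
  qed
  then show ?thesis by (auto simp: pieri_state_def harmonic_def)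
qed

lemma pieri_state_lin_ext: "harmonic h \<Longrightarrow> pieri_state (lin_ext h)"
  by (simp add: pieri_state_iff_harmonic linear_lin_ext)

lemma harmonic_att_le:
  assumes h: "harmonic h" and "att s t" shows "h t \<le> h s"
proof -
  obtain v where v: "v \<in> verts s" "attach_leaf s v = t" using assms(2) att_iff_attach by blast
  have "h t \<le> (\<Sum>v\<in>verts s. h (attach_leaf s v))"
    unfolding v(2)[symmetric] by (rule member_le_sum[OF v(1)]) (simp_all add: harmonicD(2)[OF h])
  also have "\<dots> = h s" by (rule harmonicD(3)[OF h, symmetric])
  finally show ?thesis .
qed

lemma harmonic_reach_le: "reach s t \<Longrightarrow> harmonic h \<Longrightarrow> h t \<le> h s"
  by (induction rule: rtranclp_induct) (auto intro: order_trans harmonic_att_le)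

lemma harmonic_le_1: "harmonic h \<Longrightarrow> h t \<le> 1"
  using harmonic_reach_le[OF reach_leaf, of h t] harmonicD(1)[of h] by simp

section \<open>Products of path forests\<close>

primrec pchain :: "nat \<Rightarrow> ptree" where
  "pchain 0 = PNode []"
| "pchain (Suc n) = PNode [pchain n]"

text \<open>A chain has only one plane representative, so \<open>rep\<close> is explicit for chains
  although it is a choice in general.\<close>

lemma shape_eq_stem: "shape p = stem n leaf \<Longrightarrow> p = pchain n"
proof (induction n arbitrary: p)
  case 0
  then show ?case by (cases p) auto
next
  case (Suc n)
  obtain ts where p: "p = PNode ts" by (cases p)
  then have "mset (map shape ts) = {#stem n leaf#}" using Suc.prems by simp
  then obtain q where "ts = [q]" "shape q = stem n leaf"
    by (metis (no_types, lifting) map_eq_Cons_conv map_is_Nil_conv mset_single_iff)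
  then show ?case using Suc.IH p by simp
qed

lemma shape_pchain: "shape (pchain n) = stem n leaf"
  by (induction n) auto

abbreviation tip :: "nat \<Rightarrow> vertex" where
  "tip n \<equiv> replicate n 0"

lemma stem_Node: "stem n (Node {#t#}) = Node {#stem n t#}"
  by (induction n) auto

lemma tip_in_pv: "tip n \<in> pv (pchain n)"
  by (induction n) auto

lemma pgraft_pchain:
  "(\<And>v. v \<in> pv (pchain n) \<Longrightarrow> v \<noteq> tip n \<Longrightarrow> g v = {#}) \<Longrightarrow> pgraft (pchain n) g = stem n (Node (g (tip n)))"
proof (induction n arbitrary: g)
  case 0
  then show ?case by (simp add: pgraft_PNode)
next
  case (Suc n)
  have "g [] = {#}" using Suc.prems by simp
  moreover have "pgraft (pchain n) (\<lambda>v. g (0 # v)) = stem n (Node (g (0 # tip n)))"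
    by (rule Suc.IH) (use Suc.prems in simp)
  ultimately show ?case by (simp add: pgraft_PNode)
qed

text \<open>A graft at an inner vertex, or two at the tip, would create a branching vertex.\<close>

lemma is_chain_pgraft_pchain:
  "is_chain (pgraft (pchain n) g) \<Longrightarrow> (\<forall>v\<in>pv (pchain n). v \<noteq> tip n \<longrightarrow> g v = {#}) \<and> size (g (tip n)) \<le> 1"
proof (induction n arbitrary: g)
  case 0
  then show ?case by (auto simp: pgraft_PNode is_chain_Node pv_PNode)
next
  case (Suc n)
  let ?b = "pgraft (pchain n) (\<lambda>v. g (0 # v))"
  have "is_chain (Node (add_mset ?b (g [])))" using Suc.prems by (simp add: pgraft_PNode)
  then have "g [] = {#}" "is_chain ?b" by (auto simp: is_chain_Node)
  then show ?case using Suc.IH by (auto simp: pv_PNode)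
qed

text \<open>The sum over all ways of merging some of the parts \<open>ls\<close> with distinct parts of \<open>ms\<close>;
  the parts in \<open>R\<close> are finished.\<close>

primrec merge_sum :: "(nat multiset \<Rightarrow> real) \<Rightarrow> nat list \<Rightarrow> nat multiset \<Rightarrow> nat multiset \<Rightarrow> real" where
  "merge_sum \<phi> [] ms R = \<phi> (R + ms)"
| "merge_sum \<phi> (l # ls) ms R = merge_sum \<phi> ls ms (add_mset l R) +
     (\<Sum>m\<in>#ms. merge_sum \<phi> ls (ms - {#m#}) (add_mset (l + m) R))"

definition del_nth :: "nat \<Rightarrow> 'a list \<Rightarrow> 'a list" where
  "del_nth i ls = take i ls @ drop (Suc i) ls"

lemma del_nth_Cons [simp]: "del_nth 0 (l # ls) = ls" "del_nth (Suc i) (l # ls) = l # del_nth i ls"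
  by (simp_all add: del_nth_def)

lemma mset_del_nth: "i < length ls \<Longrightarrow> mset (del_nth i ls) = mset ls - {#ls ! i#}"
  by (subst (2) id_take_nth_drop[of i]) (simp_all add: del_nth_def)

text \<open>The additional right part \<open>m\<close> either stays alone or is joined to exactly
  one left part.\<close>

lemma merge_sum_add_right:
  "merge_sum \<phi> ls (add_mset m ms) R = merge_sum \<phi> ls ms (add_mset m R) +
     (\<Sum>i<length ls. merge_sum \<phi> (del_nth i ls) ms (add_mset (ls ! i + m) R))"
proof (induction ls arbitrary: ms R)
  case Nil
  then show ?case by simp
next
  case (Cons l ls)
  have rm: "add_mset m ms - {#m'#} = add_mset m (ms - {#m'#})" if "m' \<in># ms" for m'
  proof -
    obtain A where "ms = add_mset m' A" using multi_member_split[OF \<open>m' \<in># ms\<close>] by blast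
    then show ?thesis by (simp only: add_mset_commute[of m m'] add_mset_remove_trivial)
  qed
  have "(\<Sum>m'\<in>#ms. merge_sum \<phi> ls (add_mset m ms - {#m'#}) (add_mset (l + m') R)) =
     (\<Sum>m'\<in>#ms. merge_sum \<phi> ls (ms - {#m'#}) (add_mset m (add_mset (l + m') R)) +
        (\<Sum>i<length ls. merge_sum \<phi> (del_nth i ls) (ms - {#m'#}) (add_mset (ls ! i + m) (add_mset (l + m') R))))"
    by (intro arg_cong[where f=sum_mset] image_mset_cong) (simp only: rm Cons.IH)
  also have "\<dots> = (\<Sum>m'\<in>#ms. merge_sum \<phi> ls (ms - {#m'#}) (add_mset (l + m') (add_mset m R))) +
     (\<Sum>i<length ls. \<Sum>m'\<in>#ms. merge_sum \<phi> (del_nth i ls) (ms - {#m'#}) (add_mset (l + m') (add_mset (ls ! i + m) R)))"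
    unfolding sum_mset.distrib sum_unfold_sum_mset
    by (subst sum_mset.swap) (simp add: add_mset_commute)
  finally have e: "(\<Sum>m'\<in>#ms. merge_sum \<phi> ls (add_mset m ms - {#m'#}) (add_mset (l + m') R)) = \<dots>" .
  have "merge_sum \<phi> (l # ls) (add_mset m ms) R = merge_sum \<phi> ls (add_mset m ms) (add_mset l R) +
     (merge_sum \<phi> ls ms (add_mset (l + m) R) + (\<Sum>m'\<in>#ms. merge_sum \<phi> ls (add_mset m ms - {#m'#}) (add_mset (l + m') R)))"
    by simp
  also have "\<dots> = merge_sum \<phi> (l # ls) ms (add_mset m R) +
     (\<Sum>i<length (l # ls). merge_sum \<phi> (del_nth i (l # ls)) ms (add_mset ((l # ls) ! i + m) R))"
    unfolding e Cons.IH[of ms "add_mset l R"]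
    by (simp add: sum.lessThan_Suc_shift sum.distrib add_mset_commute algebra_simps del: sum.lessThan_Suc)
  finally show ?case .
qed

text \<open>Both sides run over the partial matchings of the two lists, organised once by the left
  parts and once by the right ones.\<close>

lemma merge_sum_commute: "merge_sum \<phi> ls (mset ms) R = merge_sum \<phi> ms (mset ls) R"
proof (induction ms arbitrary: ls R)
  case Nil
  have "merge_sum \<phi> ls {#} R = \<phi> (R + mset ls)" by (induction ls arbitrary: R) auto
  then show ?case by simp
next
  case (Cons m ms)
  have "(\<Sum>i<length ls. merge_sum \<phi> (del_nth i ls) (mset ms) (add_mset (ls ! i + m) R)) =
     (\<Sum>i<length ls. merge_sum \<phi> ms (mset ls - {#ls ! i#}) (add_mset (m + ls ! i) R))"
    by (intro sum.cong refl) (simp add: Cons.IH mset_del_nth add.commute)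
  also have "\<dots> = (\<Sum>l\<leftarrow>ls. merge_sum \<phi> ms (mset ls - {#l#}) (add_mset (m + l) R))"
    by (simp add: sum_list_sum_nth atLeast0LessThan)
  also have "\<dots> = (\<Sum>l\<in>#mset ls. merge_sum \<phi> ms (mset ls - {#l#}) (add_mset (m + l) R))"
    by (simp add: sum_mset_sum_list[symmetric] flip: mset_map)
  finally show ?case by (simp add: merge_sum_add_right Cons.IH)
qed

lemma graft_sum_zero:
  assumes "\<And>g'. (\<And>w. g w \<subseteq># g' w) \<Longrightarrow> h (pgraft p g') = 0"
  shows "graft_sum h p ss g = 0"
  using assms
proof (induction ss arbitrary: g)
  case (Cons s ss)
  have "graft_sum h p ss (\<lambda>w. g w + at_vertex v {#s#} w) = 0" for v
  proof (rule Cons.IH)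
    fix g' assume le: "\<And>w. g w + at_vertex v {#s#} w \<subseteq># g' w"
    have "g w \<subseteq># g' w" for w by (rule subset_mset.order_trans[OF _ le[of w]]) simp
    then show "h (pgraft p g') = 0" by (rule Cons.prems)
  qed
  then show ?case by simp
qed simp

definition pf_rep :: "nat list \<Rightarrow> ptree" where
  "pf_rep ks = PNode (map (\<lambda>k. pchain (k - 1)) ks)"

definition tip_of :: "nat list \<Rightarrow> nat \<Rightarrow> vertex" where
  "tip_of ks i = i # tip (ks ! i - 1)"

text \<open>The intermediate states of the attachment that can still end in a path forest:
  \<open>A\<close> holds the chains whose tip is free, \<open>c i\<close> is the length attached at
  a used tip, and \<open>R\<close> collects the chains attached at the root.\<close>

definition good_graft :: "nat list \<Rightarrow> (vertex \<Rightarrow> rtree multiset) \<Rightarrow> nat set \<Rightarrow> nat multiset \<Rightarrow> (nat \<Rightarrow> nat) \<Rightarrow> bool" where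
  "good_graft ks g A R c \<longleftrightarrow> A \<subseteq> {..<length ks} \<and>
  (\<forall>i<length ks. \<forall>v\<in>pv (pchain (ks ! i - 1)). v \<noteq> tip (ks ! i - 1) \<longrightarrow> g (i # v) = {#}) \<and>
  (\<forall>i<length ks. g (tip_of ks i) = (if i \<in> A then {#} else {#chain_tree (c i)#}) \<and> (i \<notin> A \<longrightarrow> 0 < c i)) \<and>
  g [] = image_mset chain_tree R"

context
  fixes h :: "rtree \<Rightarrow> real" and ks :: "nat list"
  assumes h0: "\<And>t. \<not> path_forest t \<Longrightarrow> h t = 0" and ks: "0 \<notin> set ks"
begin

text \<open>Later attachments only add branches and never repair a bad vertex, so all terms are
  trees at which \<open>h\<close> vanishes.\<close>

lemma graft_sum_bad:
  assumes i: "i < length ks" and v: "v \<in> pv (pchain (ks ! i - 1))"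
    and bad: "v \<noteq> tip (ks ! i - 1) \<and> g (i # v) \<noteq> {#} \<or> size (g (i # v)) \<ge> 2"
  shows "graft_sum h (pf_rep ks) ss g = 0"
proof (rule graft_sum_zero, rule h0)
  fix g' assume le: "\<And>w. g w \<subseteq># g' w"
  let ?b = "pgraft (pchain (ks ! i - 1)) (\<lambda>v. g' (i # v))"
  have "\<not> is_chain ?b"
  proof
    assume "is_chain ?b"
    note c = is_chain_pgraft_pchain[OF this]
    show False
    proof (cases "v = tip (ks ! i - 1)")
      case True
      then have "size (g (i # v)) \<le> 1" using c size_mset_mono[OF le[of "i # v"]] by simp
      then show False using bad True by simp
    next
      case False
      then have "g' (i # v) = {#}" using c v by blast
      then have "g (i # v) = {#}" using le[of "i # v"] by simp
      then show False using bad False by simp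
    qed
  qed
  moreover have "?b \<in># branches (pgraft (pf_rep ks) g')"
    unfolding pf_rep_def pgraft_PNode using i by (auto simp: image_iff intro!: disjI2 bexI[of _ i])
  ultimately show "\<not> path_forest (pgraft (pf_rep ks) g')" by (auto simp: path_forest_iff)
qed

lemma pgraft_good:
  assumes g: "good_graft ks g A R c"
  shows "pgraft (pf_rep ks) g = path_forest_tree (R + image_mset (\<lambda>i. ks ! i + c i) (mset_set ({..<length ks} - A)) + image_mset ((!) ks) (mset_set A))"
proof -
  let ?n = "\<lambda>i. ks ! i + (if i \<in> A then 0 else c i)"
  have kpos: "ks ! i > 0" if "i < length ks" for i using ks that by (metis gr_zeroI nth_mem)
  have br: "pgraft (map (\<lambda>k. pchain (k - 1)) ks ! i) (\<lambda>v. g (i # v)) = chain_tree (?n i)" if i: "i < length ks" for i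
  proof -
    obtain n where n: "ks ! i = Suc n" using kpos[OF i] gr0_conv_Suc by blast
    have "pgraft (pchain n) (\<lambda>v. g (i # v)) = stem n (Node (g (i # tip n)))"
      using g i n by (intro pgraft_pchain) (auto simp: good_graft_def)
    also have "g (i # tip n) = (if i \<in> A then {#} else {#chain_tree (c i)#})"
      using g i n by (auto simp: good_graft_def tip_of_def)
    also have "stem n (Node (if i \<in> A then {#} else {#chain_tree (c i)#})) = chain_tree (?n i)"
    proof (cases "i \<in> A")
      case True
      then show ?thesis by (simp add: n chain_tree_Suc)
    next
      case False
      then have "c i > 0" using g i by (simp add: good_graft_def)
      then obtain d where d: "c i = Suc d" using gr0_conv_Suc by blast
      have "stem n (Node {#stem d leaf#}) = stem (Suc n + d) leaf"
        unfolding stem_Node by (simp add: funpow_add)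
      then show ?thesis using False by (simp add: n d chain_tree_Suc)
    qed
    finally show ?thesis using i n by simp
  qed
  have fA: "finite A" and A: "A \<subseteq> {..<length ks}" using g finite_subset by (auto simp: good_graft_def)
  have "pgraft (pf_rep ks) g = Node (image_mset chain_tree R + mset (map (\<lambda>i. chain_tree (?n i)) [0..<length ks]))"
    unfolding pf_rep_def pgraft_PNode using g br by (auto simp: good_graft_def intro!: arg_cong[where f=mset] image_mset_cong)
  also have "mset (map (\<lambda>i. chain_tree (?n i)) [0..<length ks]) = image_mset chain_tree (image_mset ?n (mset_set {..<length ks}))"
    by (simp add: multiset.map_comp o_def lessThan_atLeast0)
  also have "{..<length ks} = ({..<length ks} - A) \<union> A" using A by blast
  also have "mset_set \<dots> = mset_set ({..<length ks} - A) + mset_set A"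
    using fA by (intro mset_set_Union) auto
  also have "image_mset ?n (mset_set ({..<length ks} - A) + mset_set A) =
      image_mset (\<lambda>i. ks ! i + c i) (mset_set ({..<length ks} - A)) + image_mset ((!) ks) (mset_set A)"
    using fA by (auto intro!: arg_cong2[where f="(+)"] image_mset_cong)
  finally show ?thesis by (simp add: path_forest_tree_def add.assoc)
qed

text \<open>A further chain survives only at the root, where it is a finished part, or at a free
  tip, where it merges with that part; these are the two summands of
  \<open>merge_sum\<close>.\<close>

lemma graft_sum_good:
  assumes "0 \<notin> set ls" "good_graft ks g A R c"
  shows "graft_sum h (pf_rep ks) (map chain_tree ls) g =
    merge_sum (\<lambda>l. h (path_forest_tree l)) ls (image_mset ((!) ks) (mset_set A))
      (R + image_mset (\<lambda>i. ks ! i + c i) (mset_set ({..<length ks} - A)))"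
  using assms
proof (induction ls arbitrary: g A R c)
  case Nil
  then show ?case by (simp add: pgraft_good)
next
  case (Cons l ls)
  let ?\<phi> = "\<lambda>l. h (path_forest_tree l)" and ?m = "\<lambda>A. image_mset ((!) ks) (mset_set A)"
  let ?F = "\<lambda>A c. image_mset (\<lambda>i. ks ! i + c i) (mset_set ({..<length ks} - A))"
  let ?g = "\<lambda>v w. g w + at_vertex v {#chain_tree l#} w"
  let ?S = "\<lambda>v. graft_sum h (pf_rep ks) (map chain_tree ls) (?g v)"
  have l: "l > 0" "0 \<notin> set ls" using Cons.prems by auto
  note good = Cons.prems(2)
  have A: "A \<subseteq> {..<length ks}" "finite A" using good finite_subset by (auto simp: good_graft_def)
  have root: "?S [] = merge_sum ?\<phi> ls (?m A) (add_mset l R + ?F A c)"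
    by (rule Cons.IH[OF l(2)]) (use good in \<open>auto simp: good_graft_def at_vertex_def tip_of_def\<close>)
  have in_A: "?S (tip_of ks i) = merge_sum ?\<phi> ls (?m A - {#ks ! i#}) (add_mset (l + ks ! i) (R + ?F A c))" if i: "i \<in> A" for i
  proof -
    have "?S (tip_of ks i) = merge_sum ?\<phi> ls (?m (A - {i})) (R + ?F (A - {i}) (c(i := l)))"
      by (rule Cons.IH[OF l(2)]) (use good i l in \<open>auto simp: good_graft_def at_vertex_def tip_of_def\<close>)
    moreover have "?m (A - {i}) = ?m A - {#ks ! i#}"
      using i A by (simp add: mset_set.remove[of A i])
    moreover have "?F (A - {i}) (c(i := l)) = add_mset (l + ks ! i) (?F A c)"
    proof -
      have "{..<length ks} - (A - {i}) = insert i ({..<length ks} - A)" using i A by auto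
      moreover have "image_mset (\<lambda>j. ks ! j + (c(i := l)) j) (mset_set ({..<length ks} - A)) = ?F A c"
        using i by (intro image_mset_cong) auto
      ultimately show ?thesis using i by (simp add: add.commute)
    qed
    ultimately show ?thesis by simp
  qed
  have zero: "?S (i # v) = 0" if i: "i < length ks" and v: "v \<in> pv (pchain (ks ! i - 1))" and n: "v \<noteq> tip (ks ! i - 1) \<or> i \<notin> A" for i v
  proof (rule graft_sum_bad[OF i v])
    show "v \<noteq> tip (ks ! i - 1) \<and> ?g (i # v) (i # v) \<noteq> {#} \<or> 2 \<le> size (?g (i # v) (i # v))"
      using n i good by (auto simp: good_graft_def tip_of_def)
  qed
  have inner: "(\<Sum>v\<in>pv (pchain (ks ! i - 1)). ?S (i # v)) = (if i \<in> A then ?S (tip_of ks i) else 0)" if i: "i < length ks" for i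
  proof -
    let ?P = "pv (pchain (ks ! i - 1))" and ?t = "tip (ks ! i - 1)"
    have "(\<Sum>v\<in>?P. ?S (i # v)) = ?S (i # ?t) + (\<Sum>v\<in>?P - {?t}. ?S (i # v))"
      by (rule sum.remove) (auto simp: tip_in_pv)
    also have "(\<Sum>v\<in>?P - {?t}. ?S (i # v)) = 0" using zero[OF i] by (intro sum.neutral) auto
    also have "?S (i # ?t) = (if i \<in> A then ?S (tip_of ks i) else 0)"
      using zero[OF i tip_in_pv] by (auto simp: tip_of_def)
    finally show ?thesis by simp
  qed
  have "graft_sum h (pf_rep ks) (map chain_tree (l # ls)) g = (\<Sum>v\<in>pv (pf_rep ks). ?S v)" by simp
  also have "\<dots> = ?S [] + (\<Sum>i<length ks. \<Sum>v\<in>pv (pchain (ks ! i - 1)). ?S (i # v))"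
    unfolding pf_rep_def sum_pv_PNode by simp
  also have "(\<Sum>i<length ks. \<Sum>v\<in>pv (pchain (ks ! i - 1)). ?S (i # v)) = (\<Sum>i<length ks. if i \<in> A then ?S (tip_of ks i) else 0)"
    by (intro sum.cong refl inner) simp
  also have "\<dots> = (\<Sum>i\<in>A. ?S (tip_of ks i))"
    using A by (simp add: sum.If_cases Int_absorb1)
  also have "\<dots> = (\<Sum>i\<in>A. merge_sum ?\<phi> ls (?m A - {#ks ! i#}) (add_mset (l + ks ! i) (R + ?F A c)))"
    by (intro sum.cong refl in_A)
  also have "\<dots> = (\<Sum>m\<in>#?m A. merge_sum ?\<phi> ls (?m A - {#m#}) (add_mset (l + m) (R + ?F A c)))"
    by (simp add: sum_unfold_sum_mset multiset.map_comp o_def)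
  finally show ?case using root by simp
qed

end

text \<open>\<open>branch_list\<close> fixes an unknown order of the branches, so the parts enter as
  the vertex counts of its entries and not as \<open>ls\<close>; only their multiset matters once
  \<open>merge_sum_commute\<close> is applied.\<close>

theorem linear_mult_path_forest:
  assumes L: "linear L" and L0: "\<And>t. \<not> path_forest t \<Longrightarrow> L (\<F> t) = 0"
    and ls: "0 \<notin> set ls" and m: "is_partition m"
  shows "L (gl_basis_mult (path_forest_tree (mset ls)) (path_forest_tree m)) =
    merge_sum (\<lambda>l. L (\<F> (path_forest_tree l))) (rev (map nv (branch_list (path_forest_tree (mset ls))))) m {#}"
proof -
  let ?s = "path_forest_tree (mset ls)" and ?t = "path_forest_tree m"
  obtain ts where ts: "rep ?t = PNode ts" by (cases "rep ?t")
  then have br: "mset (map shape ts) = image_mset chain_tree m"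
    by (metis path_forest_tree_def rtree.sel shape.simps shape_rep)
  define ks where "ks = map (nv \<circ> shape) ts"
  have "mset ks = image_mset nv (image_mset chain_tree m)"
    unfolding ks_def br[symmetric] by (simp add: multiset.map_comp)
  also have "\<dots> = m" using path_forest_tree_inverse[OF m] by (simp add: path_forest_tree_def)
  finally have ks: "mset ks = m" .
  then have ks0: "0 \<notin> set ks" using m by (auto simp: is_partition_def)
  have "ts = map (\<lambda>k. pchain (k - 1)) ks"
  proof (rule nth_equalityI)
    fix i assume i: "i < length ts"
    then have "shape (ts ! i) \<in># image_mset chain_tree m" unfolding br[symmetric] by auto
    then obtain k where k: "k \<in># m" "shape (ts ! i) = chain_tree k" by auto
    then have "k > 0" using m by (metis gr_zeroI is_partition_def)
    then obtain n where n: "k = Suc n" using gr0_conv_Suc by blast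
    then have "ts ! i = pchain n" using k by (intro shape_eq_stem) (simp add: chain_tree_Suc)
    moreover have "ks ! i = k" using i k nv_chain[OF \<open>k > 0\<close>] by (simp add: ks_def)
    ultimately show "ts ! i = map (\<lambda>k. pchain (k - 1)) ks ! i" using i n by (simp add: ks_def)
  qed (simp add: ks_def)
  then have rep: "rep ?t = pf_rep ks" using ts by (simp add: pf_rep_def)
  let ?b = "branch_list ?s"
  have bs: "mset ?b = image_mset chain_tree (mset ls)" by (simp add: mset_branch_list path_forest_tree_def)
  have b_in: "\<exists>k>0. b = chain_tree k" if "b \<in> set ?b" for b
  proof -
    have "b \<in># image_mset chain_tree (mset ls)" using that unfolding bs[symmetric] by simp
    then obtain k where k: "k \<in> set ls" "b = chain_tree k" by auto
    then have "k > 0" using ls by (metis gr_zeroI)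
    then show ?thesis using k by blast
  qed
  have b1: "rev ?b = map chain_tree (rev (map nv ?b))"
  proof -
    have "chain_tree (nv b) = b" if "b \<in> set ?b" for b using b_in[OF that] nv_chain by auto
    then have "map chain_tree (map nv ?b) = ?b" by (simp add: map_idI)
    then show ?thesis by (simp only: rev_map[symmetric])
  qed
  have b0: "0 \<notin> set (rev (map nv ?b))" using b_in nv_chain by fastforce
  have "good_graft ks (\<lambda>_. {#}) {..<length ks} {#} (\<lambda>_. 1)" by (simp add: good_graft_def)
  note graft_sum_good[OF L0 ks0 b0 this]
  moreover have "image_mset ((!) ks) (mset_set {..<length ks}) = m"
    unfolding ks[symmetric] by (metis lessThan_atLeast0 map_nth mset_map mset_upt)
  ultimately show ?thesis unfolding linear_gl_basis_mult[OF L] rep b1 by simp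
qed

section \<open>States vanishing off the path forests\<close>

lemma path_forest_pgraft:
  assumes "path_forest (pgraft p g)"
  shows "path_forest (shape p)" "\<And>v b. v \<in> pv p \<Longrightarrow> b \<in># g v \<Longrightarrow> is_chain b"
proof -
  obtain ts where p: "p = PNode ts" by (cases p)
  have ch: "is_chain (pgraft (ts ! i) (\<lambda>v. g (i # v)))" if "i < length ts" for i
    using assms that by (auto simp: p pgraft_PNode path_forest_iff)
  show "path_forest (shape p)"
    using ch is_chain_pgraft by (fastforce simp: p path_forest_iff in_set_conv_nth)
  show "is_chain b" if vb: "v \<in> pv p" "b \<in># g v" for v b
  proof (cases v)
    case Nil
    then show ?thesis using assms vb by (auto simp: p pgraft_PNode path_forest_iff)
  next
    case (Cons i w)
    then have "i < length ts" "w \<in> pv (ts ! i)" using vb p by auto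
    then show ?thesis using is_chain_pgraft[OF ch] vb(2) Cons by blast
  qed
qed

text \<open>Contrapositively, the trees that are not path-forest span a two-sided ideal.\<close>

lemma path_forest_circ:
  assumes f: "f \<in> {..<length (branch_list s)} \<rightarrow>\<^sub>E verts t" and pf: "path_forest (circ t (branch_list s) f)"
  shows "path_forest s" "path_forest t"
proof -
  let ?ss = "branch_list s"
  note c = path_forest_pgraft[OF pf[unfolded circ_def]]
  show "path_forest t" using c(1) by simp
  show "path_forest s"
    unfolding path_forest_iff
  proof
    fix b assume "b \<in># branches s"
    then have "b \<in> set ?ss" by (metis mset_branch_list set_mset_mset)
    then obtain i where i: "i < length ?ss" "b = ?ss ! i" by (metis in_set_conv_nth)
    have "f i \<in> pv (rep t)" using f i by (auto simp: verts_eq)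
    moreover have "b \<in># image_mset ((!) ?ss) (mset_set {j. j < length ?ss \<and> f j = f i})"
      using i by auto
    ultimately show "is_chain b" by (rule c(2))
  qed
qed

context
  fixes L :: "gl_algebra \<Rightarrow> real"
  assumes L: "linear L" and L0: "\<And>t. \<not> path_forest t \<Longrightarrow> L (\<F> t) = 0"
begin

lemma gl_basis_mult_vanish:
  assumes "\<not> path_forest s \<or> \<not> path_forest t" shows "L (gl_basis_mult s t) = 0"
  unfolding gl_basis_mult_def linear_sum[OF L]
  using path_forest_circ assms by (intro sum.neutral ballI L0) blast

lemma mset_nv_branch_list:
  "is_partition l \<Longrightarrow> mset (rev (map nv (branch_list (path_forest_tree l)))) = l"
  using path_forest_tree_inverse[of l] by (simp add: mset_branch_list)

text \<open>For two path forests both sides are the same merging sum; otherwise both vanish by the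
  ideal property.\<close>

lemma gl_basis_mult_commute: "L (gl_basis_mult s t) = L (gl_basis_mult t s)"
proof (cases "path_forest s \<and> path_forest t")
  case True
  then obtain l m where l: "is_partition l" "s = path_forest_tree l" and m: "is_partition m" "t = path_forest_tree m"
    using path_forest_iff_partition by auto
  obtain ls ms where ls: "mset ls = l" "mset ms = m" using ex_mset by metis
  have "0 \<notin> set ls" "0 \<notin> set ms" using l m ls by (auto simp: is_partition_def)
  then have "L (gl_basis_mult s t) = merge_sum (\<lambda>l. L (\<F> (path_forest_tree l))) (rev (map nv (branch_list s))) m {#}"
    "L (gl_basis_mult t s) = merge_sum (\<lambda>l. L (\<F> (path_forest_tree l))) (rev (map nv (branch_list t))) l {#}"
    using linear_mult_path_forest[OF L L0, of ls m] linear_mult_path_forest[OF L L0, of ms l] l m ls by simp_all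
  moreover have "mset (rev (map nv (branch_list s))) = l" "mset (rev (map nv (branch_list t))) = m"
    unfolding l(2) m(2) using mset_nv_branch_list l(1) m(1) by blast+
  ultimately show ?thesis using merge_sum_commute by metis
next
  case False
  then show ?thesis using gl_basis_mult_vanish by metis
qed

theorem tracial_of_vanish: "L (x \<circledast> y) = L (y \<circledast> x)"
proof -
  have "L (x \<circledast> y) = (\<Sum>t\<in>Poly_Mapping.keys y. \<Sum>s\<in>Poly_Mapping.keys x.
     Poly_Mapping.lookup x s * Poly_Mapping.lookup y t * L (gl_basis_mult s t))"
    unfolding linear_gl_mult[OF L] by (rule sum.swap)
  also have "\<dots> = L (y \<circledast> x)"
    unfolding linear_gl_mult[OF L] by (intro sum.cong refl) (simp only: gl_basis_mult_commute mult_ac)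
  finally show ?thesis .
qed

lemma tau_mult_path_forest:
  assumes m: "is_partition m"
  shows "L (gl_basis_mult \<tau> (path_forest_tree m)) = L (\<F> (path_forest_tree (add_mset 1 m))) +
    (\<Sum>j\<in>set_mset m. real (count m j) * L (\<F> (path_forest_tree (add_mset (j + 1) (m - {#j#})))))"
proof -
  have tau: "\<tau> = path_forest_tree (mset [1])" by (simp add: path_forest_tree_def chain_tree_def)
  have "mset (rev (map nv (branch_list \<tau>))) = {#1#}"
    unfolding tau by (subst mset_nv_branch_list) (auto simp: is_partition_def)
  then have b: "rev (map nv (branch_list \<tau>)) = [1]" by (metis mset_single_iff)
  obtain ms where ms: "mset ms = m" using ex_mset by blast
  let ?f = "\<lambda>j. L (\<F> (path_forest_tree (add_mset (j + 1) (m - {#j#}))))"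
  have "L (gl_basis_mult \<tau> (path_forest_tree m)) = merge_sum (\<lambda>l. L (\<F> (path_forest_tree l))) [1] m {#}"
    using linear_mult_path_forest[OF L L0, of "[1]" m] m unfolding tau[symmetric] b by simp
  also have "\<dots> = L (\<F> (path_forest_tree (add_mset 1 m))) + (\<Sum>j\<in>#m. ?f j)"
    by simp
  also have "(\<Sum>j\<in>#m. ?f j) = (\<Sum>j\<leftarrow>ms. ?f j)"
    unfolding ms[symmetric] by (simp add: sum_mset_sum_list[symmetric] flip: mset_map)
  also have "\<dots> = (\<Sum>j\<in>set_mset m. real (count (mset ms) j) * ?f j)"
    by (rule sum_list_eq_sum_count) (use ms in auto)
  finally show ?thesis unfolding ms .
qed

end

lemma harmonic_pf_of_harmonic:
  assumes h: "harmonic h" and h0: "\<And>t. \<not> path_forest t \<Longrightarrow> h t = 0"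
  shows "harmonic_pf (\<lambda>l. h (path_forest_tree l))"
  unfolding harmonic_pf_def
proof (intro allI impI)
  fix l assume l: "is_partition l"
  have "h (path_forest_tree l) = lin_ext h (gl_basis_mult \<tau> (path_forest_tree l))"
    unfolding linear_tau_mult[OF linear_lin_ext] lin_ext_basis by (rule harmonicD(3)[OF h])
  also have "\<dots> = h (path_forest_tree (add_mset 1 l)) +
    (\<Sum>j\<in>set_mset l. real (count l j) * h (path_forest_tree (add_mset (j + 1) (l - {#j#}))))"
    using tau_mult_path_forest[OF linear_lin_ext _ l, of h] h0 by simp
  finally show "h (path_forest_tree l) = h (path_forest_tree (add_mset 1 l)) +
    (\<Sum>j\<in>set_mset l. real (count l j) * h (path_forest_tree (add_mset (j + 1) (l - {#j#}))))" .
qed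

lemma psi_basis_vanish: "\<not> path_forest t \<Longrightarrow> psi_basis p t = 0"
  by (simp add: psi_basis_def)

lemma psi_basis_nonneg: "p \<in> nabla \<Longrightarrow> 0 \<le> psi_basis p t"
  unfolding psi_basis_def using aug_value_nonneg[of p] by (simp add: aug_value_def)

lemma leaf_eq_path_forest_tree: "leaf = path_forest_tree {#}"
  by (simp add: path_forest_tree_def)

text \<open>On path forests this is the recurrence of \<open>aug_value\<close> for
  \<open>k = 1\<close>, where the first power sum has the value 1; from the other trees growth never
  returns to path forests.\<close>

lemma harmonic_psi_basis:
  assumes p: "p \<in> nabla" shows "harmonic (psi_basis p)"
  unfolding harmonic_def
proof (intro conjI allI)
  show "psi_basis p leaf = 1"
    unfolding leaf_eq_path_forest_tree by (subst psi_basis_path_forest) (auto simp: is_partition_def aug_value_empty[OF p])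
  show "0 \<le> psi_basis p t" for t using p by (rule psi_basis_nonneg)
  fix t
  show "psi_basis p t = (\<Sum>v\<in>verts t. psi_basis p (attach_leaf t v))"
  proof (cases "path_forest t")
    case True
    then obtain l where l: "is_partition l" "t = path_forest_tree l" using path_forest_iff_partition by blast
    have l1: "is_partition (add_mset 1 l)" using l(1) by (simp add: is_partition_def)
    have "(\<Sum>v\<in>verts t. psi_basis p (attach_leaf t v)) = lin_ext (psi_basis p) (gl_basis_mult \<tau> t)"
      by (simp add: linear_tau_mult[OF linear_lin_ext])
    also have "\<dots> = psi_basis p (path_forest_tree (add_mset 1 l)) +
      (\<Sum>j\<in>set_mset l. real (count l j) * psi_basis p (path_forest_tree (add_mset (j + 1) (l - {#j#}))))"
      unfolding l(2) using tau_mult_path_forest[OF linear_lin_ext _ l(1), of "psi_basis p"] psi_basis_vanish by simp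
    also have "\<dots> = aug_value p (add_mset 1 l) + (\<Sum>j\<in>set_mset l. real (count l j) * aug_value p (add_mset (j + 1) (l - {#j#})))"
      unfolding psi_basis_path_forest[OF l1] psi_basis_path_forest[OF merge_partition[OF l(1) zero_less_one]] ..
    also have "\<dots> = ext_power_sum p 1 * aug_value p l"
      by (rule aug_value_recurrence[OF p zero_less_one l(1), symmetric])
    also have "\<dots> = psi_basis p t" unfolding l(2) psi_basis_path_forest[OF l(1)] by (simp add: ext_power_sum_def)
    finally show ?thesis ..
  next
    case False
    have "\<not> path_forest (attach_leaf t v)" if "v \<in> verts t" for v
      using False att_path_forest att_iff_attach that by blast
    then show ?thesis using False by (simp add: psi_basis_vanish)
  qed
qed

section \<open>Chain identities\<close>

text \<open>A leaf attached at depth \<open>d < n\<close> makes that vertex branch into the leaf and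
  the rest of the chain; at the tip, of depth \<open>n\<close>, the chain only gets longer.\<close>

lemma sum_pchain:
  "(\<Sum>v\<in>pv (pchain n). h (pgraft (pchain n) (at_vertex v {#leaf#}))) =
   (\<Sum>d<n. h (stem d (Node {#leaf, stem (n - 1 - d) leaf#}))) + (h (stem (Suc n) leaf) :: real)"
proof (induction n arbitrary: h)
  case 0
  have "pv (PNode []) = {[]}" by (auto simp: pv_PNode)
  then show ?case by (simp add: pgraft_root)
next
  case (Suc n)
  have "(\<Sum>v\<in>pv (pchain (Suc n)). h (pgraft (pchain (Suc n)) (at_vertex v {#leaf#}))) =
    h (Node {#leaf, stem n leaf#}) + (\<Sum>v\<in>pv (pchain n). h (Node {#pgraft (pchain n) (at_vertex v {#leaf#})#}))"
    unfolding pchain.simps sum_pv_PNode by (simp add: pgraft_root pgraft_child shape_pchain add_mset_commute)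
  also have "(\<Sum>v\<in>pv (pchain n). h (Node {#pgraft (pchain n) (at_vertex v {#leaf#})#})) =
     (\<Sum>d<n. h (Node {#stem d (Node {#leaf, stem (n - 1 - d) leaf#})#})) + h (Node {#stem (Suc n) leaf#})"
    by (rule Suc.IH)
  finally show ?case by (simp add: sum.lessThan_Suc_shift del: sum.lessThan_Suc)
qed

text \<open>The commutator value for the \<open>m\<close>-chain. Of the leaf attachments to the
  chain, those at the root, \<open>d = 0\<close>, and at the tip cancel against the two terms of
  \<open>\<F> (chain_tree m) \<circledast> \<F> \<tau>\<close>; the remaining trees all branch below
  the root.\<close>

definition chain_defect :: "(rtree \<Rightarrow> real) \<Rightarrow> nat \<Rightarrow> real" where
  "chain_defect h m = (\<Sum>d\<in>{1..<m - 1}. h (stem d (Node {#leaf, stem (m - 2 - d) leaf#})))"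

lemma rep_stem: "rep (stem n leaf) = pchain n"
  by (rule shape_eq_stem) simp

lemma linear_chain_mult_tau:
  fixes L :: "gl_algebra \<Rightarrow> real"
  assumes L: "linear L"
  shows "L (gl_basis_mult (chain_tree (Suc (Suc n))) \<tau>) = L (\<F> (Node {#leaf, stem n leaf#})) + L (\<F> (stem (Suc (Suc n)) leaf))"
proof -
  have "branches (chain_tree (Suc (Suc n))) = {#stem n leaf#}" by (simp add: chain_tree_Suc)
  moreover have "rep \<tau> = pchain 1" using rep_stem[of 1] by (simp add: chain_tree_def)
  moreover have "pv (PNode []) = {[]}" by (auto simp: pv_PNode)
  ultimately show ?thesis
    by (simp add: linear_gl_basis_mult_single[OF L] verts_eq sum_pv_PNode pgraft_root pgraft_child add_mset_commute)
qed

lemma linear_chain_commutator: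
  fixes L :: "gl_algebra \<Rightarrow> real"
  assumes L: "linear L" and m: "m \<ge> 3"
  shows "L (\<F> \<tau> \<circledast> \<F> (chain_tree m) - \<F> (chain_tree m) \<circledast> \<F> \<tau>) = chain_defect (\<lambda>t. L (\<F> t)) m"
proof -
  obtain n where n: "m = Suc (Suc n)" "n > 0" using m by (metis Suc_le_D Suc_le_eq less_Suc_eq_0_disj numeral_3_eq_3 Suc_le_mono)
  have "L (gl_basis_mult \<tau> (chain_tree m)) =
     (\<Sum>d<Suc n. L (\<F> (stem d (Node {#leaf, stem (n - d) leaf#})))) + L (\<F> (stem (Suc (Suc n)) leaf))"
    unfolding linear_tau_mult[OF L] n chain_tree_Suc verts_eq attach_leaf_eq rep_stem
    using sum_pchain[where h="\<lambda>t. L (\<F> t)" and n="Suc n"] by simp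
  also have "(\<Sum>d<Suc n. L (\<F> (stem d (Node {#leaf, stem (n - d) leaf#})))) =
     L (\<F> (Node {#leaf, stem n leaf#})) + (\<Sum>d\<in>{1..<Suc n}. L (\<F> (stem d (Node {#leaf, stem (n - d) leaf#}))))"
    by (simp add: lessThan_atLeast0 sum.atLeast_Suc_lessThan)
  finally show ?thesis
    by (simp add: linear_diff[OF L] gl_mult_basis linear_chain_mult_tau[OF L] n chain_defect_def)
qed

lemma chain_identity_iff:
  assumes "pieri_state L" "m \<ge> 3"
  shows "chain_identity L m \<longleftrightarrow> chain_defect (\<lambda>t. L (\<F> t)) m = 0"
proof -
  have L: "linear L" "L (\<F> \<tau> \<circledast> \<F> (chain_tree m)) = L (\<F> (chain_tree m))"
    using assms(1) by (auto simp: pieri_state_def)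
  show ?thesis
    using linear_chain_commutator[OF L(1) assms(2)] L by (auto simp: chain_identity_def linear_diff)
qed

text \<open>By the Pieri identity the defect is \<open>h (chain_tree m)\<close> minus a nonnegative
  value. The bound 1, uniform in \<open>h\<close> and \<open>m\<close>, later gives uniform
  convergence of the weighted sum.\<close>

lemma chain_defect_bounds:
  assumes h: "harmonic h" and m: "m \<ge> 3" shows "0 \<le> chain_defect h m" "chain_defect h m \<le> 1"
proof -
  have L: "pieri_state (lin_ext h)" by (rule pieri_state_lin_ext[OF h])
  then have "lin_ext h (\<F> \<tau> \<circledast> \<F> (chain_tree m)) = h (chain_tree m)" by (simp add: pieri_state_def)
  moreover have "chain_defect h m = lin_ext h (\<F> \<tau> \<circledast> \<F> (chain_tree m)) - lin_ext h (\<F> (chain_tree m) \<circledast> \<F> \<tau>)"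
    using linear_chain_commutator[OF linear_lin_ext m, of h] by (simp add: linear_diff[OF linear_lin_ext])
  moreover have "0 \<le> lin_ext h (\<F> (chain_tree m) \<circledast> \<F> \<tau>)"
  proof -
    obtain n where n: "m = Suc (Suc n)" using m by (metis Suc_le_D numeral_3_eq_3 Suc_le_mono)
    show ?thesis unfolding gl_mult_basis n linear_chain_mult_tau[OF linear_lin_ext] using harmonicD(2)[OF h] by simp
  qed
  ultimately show "chain_defect h m \<le> 1" using harmonic_le_1[OF h, of "chain_tree m"] by linarith
  show "0 \<le> chain_defect h m" unfolding chain_defect_def using harmonicD(2)[OF h] by (intro sum_nonneg)
qed

lemma path_forest_stem: "path_forest (stem (Suc d) (Node {#a, b#})) \<Longrightarrow> False"
proof -
  have "\<not> is_chain (stem d (Node {#a, b#}))" by (induction d) (auto simp: is_chain_Node)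
  then show "path_forest (stem (Suc d) (Node {#a, b#})) \<Longrightarrow> False" by (auto simp: path_forest_iff)
qed

theorem chain_defects_zero_iff:
  assumes h: "harmonic h"
  shows "(\<forall>m\<ge>3. chain_defect h m = 0) \<longleftrightarrow> (\<forall>t. \<not> path_forest t \<longrightarrow> h t = 0)"
proof
  assume z: "\<forall>m\<ge>3. chain_defect h m = 0"
  have ch: "h (cherry (Suc j)) = 0" for j
  proof -
    have "chain_defect h (j + 3) = 0" using z by simp
    then have "\<forall>d\<in>{1..<j + 3 - 1}. h (stem d (Node {#leaf, stem (j + 3 - 2 - d) leaf#})) = 0"
      unfolding chain_defect_def using harmonicD(2)[OF h] by (subst (asm) sum_nonneg_eq_0_iff) auto
    \<comment> \<open>At depth \<open>j + 1\<close>, one above the tip, the branching vertex carries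
      two leaves: this term is \<open>h (cherry (Suc j))\<close>.\<close>
    from bspec[OF this, of "Suc j"] show ?thesis by simp
  qed
  show "\<forall>t. \<not> path_forest t \<longrightarrow> h t = 0"
  proof (intro allI impI)
    fix t assume "\<not> path_forest t"
    then obtain j where "reach (cherry (Suc j)) t" using reach_cherry_path_forest by blast
    then have "h t \<le> 0" using harmonic_reach_le[OF _ h] ch by metis
    then show "h t = 0" using harmonicD(2)[OF h, of t] by simp
  qed
next
  assume z: "\<forall>t. \<not> path_forest t \<longrightarrow> h t = 0"
  show "\<forall>m\<ge>3. chain_defect h m = 0"
    unfolding chain_defect_def
  proof (intro allI impI sum.neutral ballI)
    fix m d :: nat assume "d \<in> {1..<m - 1}"
    then obtain d' where d: "d = Suc d'" by (cases d) auto
    have "\<not> path_forest (stem d (Node {#leaf, stem (m - 2 - d) leaf#}))" unfolding d by (rule notI) (rule path_forest_stem)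
    then show "h (stem d (Node {#leaf, stem (m - 2 - d) leaf#})) = 0" using z by blast
  qed
qed

text \<open>A chain that grows a star at its end: the support of the state violating a single chain
  identity.\<close>

primrec star_ray :: "nat \<Rightarrow> rtree set" where
  "star_ray 0 = range (\<lambda>j. Node (replicate_mset j leaf))"
| "star_ray (Suc d) = insert leaf ((\<lambda>r. Node {#r#}) ` star_ray d)"

lemma leaf_in_star_ray: "leaf \<in> star_ray d"
  by (cases d) (auto intro!: image_eqI[of _ _ 0])

lemma mset_replicate_iff: "(\<exists>j. B = replicate_mset j x) \<longleftrightarrow> set_mset B \<subseteq> {x}"
  by (auto dest: set_mset_subset_singletonD split: if_splits)

lemma star_ray_0_iff: "Node B \<in> star_ray 0 \<longleftrightarrow> set_mset B \<subseteq> {leaf}"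
  unfolding mset_replicate_iff[symmetric] by auto

lemma star_ray_Suc_iff: "Node B \<in> star_ray (Suc d) \<longleftrightarrow> B = {#} \<or> (\<exists>r\<in>star_ray d. B = {#r#})"
  by auto

lemma pgraft_not_leaf: "v \<in> pv p \<Longrightarrow> pgraft p (at_vertex v {#leaf#}) \<noteq> leaf"
proof
  assume v: "v \<in> pv p" and e: "pgraft p (at_vertex v {#leaf#}) = leaf"
  have "nv leaf = Suc (nv (shape p))" using nv_att[OF att_pgraft[OF v]] unfolding e .
  then show False by (cases "shape p") auto
qed

text \<open>Inside the family there is exactly one vertex at which a leaf can be added without
  leaving it, the end of the growing chain or the centre of the star; from outside there is
  none.\<close>

lemma star_ray_count:
  "(\<Sum>v\<in>pv p. of_bool (pgraft p (at_vertex v {#leaf#}) \<in> star_ray d)) = (of_bool (shape p \<in> star_ray d) :: real)"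
proof (induction d arbitrary: p)
  case 0
  obtain ts where p: "p = PNode ts" by (cases p)
  have z: "pgraft (PNode ts) (at_vertex (i # v) {#leaf#}) \<notin> star_ray 0" if "i < length ts" "v \<in> pv (ts ! i)" for i v
    unfolding pgraft_child[OF that(1)] star_ray_0_iff using pgraft_not_leaf[OF that(2)] by auto
  have "(\<Sum>v\<in>pv p. of_bool (pgraft p (at_vertex v {#leaf#}) \<in> star_ray 0)) =
      (of_bool (pgraft p (at_vertex [] {#leaf#}) \<in> star_ray 0) :: real)"
    unfolding p sum_pv_PNode using z by (simp del: star_ray.simps)
  also have "\<dots> = of_bool (shape p \<in> star_ray 0)"
    unfolding p pgraft_root shape.simps star_ray_0_iff by simp
  finally show ?case .
next
  case (Suc d)
  obtain ts where p: "p = PNode ts" by (cases p)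
  consider "ts = []" | q where "ts = [q]" | q q' ts' where "ts = q # q' # ts'" by (metis list.exhaust)
  then show ?case
  proof cases
    case 1
    then show ?thesis unfolding p sum_pv_PNode pgraft_root shape.simps star_ray_Suc_iff
      by (auto simp: leaf_in_star_ray)
  next
    case (2 q)
    have "(\<Sum>v\<in>pv p. of_bool (pgraft p (at_vertex v {#leaf#}) \<in> star_ray (Suc d))) =
      (\<Sum>v\<in>pv q. of_bool (pgraft (PNode [q]) (at_vertex (0 # v) {#leaf#}) \<in> star_ray (Suc d)) :: real)"
      unfolding p 2 sum_pv_PNode pgraft_root shape.simps star_ray_Suc_iff by auto
    also have "\<dots> = (\<Sum>v\<in>pv q. of_bool (pgraft q (at_vertex v {#leaf#}) \<in> star_ray d))"
      by (intro sum.cong refl) (simp add: pgraft_child star_ray_Suc_iff del: star_ray.simps)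
    also have "\<dots> = of_bool (shape q \<in> star_ray d)" by (rule Suc)
    also have "\<dots> = of_bool (shape p \<in> star_ray (Suc d))"
      unfolding p 2 shape.simps star_ray_Suc_iff by simp
    finally show ?thesis .
  next
    case (3 q q' ts')
    have sz: "size (branches t) \<le> 1" if "t \<in> star_ray (Suc d)" for t using that by auto
    have "pgraft p (at_vertex v {#leaf#}) \<notin> star_ray (Suc d)" if v: "v \<in> pv p" for v
    proof -
      have "size (branches (pgraft p (at_vertex v {#leaf#}))) \<ge> 2" using 3 p by (simp add: pgraft_PNode)
      then show ?thesis using sz by fastforce
    qed
    moreover have "shape p \<notin> star_ray (Suc d)"
    proof -
      have "size (branches (shape p)) \<ge> 2" using 3 p by simp
      then show ?thesis using sz by fastforce
    qed
    ultimately show ?thesis by (simp del: star_ray.simps)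
  qed
qed

lemma harmonic_star_ray: "harmonic (\<lambda>t. of_bool (t \<in> star_ray d))"
  unfolding harmonic_def
proof (intro conjI allI)
  fix t
  show "of_bool (t \<in> star_ray d) = (\<Sum>v\<in>verts t. of_bool (attach_leaf t v \<in> star_ray d) :: real)"
    using star_ray_count[of "rep t" d] by (simp add: verts_eq attach_leaf_eq)
qed (auto simp: leaf_in_star_ray)

lemma stem_in_star_ray: "stem k leaf \<in> star_ray d \<longleftrightarrow> k \<le> Suc d"
proof (induction d arbitrary: k)
  case 0
  show ?case
  proof (cases k)
    case (Suc k')
    then have "stem k leaf \<in> star_ray 0 \<longleftrightarrow> stem k' leaf = leaf" by (simp add: star_ray_0_iff del: star_ray.simps)
    also have "\<dots> \<longleftrightarrow> k' = 0" by (cases k') auto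
    finally show ?thesis using Suc by simp
  qed (use leaf_in_star_ray[of 0] in simp)
next
  case (Suc d)
  show ?case using Suc leaf_in_star_ray[of "Suc d"] by (cases k) (auto simp: star_ray_Suc_iff simp del: star_ray.simps)
qed

text \<open>For \<open>m = d + 3\<close> the chains in \<open>star_ray (Suc d)\<close> are those
  with at most \<open>m\<close> vertices. The tree with two root branches is absent, so the
  \<open>k\<close>-th identity compares the presence of the chains with \<open>k + 1\<close> and
  with \<open>k\<close> vertices, which differs only for \<open>k = m\<close>.\<close>

theorem ex_single_chain_violation:
  assumes m: "m \<ge> 3"
  shows "\<exists>L. pieri_state L \<and> (\<forall>k\<ge>3. k \<noteq> m \<longrightarrow> chain_identity L k) \<and> \<not> chain_identity L m"
proof -
  obtain d where d: "m = d + 3" using m by (metis add.commute le_Suc_ex)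
  define L where "L = lin_ext (\<lambda>t. of_bool (t \<in> star_ray (Suc d)))"
  have L: "linear L" unfolding L_def by (rule linear_lin_ext)
  have "chain_identity L k \<longleftrightarrow> k \<noteq> m" if "k \<ge> 3" for k
  proof -
    obtain n where n: "k = Suc (Suc n)" using \<open>k \<ge> 3\<close> by (metis Suc_le_D numeral_3_eq_3 Suc_le_mono)
    have "Node {#leaf, stem n leaf#} \<notin> star_ray (Suc d)" unfolding star_ray_Suc_iff by auto
    then have "L (\<F> (chain_tree k) \<circledast> \<F> \<tau>) = of_bool (Suc (Suc n) \<le> Suc (Suc d))"
      unfolding gl_mult_basis n linear_chain_mult_tau[OF L] unfolding L_def lin_ext_basis stem_in_star_ray by simp
    moreover have "L (\<F> (chain_tree k)) = of_bool (Suc n \<le> Suc (Suc d))"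
      unfolding L_def n chain_tree_Suc lin_ext_basis stem_in_star_ray ..
    ultimately show ?thesis unfolding chain_identity_def by (auto simp: n d)
  qed
  moreover have "pieri_state L" unfolding L_def by (rule pieri_state_lin_ext[OF harmonic_star_ray])
  ultimately show ?thesis using m by blast
qed

section \<open>Central measures on the path space\<close>

instance edge :: countable
  by countable_datatype

definition edges_from :: "rtree \<Rightarrow> edge set" where
  "edges_from s = {e \<in> edges. src e = s}"

lemma edge_mult_pos_iff: "0 < edge_mult s t \<longleftrightarrow> t \<in> attach_leaf s ` verts s"
proof -
  have "finite {v\<in>verts s. attach_leaf s v = t}" by simp
  then show ?thesis unfolding edge_mult_def by (auto simp: card_gt_0_iff)
qed

lemma edges_from_eq:
  "edges_from s = (\<lambda>(t, i). Edge s i t) ` (SIGMA t:attach_leaf s ` verts s. {..<edge_mult s t})"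
proof (rule set_eqI)
  fix e
  have "e \<in> edges_from s \<longleftrightarrow> src e = s \<and> copy e < edge_mult s (tgt e)"
    by (auto simp: edges_from_def edges_def)
  also have "\<dots> \<longleftrightarrow> src e = s \<and> copy e < edge_mult s (tgt e) \<and> tgt e \<in> attach_leaf s ` verts s"
    using edge_mult_pos_iff[of s "tgt e"] by linarith
  also have "\<dots> \<longleftrightarrow> e \<in> (\<lambda>(t, i). Edge s i t) ` (SIGMA t:attach_leaf s ` verts s. {..<edge_mult s t})"
    by (cases e) (auto intro!: image_eqI[of _ _ "(tgt e, copy e)"])
  finally show "e \<in> edges_from s \<longleftrightarrow> e \<in> (\<lambda>(t, i). Edge s i t) ` (SIGMA t:attach_leaf s ` verts s. {..<edge_mult s t})" .
qed

lemma finite_edges_from: "finite (edges_from s)"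
  unfolding edges_from_eq by (intro finite_imageI finite_SigmaI) auto

text \<open>The copies of an edge are as numerous as the vertices at which attaching a leaf gives
  its target.\<close>

lemma sum_edges_from: "(\<Sum>e\<in>edges_from s. h (tgt e)) = (\<Sum>v\<in>verts s. h (attach_leaf s v) :: real)"
proof -
  let ?T = "attach_leaf s ` verts s"
  have inj: "inj_on (\<lambda>(t, i). Edge s i t) (SIGMA t:?T. {..<edge_mult s t})" by (auto simp: inj_on_def)
  have "(\<Sum>e\<in>edges_from s. h (tgt e)) = (\<Sum>(t, i)\<in>(SIGMA t:?T. {..<edge_mult s t}). h t)"
    unfolding edges_from_eq by (subst sum.reindex[OF inj]) (simp add: case_prod_beta')
  also have "\<dots> = (\<Sum>t\<in>?T. \<Sum>i<edge_mult s t. h t)" by (rule sum.Sigma[symmetric]) auto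
  also have "\<dots> = (\<Sum>t\<in>?T. \<Sum>v\<in>{v\<in>verts s. attach_leaf s v = t}. h (attach_leaf s v))"
    by (intro sum.cong refl) (simp add: edge_mult_def)
  also have "\<dots> = (\<Sum>v\<in>verts s. h (attach_leaf s v))"
    by (rule sum.image_gen[symmetric]) simp
  finally show ?thesis .
qed

lemma edge_att: "e \<in> edges \<Longrightarrow> att (src e) (tgt e)"
  using edge_mult_pos_iff[of "src e" "tgt e"] att_iff_attach unfolding edges_def by fastforce

lemma att_edge: "att s t \<Longrightarrow> Edge s 0 t \<in> edges"
  using edge_mult_pos_iff[of s t] att_iff_attach unfolding edges_def by fastforce

lemma hpath_append: "hpath s (es @ fs) t \<longleftrightarrow> (\<exists>u. hpath s es u \<and> hpath u fs t)"
  by (induction es arbitrary: s) auto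

lemma hpath_snoc: "hpath s (es @ [e]) t \<longleftrightarrow> e \<in> edges \<and> hpath s es (src e) \<and> tgt e = t"
  by (auto simp: hpath_append)

lemma hpath_unique: "hpath s es t \<Longrightarrow> hpath s es t' \<Longrightarrow> t = t'"
  by (induction es arbitrary: s) auto

lemma hpath_nv: "hpath s es t \<Longrightarrow> nv t = nv s + length es"
  by (induction es arbitrary: s) (auto simp: nv_att[OF edge_att])

lemma hpath_leaf_nv: "hpath leaf es t \<Longrightarrow> nv t = Suc (length es)"
  using hpath_nv[of leaf es t] by simp

lemma ex_hpath: "\<exists>es. hpath leaf es t"
  using reach_leaf[of t]
proof (induction rule: rtranclp_induct)
  case base
  then show ?case by (intro exI[of _ "[]"]) simp
next
  case (step y z)
  then obtain es where "hpath leaf es y" by blast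
  then have "hpath leaf (es @ [Edge y 0 z]) z" using att_edge[OF step(2)] by (simp add: hpath_snoc)
  then show ?case ..
qed

lemma finite_hpaths: "finite {es. length es = n \<and> (\<exists>t. hpath leaf es t)}"
proof (induction n)
  case (Suc n)
  let ?P = "\<lambda>n. {es. length es = n \<and> (\<exists>t. hpath leaf es t)}"
  have "?P (Suc n) \<subseteq> (\<Union>es\<in>?P n. \<Union>e\<in>edges_from (THE t. hpath leaf es t). {es @ [e]})"
  proof
    fix fs assume fs: "fs \<in> ?P (Suc n)"
    then obtain es e where f: "fs = es @ [e]" "length es = n" by (metis (mono_tags, lifting) length_Suc_conv_rev mem_Collect_eq)
    then have h: "hpath leaf es (src e)" "e \<in> edges" using fs by (auto simp: hpath_snoc)
    then have "(THE t. hpath leaf es t) = src e" using hpath_unique by blast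
    then have "e \<in> edges_from (THE t. hpath leaf es t)" using h by (simp add: edges_from_def)
    then show "fs \<in> (\<Union>es\<in>?P n. \<Union>e\<in>edges_from (THE t. hpath leaf es t). {es @ [e]})" using f h by blast
  qed
  then show ?case by (rule finite_subset) (use Suc finite_edges_from in auto)
qed simp

lemma finite_hpaths_to: "finite {es. hpath leaf es t}"
  by (rule finite_subset[OF _ finite_hpaths[of "nv t - 1"]]) (auto dest: hpath_leaf_nv)

lemma num_paths_pos: "0 < num_paths t"
  unfolding num_paths_def using finite_hpaths_to ex_hpath by (auto simp: card_gt_0_iff)

section \<open>Topology and Borel sets of the path space\<close>

abbreviation edge_seqs :: "(nat \<Rightarrow> edge) topology" where
  "edge_seqs \<equiv> product_topology (\<lambda>_. discrete_topology UNIV) UNIV"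

abbreviation agree :: "nat \<Rightarrow> (nat \<Rightarrow> edge) \<Rightarrow> (nat \<Rightarrow> edge) \<Rightarrow> bool" where
  "agree N \<omega> \<omega>' \<equiv> \<forall>i<N. \<omega> i = \<omega>' i"

lemma openin_agree: "openin edge_seqs {\<omega>'. agree N \<omega> \<omega>'}"
proof -
  let ?B = "\<lambda>i. if i < N then {\<omega> i} else UNIV"
  have "{i \<in> UNIV. ?B i \<noteq> topspace (discrete_topology UNIV)} \<subseteq> {..<N}" by auto
  then have "finite {i \<in> UNIV. ?B i \<noteq> topspace (discrete_topology UNIV)}" by (rule finite_subset) simp
  then have "openin edge_seqs (PiE UNIV ?B)"
    unfolding openin_PiE_gen by simp
  moreover have "PiE UNIV ?B = {\<omega>'. agree N \<omega> \<omega>'}"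
  proof (intro set_eqI iffI)
    fix \<omega>' assume "\<omega>' \<in> PiE UNIV ?B"
    then have "\<omega>' i \<in> ?B i" for i by blast
    then have "\<omega> i = \<omega>' i" if "i < N" for i using that by (metis singletonD)
    then show "\<omega>' \<in> {\<omega>'. agree N \<omega> \<omega>'}" by blast
  qed auto
  ultimately show ?thesis by simp
qed

lemma openin_finite_dep:
  assumes "\<And>\<omega> \<omega>'. agree N \<omega> \<omega>' \<Longrightarrow> P \<omega> \<Longrightarrow> P \<omega>'"
  shows "openin edge_seqs {\<omega>. P \<omega>}"
proof (subst openin_subopen, intro ballI)
  fix \<omega> assume "\<omega> \<in> {\<omega>. P \<omega>}"
  then show "\<exists>T. openin edge_seqs T \<and> \<omega> \<in> T \<and> T \<subseteq> {\<omega>. P \<omega>}"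
    using assms by (intro exI[of _ "{\<omega>'. agree N \<omega> \<omega>'}"]) (auto simp: openin_agree)
qed

lemma closedin_finite_dep:
  assumes "\<And>\<omega> \<omega>'. agree N \<omega> \<omega>' \<Longrightarrow> P \<omega> = P \<omega>'"
  shows "closedin edge_seqs {\<omega>. P \<omega>}"
proof -
  have "openin edge_seqs {\<omega>. \<not> P \<omega>}" using assms by (intro openin_finite_dep[of N]) auto
  moreover have "topspace edge_seqs - {\<omega>. P \<omega>} = {\<omega>. \<not> P \<omega>}" by auto
  ultimately show ?thesis by (simp add: closedin_def)
qed

lemma topspace_path [simp]: "topspace path_topology = inf_paths"
  by (simp add: path_topology_def)

lemma inf_path_prefix:
  assumes "\<omega> \<in> inf_paths" shows "hpath leaf (map \<omega> [0..<n]) (src (\<omega> n))"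
proof (induction n)
  case 0
  then show ?case using assms by (simp add: inf_paths_def)
next
  case (Suc n)
  then show ?case using assms by (simp add: hpath_snoc inf_paths_def)
qed

lemma openin_path_finite_dep:
  assumes "\<And>\<omega> \<omega>'. \<omega> \<in> inf_paths \<Longrightarrow> \<omega>' \<in> inf_paths \<Longrightarrow> agree N \<omega> \<omega>' \<Longrightarrow> P \<omega> \<Longrightarrow> P \<omega>'"
  shows "openin path_topology {\<omega>\<in>inf_paths. P \<omega>}"
proof -
  have "openin edge_seqs {\<omega>. \<exists>\<omega>'\<in>inf_paths. P \<omega>' \<and> agree N \<omega>' \<omega>}"
    by (rule openin_finite_dep[of N]) fastforce
  moreover have "{\<omega>\<in>inf_paths. P \<omega>} = {\<omega>. \<exists>\<omega>'\<in>inf_paths. P \<omega>' \<and> agree N \<omega>' \<omega>} \<inter> inf_paths"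
    using assms by blast
  ultimately show ?thesis unfolding path_topology_def openin_subtopology by blast
qed

lemma continuous_map_finite_dep:
  assumes "\<And>\<omega> \<omega>'. \<omega> \<in> inf_paths \<Longrightarrow> \<omega>' \<in> inf_paths \<Longrightarrow> agree N \<omega> \<omega>' \<Longrightarrow> f \<omega> = f \<omega>'"
  shows "continuous_map path_topology euclideanreal f"
  unfolding continuous_map_def
proof (intro conjI allI impI)
  fix U :: "real set"
  show "openin path_topology {\<omega> \<in> topspace path_topology. f \<omega> \<in> U}"
    unfolding topspace_path by (rule openin_path_finite_dep[of N]) (metis assms)
qed auto

lemma openin_path_cylinder:
  assumes U: "openin path_topology U" "\<omega> \<in> U"
  shows "\<exists>n. \<forall>\<omega>'\<in>inf_paths. agree n \<omega> \<omega>' \<longrightarrow> \<omega>' \<in> U"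
proof -
  obtain V where V: "openin edge_seqs V" "U = V \<inter> inf_paths"
    using U(1) by (auto simp: path_topology_def openin_subtopology)
  obtain B where B: "finite {i. B i \<noteq> (UNIV :: edge set)}" "\<omega> \<in> PiE UNIV B" "PiE UNIV B \<subseteq> V"
    using V(1) U(2) unfolding V(2) openin_product_topology_alt by fastforce
  obtain n where n: "\<And>i. B i \<noteq> UNIV \<Longrightarrow> i < n"
    using finite_nat_set_iff_bounded[of "{i. B i \<noteq> UNIV}"] B(1) by auto
  have "\<omega>' \<in> U" if w: "\<omega>' \<in> inf_paths" "agree n \<omega> \<omega>'" for \<omega>'
  proof -
    have "\<omega> i \<in> B i" for i using B(2) by auto
    then have "\<omega>' i \<in> B i" for i using n[of i] w(2) by (cases "B i = UNIV") (simp, metis)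
    then have "\<omega>' \<in> PiE UNIV B" by auto
    then show ?thesis using B(3) V(2) w(1) by blast
  qed
  then show ?thesis by blast
qed

text \<open>Only finitely many edges can occur at each position, so the path space is a closed
  subset of a product of finite sets.\<close>

lemma inf_paths_compact: "compactin path_topology inf_paths"
proof -
  let ?E = "\<lambda>n. \<Union>es\<in>{es. length es = Suc n \<and> (\<exists>t. hpath leaf es t)}. set es"
  have c: "compactin edge_seqs (PiE UNIV ?E)"
    unfolding compactin_PiE using finite_hpaths by (auto simp: compactin_discrete_topology)
  have sub: "inf_paths \<subseteq> PiE UNIV ?E"
  proof
    fix \<omega> assume w: "\<omega> \<in> inf_paths"
    have "\<omega> n \<in> ?E n" for n
      using inf_path_prefix[OF w, of "Suc n"] by (intro UN_I[of "map \<omega> [0..<Suc n]"]) auto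
    then show "\<omega> \<in> PiE UNIV ?E" by auto
  qed
  have "inf_paths = {\<omega>. src (\<omega> 0) = leaf} \<inter> (\<Inter>n. {\<omega>. \<omega> n \<in> edges \<and> tgt (\<omega> n) = src (\<omega> (Suc n))})"
    by (auto simp: inf_paths_def)
  moreover have "closedin edge_seqs \<dots>"
  proof (intro closedin_Int closedin_INT)
    show "closedin edge_seqs {\<omega>. src (\<omega> 0) = leaf}" by (rule closedin_finite_dep[of 1]) auto
    show "closedin edge_seqs {\<omega>. \<omega> n \<in> edges \<and> tgt (\<omega> n) = src (\<omega> (Suc n))}" for n
      by (rule closedin_finite_dep[of "Suc (Suc n)"]) auto
  qed auto
  ultimately have "compactin edge_seqs inf_paths" using closed_compactin[OF c sub] by simp
  then show ?thesis by (simp add: path_topology_def compactin_subtopology)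
qed

text \<open>Each path has a neighbourhood, given by finitely many fixed edges, on which
  \<open>f\<close> varies little; \<open>N\<close> is the longest prefix in a finite
  subcover.\<close>

lemma path_uniformly_continuous:
  assumes f: "continuous_map path_topology euclideanreal f" and e: "e > 0"
  shows "\<exists>N. \<forall>\<omega>\<in>inf_paths. \<forall>\<omega>'\<in>inf_paths. agree N \<omega> \<omega>' \<longrightarrow> \<bar>f \<omega> - f \<omega>'\<bar> < e"
proof -
  have ex: "\<exists>n. \<forall>\<omega>'\<in>inf_paths. agree n \<omega> \<omega>' \<longrightarrow> \<bar>f \<omega>' - f \<omega>\<bar> < e / 2" if w: "\<omega> \<in> inf_paths" for \<omega>
  proof -
    have "openin path_topology {\<omega>' \<in> topspace path_topology. f \<omega>' \<in> ball (f \<omega>) (e / 2)}"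
      using f open_ball unfolding continuous_map_def open_openin[symmetric] by blast
    from openin_path_cylinder[OF this, of \<omega>] w e show ?thesis by (auto simp: dist_real_def abs_minus_commute)
  qed
  then obtain n where n: "\<And>\<omega> \<omega>'. \<omega> \<in> inf_paths \<Longrightarrow> \<omega>' \<in> inf_paths \<Longrightarrow> agree (n \<omega>) \<omega> \<omega>' \<Longrightarrow> \<bar>f \<omega>' - f \<omega>\<bar> < e / 2"
    by metis
  let ?U = "\<lambda>\<omega>. {\<omega>'\<in>inf_paths. agree (n \<omega>) \<omega> \<omega>'}"
  have "\<exists>F. finite F \<and> F \<subseteq> ?U ` inf_paths \<and> inf_paths \<subseteq> \<Union>F"
  proof (rule compactinD[OF inf_paths_compact])
    show "openin path_topology U" if "U \<in> ?U ` inf_paths" for U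
      using that by (auto intro!: openin_path_finite_dep)
    show "inf_paths \<subseteq> \<Union> (?U ` inf_paths)" by auto
  qed
  then obtain F where F: "finite F" "F \<subseteq> ?U ` inf_paths" "inf_paths \<subseteq> \<Union>F" by blast
  obtain W where "W \<subseteq> inf_paths" "finite W" "F = ?U ` W"
    using finite_subset_image[OF F(1,2)] by blast
  then have W: "finite W" "W \<subseteq> inf_paths" "inf_paths \<subseteq> \<Union> (?U ` W)" using F(3) by simp_all
  obtain N where N: "\<And>\<omega>. \<omega> \<in> W \<Longrightarrow> n \<omega> \<le> N"
    using finite_nat_set_iff_bounded_le[of "n ` W"] W(1) by auto
  have "\<bar>f \<omega> - f \<omega>'\<bar> < e" if w: "\<omega> \<in> inf_paths" "\<omega>' \<in> inf_paths" "agree N \<omega> \<omega>'" for \<omega> \<omega>'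
  proof -
    obtain \<omega>0 where w0: "\<omega>0 \<in> W" "agree (n \<omega>0) \<omega>0 \<omega>" using W(3) w(1) by blast
    have "agree (n \<omega>0) \<omega>0 \<omega>'"
    proof (intro allI impI)
      fix i assume "i < n \<omega>0"
      then show "\<omega>0 i = \<omega>' i" using w0(2) w(3) N[OF w0(1)] by (metis order_less_le_trans)
    qed
    then have "\<bar>f \<omega> - f \<omega>0\<bar> < e / 2" "\<bar>f \<omega>' - f \<omega>0\<bar> < e / 2" using n w0 w W(2) by blast+
    then show ?thesis by linarith
  qed
  then show ?thesis by blast
qed

lemma cylinder_eq: "cylinder es = {\<omega>\<in>inf_paths. map \<omega> [0..<length es] = es}"
proof -
  have "map \<omega> [0..<length es] = es \<longleftrightarrow> (\<forall>i<length es. \<omega> i = es ! i)" for \<omega>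
    unfolding list_eq_iff_nth_eq by simp
  then show ?thesis unfolding cylinder_def by simp
qed

lemma cylinder_Nil [simp]: "cylinder [] = inf_paths"
  by (simp add: cylinder_def)

lemma cylinder_subset: "cylinder es \<subseteq> inf_paths"
  by (auto simp: cylinder_def)

lemma cylinder_hpath: "\<omega> \<in> cylinder es \<Longrightarrow> hpath leaf es (src (\<omega> (length es)))"
  using inf_path_prefix[of \<omega> "length es"] by (simp add: cylinder_eq)

lemma openin_cylinder: "openin path_topology (cylinder es)"
  unfolding cylinder_def by (rule openin_path_finite_dep[of "length es"]) auto

lemma sets_cylinder: "cylinder es \<in> sets (borel_of path_topology)"
  unfolding sets_borel_of using openin_cylinder by (auto intro: sigma_sets.Basic)

text \<open>Cylinders are nested or disjoint, according to whether one prefix extends the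
  other.\<close>

lemma Int_cylinder: "cylinder es \<inter> cylinder fs \<in> {cylinder es, cylinder fs, {}}"
proof -
  have "cylinder es \<inter> cylinder fs \<in> {cylinder fs, {}}" if "length es \<le> length fs" for es fs
  proof (cases "take (length es) fs = es")
    case True
    have "\<omega> \<in> cylinder es" if "\<omega> \<in> cylinder fs" for \<omega>
      using that \<open>length es \<le> length fs\<close> True unfolding cylinder_def
      by (auto, metis nth_take order_less_le_trans)
    then show ?thesis by blast
  next
    case False
    have "\<omega> \<notin> cylinder es" if w: "\<omega> \<in> cylinder fs" for \<omega>
    proof
      assume "\<omega> \<in> cylinder es"
      then have "es = take (length es) (map \<omega> [0..<length fs])" using \<open>length es \<le> length fs\<close> by (simp add: cylinder_eq take_map)
      then show False using False w by (simp add: cylinder_eq)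
    qed
    then show ?thesis by blast
  qed
  then show ?thesis by (metis (no_types, lifting) Int_commute insert_iff nat_le_linear)
qed

lemma sets_borel_path:
  "sets (borel_of path_topology) = sigma_sets inf_paths (insert {} (range cylinder))"
proof -
  have "U \<in> sigma_sets inf_paths (insert {} (range cylinder))" if U: "openin path_topology U" for U
  proof -
    let ?C = "{es. cylinder es \<subseteq> U}"
    have "U \<subseteq> (\<Union>es\<in>?C. cylinder es)"
    proof
      fix \<omega> assume w: "\<omega> \<in> U"
      then have wp: "\<omega> \<in> inf_paths" using openin_subset[OF U] by auto
      obtain n where "\<forall>\<omega>'\<in>inf_paths. agree n \<omega> \<omega>' \<longrightarrow> \<omega>' \<in> U" using openin_path_cylinder[OF U w] by blast
      then have "cylinder (map \<omega> [0..<n]) \<subseteq> U" by (auto simp: cylinder_def)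
      moreover have "\<omega> \<in> cylinder (map \<omega> [0..<n])" using wp by (auto simp: cylinder_def)
      ultimately show "\<omega> \<in> (\<Union>es\<in>?C. cylinder es)" by blast
    qed
    then have "U = (\<Union>es\<in>?C. cylinder es)" by blast
    also have "\<dots> \<in> sigma_sets inf_paths (insert {} (range cylinder))"
      by (rule sigma_sets_UNION) (auto intro: sigma_sets.Basic)
    finally show ?thesis .
  qed
  then have "sigma_sets inf_paths {U. openin path_topology U} = sigma_sets inf_paths (insert {} (range cylinder))"
    by (intro sigma_sets_eqI) (auto intro: sigma_sets.Basic openin_cylinder)
  then show ?thesis by (simp add: sets_borel_of)
qed

lemma path_measure_eqI:
  assumes \<mu>: "\<mu> \<in> prob_measures path_topology" and \<nu>: "\<nu> \<in> prob_measures path_topology"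
    and eq: "\<And>es t. hpath leaf es t \<Longrightarrow> measure \<mu> (cylinder es) = measure \<nu> (cylinder es)"
  shows "\<mu> = \<nu>"
proof (rule measure_eqI_generator_eq[where E="insert {} (range cylinder)" and \<Omega>=inf_paths and A="\<lambda>_. inf_paths"])
  interpret m: prob_space \<mu> using prob_measuresD(1)[OF \<mu>] .
  interpret n: prob_space \<nu> using prob_measuresD(1)[OF \<nu>] .
  show "Int_stable (insert {} (range cylinder))"
    using Int_cylinder unfolding Int_stable_def by blast
  show "insert {} (range cylinder) \<subseteq> Pow inf_paths" using cylinder_subset by blast
  show "range (\<lambda>_. inf_paths) \<subseteq> insert {} (range cylinder)" by (metis cylinder_Nil image_subset_iff insertCI rangeI)
  show "sets \<mu> = sigma_sets inf_paths (insert {} (range cylinder))" "sets \<nu> = sigma_sets inf_paths (insert {} (range cylinder))"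
    using prob_measuresD(2)[OF \<mu>] prob_measuresD(2)[OF \<nu>] sets_borel_path by simp_all
  show "emeasure \<mu> X = emeasure \<nu> X" if X: "X \<in> insert {} (range cylinder)" for X
  proof (cases "X = {}")
    case False
    \<comment> \<open>A cylinder that is not empty has a genuine path as its prefix, so the
      hypothesis applies to it.\<close>
    then obtain es \<omega> where "X = cylinder es" "\<omega> \<in> cylinder es" using X by blast
    then show ?thesis using eq[OF cylinder_hpath] by (simp add: m.emeasure_eq_measure n.emeasure_eq_measure)
  qed simp
  show "emeasure \<mu> inf_paths \<noteq> \<infinity>" by (simp add: m.emeasure_eq_measure)
qed auto

section \<open>Harmonic functions and central measures\<close>

definition path_end :: "edge list \<Rightarrow> rtree" where
  "path_end es = (if es = [] then leaf else tgt (last es))"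

lemma hpath_path_end: "hpath leaf es t \<Longrightarrow> path_end es = t"
  by (cases es rule: rev_cases) (auto simp: path_end_def hpath_snoc)

text \<open>\<open>tree_weight\<close> ranges over all lists, so edge lists that are not paths
  receive the weight 0.\<close>

definition path_weight :: "(rtree \<Rightarrow> real) \<Rightarrow> edge list \<Rightarrow> real" where
  "path_weight h es = (if hpath leaf es (path_end es) then h (path_end es) else 0)"

lemma path_weight_hpath: "hpath leaf es t \<Longrightarrow> path_weight h es = h t"
  using hpath_path_end[of es t] by (simp add: path_weight_def)

lemma tree_weight_path_weight:
  assumes h: "harmonic h" shows "tree_weight (path_weight h)"
  unfolding tree_weight_def
proof (intro conjI allI)
  show "path_weight h [] = 1" using harmonicD(1)[OF h] by (simp add: path_weight_def path_end_def)
  show "0 \<le> path_weight h es" for es using harmonicD(2)[OF h] by (simp add: path_weight_def)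
  fix es
  have snoc: "path_weight h (es @ [e]) = (if hpath leaf es (path_end es) \<and> e \<in> edges_from (path_end es) then h (tgt e) else 0)" for e
  proof -
    have "path_end (es @ [e]) = tgt e" by (simp add: path_end_def)
    moreover have "hpath leaf es (src e) \<longleftrightarrow> hpath leaf es (path_end es) \<and> src e = path_end es"
      using hpath_path_end[of es "src e"] by metis
    ultimately show ?thesis unfolding path_weight_def hpath_snoc edges_from_def by simp
  qed
  show "\<exists>A. finite A \<and> (\<forall>a. a \<notin> A \<longrightarrow> path_weight h (es @ [a]) = 0) \<and> (\<Sum>a\<in>A. path_weight h (es @ [a])) = path_weight h es"
  proof (intro exI[of _ "edges_from (path_end es)"] conjI allI impI)
    show "(\<Sum>a\<in>edges_from (path_end es). path_weight h (es @ [a])) = path_weight h es"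
    proof (cases "hpath leaf es (path_end es)")
      case True
      then have "(\<Sum>a\<in>edges_from (path_end es). path_weight h (es @ [a])) = (\<Sum>a\<in>edges_from (path_end es). h (tgt a))"
        by (intro sum.cong) (auto simp: snoc)
      also have "\<dots> = h (path_end es)"
        unfolding sum_edges_from by (rule harmonicD(3)[OF h, symmetric])
      finally show ?thesis using True by (simp add: path_weight_def)
    next
      case False
      then show ?thesis by (simp add: snoc) (simp add: path_weight_def)
    qed
  qed (auto simp: snoc finite_edges_from)
qed

definition has_density :: "(nat \<Rightarrow> edge) measure \<Rightarrow> (rtree \<Rightarrow> real) \<Rightarrow> bool" where
  "has_density \<mu> h \<longleftrightarrow> \<mu> \<in> prob_measures path_topology \<and> (\<forall>es t. hpath leaf es t \<longrightarrow> measure \<mu> (cylinder es) = h t)"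

lemma has_density_unique: "has_density \<mu> h \<Longrightarrow> has_density \<nu> h \<Longrightarrow> \<mu> = \<nu>"
  unfolding has_density_def by (intro path_measure_eqI) auto

text \<open>The process built from \<open>path_weight\<close> is almost surely an infinite path:
  there are countably many lists that are not paths, each of probability zero. On the exceptional
  set it is replaced by one fixed path.\<close>

lemma ex_has_density:
  assumes h: "harmonic h" shows "\<exists>\<mu>. has_density \<mu> h"
proof -
  obtain M :: "(edge list \<Rightarrow> edge) measure" and Y where M: "prob_space M"
    and Y: "\<And>n. Y n \<in> measurable M (count_space UNIV)"
    and MY: "\<And>es. measure M {x\<in>space M. \<forall>i<length es. Y i x = es ! i} = path_weight h es"
    by (rule tree_weight_process[OF tree_weight_path_weight[OF h]]) (rule that)
  interpret M: prob_space M by fact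
  note Y[measurable]
  define G where "G = {x\<in>space M. \<forall>es\<in>{es. \<nexists>t. hpath leaf es t}. \<not> (\<forall>i<length es. Y i x = es ! i)}"
  have G[measurable]: "G \<in> sets M" unfolding G_def by measurable
  have AEG: "AE x in M. x \<in> G"
  proof -
    have "AE x in M. \<not> (\<forall>i<length es. Y i x = es ! i)" if "\<nexists>t. hpath leaf es t" for es
    proof (rule AE_I)
      show "{x\<in>space M. \<not> \<not> (\<forall>i<length es. Y i x = es ! i)} \<subseteq> {x\<in>space M. \<forall>i<length es. Y i x = es ! i}" by auto
      have "path_weight h es = 0" using that by (simp add: path_weight_def)
      then show "emeasure M {x\<in>space M. \<forall>i<length es. Y i x = es ! i} = 0"
        using MY[of es] by (simp add: M.emeasure_eq_measure)
    qed measurable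
    then have "AE x in M. \<forall>es\<in>{es. \<nexists>t. hpath leaf es t}. \<not> (\<forall>i<length es. Y i x = es ! i)"
      by (subst AE_ball_countable) auto
    then show ?thesis by (auto simp: G_def)
  qed
  have inf: "(\<lambda>n. Y n x) \<in> inf_paths" if x: "x \<in> G" for x
  proof -
    have hp: "\<exists>t. hpath leaf (map (\<lambda>i. Y i x) [0..<n]) t" for n
      using x unfolding G_def by (auto dest!: spec[of _ "map (\<lambda>i. Y i x) [0..<n]"])
    have "hpath leaf (map (\<lambda>i. Y i x) [0..<n]) (src (Y n x)) \<and> Y n x \<in> edges" for n
      using hp[of "Suc n"] by (auto simp: hpath_snoc)
    moreover from this have "tgt (Y n x) = src (Y (Suc n) x)" for n
      using hpath_unique by (metis (no_types, lifting) diff_zero hpath_snoc list.simps(8) list.simps(9) map_append upt_Suc_append zero_le)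
    moreover have "src (Y 0 x) = leaf" using calculation(1)[of 0] by simp
    ultimately show ?thesis by (simp add: inf_paths_def)
  qed
  have "measure M G = 1" using AEG by (simp add: M.prob_eq_1)
  then have "G \<noteq> {}" by auto
  then obtain x0 where x0: "x0 \<in> G" by blast
  define Z where "Z = (\<lambda>x. if x \<in> G then (\<lambda>n. Y n x) else (\<lambda>n. Y n x0))"
  have Zinf: "Z x \<in> inf_paths" for x using inf x0 by (simp add: Z_def)
  have Zm: "Z \<in> measurable M (borel_of path_topology)"
  proof (rule measurable_sigma_sets[OF sets_borel_path])
    show "insert {} (range cylinder) \<subseteq> Pow inf_paths" using cylinder_subset by blast
    show "Z \<in> space M \<rightarrow> inf_paths" using Zinf by blast
    fix A assume A: "A \<in> insert {} (range cylinder)"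
    show "Z -` A \<inter> space M \<in> sets M"
    proof (cases "A = {}")
      case False
      then obtain es where es: "A = cylinder es" using A by blast
      have "Z -` A \<inter> space M = {x\<in>space M. \<forall>i<length es. (if x \<in> G then Y i x else Y i x0) = es ! i}"
        using Zinf by (auto simp: es cylinder_def Z_def)
      also have "\<dots> \<in> sets M" by measurable
      finally show ?thesis .
    qed simp
  qed
  have "has_density (distr M (borel_of path_topology) Z) h"
    unfolding has_density_def
  proof (intro conjI allI impI)
    show "distr M (borel_of path_topology) Z \<in> prob_measures path_topology"
      unfolding prob_measures_def using M.prob_space_distr[OF Zm] by simp
    fix es t assume hp: "hpath leaf es t"
    have "measure (distr M (borel_of path_topology) Z) (cylinder es) = measure M (Z -` cylinder es \<inter> space M)"
      by (rule measure_distr[OF Zm sets_cylinder])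
    also have "\<dots> = measure M {x\<in>space M. \<forall>i<length es. Y i x = es ! i}"
    proof (rule M.finite_measure_eq_AE)
      show "AE x in M. (x \<in> Z -` cylinder es \<inter> space M) = (x \<in> {x\<in>space M. \<forall>i<length es. Y i x = es ! i})"
        using AEG by eventually_elim (auto simp: Z_def cylinder_def inf)
      show "Z -` cylinder es \<inter> space M \<in> sets M" by (rule measurable_sets[OF Zm sets_cylinder])
      show "{x\<in>space M. \<forall>i<length es. Y i x = es ! i} \<in> sets M" by measurable
    qed
    also have "\<dots> = h t" using MY path_weight_hpath[OF hp] by simp
    finally show "measure (distr M (borel_of path_topology) Z) (cylinder es) = h t" .
  qed
  then show ?thesis ..
qed

definition law :: "(rtree \<Rightarrow> real) \<Rightarrow> (nat \<Rightarrow> edge) measure" where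
  "law h = central_law (lin_ext h)"

lemma has_density_law:
  assumes "harmonic h" shows "has_density (law h) h"
proof -
  obtain \<mu> where \<mu>: "has_density \<mu> h" using ex_has_density[OF assms] by blast
  have "law h = (THE \<mu>. has_density \<mu> h)" by (simp add: law_def central_law_def has_density_def)
  also have "\<dots> = \<mu>" using \<mu> has_density_unique by (intro the_equality) auto
  finally show ?thesis using \<mu> by simp
qed

lemma central_law_eq_law: "pieri_state L \<Longrightarrow> central_law L = law (\<lambda>t. L (\<F> t))"
  unfolding law_def by (rule arg_cong[where f=central_law], rule lin_ext_unique) (simp add: pieri_state_def)

text \<open>For a central measure all prefixes ending at \<open>t\<close> have the same probability,
  so any chosen one serves.\<close>

definition tree_density :: "(nat \<Rightarrow> edge) measure \<Rightarrow> rtree \<Rightarrow> real" where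
  "tree_density \<mu> t = measure \<mu> (cylinder (SOME es. hpath leaf es t))"

lemma tree_density_eq: "has_density \<mu> h \<Longrightarrow> tree_density \<mu> = h"
proof
  fix t assume "has_density \<mu> h"
  then show "tree_density \<mu> t = h t"
    using someI_ex[OF ex_hpath[of t]] by (simp add: tree_density_def has_density_def)
qed

lemma vertex_event_eq:
  assumes "hpath leaf es t"
  shows "{\<omega>\<in>inf_paths. nth_vertex (length es + 1) \<omega> = t} = (\<Union>fs\<in>{fs. hpath leaf fs t}. cylinder fs)"
proof (intro equalityI subsetI)
  fix \<omega> assume "\<omega> \<in> {\<omega>\<in>inf_paths. nth_vertex (length es + 1) \<omega> = t}"
  then have w: "\<omega> \<in> inf_paths" "src (\<omega> (length es)) = t" by (auto simp: nth_vertex_def)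
  then have "hpath leaf (map \<omega> [0..<length es]) t" using inf_path_prefix by blast
  moreover have "\<omega> \<in> cylinder (map \<omega> [0..<length es])" using w(1) by (simp add: cylinder_eq)
  ultimately show "\<omega> \<in> (\<Union>fs\<in>{fs. hpath leaf fs t}. cylinder fs)" by blast
next
  fix \<omega> assume "\<omega> \<in> (\<Union>fs\<in>{fs. hpath leaf fs t}. cylinder fs)"
  then obtain fs where fs: "hpath leaf fs t" "\<omega> \<in> cylinder fs" by blast
  have "length fs = length es" using hpath_leaf_nv[OF fs(1)] hpath_leaf_nv[OF assms] by simp
  then have "src (\<omega> (length es)) = t" using cylinder_hpath[OF fs(2)] hpath_unique fs(1) by metis
  then show "\<omega> \<in> {\<omega>\<in>inf_paths. nth_vertex (length es + 1) \<omega> = t}"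
    using fs(2) cylinder_subset by (auto simp: nth_vertex_def)
qed

lemma disjoint_cylinders:
  "(\<And>es. es \<in> P \<Longrightarrow> length es = n) \<Longrightarrow> disjoint_family_on cylinder P"
  unfolding disjoint_family_on_def cylinder_eq by auto

lemma has_density_central:
  assumes \<mu>: "has_density \<mu> h" shows "\<mu> \<in> central_measures"
  unfolding central_measures_def
proof (intro CollectI conjI allI impI)
  show p: "\<mu> \<in> prob_measures path_topology" using \<mu> by (simp add: has_density_def)
  interpret prob_space \<mu> using prob_measuresD(1)[OF p] .
  fix es t assume hp: "hpath leaf es t"
  have "measure \<mu> {\<omega>\<in>inf_paths. nth_vertex (length es + 1) \<omega> = t} = (\<Sum>fs\<in>{fs. hpath leaf fs t}. measure \<mu> (cylinder fs))"
    unfolding vertex_event_eq[OF hp]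
  proof (rule finite_measure_finite_Union[OF finite_hpaths_to])
    show "cylinder ` {fs. hpath leaf fs t} \<subseteq> sets \<mu>" using sets_cylinder prob_measuresD(2)[OF p] by auto
    show "disjoint_family_on cylinder {fs. hpath leaf fs t}"
      by (rule disjoint_cylinders[of _ "nv t - 1"]) (auto dest: hpath_leaf_nv)
  qed
  also have "\<dots> = (\<Sum>fs\<in>{fs. hpath leaf fs t}. h t)" using \<mu> by (intro sum.cong) (auto simp: has_density_def)
  also have "\<dots> = real (num_paths t) * h t" by (simp add: num_paths_def)
  finally show "measure \<mu> (cylinder es) = measure \<mu> {\<omega>\<in>inf_paths. nth_vertex (length es + 1) \<omega> = t} / real (num_paths t)"
    using \<mu> hp num_paths_pos[of t] by (simp add: has_density_def)
qed

text \<open>Harmonicity is additivity of the measure when a cylinder is split according to the next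
  edge.\<close>

lemma central_has_density:
  assumes \<mu>: "\<mu> \<in> central_measures" shows "has_density \<mu> (tree_density \<mu>)" "harmonic (tree_density \<mu>)"
proof -
  have p: "\<mu> \<in> prob_measures path_topology" using \<mu> by (simp add: central_measures_def)
  interpret prob_space \<mu> using prob_measuresD(1)[OF p] .
  have c: "measure \<mu> (cylinder es) = measure \<mu> {\<omega>\<in>inf_paths. nth_vertex (nv t) \<omega> = t} / real (num_paths t)"
    if "hpath leaf es t" for es t
    using \<mu> that hpath_leaf_nv[OF that] by (simp add: central_measures_def)
  have d: "measure \<mu> (cylinder es) = tree_density \<mu> t" if "hpath leaf es t" for es t
    using c[OF that] c[OF someI_ex[OF ex_hpath[of t]]] by (simp add: tree_density_def)
  then show "has_density \<mu> (tree_density \<mu>)" using p by (simp add: has_density_def)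
  show "harmonic (tree_density \<mu>)"
    unfolding harmonic_def
  proof (intro conjI allI)
    have "measure \<mu> (cylinder []) = tree_density \<mu> leaf" by (rule d) simp
    then show "tree_density \<mu> leaf = 1" using prob_space prob_measuresD(3)[OF p] by simp
    show "0 \<le> tree_density \<mu> t" for t by (simp add: tree_density_def)
    fix t
    obtain es where es: "hpath leaf es t" using ex_hpath by blast
    have "cylinder es = (\<Union>e\<in>edges_from t. cylinder (es @ [e]))"
    proof (intro equalityI subsetI)
      fix \<omega> assume w: "\<omega> \<in> cylinder es"
      then have "src (\<omega> (length es)) = t" using cylinder_hpath es hpath_unique by blast
      moreover have "\<omega> (length es) \<in> edges" using w by (simp add: cylinder_def inf_paths_def)
      moreover have "\<omega> \<in> cylinder (es @ [\<omega> (length es)])" using w by (simp add: cylinder_def nth_append less_Suc_eq)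
      ultimately show "\<omega> \<in> (\<Union>e\<in>edges_from t. cylinder (es @ [e]))" by (auto simp: edges_from_def)
    next
      fix \<omega> assume "\<omega> \<in> (\<Union>e\<in>edges_from t. cylinder (es @ [e]))"
      then show "\<omega> \<in> cylinder es" unfolding cylinder_def by (auto simp: nth_append)
    qed
    then have "measure \<mu> (cylinder es) = (\<Sum>e\<in>edges_from t. measure \<mu> (cylinder (es @ [e])))"
    proof (simp only:, intro finite_measure_finite_Union finite_edges_from)
      show "(\<lambda>e. cylinder (es @ [e])) ` edges_from t \<subseteq> sets \<mu>" using sets_cylinder prob_measuresD(2)[OF p] by auto
      show "disjoint_family_on (\<lambda>e. cylinder (es @ [e])) (edges_from t)"
        unfolding disjoint_family_on_def cylinder_eq by auto
    qed
    also have "\<dots> = (\<Sum>e\<in>edges_from t. tree_density \<mu> (tgt e))"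
      by (intro sum.cong refl d) (use es in \<open>auto simp: hpath_snoc edges_from_def\<close>)
    finally show "tree_density \<mu> t = (\<Sum>v\<in>verts t. tree_density \<mu> (attach_leaf t v))"
      unfolding d[OF es] sum_edges_from .
  qed
qed

lemma law_central: "harmonic h \<Longrightarrow> law h \<in> central_measures"
  by (rule has_density_central[OF has_density_law])

lemma tree_density_law: "harmonic h \<Longrightarrow> tree_density (law h) = h"
  by (rule tree_density_eq[OF has_density_law])

lemma law_tree_density: "\<mu> \<in> central_measures \<Longrightarrow> law (tree_density \<mu>) = \<mu>"
  using central_has_density has_density_law has_density_unique by blast

text \<open>A tree occurs with probability \<open>num_paths t * tree_density \<mu> t\<close>, where
  the number of paths is positive, and countably many null trees form a null event.\<close>

lemma central_pf_iff:
  assumes \<mu>: "\<mu> \<in> central_measures"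
  shows "\<mu> \<in> central_pf \<longleftrightarrow> (\<forall>t. \<not> path_forest t \<longrightarrow> tree_density \<mu> t = 0)"
proof -
  have p: "\<mu> \<in> prob_measures path_topology" using \<mu> by (simp add: central_measures_def)
  interpret prob_space \<mu> using prob_measuresD(1)[OF p] .
  have sp: "space \<mu> = inf_paths" using prob_measuresD(3)[OF p] by simp
  have S: "{\<omega>\<in>inf_paths. P (nth_vertex n \<omega>)} \<in> sets \<mu>" for P n
  proof -
    have "openin path_topology {\<omega>\<in>inf_paths. P (nth_vertex n \<omega>)}"
      by (rule openin_path_finite_dep[of "Suc n"]) (simp add: nth_vertex_def)
    then show ?thesis unfolding prob_measuresD(2)[OF p] sets_borel_of by (auto intro: sigma_sets.Basic)
  qed
  have ev: "measure \<mu> {\<omega>\<in>inf_paths. nth_vertex (nv t) \<omega> = t} = real (num_paths t) * tree_density \<mu> t" for t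
  proof -
    obtain es where es: "hpath leaf es t" using ex_hpath by blast
    have "tree_density \<mu> t = measure \<mu> (cylinder es)" using central_has_density(1)[OF \<mu>] es by (simp add: has_density_def)
    also have "\<dots> = measure \<mu> {\<omega>\<in>inf_paths. nth_vertex (nv t) \<omega> = t} / real (num_paths t)"
      using \<mu> es hpath_leaf_nv[OF es] by (simp add: central_measures_def)
    finally show ?thesis using num_paths_pos[of t] by simp
  qed
  have nvX: "nv (nth_vertex n \<omega>) = n" if "\<omega> \<in> inf_paths" "n \<ge> 1" for \<omega> n
    using hpath_leaf_nv[OF inf_path_prefix[OF that(1), of "n - 1"]] that(2) by (simp add: nth_vertex_def)
  show ?thesis
  proof
    assume "\<mu> \<in> central_pf"
    then have pf: "measure \<mu> {\<omega>\<in>inf_paths. path_forest (nth_vertex n \<omega>)} = 1" if "n \<ge> 1" for n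
      using that by (simp add: central_pf_def)
    show "\<forall>t. \<not> path_forest t \<longrightarrow> tree_density \<mu> t = 0"
    proof (intro allI impI)
      fix t assume t: "\<not> path_forest t"
      have n: "nv t \<ge> 1" by (cases t) simp
      have "measure \<mu> {\<omega>\<in>inf_paths. nth_vertex (nv t) \<omega> = t} \<le> measure \<mu> (space \<mu> - {\<omega>\<in>inf_paths. path_forest (nth_vertex (nv t) \<omega>)})"
      proof (rule finite_measure_mono)
        show "space \<mu> - {\<omega>\<in>inf_paths. path_forest (nth_vertex (nv t) \<omega>)} \<in> sets \<mu>"
          by (rule sets.compl_sets) (rule S)
      qed (use t in \<open>auto simp: sp\<close>)
      also have "\<dots> = 0" using pf[OF n] prob_compl[OF S[of "\<lambda>x. path_forest x" "nv t"]] by simp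
      finally have "real (num_paths t) * tree_density \<mu> t \<le> 0" unfolding ev .
      then have "tree_density \<mu> t \<le> 0" using num_paths_pos[of t] by (simp add: mult_le_0_iff)
      then show "tree_density \<mu> t = 0" using harmonicD(2)[OF central_has_density(2)[OF \<mu>], of t] by simp
    qed
  next
    assume z: "\<forall>t. \<not> path_forest t \<longrightarrow> tree_density \<mu> t = 0"
    have "measure \<mu> {\<omega>\<in>inf_paths. path_forest (nth_vertex n \<omega>)} = 1" if n: "n \<ge> 1" for n
    proof -
      have "AE \<omega> in \<mu>. nth_vertex n \<omega> \<noteq> t" if t: "t \<in> {t. \<not> path_forest t}" for t
      proof (rule AE_I[of _ _ "{\<omega>\<in>inf_paths. nth_vertex n \<omega> = t}"])
        show "{\<omega>\<in>space \<mu>. \<not> nth_vertex n \<omega> \<noteq> t} \<subseteq> {\<omega>\<in>inf_paths. nth_vertex n \<omega> = t}" by (auto simp: sp)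
        show "emeasure \<mu> {\<omega>\<in>inf_paths. nth_vertex n \<omega> = t} = 0"
        proof (cases "nv t = n")
          case True
          then show ?thesis using ev[of t] z t by (simp add: emeasure_eq_measure)
        next
          case False
          then have "{\<omega>\<in>inf_paths. nth_vertex n \<omega> = t} = {}" using nvX n by blast
          then show ?thesis by (simp only: emeasure_empty)
        qed
        show "{\<omega>\<in>inf_paths. nth_vertex n \<omega> = t} \<in> sets \<mu>" by (rule S)
      qed
      then have "AE \<omega> in \<mu>. \<forall>t\<in>{t. \<not> path_forest t}. nth_vertex n \<omega> \<noteq> t"
        by (subst AE_ball_countable) auto
      then have "AE \<omega> in \<mu>. \<omega> \<in> {\<omega>\<in>inf_paths. path_forest (nth_vertex n \<omega>)}"
        using AE_space by eventually_elim (auto simp: sp)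
      then show ?thesis using S[of "\<lambda>x. path_forest x" n] by (subst prob_eq_1) auto
    qed
    then show "\<mu> \<in> central_pf" using \<mu> by (simp add: central_pf_def)
  qed
qed

section \<open>Topology of the harmonic functions\<close>

lemma continuous_on_uniform_approx:
  fixes F :: "'a::topological_space \<Rightarrow> real"
  assumes "\<And>e. e > 0 \<Longrightarrow> \<exists>g. continuous_on S g \<and> (\<forall>x\<in>S. \<bar>F x - g x\<bar> \<le> e)"
  shows "continuous_on S F"
proof -
  have "\<forall>n. \<exists>g. continuous_on S g \<and> (\<forall>x\<in>S. \<bar>F x - g x\<bar> \<le> 1 / real (Suc n))" using assms by simp
  then obtain g where g: "\<And>n. continuous_on S (g n)" "\<And>n x. x \<in> S \<Longrightarrow> \<bar>F x - g n x\<bar> \<le> 1 / real (Suc n)" by metis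
  show ?thesis
  proof (rule uniform_limit_theorem[where F=sequentially])
    show "uniform_limit S g F sequentially"
      unfolding uniform_limit_sequentially_iff
    proof (intro allI impI)
      fix e :: real assume "e > 0"
      then obtain N where N: "1 / real (Suc N) < e" using nat_approx_posE by blast
      have "dist (g n x) (F x) < e" if "n \<ge> N" "x \<in> S" for n x
      proof -
        have "1 / real (Suc n) \<le> 1 / real (Suc N)" using that by (simp add: frac_le)
        then show ?thesis using g(2)[OF that(2), of n] N by (simp add: dist_real_def abs_minus_commute)
      qed
      then show "\<exists>N. \<forall>n\<ge>N. \<forall>x\<in>S. dist (g n x) (F x) < e" by blast
    qed
  qed (use g in auto)
qed

definition harmonics :: "(rtree \<Rightarrow> real) set" where
  "harmonics = {h. harmonic h}"

definition pf_harmonics :: "(rtree \<Rightarrow> real) set" where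
  "pf_harmonics = {h. harmonic h \<and> (\<forall>t. \<not> path_forest t \<longrightarrow> h t = 0)}"

lemma continuous_on_coordinate: "continuous_on S (\<lambda>h::'i \<Rightarrow> real. h t)"
  by (rule continuous_on_subset[OF continuous_on_product_coordinates]) simp

text \<open>Harmonicity is a closed condition because each tree has finitely many vertices, and
  \<open>harmonic_le_1\<close> places all values in a compact cube.\<close>

lemma compact_harmonics: "compact harmonics"
proof -
  let ?B = "{h::rtree \<Rightarrow> real. \<forall>t. h t \<in> {0..1}}"
  have eq: "harmonics = ?B \<inter> ({h. h leaf = 1} \<inter> (\<Inter>t. {h. h t = (\<Sum>v\<in>verts t. h (attach_leaf t v))}))"
    (is "_ = ?R")
  proof (intro equalityI subsetI)
    fix h assume "h \<in> harmonics"
    then have h: "harmonic h" by (simp add: harmonics_def)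
    then show "h \<in> ?R" using harmonicD(1,2)[OF h] harmonic_le_1[OF h] by (auto intro: harmonicD(3))
  next
    fix h assume h: "h \<in> ?R"
    have "h t = (\<Sum>v\<in>verts t. h (attach_leaf t v))" for t using h by blast
    moreover have "0 \<le> h t" for t
    proof -
      have "h t \<in> {0..1}" using h by blast
      then show ?thesis by simp
    qed
    moreover have "h leaf = 1" using h by blast
    ultimately show "h \<in> harmonics" unfolding harmonics_def harmonic_def by blast
  qed
  moreover have "compact ?B" by (rule compact_function_box) simp
  moreover have "closed ({h::rtree \<Rightarrow> real. h leaf = 1} \<inter> (\<Inter>t. {h. h t = (\<Sum>v\<in>verts t. h (attach_leaf t v))}))"
    by (intro closed_Int closed_INT ballI closed_Collect_eq continuous_on_coordinate continuous_on_sum continuous_on_const)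
  ultimately show ?thesis unfolding eq by (intro compact_Int_closed)
qed

lemma compact_pf_harmonics: "compact pf_harmonics"
proof -
  have eq: "pf_harmonics = harmonics \<inter> (\<Inter>t\<in>{t. \<not> path_forest t}. {h. h t = 0})"
    by (auto simp: pf_harmonics_def harmonics_def)
  have "closed (\<Inter>t\<in>{t. \<not> path_forest t}. {h::rtree \<Rightarrow> real. h t = 0})"
    by (intro closed_INT ballI closed_Collect_eq continuous_on_coordinate continuous_on_const)
  then show ?thesis unfolding eq by (rule compact_Int_closed[OF compact_harmonics])
qed

text \<open>A continuous function on the path space is uniformly close to one that depends on the
  first \<open>N\<close> edges, whose integral is a finite linear combination of values of
  \<open>h\<close>. The error bound is the same for all \<open>h\<close>.\<close>

lemma continuous_map_law: "continuous_map (top_of_set harmonics) (weak_topology path_topology) law"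
proof (rule continuous_map_into_weak)
  fix h assume "h \<in> topspace (top_of_set harmonics)"
  then show "law h \<in> prob_measures path_topology"
    using has_density_law[of h] by (simp add: harmonics_def has_density_def)
next
  fix f assume f: "continuous_map path_topology euclideanreal f" and b: "bounded (f ` topspace path_topology)"
  obtain B where B: "\<And>\<omega>. \<omega> \<in> inf_paths \<Longrightarrow> \<bar>f \<omega>\<bar> \<le> B" using b by (auto simp: bounded_iff)
  have "continuous_on harmonics (\<lambda>h. \<integral>\<omega>. f \<omega> \<partial>law h)"
  proof (rule continuous_on_uniform_approx)
    fix e :: real assume e: "e > 0"
    obtain N where N: "\<And>\<omega> \<omega>'. \<omega> \<in> inf_paths \<Longrightarrow> \<omega>' \<in> inf_paths \<Longrightarrow> agree N \<omega> \<omega>' \<Longrightarrow> \<bar>f \<omega> - f \<omega>'\<bar> < e"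
      using path_uniformly_continuous[OF f e] by blast
    define P where "P = {es. length es = N \<and> (\<exists>t. hpath leaf es t)}"
    have finP: "finite P" unfolding P_def by (rule finite_hpaths)
    \<comment> \<open>A sample path in each cylinder, at which \<open>f\<close> is frozen.\<close>
    define c where "c = (\<lambda>es. SOME \<omega>. \<omega> \<in> cylinder es)"
    let ?g = "\<lambda>h. \<Sum>es\<in>P. f (c es) * h (path_end es)"
    have "continuous_on harmonics ?g" by (intro continuous_on_sum continuous_on_mult continuous_on_const continuous_on_coordinate)
    moreover have "\<bar>(\<integral>\<omega>. f \<omega> \<partial>law h) - ?g h\<bar> \<le> e" if h: "h \<in> harmonics" for h
    proof -
      have d: "has_density (law h) h" using h has_density_law by (simp add: harmonics_def)
      then have pm: "law h \<in> prob_measures path_topology" by (simp add: has_density_def)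
      interpret prob_space "law h" by (rule prob_measuresD(1)[OF pm])
      have sp: "space (law h) = inf_paths" using prob_measuresD(3)[OF pm] by simp
      have cyl: "cylinder es \<in> sets (law h)" for es using prob_measuresD(2)[OF pm] sets_cylinder by simp
      let ?s = "\<lambda>\<omega>. \<Sum>es\<in>P. f (c es) * indicator (cylinder es) \<omega>"
      have i1: "integrable (law h) f"
        using B borel_measurable_continuous_map[OF f] measurable_cong_sets[OF prob_measuresD(2)[OF pm] refl]
        by (intro integrable_bounded_prob[OF prob_space_axioms, of _ B]) (auto simp: sp)
      have ic: "integrable (law h) (\<lambda>\<omega>. f (c es) * indicator (cylinder es) \<omega>)" for es
        using cyl by (intro integrable_mult_right integrable_const_bound[of _ 1]) auto
      have i2: "integrable (law h) ?s" by (intro Bochner_Integration.integrable_sum ic)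
      have "(\<integral>\<omega>. ?s \<omega> \<partial>law h) = (\<Sum>es\<in>P. \<integral>\<omega>. f (c es) * indicator (cylinder es) \<omega> \<partial>law h)"
        by (rule Bochner_Integration.integral_sum) (rule ic)
      also have "\<dots> = ?g h"
      proof (intro sum.cong refl)
        fix es assume "es \<in> P"
        then obtain t where t: "hpath leaf es t" by (auto simp: P_def)
        then have "measure (law h) (cylinder es) = h (path_end es)" using d hpath_path_end[OF t] by (simp add: has_density_def)
        then show "(\<integral>\<omega>. f (c es) * indicator (cylinder es) \<omega> \<partial>law h) = f (c es) * h (path_end es)"
          using cyl[of es] by simp
      qed
      finally have "(\<integral>\<omega>. f \<omega> \<partial>law h) - ?g h = (\<integral>\<omega>. f \<omega> - ?s \<omega> \<partial>law h)"
        by (simp only: Bochner_Integration.integral_diff[OF i1 i2])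
      then have "\<bar>(\<integral>\<omega>. f \<omega> \<partial>law h) - ?g h\<bar> \<le> (\<integral>\<omega>. \<bar>f \<omega> - ?s \<omega>\<bar> \<partial>law h)"
        by (simp only: integral_abs_bound)
      also have "\<dots> \<le> (\<integral>\<omega>. e \<partial>law h)"
      proof (rule integral_mono)
        fix \<omega> assume "\<omega> \<in> space (law h)"
        then have w: "\<omega> \<in> inf_paths" by (simp add: sp)
        let ?es = "map \<omega> [0..<N]"
        have esP: "?es \<in> P" using inf_path_prefix[OF w, of N] by (auto simp: P_def)
        have wc: "\<omega> \<in> cylinder ?es" using w by (simp add: cylinder_eq)
        then have cc: "c ?es \<in> cylinder ?es" unfolding c_def by (rule someI[where P="\<lambda>\<omega>'. \<omega>' \<in> cylinder ?es"])
        have "?s \<omega> = (\<Sum>es\<in>P. if es = ?es then f (c ?es) else 0)"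
        proof (intro sum.cong refl)
          fix es assume "es \<in> P"
          then have "\<omega> \<in> cylinder es \<longleftrightarrow> es = ?es" using w by (auto simp: cylinder_eq P_def)
          then show "f (c es) * indicator (cylinder es) \<omega> = (if es = ?es then f (c ?es) else 0)"
            by (cases "es = ?es") (simp_all add: indicator_def)
        qed
        then have s: "?s \<omega> = f (c ?es)" using finP esP by simp
        have "agree N \<omega> (c ?es)" using cc by (simp add: cylinder_def)
        then show "\<bar>f \<omega> - ?s \<omega>\<bar> \<le> e" unfolding s using N[OF w, of "c ?es"] cc cylinder_subset by fastforce
      qed (auto intro!: integrable_abs Bochner_Integration.integrable_diff i1 i2)
      finally show ?thesis by (simp add: prob_space)
    qed
    ultimately show "\<exists>g. continuous_on harmonics g \<and> (\<forall>h\<in>harmonics. \<bar>(\<integral>\<omega>. f \<omega> \<partial>law h) - g h\<bar> \<le> e)" by blast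
  qed
  then show "continuous_map (top_of_set harmonics) euclideanreal (\<lambda>h. \<integral>\<omega>. f \<omega> \<partial>law h)" by simp
qed

lemma continuous_map_into_functions:
  fixes F :: "'a \<Rightarrow> 'i \<Rightarrow> real"
  assumes "\<And>i. continuous_map X euclideanreal (\<lambda>x. F x i)" shows "continuous_map X euclidean F"
  using assms continuous_map_componentwise_UNIV[of X "\<lambda>_. euclideanreal" F] by (simp add: euclidean_product_topology)

lemma continuous_map_tree_density:
  "continuous_map (subtopology (weak_topology path_topology) K) euclidean tree_density"
proof (rule continuous_map_into_functions)
  fix t
  let ?C = "cylinder (SOME es. hpath leaf es t)"
  have "continuous_map path_topology euclideanreal (indicator ?C)"
    by (rule continuous_map_finite_dep[of "length (SOME es. hpath leaf es t)"]) (auto simp: indicator_def cylinder_def)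
  moreover have "bounded ((indicator ?C :: _ \<Rightarrow> real) ` topspace path_topology)"
    by (rule boundedI[of _ 1]) auto
  ultimately have "continuous_map (weak_topology path_topology) euclideanreal (\<lambda>\<mu>. \<integral>\<omega>. indicator ?C \<omega> \<partial>\<mu>)"
    by (rule continuous_map_weak_integral)
  then have "continuous_map (subtopology (weak_topology path_topology) K) euclideanreal (\<lambda>\<mu>. \<integral>\<omega>. indicator ?C \<omega> \<partial>\<mu>)"
    by (rule continuous_map_from_subtopology)
  then show "continuous_map (subtopology (weak_topology path_topology) K) euclideanreal (\<lambda>\<mu>. tree_density \<mu> t)"
  proof (rule continuous_map_eq)
    fix \<mu> assume "\<mu> \<in> topspace (subtopology (weak_topology path_topology) K)"
    then have "?C \<in> sets \<mu>" using prob_measuresD(2)[of \<mu> path_topology] sets_cylinder by simp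
    then show "(\<integral>\<omega>. indicator ?C \<omega> \<partial>\<mu>) = tree_density \<mu> t" by (simp add: tree_density_def)
  qed
qed

lemma harmonic_mix:
  assumes "harmonic h" "harmonic h'" "c \<in> {0..1}"
  shows "harmonic (\<lambda>t. (1 - c) * h t + c * h' t)"
  unfolding harmonic_def
proof (intro conjI allI)
  fix t
  show "0 \<le> (1 - c) * h t + c * h' t" using assms(3) harmonicD(2)[OF assms(1)] harmonicD(2)[OF assms(2)] by simp
  show "(1 - c) * h t + c * h' t = (\<Sum>v\<in>verts t. (1 - c) * h (attach_leaf t v) + c * h' (attach_leaf t v))"
    by (simp only: sum.distrib sum_distrib_left[symmetric] harmonicD(3)[OF assms(1), of t, symmetric] harmonicD(3)[OF assms(2), of t, symmetric])
qed (simp add: harmonicD(1)[OF assms(1)] harmonicD(1)[OF assms(2)])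

lemma central_mix:
  assumes \<mu>: "\<mu> \<in> central_measures" and \<nu>: "\<nu> \<in> central_measures" and c: "c \<in> {0..1}"
  shows "mix c \<mu> \<nu> \<in> central_measures" "tree_density (mix c \<mu> \<nu>) = (\<lambda>t. (1 - c) * tree_density \<mu> t + c * tree_density \<nu> t)"
proof -
  note dm = central_has_density(1)[OF \<mu>] and dn = central_has_density(1)[OF \<nu>]
  have p: "\<mu> \<in> prob_measures path_topology" "\<nu> \<in> prob_measures path_topology" using dm dn by (auto simp: has_density_def)
  have "has_density (mix c \<mu> \<nu>) (\<lambda>t. (1 - c) * tree_density \<mu> t + c * tree_density \<nu> t)"
    unfolding has_density_def
  proof (intro conjI allI impI)
    show "mix c \<mu> \<nu> \<in> prob_measures path_topology" using p c by (rule mix_prob_measures)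
    fix es t assume "hpath leaf es t"
    moreover have "cylinder es \<in> sets \<mu>" using prob_measuresD(2)[OF p(1)] sets_cylinder by simp
    ultimately show "measure (mix c \<mu> \<nu>) (cylinder es) = (1 - c) * tree_density \<mu> t + c * tree_density \<nu> t"
      using measure_mix[of \<mu> \<nu> c "cylinder es"] prob_measuresD[OF p(1)] prob_measuresD[OF p(2)] c dm dn
      by (simp add: has_density_def)
  qed
  then show "mix c \<mu> \<nu> \<in> central_measures" "tree_density (mix c \<mu> \<nu>) = (\<lambda>t. (1 - c) * tree_density \<mu> t + c * tree_density \<nu> t)"
    by (rule has_density_central, rule tree_density_eq)
qed

section \<open>Measures on the Kingman simplex\<close>

text \<open>The condition on the infinite sum is replaced by conditions on its partial sums, each of
  which is closed in the product topology.\<close>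

lemma nabla_eq:
  "nabla = {p. \<forall>i. p i \<in> {0..1}} \<inter> ((\<Inter>i. {p. p (Suc i) \<le> p i}) \<inter> (\<Inter>n. {p. (\<Sum>i<n. p i) \<le> 1}))"
proof (intro equalityI subsetI)
  fix p assume p: "p \<in> nabla"
  note n = nabla_props[OF p]
  show "p \<in> {p. \<forall>i. p i \<in> {0..1}} \<inter> ((\<Inter>i. {p. p (Suc i) \<le> p i}) \<inter> (\<Inter>n. {p. (\<Sum>i<n. p i) \<le> 1}))"
    using n(1,2,3) n(5)[of _ "Suc _"] by auto
next
  fix p :: "nat \<Rightarrow> real"
  assume a: "p \<in> {p. \<forall>i. p i \<in> {0..1}} \<inter> ((\<Inter>i. {p. p (Suc i) \<le> p i}) \<inter> (\<Inter>n. {p. (\<Sum>i<n. p i) \<le> 1}))"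
  then have 0: "0 \<le> p i" and d: "p (Suc i) \<le> p i" and s: "(\<Sum>i<n. p i) \<le> 1" for i n by auto
  have sm: "summable p" by (rule summableI_nonneg_bounded[where x=1]) (use 0 s in auto)
  have "suminf p \<le> 1" using sm s by (rule suminf_le_const)
  then show "p \<in> nabla" using 0 d sm by (simp add: nabla_def decseq_Suc_iff)
qed

lemma compact_nabla: "compact nabla"
proof -
  have "compact {p::nat \<Rightarrow> real. \<forall>i. p i \<in> {0..1}}" by (rule compact_function_box) simp
  moreover have "closed ((\<Inter>i. {p::nat \<Rightarrow> real. p (Suc i) \<le> p i}) \<inter> (\<Inter>n. {p. (\<Sum>i<n. p i) \<le> 1}))"
    by (intro closed_Int closed_INT ballI closed_Collect_le continuous_on_sum continuous_on_coordinate continuous_on_const)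
  ultimately show ?thesis unfolding nabla_eq by (rule compact_Int_closed)
qed

lemma nabla_borel: "nabla \<in> sets borel"
  using compact_imp_closed[OF compact_nabla] by simp

lemma prob_measures_nabla:
  "\<rho> \<in> prob_measures (top_of_set nabla) \<longleftrightarrow> prob_space \<rho> \<and> sets \<rho> = sets (restrict_space borel nabla)"
  by (simp add: prob_measures_def sets_borel_of_top_of_set[OF nabla_borel])

text \<open>For \<open>k \<ge> 2\<close> the tail from \<open>N\<close> on is at most
  \<open>p_N\<close> times the total mass, hence at most \<open>1/(N+1)\<close> for all
  \<open>p\<close> at once.\<close>

lemma continuous_on_ext_power_sum:
  assumes "k > 0" shows "continuous_on nabla (\<lambda>p. ext_power_sum p k)"
proof (cases "k = 1")
  case True
  then show ?thesis by (simp add: ext_power_sum_def continuous_on_const)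
next
  case False
  show ?thesis
  proof (rule continuous_on_uniform_approx)
    fix e :: real assume "e > 0"
    then obtain N where N: "1 / real (Suc N) < e" using nat_approx_posE by blast
    have "\<bar>ext_power_sum p k - (\<Sum>i<N. p i ^ k)\<bar> \<le> e" if p: "p \<in> nabla" for p
    proof -
      note n = nabla_props[OF p]
      have sk: "summable (\<lambda>i. p i ^ k)" by (rule n(7)[OF assms])
      have pN: "p N \<le> 1 / real (Suc N)" using n(4)[of N] by (simp add: field_simps)
      have "ext_power_sum p k - (\<Sum>i<N. p i ^ k) = suminf (\<lambda>i. p (i + N) ^ k)"
        using suminf_minus_initial_segment[OF sk, of N] False by (simp add: ext_power_sum_def)
      moreover have "0 \<le> suminf (\<lambda>i. p (i + N) ^ k)"
        using summable_ignore_initial_segment[OF sk, of N] n(1) by (intro suminf_nonneg) auto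
      moreover have "suminf (\<lambda>i. p (i + N) ^ k) \<le> suminf (\<lambda>i. p N * p (i + N))"
      proof (rule suminf_le)
        show "summable (\<lambda>i. p (i + N) ^ k)" by (rule summable_ignore_initial_segment[OF sk])
        show "summable (\<lambda>i. p N * p (i + N))"
          using n(7)[of 1] by (intro summable_mult summable_ignore_initial_segment) simp
        fix i
        have "p (i + N) ^ k \<le> p (i + N) ^ 2"
          using assms False n(1,2) by (intro power_decreasing) auto
        also have "\<dots> \<le> p N * p (i + N)" using n(5)[of N "i + N"] n(1)[of "i + N"] by (simp add: power2_eq_square mult_right_mono)
        finally show "p (i + N) ^ k \<le> p N * p (i + N)" .
      qed
      moreover have "suminf (\<lambda>i. p N * p (i + N)) \<le> p N * 1"
      proof -
        have s1: "summable p" using n(7)[of 1] by simp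
        then have "suminf (\<lambda>i. p N * p (i + N)) = p N * suminf (\<lambda>i. p (i + N))"
          by (intro suminf_mult summable_ignore_initial_segment)
        moreover have "suminf (\<lambda>i. p (i + N)) \<le> suminf p"
          using suminf_minus_initial_segment[OF s1, of N] sum_nonneg[of "{..<N}" p] n(1) by simp
        moreover have "suminf p \<le> 1" using p by (simp add: nabla_def)
        ultimately show ?thesis using n(1)[of N] by (simp add: mult_left_le)
      qed
      ultimately show ?thesis using pN N by linarith
    qed
    moreover have "continuous_on nabla (\<lambda>p::nat \<Rightarrow> real. \<Sum>i<N. p i ^ k)"
      by (intro continuous_on_sum continuous_on_power continuous_on_coordinate)
    ultimately show "\<exists>g. continuous_on nabla g \<and> (\<forall>p\<in>nabla. \<bar>ext_power_sum p k - g p\<bar> \<le> e)" by blast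
  qed
qed

lemma continuous_on_aug_value:
  assumes "is_partition l" shows "continuous_on nabla (\<lambda>p. aug_value p l)"
  using assms
proof (induction l rule: partition_parts_induct)
  case empty
  have "continuous_on nabla (\<lambda>p. 1 :: real)" by (rule continuous_on_const)
  then show ?case by (rule continuous_on_eq) (simp add: aug_value_empty)
next
  case (add k l)
  let ?F = "\<lambda>p. ext_power_sum p k * aug_value p l - (\<Sum>j\<in>set_mset l. real (count l j) * aug_value p (add_mset (j + k) (l - {#j#})))"
  have "continuous_on nabla ?F"
  proof (intro continuous_on_diff continuous_on_mult continuous_on_sum continuous_on_const continuous_on_ext_power_sum add(1))
    show "continuous_on nabla (\<lambda>p. aug_value p l)" using add(2,3) by blast
    show "continuous_on nabla (\<lambda>p. aug_value p (add_mset (j + k) (l - {#j#})))" if "j \<in> set_mset l" for j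
      by (rule add(3)[OF merge_partition[OF add(2,1)] size_merge[OF that]])
  qed
  then show ?case by (rule continuous_on_eq) (simp add: aug_value_recurrence[OF _ add(1,2)])
qed

lemma continuous_on_psi_basis: "continuous_on nabla (\<lambda>p. psi_basis p t)"
proof (cases "path_forest t")
  case True
  then obtain l where "is_partition l" "t = path_forest_tree l" using path_forest_iff_partition by blast
  then show ?thesis by (simp add: psi_basis_path_forest continuous_on_aug_value)
next
  case False
  then show ?thesis by (simp add: psi_basis_vanish continuous_on_const)
qed

text \<open>If \<open>i\<close> is the first coordinate in which two points differ, the larger value there wins in
  the power sums of high order.\<close>

lemma power_sums_determine_nabla:
  assumes p: "p \<in> nabla" and q: "q \<in> nabla" and eq: "\<And>k. k \<ge> 2 \<Longrightarrow> ext_power_sum p k = ext_power_sum q k"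
  shows "p = q"
proof (rule ccontr)
  assume "p \<noteq> q"
  then have ex: "\<exists>i. p i \<noteq> q i" by auto
  define i where "i = (LEAST i. p i \<noteq> q i)"
  have i1: "p i \<noteq> q i" unfolding i_def using ex by (rule LeastI_ex)
  have i2: "p j = q j" if "j < i" for j
    using not_less_Least[of j "\<lambda>i. p i \<noteq> q i"] that unfolding i_def by blast
  have contra: False if p: "p \<in> nabla" and q: "q \<in> nabla" and eq: "\<And>k. k \<ge> 2 \<Longrightarrow> ext_power_sum p k = ext_power_sum q k"
    and lt: "q i < p i" and agr: "\<And>j. j < i \<Longrightarrow> p j = q j" for p q
  proof -
    note np = nabla_props[OF p] and nq = nabla_props[OF q]
    have tail: "suminf (\<lambda>j. p (j + i) ^ k) = suminf (\<lambda>j. q (j + i) ^ k)" if "k \<ge> 2" for k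
      using eq[OF that] that agr suminf_minus_initial_segment[OF np(7)[of k], of i] suminf_minus_initial_segment[OF nq(7)[of k], of i]
      by (simp add: ext_power_sum_def)
    \<comment> \<open>After cancelling the common first coordinates, the leading term on the left is
      bounded by the whole tail on the right, where one factor of each term is spent on the total
      mass, which is at most 1.\<close>
    have le: "p i ^ Suc k \<le> q i ^ k" if k: "k \<ge> 1" for k
    proof -
      have sp: "summable (\<lambda>j. p (j + i) ^ Suc k)" by (rule summable_ignore_initial_segment[OF np(7)]) simp
      have sq: "summable (\<lambda>j. q (j + i) ^ Suc k)" by (rule summable_ignore_initial_segment[OF nq(7)]) simp
      have sq1: "summable q" using nq(7)[of 1] by simp
      have "p i ^ Suc k \<le> suminf (\<lambda>j. p (j + i) ^ Suc k)"
        using sum_le_suminf[OF sp, of "{0}"] np(1) by simp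
      also have "\<dots> = suminf (\<lambda>j. q (j + i) ^ Suc k)" using k by (intro tail) simp
      also have "\<dots> \<le> suminf (\<lambda>j. q i ^ k * q (j + i))"
      proof (rule suminf_le[OF _ sq])
        fix j
        have "q (j + i) ^ k \<le> q i ^ k" using nq(1) nq(5)[of i "j + i"] by (intro power_mono) auto
        then show "q (j + i) ^ Suc k \<le> q i ^ k * q (j + i)"
          unfolding power_Suc2 using nq(1)[of "j + i"] by (rule mult_right_mono)
        show "summable (\<lambda>j. q i ^ k * q (j + i))" by (intro summable_mult summable_ignore_initial_segment sq1)
      qed
      also have "\<dots> = q i ^ k * suminf (\<lambda>j. q (j + i))"
        by (intro suminf_mult summable_ignore_initial_segment sq1)
      also have "\<dots> \<le> q i ^ k * 1"
      proof (intro mult_left_mono)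
        have "suminf (\<lambda>j. q (j + i)) \<le> suminf q"
          using suminf_minus_initial_segment[OF sq1, of i] sum_nonneg[of "{..<i}" q] nq(1) by simp
        then show "suminf (\<lambda>j. q (j + i)) \<le> 1" using q by (simp add: nabla_def)
      qed (use nq(1) in simp)
      finally show ?thesis by simp
    qed
    have pos: "p i > 0" using lt nq(1)[of i] by linarith
    \<comment> \<open>With this \<open>k\<close> one gets \<open>q_i^(k+1) < p_i^(k+2)\<close>,
      against \<open>le\<close> at \<open>k + 1\<close>.\<close>
    obtain k where k: "(q i / p i) ^ k < p i"
      using real_arch_pow_inv[OF pos, of "q i / p i"] lt pos nq(1) by auto
    have "q i ^ Suc k \<le> q i ^ k * p i" unfolding power_Suc2 using lt nq(1)[of i] by (intro mult_left_mono) auto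
    also have "\<dots> < p i * p i ^ k * p i"
      using k pos by (simp add: power_divide divide_less_eq mult.commute)
    finally have "q i ^ Suc k < p i ^ Suc (Suc k)" by (simp add: mult_ac)
    then show False using le[of "Suc k"] by simp
  qed
  from i1 consider "q i < p i" | "p i < q i" by linarith
  then show False
  proof cases
    case 1
    show False by (rule contra[OF p q eq 1 i2])
  next
    case 2
    show False by (rule contra[OF q p eq[symmetric] 2 i2[symmetric]])
  qed
qed

section \<open>Density of the symmetric functions on the simplex\<close>

lemma ext_eval_expand:
  assumes f: "f \<in> Sym"
  obtains A c where "finite A" "\<And>l. l \<in> A \<Longrightarrow> is_partition l" "\<And>p. p \<in> nabla \<Longrightarrow> ext_eval p f = (\<Sum>l\<in>A. c l * aug_value p l)"
proof -
  obtain d where d: "\<And>M. f M \<noteq> 0 \<Longrightarrow> size M \<le> d" using f by (meson SymE)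
  show thesis
  proof (rule that[of "{l. is_partition l \<and> sum_mset l \<le> d}" "\<lambda>l. f (canon l) / symfac l"])
    fix p assume p: "p \<in> nabla"
    show "ext_eval p f = (\<Sum>l\<in>{l. is_partition l \<and> sum_mset l \<le> d}. f (canon l) / symfac l * aug_value p l)"
      unfolding aug_value_eq[OF p] by (rule sym_hom_expand[OF sym_hom_ext_eval[OF p] f]) (rule d)
  qed (auto simp: finite_partitions)
qed

text \<open>Stone-Weierstrass: the functions \<open>ext_eval p g\<close> of \<open>p\<close> form an
  algebra because \<open>ext_eval p\<close> is a homomorphism, and the power sums with
  \<open>k \<ge> 2\<close> separate points.\<close>

lemma sym_dense:
  assumes f: "continuous_on nabla f" and e: "e > 0"
  shows "\<exists>g\<in>Sym. \<forall>p\<in>nabla. \<bar>f p - ext_eval p g\<bar> < e"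
proof -
  define R where "R = {g. \<exists>f\<in>Sym. \<forall>p\<in>nabla. g p = ext_eval p f}"
  note hom = sym_hom_ext_eval[unfolded sym_hom_def]
  have one: "ser_one \<in> Sym" by (simp add: ser_one_eq_aug aug_mono_sym_Sym)
  interpret function_ring_on R nabla
  proof
    show "compact nabla" by (rule compact_nabla)
    show "continuous_on nabla g" if "g \<in> R" for g
    proof -
      obtain f where f: "f \<in> Sym" "\<forall>p\<in>nabla. g p = ext_eval p f" using \<open>g \<in> R\<close> by (auto simp: R_def)
      obtain A c where A: "finite A" "\<And>l. l \<in> A \<Longrightarrow> is_partition l" "\<And>p. p \<in> nabla \<Longrightarrow> ext_eval p f = (\<Sum>l\<in>A. c l * aug_value p l)"
        by (rule ext_eval_expand[OF f(1)]) (rule that)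
      have "continuous_on nabla (\<lambda>p. \<Sum>l\<in>A. c l * aug_value p l)"
        by (intro continuous_on_sum continuous_on_mult continuous_on_const continuous_on_aug_value A)
      then show ?thesis by (rule continuous_on_eq) (simp add: f(2) A(3))
    qed
    show "(\<lambda>x. g x + g' x) \<in> R" if g: "g \<in> R" "g' \<in> R" for g g'
    proof -
      obtain f f' where f: "f \<in> Sym" "f' \<in> Sym" "\<forall>p\<in>nabla. g p = ext_eval p f" "\<forall>p\<in>nabla. g' p = ext_eval p f'"
        using g by (auto simp: R_def)
      then have "\<forall>p\<in>nabla. g p + g' p = ext_eval p (ser_add f f')" using hom by simp
      then show ?thesis using ser_add_Sym[OF f(1,2)] by (auto simp: R_def)
    qed
    show "(\<lambda>x. g x * g' x) \<in> R" if g: "g \<in> R" "g' \<in> R" for g g'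
    proof -
      obtain f f' where f: "f \<in> Sym" "f' \<in> Sym" "\<forall>p\<in>nabla. g p = ext_eval p f" "\<forall>p\<in>nabla. g' p = ext_eval p f'"
        using g by (auto simp: R_def)
      then have "\<forall>p\<in>nabla. g p * g' p = ext_eval p (ser_mult f f')" using hom by simp
      then show ?thesis using ser_mult_Sym[OF f(1,2)] by (auto simp: R_def)
    qed
    show "(\<lambda>_. c) \<in> R" for c
    proof -
      have "\<forall>p\<in>nabla. c = ext_eval p (ser_scale c ser_one)" using hom one by simp
      then show ?thesis using ser_scale_Sym[OF one, of c] by (auto simp: R_def)
    qed
    show "\<exists>f\<in>R. f p \<noteq> f q" if pq: "p \<in> nabla" "q \<in> nabla" "p \<noteq> q" for p q
    proof -
      obtain k where k: "k \<ge> 2" "ext_power_sum p k \<noteq> ext_power_sum q k"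
        using power_sums_determine_nabla[OF pq(1,2)] pq(3) by blast
      have "(\<lambda>p. ext_eval p (power_sum k)) \<in> R" using power_sum_Sym[of k] k(1) by (auto simp: R_def)
      then show ?thesis using k pq ext_eval_power_sum by (intro bexI) auto
    qed
  qed
  obtain h where h: "h \<in> R" "\<forall>p\<in>nabla. \<bar>f p - h p\<bar> < e" using Stone_Weierstrass_basic[OF f e] by blast
  then obtain g where "g \<in> Sym" "\<forall>p\<in>nabla. h p = ext_eval p g" by (auto simp: R_def)
  then show ?thesis using h(2) by (intro bexI[of _ g]) simp_all
qed

section \<open>Mixtures of the functionals psi\<close>

definition mixture :: "(nat \<Rightarrow> real) measure \<Rightarrow> rtree \<Rightarrow> real" where
  "mixture \<rho> t = (\<integral>p. psi_basis p t \<partial>\<rho>)"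

abbreviation nabla_probs :: "(nat \<Rightarrow> real) measure set" where
  "nabla_probs \<equiv> prob_measures (top_of_set nabla)"

lemma nabla_probsD:
  assumes "\<rho> \<in> nabla_probs"
  shows "prob_space \<rho>" "sets \<rho> = sets (restrict_space borel nabla)" "space \<rho> = nabla"
  using assms prob_measuresD(3)[OF assms] by (auto simp: prob_measures_nabla)

lemma nabla_measurable:
  assumes "\<rho> \<in> nabla_probs" "continuous_on nabla f" shows "f \<in> borel_measurable \<rho>"
  using borel_measurable_continuous_on_restrict[OF assms(2)] measurable_cong_sets[OF nabla_probsD(2)[OF assms(1)] refl] by blast

lemma nabla_bounded:
  fixes f :: "(nat \<Rightarrow> real) \<Rightarrow> real"
  assumes "continuous_on nabla f" obtains B where "\<And>p. p \<in> nabla \<Longrightarrow> \<bar>f p\<bar> \<le> B"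
  using compact_imp_bounded[OF compact_continuous_image[OF assms compact_nabla]] by (auto simp: bounded_iff)

lemma nabla_integrable:
  fixes f :: "(nat \<Rightarrow> real) \<Rightarrow> real"
  assumes \<rho>: "\<rho> \<in> nabla_probs" and f: "continuous_on nabla f" shows "integrable \<rho> f"
proof -
  obtain B where "\<And>p. p \<in> nabla \<Longrightarrow> \<bar>f p\<bar> \<le> B" by (rule nabla_bounded[OF f]) (rule that)
  then show ?thesis
    using nabla_probsD[OF \<rho>] nabla_measurable[OF \<rho> f] by (intro integrable_bounded_prob[of _ _ B]) auto
qed

lemma integral_aug_value:
  assumes "is_partition l" shows "(\<integral>p. aug_value p l \<partial>\<rho>) = mixture \<rho> (path_forest_tree l)"
  unfolding mixture_def psi_basis_path_forest[OF assms] ..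

lemma integral_ext_eval:
  assumes f: "f \<in> Sym"
  obtains A c where "finite A" "\<And>\<rho>. \<rho> \<in> nabla_probs \<Longrightarrow> (\<integral>p. ext_eval p f \<partial>\<rho>) = (\<Sum>l\<in>A. c l * mixture \<rho> (path_forest_tree l))"
proof -
  obtain A c where A: "finite A" "\<And>l. l \<in> A \<Longrightarrow> is_partition l" "\<And>p. p \<in> nabla \<Longrightarrow> ext_eval p f = (\<Sum>l\<in>A. c l * aug_value p l)"
    by (rule ext_eval_expand[OF f]) (rule that)
  show thesis
  proof (rule that[OF A(1)])
    fix \<rho> assume \<rho>: "\<rho> \<in> nabla_probs"
    have "(\<integral>p. ext_eval p f \<partial>\<rho>) = (\<integral>p. (\<Sum>l\<in>A. c l * aug_value p l) \<partial>\<rho>)"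
      by (rule Bochner_Integration.integral_cong) (auto simp: nabla_probsD[OF \<rho>] A(3))
    also have "\<dots> = (\<Sum>l\<in>A. \<integral>p. c l * aug_value p l \<partial>\<rho>)"
      by (intro Bochner_Integration.integral_sum integrable_mult_right nabla_integrable[OF \<rho>] continuous_on_aug_value A(2))
    also have "\<dots> = (\<Sum>l\<in>A. c l * mixture \<rho> (path_forest_tree l))"
      by (intro sum.cong refl) (simp add: integral_aug_value A(2))
    finally show "(\<integral>p. ext_eval p f \<partial>\<rho>) = (\<Sum>l\<in>A. c l * mixture \<rho> (path_forest_tree l))" .
  qed
qed

lemma continuous_on_ext_eval:
  assumes "f \<in> Sym" shows "continuous_on nabla (\<lambda>p. ext_eval p f)"
proof -
  obtain A c where A: "finite A" "\<And>l. l \<in> A \<Longrightarrow> is_partition l" "\<And>p. p \<in> nabla \<Longrightarrow> ext_eval p f = (\<Sum>l\<in>A. c l * aug_value p l)"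
    by (rule ext_eval_expand[OF assms]) (rule that)
  have "continuous_on nabla (\<lambda>p. \<Sum>l\<in>A. c l * aug_value p l)"
    by (intro continuous_on_sum continuous_on_mult continuous_on_const continuous_on_aug_value A)
  then show ?thesis by (rule continuous_on_eq) (simp add: A(3))
qed

lemma integral_approx:
  fixes f g :: "(nat \<Rightarrow> real) \<Rightarrow> real"
  assumes \<rho>: "\<rho> \<in> nabla_probs" and f: "continuous_on nabla f" and g: "continuous_on nabla g"
    and e: "\<And>p. p \<in> nabla \<Longrightarrow> \<bar>f p - g p\<bar> \<le> e"
  shows "\<bar>(\<integral>p. f p \<partial>\<rho>) - (\<integral>p. g p \<partial>\<rho>)\<bar> \<le> e"
proof -
  interpret prob_space \<rho> by (rule nabla_probsD(1)[OF \<rho>])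
  note i = nabla_integrable[OF \<rho> f] nabla_integrable[OF \<rho> g]
  have "\<bar>\<integral>p. f p - g p \<partial>\<rho>\<bar> \<le> (\<integral>p. \<bar>f p - g p\<bar> \<partial>\<rho>)" by (rule integral_abs_bound)
  also have "\<dots> \<le> (\<integral>p. e \<partial>\<rho>)"
    by (intro integral_mono integrable_abs Bochner_Integration.integrable_diff i integrable_const)
       (use e nabla_probsD(3)[OF \<rho>] in auto)
  finally show ?thesis using i by (simp add: prob_space)
qed

text \<open>A mixture determines the integrals of all symmetric functions, and these are dense in
  the continuous functions.\<close>

lemma mixture_inj:
  assumes \<rho>: "\<rho> \<in> nabla_probs" and \<sigma>: "\<sigma> \<in> nabla_probs" and eq: "mixture \<rho> = mixture \<sigma>"
  shows "\<rho> = \<sigma>"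
proof (rule prob_eqI_continuous[OF compact_nabla])
  fix f :: "(nat \<Rightarrow> real) \<Rightarrow> real" assume f: "continuous_on nabla f"
  have le: "\<bar>(\<integral>p. f p \<partial>\<rho>) - (\<integral>p. f p \<partial>\<sigma>)\<bar> \<le> e" if "e > 0" for e
  proof -
    obtain g where g: "g \<in> Sym" "\<forall>p\<in>nabla. \<bar>f p - ext_eval p g\<bar> < e / 2"
      using sym_dense[OF f, of "e / 2"] \<open>e > 0\<close> by auto
    obtain A c where "finite A" and A: "\<And>\<rho>. \<rho> \<in> nabla_probs \<Longrightarrow> (\<integral>p. ext_eval p g \<partial>\<rho>) = (\<Sum>l\<in>A. c l * mixture \<rho> (path_forest_tree l))"
      by (rule integral_ext_eval[OF g(1)]) (rule that)
    have "(\<integral>p. ext_eval p g \<partial>\<rho>) = (\<integral>p. ext_eval p g \<partial>\<sigma>)" unfolding A[OF \<rho>] A[OF \<sigma>] eq ..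
    moreover have "\<bar>(\<integral>p. f p \<partial>\<rho>) - (\<integral>p. ext_eval p g \<partial>\<rho>)\<bar> \<le> e / 2" "\<bar>(\<integral>p. f p \<partial>\<sigma>) - (\<integral>p. ext_eval p g \<partial>\<sigma>)\<bar> \<le> e / 2"
      by (rule integral_approx[OF \<rho> f continuous_on_ext_eval[OF g(1)]], use g(2) in force,
          rule integral_approx[OF \<sigma> f continuous_on_ext_eval[OF g(1)]], use g(2) in force)
    ultimately show ?thesis by linarith
  qed
  show "(\<integral>p. f p \<partial>\<rho>) = (\<integral>p. f p \<partial>\<sigma>)"
  proof (rule ccontr)
    assume "(\<integral>p. f p \<partial>\<rho>) \<noteq> (\<integral>p. f p \<partial>\<sigma>)"
    then have "\<bar>(\<integral>p. f p \<partial>\<rho>) - (\<integral>p. f p \<partial>\<sigma>)\<bar> > 0" by simp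
    then show False using le[of "\<bar>(\<integral>p. f p \<partial>\<rho>) - (\<integral>p. f p \<partial>\<sigma>)\<bar> / 2"] by simp
  qed
qed (use nabla_probsD[OF \<rho>] nabla_probsD[OF \<sigma>] in auto)

lemma mixture_pf_harmonic:
  assumes \<rho>: "\<rho> \<in> nabla_probs" shows "mixture \<rho> \<in> pf_harmonics"
proof -
  interpret prob_space \<rho> by (rule nabla_probsD(1)[OF \<rho>])
  have h: "harmonic (psi_basis p)" if "p \<in> space \<rho>" for p
    using that nabla_probsD(3)[OF \<rho>] by (simp add: harmonic_psi_basis)
  have "harmonic (mixture \<rho>)"
    unfolding harmonic_def
  proof (intro conjI allI)
    have "mixture \<rho> leaf = (\<integral>p. 1 \<partial>\<rho>)"
      unfolding mixture_def by (rule Bochner_Integration.integral_cong) (auto simp: harmonicD(1)[OF h])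
    then show "mixture \<rho> leaf = 1" by (simp add: prob_space)
    show "0 \<le> mixture \<rho> t" for t
      unfolding mixture_def by (rule integral_nonneg_AE) (auto intro!: AE_I2 harmonicD(2)[OF h])
    fix t
    have "mixture \<rho> t = (\<integral>p. (\<Sum>v\<in>verts t. psi_basis p (attach_leaf t v)) \<partial>\<rho>)"
      unfolding mixture_def by (rule Bochner_Integration.integral_cong) (auto intro!: harmonicD(3)[OF h])
    also have "\<dots> = (\<Sum>v\<in>verts t. mixture \<rho> (attach_leaf t v))"
      unfolding mixture_def by (intro Bochner_Integration.integral_sum nabla_integrable[OF \<rho>] continuous_on_psi_basis)
    finally show "mixture \<rho> t = (\<Sum>v\<in>verts t. mixture \<rho> (attach_leaf t v))" .
  qed
  moreover have "mixture \<rho> t = 0" if "\<not> path_forest t" for t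
    unfolding mixture_def using that by (simp add: psi_basis_vanish)
  ultimately show ?thesis by (simp add: pf_harmonics_def)
qed

text \<open>\<rho> is a weak limit of the laws of \<open>freq\<close> under
  \<open>part_weight\<close>; continuity of \<open>aug_value\<close> carries the finite
  approximation over to the limit.\<close>

theorem mixture_surj:
  assumes h: "h \<in> pf_harmonics" shows "\<exists>\<rho>\<in>nabla_probs. mixture \<rho> = h"
proof -
  have hh: "harmonic h" "\<And>t. \<not> path_forest t \<Longrightarrow> h t = 0" using h by (auto simp: pf_harmonics_def)
  define \<phi> where "\<phi> = (\<lambda>l. h (path_forest_tree l))"
  have \<phi>: "harmonic_pf \<phi>" "\<phi> {#} = 1" "\<And>l. is_partition l \<Longrightarrow> 0 \<le> \<phi> l"
    using harmonic_pf_of_harmonic[OF hh] harmonicD(1,2)[OF hh(1)] leaf_eq_path_forest_tree by (auto simp: \<phi>_def)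
  obtain r \<rho> where r: "strict_mono (r :: nat \<Rightarrow> nat)" and \<rho>: "prob_space \<rho>" "sets \<rho> = sets (restrict_space borel nabla)"
    and lim: "\<And>f. continuous_on nabla f \<Longrightarrow>
      (\<lambda>n. \<Sum>i\<in>parts_of (Suc (r n)). part_weight \<phi> (Suc (r n)) i * f (freq (Suc (r n)) i)) \<longlonglongrightarrow> (\<integral>x. f x \<partial>\<rho> :: real)"
  \<comment> \<open>Level 0 is skipped because \<open>freq\<close> divides by the level.\<close>
  proof (rule compact_weak_limit[OF compact_nabla, of "\<lambda>n. parts_of (Suc n)" "\<lambda>n. part_weight \<phi> (Suc n)" "\<lambda>n. freq (Suc n)"])
    show "finite (parts_of (Suc n))" for n by (rule finite_parts_of)
    show "0 \<le> part_weight \<phi> (Suc n) i" if "i \<in> parts_of (Suc n)" for n i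
      by (rule part_weight_nonneg[OF \<phi> that])
    show "(\<Sum>i\<in>parts_of (Suc n). part_weight \<phi> (Suc n) i) = 1" for n by (rule part_weight_sum[OF \<phi>])
    show "freq (Suc n) i \<in> nabla" if "i \<in> parts_of (Suc n)" for n i by (rule freq_props(1)[OF _ that]) simp
  qed (rule that)
  have \<rho>n: "\<rho> \<in> nabla_probs" using \<rho> by (simp add: prob_measures_nabla)
  have "mixture \<rho> t = h t" for t
  proof (cases "path_forest t")
    case True
    then obtain l where l: "is_partition l" "t = path_forest_tree l" using path_forest_iff_partition by blast
    have "(\<lambda>n. \<Sum>i\<in>parts_of (Suc (r n)). part_weight \<phi> (Suc (r n)) i * aug_value (freq (Suc (r n)) i) l) \<longlonglongrightarrow> \<phi> l"
      using LIMSEQ_subseq_LIMSEQ[OF LIMSEQ_Suc[OF harmonic_pf_approx(3)[OF \<phi> l(1)]] r] by (simp add: o_def)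
    then have "\<phi> l = (\<integral>p. aug_value p l \<partial>\<rho>)"
      using lim[OF continuous_on_aug_value[OF l(1)]] by (rule LIMSEQ_unique)
    then show ?thesis using l integral_aug_value[OF l(1)] by (simp add: \<phi>_def)
  next
    case False
    then show ?thesis using mixture_pf_harmonic[OF \<rho>n] hh(2) by (simp add: pf_harmonics_def)
  qed
  then show ?thesis using \<rho>n by blast
qed

definition mixing :: "(rtree \<Rightarrow> real) \<Rightarrow> (nat \<Rightarrow> real) measure" where
  "mixing h = (THE \<rho>. \<rho> \<in> nabla_probs \<and> mixture \<rho> = h)"

lemma mixing_eq: "\<rho> \<in> nabla_probs \<Longrightarrow> mixing (mixture \<rho>) = \<rho>"
  unfolding mixing_def by (rule the_equality) (auto intro: mixture_inj)

lemma mixing: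
  assumes "h \<in> pf_harmonics" shows "mixing h \<in> nabla_probs" "mixture (mixing h) = h"
  using mixture_surj[OF assms] mixing_eq by auto

lemma continuous_map_mixture: "continuous_map (weak_topology (top_of_set nabla)) euclidean mixture"
proof (rule continuous_map_into_functions)
  fix t
  have "bounded ((\<lambda>p. psi_basis p t) ` topspace (top_of_set nabla))"
    using compact_imp_bounded[OF compact_continuous_image[OF continuous_on_psi_basis compact_nabla]] by simp
  then show "continuous_map (weak_topology (top_of_set nabla)) euclideanreal (\<lambda>\<rho>. mixture \<rho> t)"
    unfolding mixture_def using continuous_on_psi_basis by (intro continuous_map_weak_integral) simp_all
qed

text \<open>The integral of a symmetric function against \<open>mixing h\<close> is a finite linear
  combination of values of \<open>h\<close>; density makes every continuous integrand a uniform
  limit of such functions.\<close>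

lemma continuous_map_mixing: "continuous_map (top_of_set pf_harmonics) (weak_topology (top_of_set nabla)) mixing"
proof (rule continuous_map_into_weak)
  fix h assume "h \<in> topspace (top_of_set pf_harmonics)"
  then show "mixing h \<in> nabla_probs" by (simp add: mixing)
next
  fix f assume "continuous_map (top_of_set nabla) euclideanreal f"
  then have f: "continuous_on nabla f" by simp
  have "continuous_on pf_harmonics (\<lambda>h. \<integral>p. f p \<partial>mixing h)"
  proof (rule continuous_on_uniform_approx)
    fix e :: real assume "e > 0"
    then obtain g where g: "g \<in> Sym" "\<forall>p\<in>nabla. \<bar>f p - ext_eval p g\<bar> < e" using sym_dense[OF f] by blast
    obtain A c where A: "finite A" "\<And>\<rho>. \<rho> \<in> nabla_probs \<Longrightarrow> (\<integral>p. ext_eval p g \<partial>\<rho>) = (\<Sum>l\<in>A. c l * mixture \<rho> (path_forest_tree l))"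
      by (rule integral_ext_eval[OF g(1)]) (rule that)
    let ?g = "\<lambda>h. \<Sum>l\<in>A. c l * h (path_forest_tree l)"
    have "\<bar>(\<integral>p. f p \<partial>mixing h) - ?g h\<bar> \<le> e" if h: "h \<in> pf_harmonics" for h
    proof -
      have "?g h = (\<integral>p. ext_eval p g \<partial>mixing h)" unfolding A(2)[OF mixing(1)[OF h]] mixing(2)[OF h] ..
      moreover have "\<bar>(\<integral>p. f p \<partial>mixing h) - (\<integral>p. ext_eval p g \<partial>mixing h)\<bar> \<le> e"
        by (rule integral_approx[OF mixing(1)[OF h] f continuous_on_ext_eval[OF g(1)]]) (use g(2) in force)
      ultimately show ?thesis by simp
    qed
    moreover have "continuous_on pf_harmonics ?g"
      by (intro continuous_on_sum continuous_on_mult continuous_on_const continuous_on_coordinate)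
    ultimately show "\<exists>g. continuous_on pf_harmonics g \<and> (\<forall>h\<in>pf_harmonics. \<bar>(\<integral>p. f p \<partial>mixing h) - g h\<bar> \<le> e)" by blast
  qed
  then show "continuous_map (top_of_set pf_harmonics) euclideanreal (\<lambda>h. \<integral>p. f p \<partial>mixing h)" by simp
qed

lemma mixture_mix:
  assumes \<rho>: "\<rho> \<in> nabla_probs" and \<sigma>: "\<sigma> \<in> nabla_probs" and c: "c \<in> {0..1}"
  shows "mixture (mix c \<rho> \<sigma>) = (\<lambda>t. (1 - c) * mixture \<rho> t + c * mixture \<sigma> t)"
proof
  fix t
  have B: "\<bar>psi_basis p t\<bar> \<le> 1" if "p \<in> space \<rho>" for p
    using that nabla_probsD(3)[OF \<rho>] harmonicD(2)[OF harmonic_psi_basis] harmonic_le_1[OF harmonic_psi_basis] by simp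
  have "sets \<sigma> = sets \<rho>" using nabla_probsD(2)[OF \<rho>] nabla_probsD(2)[OF \<sigma>] by simp
  then show "mixture (mix c \<rho> \<sigma>) t = (1 - c) * mixture \<rho> t + c * mixture \<sigma> t"
    unfolding mixture_def using c
    by (intro integral_mix[where B=1] nabla_probsD(1) \<rho> \<sigma> nabla_measurable continuous_on_psi_basis B) auto
qed

text \<open>By linearity the representation can be tested on the tree basis.\<close>

lemma nabla_representing_iff:
  assumes L: "linear L"
  shows "nabla_representing L \<rho> \<longleftrightarrow> \<rho> \<in> nabla_probs \<and> mixture \<rho> = (\<lambda>t. L (\<F> t))"
proof
  assume r: "nabla_representing L \<rho>"
  show "\<rho> \<in> nabla_probs \<and> mixture \<rho> = (\<lambda>t. L (\<F> t))"
  proof (intro conjI ext)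
    show "\<rho> \<in> nabla_probs" using r by (simp add: nabla_representing_def)
    fix t
    have "has_bochner_integral \<rho> (\<lambda>p. psi p (\<F> t)) (L (\<F> t))" using r by (simp add: nabla_representing_def)
    then show "mixture \<rho> t = L (\<F> t)"
      by (simp add: psi_eq_lin_ext mixture_def has_bochner_integral_integral_eq)
  qed
next
  assume a: "\<rho> \<in> nabla_probs \<and> mixture \<rho> = (\<lambda>t. L (\<F> t))"
  have "has_bochner_integral \<rho> (\<lambda>p. psi p x) (L x)" for x
  proof -
    have "has_bochner_integral \<rho> (\<lambda>p. psi_basis p t) (L (\<F> t))" for t
    proof -
      have "mixture \<rho> t = L (\<F> t)" using a by simp
      then show ?thesis
        unfolding has_bochner_integral_iff mixture_def using a nabla_integrable[OF _ continuous_on_psi_basis, of \<rho> t] by blast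
    qed
    then have "has_bochner_integral \<rho> (\<lambda>p. \<Sum>t\<in>Poly_Mapping.keys x. Poly_Mapping.lookup x t * psi_basis p t)
      (\<Sum>t\<in>Poly_Mapping.keys x. Poly_Mapping.lookup x t * L (\<F> t))"
      by (intro has_bochner_integral_sum has_bochner_integral_mult_right)
    then show ?thesis unfolding psi_def linear_expand[OF L, of x] .
  qed
  then show "nabla_representing L \<rho>" using a by (simp add: nabla_representing_def)
qed

lemma tendsto_functions:
  fixes f :: "'a \<Rightarrow> 'i \<Rightarrow> real"
  assumes "\<And>i. ((\<lambda>n. f n i) \<longlongrightarrow> l i) F" shows "(f \<longlongrightarrow> l) F"
proof -
  have "limitin (product_topology (\<lambda>_. euclideanreal) UNIV) f l F"
    unfolding limitin_componentwise using assms by simp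
  then show ?thesis by (simp add: euclidean_product_topology)
qed

section \<open>The path-forest face\<close>

lemma central_pfD:
  assumes "\<mu> \<in> central_pf" shows "\<mu> \<in> central_measures" "tree_density \<mu> \<in> pf_harmonics" "law (tree_density \<mu>) = \<mu>"
proof -
  show c: "\<mu> \<in> central_measures" using assms by (simp add: central_pf_def)
  show "tree_density \<mu> \<in> pf_harmonics" using assms central_pf_iff[OF c] central_has_density(2)[OF c] by (simp add: pf_harmonics_def)
  show "law (tree_density \<mu>) = \<mu>" using c by (rule law_tree_density)
qed

lemma law_pf:
  assumes "h \<in> pf_harmonics" shows "law h \<in> central_pf" "tree_density (law h) = h"
proof -
  have h: "harmonic h" using assms by (simp add: pf_harmonics_def)
  show d: "tree_density (law h) = h" by (rule tree_density_law[OF h])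
  show "law h \<in> central_pf" using central_pf_iff[OF law_central[OF h]] assms by (simp add: d pf_harmonics_def)
qed

lemma pf_harmonics_mix:
  "h \<in> pf_harmonics \<Longrightarrow> h' \<in> pf_harmonics \<Longrightarrow> c \<in> {0..1} \<Longrightarrow> (\<lambda>t. (1 - c) * h t + c * h' t) \<in> pf_harmonics"
  using harmonic_mix[of h h' c] by (simp add: pf_harmonics_def)

lemma law_mix:
  assumes h: "h \<in> pf_harmonics" "h' \<in> pf_harmonics" and c: "c \<in> {0..1}"
  shows "law (\<lambda>t. (1 - c) * h t + c * h' t) = mix c (law h) (law h')"
proof -
  note m = central_mix[OF central_pfD(1)[OF law_pf(1)[OF h(1)]] central_pfD(1)[OF law_pf(1)[OF h(2)]] c]
  show ?thesis using law_tree_density[OF m(1)] unfolding m(2) law_pf(2)[OF h(1)] law_pf(2)[OF h(2)] .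
qed

lemma central_pf_mix:
  assumes "\<mu> \<in> central_pf" "\<nu> \<in> central_pf" "c \<in> {0..1}" shows "mix c \<mu> \<nu> \<in> central_pf"
  using law_pf(1)[OF pf_harmonics_mix[OF central_pfD(2)[OF assms(1)] central_pfD(2)[OF assms(2)] assms(3)]]
  unfolding law_mix[OF central_pfD(2)[OF assms(1)] central_pfD(2)[OF assms(2)] assms(3)] central_pfD(3)[OF assms(1)] central_pfD(3)[OF assms(2)] .

lemma chain_identities_iff:
  assumes L: "pieri_state L"
  shows "(\<forall>m\<ge>3. chain_identity L m) \<longleftrightarrow> (\<lambda>t. L (\<F> t)) \<in> pf_harmonics"
proof -
  have h: "harmonic (\<lambda>t. L (\<F> t))" using L by (simp add: pieri_state_iff_harmonic)
  show ?thesis using chain_defects_zero_iff[OF h] chain_identity_iff[OF L] h by (simp add: pf_harmonics_def)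
qed

context
  fixes L assumes L: "pieri_state L"
begin

lemma pieri_linear: "linear L"
  using L by (simp add: pieri_state_def)

lemma chain_identities_tracial:
  assumes "\<forall>m\<ge>3. chain_identity L m" shows "L (x \<circledast> y) = L (y \<circledast> x)"
  using assms chain_identities_iff[OF L] by (intro tracial_of_vanish pieri_linear) (simp add: pf_harmonics_def)

text \<open>Traciality at \<open>y = \<F> \<tau>\<close> turns the left Pieri identity into the
  right one, which contains the chain identities as special cases.\<close>

lemma chain_identities_iff_right_pieri:
  "(\<forall>m\<ge>3. chain_identity L m) \<longleftrightarrow> (\<forall>x. L (x \<circledast> \<F> \<tau>) = L x)"
proof
  assume "\<forall>m\<ge>3. chain_identity L m"
  then show "\<forall>x. L (x \<circledast> \<F> \<tau>) = L x" using chain_identities_tracial L by (simp add: pieri_state_def)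
qed (simp add: chain_identity_def)

lemma chain_identities_iff_tracial:
  "(\<forall>m\<ge>3. chain_identity L m) \<longleftrightarrow> (\<forall>x y. L (x \<circledast> y) = L (y \<circledast> x))"
proof
  assume "\<forall>x y. L (x \<circledast> y) = L (y \<circledast> x)"
  then have "\<forall>x. L (x \<circledast> \<F> \<tau>) = L x" using L by (simp add: pieri_state_def)
  then show "\<forall>m\<ge>3. chain_identity L m" using chain_identities_iff_right_pieri by blast
qed (use chain_identities_tracial in blast)

lemma chain_identities_iff_vanish:
  "(\<forall>m\<ge>3. chain_identity L m) \<longleftrightarrow> (\<forall>x\<in>I_pf. L x = 0)"
proof -
  have h: "harmonic (\<lambda>t. L (\<F> t))" using L by (simp add: pieri_state_iff_harmonic)
  have "(\<forall>x\<in>I_pf. L x = 0) \<longleftrightarrow> (\<forall>t. \<not> path_forest t \<longrightarrow> L (\<F> t) = 0)"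
  proof
    assume a: "\<forall>x\<in>I_pf. L x = 0"
    show "\<forall>t. \<not> path_forest t \<longrightarrow> L (\<F> t) = 0"
    proof (intro allI impI)
      fix t assume "\<not> path_forest t"
      then have "\<F> t \<in> I_pf" unfolding I_pf_def by (intro span_base) blast
      then show "L (\<F> t) = 0" using a by blast
    qed
  next
    assume a: "\<forall>t. \<not> path_forest t \<longrightarrow> L (\<F> t) = 0"
    show "\<forall>x\<in>I_pf. L x = 0"
    proof
      fix x assume "x \<in> I_pf"
      then show "L x = 0" unfolding I_pf_def by (rule linear_eq_0_on_span[OF pieri_linear, rotated]) (use a in blast)
    qed
  qed
  then show ?thesis using chain_identities_iff[OF L] h by (simp add: pf_harmonics_def)
qed

lemma chain_identities_iff_mixture:
  "(\<forall>m\<ge>3. chain_identity L m) \<longleftrightarrow> (\<exists>!\<rho>. nabla_representing L \<rho>)"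
proof
  assume "\<forall>m\<ge>3. chain_identity L m"
  then have h: "(\<lambda>t. L (\<F> t)) \<in> pf_harmonics" using chain_identities_iff[OF L] by simp
  show "\<exists>!\<rho>. nabla_representing L \<rho>"
    unfolding nabla_representing_iff[OF pieri_linear]
  proof (rule ex1I[of _ "mixing (\<lambda>t. L (\<F> t))"])
    show "mixing (\<lambda>t. L (\<F> t)) \<in> nabla_probs \<and> mixture (mixing (\<lambda>t. L (\<F> t))) = (\<lambda>t. L (\<F> t))" using mixing[OF h] by blast
    fix \<rho> assume a: "\<rho> \<in> nabla_probs \<and> mixture \<rho> = (\<lambda>t. L (\<F> t))"
    then have "mixing (mixture \<rho>) = \<rho>" using mixing_eq by blast
    then show "\<rho> = mixing (\<lambda>t. L (\<F> t))" unfolding conjunct2[OF a] by (rule sym)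
  qed
next
  assume "\<exists>!\<rho>. nabla_representing L \<rho>"
  then obtain \<rho> where "\<rho> \<in> nabla_probs" "mixture \<rho> = (\<lambda>t. L (\<F> t))"
    unfolding nabla_representing_iff[OF pieri_linear] by blast
  then have "(\<lambda>t. L (\<F> t)) \<in> pf_harmonics" using mixture_pf_harmonic by metis
  then show "\<forall>m\<ge>3. chain_identity L m" using chain_identities_iff[OF L] by simp
qed

end

lemma central_laws_of_chain_identities:
  "central_law ` {L. pieri_state L \<and> (\<forall>m\<ge>3. chain_identity L m)} = central_pf"
proof (intro equalityI subsetI)
  fix \<mu> assume "\<mu> \<in> central_law ` {L. pieri_state L \<and> (\<forall>m\<ge>3. chain_identity L m)}"
  then obtain L where L: "pieri_state L" "\<forall>m\<ge>3. chain_identity L m" "\<mu> = central_law L" by blast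
  then show "\<mu> \<in> central_pf"
    using chain_identities_iff[OF L(1)] law_pf(1) by (simp add: central_law_eq_law[OF L(1)])
next
  fix \<mu> assume \<mu>: "\<mu> \<in> central_pf"
  let ?h = "tree_density \<mu>"
  have L: "pieri_state (lin_ext ?h)"
    using central_pfD(2)[OF \<mu>] by (intro pieri_state_lin_ext) (simp add: pf_harmonics_def)
  have "\<forall>m\<ge>3. chain_identity (lin_ext ?h) m"
    unfolding chain_identities_iff[OF L] using central_pfD(2)[OF \<mu>] by simp
  moreover have "\<mu> = central_law (lin_ext ?h)" using central_pfD(3)[OF \<mu>] by (simp add: law_def)
  ultimately show "\<mu> \<in> central_law ` {L. pieri_state L \<and> (\<forall>m\<ge>3. chain_identity L m)}" using L by blast
qed

section \<open>The exposing functional\<close>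

definition total_defect :: "(rtree \<Rightarrow> real) \<Rightarrow> real" where
  "total_defect h = suminf (\<lambda>n. (1/2)^(n + 3) * chain_defect h (n + 3))"

lemma summable_defect:
  assumes "harmonic h" shows "summable (\<lambda>n. (1/2)^(n + 3) * chain_defect h (n + 3))"
proof (rule summable_comparison_test'[of "\<lambda>n. (1/2::real)^(n + 3)" 0])
  show "summable (\<lambda>n. (1/2::real)^(n + 3))" by (rule summable_ignore_initial_segment) simp
  fix n :: nat
  show "norm ((1/2)^(n + 3) * chain_defect h (n + 3)) \<le> (1/2::real)^(n + 3)"
    using chain_defect_bounds[OF assms, of "n + 3"] by (simp add: mult_left_le)
qed

lemma continuous_on_chain_defect: "continuous_on S (\<lambda>h. chain_defect h m)"
  unfolding chain_defect_def by (intro continuous_on_sum continuous_on_coordinate)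

text \<open>The partial sums are continuous, and \<open>chain_defect_bounds\<close> gives uniform
  convergence by the M-test.\<close>

lemma continuous_on_total_defect: "continuous_on harmonics total_defect"
proof (rule uniform_limit_theorem[where F=sequentially])
  let ?f = "\<lambda>n h. (1/2)^(n + 3) * chain_defect h (n + 3)"
  have "uniform_limit harmonics (\<lambda>n h. \<Sum>i<n. ?f i h) (\<lambda>h. suminf (\<lambda>i. ?f i h)) sequentially"
  proof (rule Weierstrass_m_test)
    show "summable (\<lambda>n. (1/2::real)^(n + 3))" by (rule summable_ignore_initial_segment) simp
    show "norm (?f n h) \<le> (1/2)^(n + 3)" if "h \<in> harmonics" for n h
      using chain_defect_bounds[of h "n + 3"] that by (simp add: harmonics_def mult_left_le)
  qed
  then show "uniform_limit harmonics (\<lambda>n h. \<Sum>i<n. ?f i h) total_defect sequentially"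
    unfolding total_defect_def .
  show "\<forall>\<^sub>F n in sequentially. continuous_on harmonics (\<lambda>h. \<Sum>i<n. ?f i h)"
    by (intro always_eventually allI continuous_on_sum continuous_on_mult continuous_on_const continuous_on_chain_defect)
qed simp

lemma total_defect_nonneg: "harmonic h \<Longrightarrow> 0 \<le> total_defect h"
  unfolding total_defect_def by (intro suminf_nonneg summable_defect) (auto simp: chain_defect_bounds)

lemma total_defect_zero_iff:
  assumes h: "harmonic h" shows "total_defect h = 0 \<longleftrightarrow> h \<in> pf_harmonics"
proof -
  have "total_defect h = 0 \<longleftrightarrow> (\<forall>n. (1/2::real)^(n + 3) * chain_defect h (n + 3) = 0)"
    unfolding total_defect_def by (rule suminf_eq_zero_iff[OF summable_defect[OF h]]) (simp add: chain_defect_bounds[OF h])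
  also have "\<dots> \<longleftrightarrow> (\<forall>m\<ge>3. chain_defect h m = 0)"
  proof
    assume a: "\<forall>n. (1/2::real)^(n + 3) * chain_defect h (n + 3) = 0"
    show "\<forall>m\<ge>3. chain_defect h m = 0"
    proof (intro allI impI)
      fix m :: nat assume "m \<ge> 3"
      then show "chain_defect h m = 0" using a[rule_format, of "m - 3"] by simp
    qed
  qed simp
  finally show ?thesis using chain_defects_zero_iff[OF h] h by (simp add: pf_harmonics_def)
qed

lemma total_defect_mix:
  assumes h: "harmonic h" and h': "harmonic h'"
  shows "total_defect (\<lambda>t. (1 - c) * h t + c * h' t) = (1 - c) * total_defect h + c * total_defect h'"
proof -
  have cd: "chain_defect (\<lambda>t. (1 - c) * h t + c * h' t) m = (1 - c) * chain_defect h m + c * chain_defect h' m" for m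
    unfolding chain_defect_def sum_distrib_left sum.distrib ..
  have "total_defect (\<lambda>t. (1 - c) * h t + c * h' t) =
     suminf (\<lambda>n. (1 - c) * ((1/2)^(n + 3) * chain_defect h (n + 3)) + c * ((1/2)^(n + 3) * chain_defect h' (n + 3)))"
    unfolding total_defect_def cd by (intro arg_cong[where f=suminf] ext) (simp only: distrib_left mult.left_commute)
  also have "\<dots> = suminf (\<lambda>n. (1 - c) * ((1/2)^(n + 3) * chain_defect h (n + 3))) + suminf (\<lambda>n. c * ((1/2)^(n + 3) * chain_defect h' (n + 3)))"
    by (intro suminf_add[symmetric] summable_mult summable_defect h h')
  also have "\<dots> = (1 - c) * total_defect h + c * total_defect h'"
    unfolding total_defect_def by (intro arg_cong2[where f="(+)"] suminf_mult summable_defect h h')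
  finally show ?thesis .
qed

lemma zero_in_nabla: "(\<lambda>_. 0) \<in> nabla"
  by (simp add: nabla_def decseq_def)

lemma psi_basis_pf: "p \<in> nabla \<Longrightarrow> psi_basis p \<in> pf_harmonics"
  by (simp add: pf_harmonics_def harmonic_psi_basis psi_basis_vanish)

lemma exposes_pf: "exposes path_topology central_measures (total_defect \<circ> tree_density) central_pf"
  unfolding exposes_def cont_affine_def
proof (intro conjI ballI)
  have "continuous_map (subtopology (weak_topology path_topology) central_measures) (top_of_set harmonics) tree_density"
    using continuous_map_tree_density central_has_density(2)
    by (intro continuous_map_into_subtopology) (auto simp: harmonics_def)
  moreover have "continuous_map (top_of_set harmonics) euclideanreal total_defect" using continuous_on_total_defect by simp
  ultimately show "continuous_map (subtopology (weak_topology path_topology) central_measures) euclideanreal (total_defect \<circ> tree_density)"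
    by (rule continuous_map_compose)
  fix \<mu> \<nu> and c :: real assume "\<mu> \<in> central_measures" "\<nu> \<in> central_measures" "c \<in> {0..1}"
  then show "(total_defect \<circ> tree_density) (mix c \<mu> \<nu>) = (1 - c) * (total_defect \<circ> tree_density) \<mu> + c * (total_defect \<circ> tree_density) \<nu>"
    by (simp add: central_mix(2) total_defect_mix central_has_density(2))
next
  let ?\<phi> = "total_defect \<circ> tree_density"
  have nn: "0 \<le> ?\<phi> \<mu>" if "\<mu> \<in> central_measures" for \<mu>
    using total_defect_nonneg[OF central_has_density(2)[OF that]] by simp
  have z: "?\<phi> \<mu> = 0 \<longleftrightarrow> \<mu> \<in> central_pf" if "\<mu> \<in> central_measures" for \<mu>
    using total_defect_zero_iff[OF central_has_density(2)[OF that]] central_pf_iff[OF that] central_has_density(2)[OF that]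
    by (simp add: pf_harmonics_def)
  \<comment> \<open>A member of the face, which shows that the minimum of the nonnegative functional
    is 0; it belongs to the point of \<open>nabla\<close> whose whole mass is missing.\<close>
  define \<mu>0 where "\<mu>0 = law (psi_basis (\<lambda>_. 0))"
  have \<mu>0: "\<mu>0 \<in> central_pf" unfolding \<mu>0_def by (rule law_pf(1)[OF psi_basis_pf[OF zero_in_nabla]])
  show "central_pf = {\<mu>\<in>central_measures. \<forall>\<nu>\<in>central_measures. ?\<phi> \<mu> \<le> ?\<phi> \<nu>}"
  proof (intro equalityI subsetI)
    fix \<mu> assume "\<mu> \<in> central_pf"
    then have "\<mu> \<in> central_measures" "?\<phi> \<mu> = 0" using z central_pfD(1) by blast+
    then show "\<mu> \<in> {\<mu>\<in>central_measures. \<forall>\<nu>\<in>central_measures. ?\<phi> \<mu> \<le> ?\<phi> \<nu>}" using nn by auto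
  next
    fix \<mu> assume a: "\<mu> \<in> {\<mu>\<in>central_measures. \<forall>\<nu>\<in>central_measures. ?\<phi> \<mu> \<le> ?\<phi> \<nu>}"
    then have "?\<phi> \<mu> \<le> ?\<phi> \<mu>0" using central_pfD(1)[OF \<mu>0] by blast
    then have "?\<phi> \<mu> = 0" using nn[of \<mu>] a z[OF central_pfD(1)[OF \<mu>0]] \<mu>0 by simp
    then show "\<mu> \<in> central_pf" using z a by blast
  qed
qed

lemma has_sum_total_defect:
  assumes L: "pieri_state L"
  shows "((\<lambda>m. (1 / 2) ^ m * L (\<F> \<tau> \<circledast> \<F> (chain_tree m) - \<F> (chain_tree m) \<circledast> \<F> \<tau>))
    has_sum (total_defect \<circ> tree_density) (central_law L)) {3..}"
proof -
  let ?h = "\<lambda>t. L (\<F> t)"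
  have h: "harmonic ?h" and lin: "linear L" using L by (auto simp: pieri_state_iff_harmonic)
  let ?g = "\<lambda>m. (1/2::real)^m * chain_defect ?h m"
  have img: "(\<lambda>n. n + 3) ` UNIV = {3::nat..}" by (auto simp: image_iff) presburger
  have "(\<lambda>n. ?g (n + 3)) sums total_defect ?h"
    unfolding total_defect_def by (rule summable_sums[OF summable_defect[OF h]])
  then have "((\<lambda>n. ?g (n + 3)) has_sum total_defect ?h) UNIV"
    by (rule sums_nonneg_imp_has_sum) (simp add: chain_defect_bounds[OF h])
  then have "(?g has_sum total_defect ?h) {3..}"
    unfolding img[symmetric] by (subst has_sum_reindex) (auto simp: o_def)
  moreover have "(total_defect \<circ> tree_density) (central_law L) = total_defect ?h"
    by (simp add: central_law_eq_law[OF L] tree_density_law[OF h])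
  ultimately show ?thesis
    using has_sum_cong[of "{3..}" "\<lambda>m. (1 / 2) ^ m * L (\<F> \<tau> \<circledast> \<F> (chain_tree m) - \<F> (chain_tree m) \<circledast> \<F> \<tau>)" ?g]
    by (simp add: linear_chain_commutator[OF lin])
qed

lemma central_pf_proper: "central_pf \<subset> central_measures"
proof -
  obtain L where L: "pieri_state L" "\<not> chain_identity L 3" using ex_single_chain_violation[of 3] by auto
  let ?h = "\<lambda>t. L (\<F> t)"
  have h: "harmonic ?h" using L by (simp add: pieri_state_iff_harmonic)
  have "?h \<notin> pf_harmonics" using chain_identities_iff[OF L(1)] L(2) by blast
  then have "law ?h \<notin> central_pf" using central_pfD(2)[of "law ?h"] tree_density_law[OF h] by auto
  then show ?thesis using law_central[OF h] central_pfD(1) by blast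
qed

lemma tree_density_map: "continuous_map (subtopology (weak_topology path_topology) central_pf) (top_of_set pf_harmonics) tree_density"
  using continuous_map_tree_density central_pfD(2) by (intro continuous_map_into_subtopology) auto

lemma law_map: "continuous_map (top_of_set pf_harmonics) (subtopology (weak_topology path_topology) central_pf) law"
proof (rule continuous_map_into_subtopology)
  have "pf_harmonics \<subseteq> harmonics" by (auto simp: pf_harmonics_def harmonics_def)
  then show "continuous_map (top_of_set pf_harmonics) (weak_topology path_topology) law"
    using continuous_map_from_subtopology_mono[OF continuous_map_law] by blast
qed (auto simp: law_pf)

text \<open>Both directions factor through \<open>pf_harmonics\<close> with pointwise convergence,
  between which and the two spaces of measures each of the four maps is continuous.\<close>

lemma affinely_homeomorphic_pf:
  "affinely_homeomorphic path_topology central_pf (top_of_set nabla) nabla_probs"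
  unfolding affinely_homeomorphic_def
proof (intro exI conjI ballI)
  let ?X = "subtopology (weak_topology path_topology) central_pf"
  let ?Y = "subtopology (weak_topology (top_of_set nabla)) nabla_probs"
  have tX: "topspace ?X = central_pf" using central_pfD(1) by (auto simp: central_measures_def)
  have "homeomorphic_maps ?X ?Y (mixing \<circ> tree_density) (law \<circ> mixture)"
    unfolding homeomorphic_maps_def
  proof (intro conjI ballI)
    have "continuous_map (top_of_set pf_harmonics) ?Y mixing"
      using continuous_map_mixing mixing(1) by (intro continuous_map_into_subtopology) auto
    then show "continuous_map ?X ?Y (mixing \<circ> tree_density)"
      by (rule continuous_map_compose[OF tree_density_map])
    have "continuous_map ?Y (top_of_set pf_harmonics) mixture"
      using continuous_map_from_subtopology[OF continuous_map_mixture] mixture_pf_harmonic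
      by (intro continuous_map_into_subtopology) auto
    then show "continuous_map ?Y ?X (law \<circ> mixture)"
      by (rule continuous_map_compose[OF _ law_map])
    show "(law \<circ> mixture) ((mixing \<circ> tree_density) \<mu>) = \<mu>" if "\<mu> \<in> topspace ?X" for \<mu>
      using that central_pfD unfolding tX by (simp add: mixing(2))
    show "(mixing \<circ> tree_density) ((law \<circ> mixture) \<rho>) = \<rho>" if "\<rho> \<in> topspace ?Y" for \<rho>
      using that by (simp add: law_pf(2) mixture_pf_harmonic mixing_eq)
  qed
  then show "homeomorphic_map ?X ?Y (mixing \<circ> tree_density)" by (rule homeomorphic_maps_imp_map)
  fix \<mu> \<nu> and c :: real assume a: "\<mu> \<in> central_pf" "\<nu> \<in> central_pf" "c \<in> {0..1}"
  note pm = mixing[OF central_pfD(2)[OF a(1)]] and pn = mixing[OF central_pfD(2)[OF a(2)]]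
  have "tree_density (mix c \<mu> \<nu>) = mixture (mix c (mixing (tree_density \<mu>)) (mixing (tree_density \<nu>)))"
    unfolding mixture_mix[OF pm(1) pn(1) a(3)] central_mix(2)[OF central_pfD(1)[OF a(1)] central_pfD(1)[OF a(2)] a(3)] pm(2) pn(2) ..
  then show "(mixing \<circ> tree_density) (mix c \<mu> \<nu>) = mix c ((mixing \<circ> tree_density) \<mu>) ((mixing \<circ> tree_density) \<nu>)"
    using mixing_eq[OF mix_prob_measures[OF pm(1) pn(1) a(3)]] by simp
qed

section \<open>Extreme points\<close>

definition dirac :: "(nat \<Rightarrow> real) \<Rightarrow> (nat \<Rightarrow> real) measure" where
  "dirac p = return (restrict_space borel nabla) p"

lemma singleton_nabla: "p \<in> nabla \<Longrightarrow> {p} \<in> sets (restrict_space borel nabla)"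
  unfolding sets_restrict_borel_closed[OF compact_imp_closed[OF compact_nabla]] by (auto intro: sigma_sets.Basic)

lemma dirac_prob: "p \<in> nabla \<Longrightarrow> dirac p \<in> nabla_probs"
  unfolding dirac_def prob_measures_nabla by (simp add: prob_space_return space_restrict_space)

lemma integral_dirac:
  assumes p: "p \<in> nabla" and f: "continuous_on nabla f" shows "(\<integral>x. f x \<partial>dirac p) = (f p :: real)"
  unfolding dirac_def using p borel_measurable_continuous_on_restrict[OF f] by (intro integral_return) (simp_all add: space_restrict_space)

lemma mixture_dirac: "p \<in> nabla \<Longrightarrow> mixture (dirac p) = psi_basis p"
  unfolding mixture_def by (simp add: integral_dirac continuous_on_psi_basis)

lemma dirac_eqI:
  assumes \<rho>: "\<rho> \<in> nabla_probs" and p: "p \<in> nabla" and m: "measure \<rho> {p} = 1" shows "\<rho> = dirac p"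
proof (rule measure_eqI)
  interpret prob_space \<rho> by (rule nabla_probsD(1)[OF \<rho>])
  note s = nabla_probsD(2)[OF \<rho>]
  show "sets \<rho> = sets (dirac p)" by (simp add: s dirac_def)
  have sp: "{p} \<in> sets \<rho>" using singleton_nabla[OF p] s by simp
  fix A assume A: "A \<in> sets \<rho>"
  have "measure \<rho> A = indicator A p"
  proof (cases "p \<in> A")
    case True
    then have "measure \<rho> {p} \<le> measure \<rho> A" using A by (intro finite_measure_mono) auto
    then show ?thesis using m True prob_le_1[of A] by simp
  next
    case False
    then have "A \<subseteq> space \<rho> - {p}" using sets.sets_into_space[OF A] by auto
    then have "measure \<rho> A \<le> measure \<rho> (space \<rho> - {p})" using sp by (intro finite_measure_mono) auto
    then show ?thesis using m False prob_compl[OF sp] measure_nonneg[of \<rho> A] by simp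
  qed
  then show "emeasure \<rho> A = emeasure (dirac p) A"
    using A s by (simp add: emeasure_eq_measure dirac_def emeasure_return ennreal_indicator)
qed

lemma measure_dirac: "p \<in> nabla \<Longrightarrow> A \<in> sets (restrict_space borel nabla) \<Longrightarrow> measure (dirac p) A = indicator A p"
  by (simp add: dirac_def measure_return)

text \<open>If no point had mass 1, every point would have a ball of measure 0, because the balls
  shrinking to it cannot all have measure 1; finitely many of them would cover
  \<open>nabla\<close>.\<close>

lemma zero_one_dirac:
  assumes \<rho>: "\<rho> \<in> nabla_probs" and z: "\<And>A. A \<in> sets \<rho> \<Longrightarrow> measure \<rho> A = 0 \<or> measure \<rho> A = 1"
  shows "\<exists>p\<in>nabla. \<rho> = dirac p"
proof (rule ccontr)
  assume neg: "\<not> (\<exists>p\<in>nabla. \<rho> = dirac p)"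
  interpret prob_space \<rho> by (rule nabla_probsD(1)[OF \<rho>])
  note s = nabla_probsD(2)[OF \<rho>]
  have inS: "nabla \<inter> A \<in> sets \<rho>" if "A \<in> sets borel" for A
    unfolding s sets_restrict_space using that by blast
  have "\<exists>n. measure \<rho> (nabla \<inter> cball p (1 / real (Suc n))) = 0" if p: "p \<in> nabla" for p
  proof (rule ccontr)
    let ?A = "\<lambda>n. nabla \<inter> cball p (1 / real (Suc n))"
    assume "\<nexists>n. measure \<rho> (?A n) = 0"
    then have one: "measure \<rho> (?A n) = 1" for n using z[OF inS] by (metis borel_closed closed_cball)
    have dec: "decseq ?A"
    proof (rule decseq_SucI)
      fix n have "1 / real (Suc (Suc n)) \<le> 1 / real (Suc n)" by (simp add: frac_le)
      then show "?A (Suc n) \<subseteq> ?A n" using subset_cball by blast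
    qed
    have "(\<lambda>n. measure \<rho> (?A n)) \<longlonglongrightarrow> measure \<rho> (\<Inter>n. ?A n)"
      using inS by (intro finite_Lim_measure_decseq dec) auto
    then have "measure \<rho> (\<Inter>n. ?A n) = 1" unfolding one by (simp add: LIMSEQ_const_iff)
    moreover have "(\<Inter>n. ?A n) = {p}"
    proof (intro equalityI subsetI)
      fix x assume x: "x \<in> (\<Inter>n. ?A n)"
      have "dist p x \<le> 0"
      proof (rule field_le_epsilon)
        fix e :: real assume "e > 0"
        then obtain n where n: "1 / real (Suc n) < e" using nat_approx_posE by blast
        have "x \<in> ?A n" using x by blast
        then show "dist p x \<le> 0 + e" using n by simp
      qed
      then show "x \<in> {p}" by simp
    qed (use p in auto)
    ultimately show False using dirac_eqI[OF \<rho> p] neg p by auto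
  qed
  then obtain n where n: "\<And>p. p \<in> nabla \<Longrightarrow> measure \<rho> (nabla \<inter> cball p (1 / real (Suc (n p)))) = 0" by metis
  have "nabla \<subseteq> (\<Union>p\<in>nabla. ball p (1 / real (Suc (n p))))"
  proof
    fix p assume "p \<in> nabla"
    then show "p \<in> (\<Union>p\<in>nabla. ball p (1 / real (Suc (n p))))" by (intro UN_I[of p]) auto
  qed
  then obtain C where C: "C \<subseteq> nabla" "finite C" "nabla \<subseteq> (\<Union>p\<in>C. ball p (1 / real (Suc (n p))))"
    by (rule compactE_image[OF compact_nabla, rotated]) auto
  have "nabla \<subseteq> (\<Union>p\<in>C. nabla \<inter> cball p (1 / real (Suc (n p))))" using C(3) ball_subset_cball by blast
  then have "measure \<rho> nabla \<le> measure \<rho> (\<Union>p\<in>C. nabla \<inter> cball p (1 / real (Suc (n p))))"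
    using C(2) inS by (intro finite_measure_mono sets.finite_UN) auto
  also have "\<dots> \<le> (\<Sum>p\<in>C. measure \<rho> (nabla \<inter> cball p (1 / real (Suc (n p)))))"
    using C(2) inS by (intro finite_measure_subadditive_finite) auto
  also have "\<dots> = 0" using n C(1) by (intro sum.neutral) auto
  finally show False using prob_space nabla_probsD(3)[OF \<rho>] by simp
qed

abbreviation point_law :: "(nat \<Rightarrow> real) \<Rightarrow> (nat \<Rightarrow> edge) measure" where
  "point_law p \<equiv> law (psi_basis p)"

text \<open>Extremality is transported to the mixing measures: conditioning on a set of intermediate
  measure would split the law, so an extreme law mixes by a 0-1 measure; conversely a point mass
  admits no proper decomposition.\<close>

lemma extreme_laws_pf: "extreme_laws central_pf = point_law ` nabla"
proof (intro equalityI subsetI)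
  fix \<mu> assume \<mu>: "\<mu> \<in> extreme_laws central_pf"
  then have pf: "\<mu> \<in> central_pf" and ext: "\<And>\<nu> \<kappa> c. \<nu> \<in> central_pf \<Longrightarrow> \<kappa> \<in> central_pf \<Longrightarrow> c \<in> {0<..<1} \<Longrightarrow> \<mu> = mix c \<nu> \<kappa> \<Longrightarrow> \<nu> = \<mu> \<and> \<kappa> = \<mu>"
    by (auto simp: extreme_laws_def)
  define \<rho> where "\<rho> = mixing (tree_density \<mu>)"
  have \<rho>: "\<rho> \<in> nabla_probs" "mixture \<rho> = tree_density \<mu>" using mixing[OF central_pfD(2)[OF pf]] by (auto simp: \<rho>_def)
  have "measure \<rho> A = 0 \<or> measure \<rho> A = 1" if A: "A \<in> sets \<rho>" for A
  proof (rule ccontr)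
    assume "\<not> (measure \<rho> A = 0 \<or> measure \<rho> A = 1)"
    then have c: "0 < measure \<rho> A" "measure \<rho> A < 1"
      using measure_nonneg[of \<rho> A] prob_space.prob_le_1[OF nabla_probsD(1)[OF \<rho>(1)], of A] by linarith+
    let ?U = "uniform_measure \<rho> A" and ?V = "uniform_measure \<rho> (space \<rho> - A)" and ?c = "measure \<rho> A"
    note um = mix_uniform_measure[OF nabla_probsD(1)[OF \<rho>(1)] A c]
    have U: "?U \<in> nabla_probs" "?V \<in> nabla_probs"
      using um nabla_probsD(2)[OF \<rho>(1)] by (simp_all add: prob_measures_nabla)
    have c01: "?c \<in> {0..1}" using c by simp
    have "\<mu> = law (mixture (mix ?c ?V ?U))" using central_pfD(3)[OF pf] \<rho>(2) um(1) by simp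
    also have "law (mixture (mix ?c ?V ?U)) = mix ?c (law (mixture ?V)) (law (mixture ?U))"
      unfolding mixture_mix[OF U(2,1) c01] by (rule law_mix[OF mixture_pf_harmonic[OF U(2)] mixture_pf_harmonic[OF U(1)] c01])
    finally have e: "\<mu> = mix ?c (law (mixture ?V)) (law (mixture ?U))" .
    have c': "?c \<in> {0<..<1}" using c by simp
    have "law (mixture ?U) = \<mu>"
      by (rule conjunct2[OF ext[OF law_pf(1)[OF mixture_pf_harmonic[OF U(2)]] law_pf(1)[OF mixture_pf_harmonic[OF U(1)]] c' e]])
    then have "mixture ?U = mixture \<rho>" using law_pf(2)[OF mixture_pf_harmonic[OF U(1)]] \<rho>(2) by simp
    then have "?U = \<rho>" by (rule mixture_inj[OF U(1) \<rho>(1)])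
    moreover have "measure ?U A = 1"
    proof -
      interpret prob_space \<rho> by (rule nabla_probsD(1)[OF \<rho>(1)])
      have "emeasure \<rho> A \<noteq> 0" using c by (auto simp: measure_def)
      then have "measure ?U A = measure \<rho> (A \<inter> A) / measure \<rho> A" using A by (intro measure_uniform_measure) auto
      then show ?thesis using c by simp
    qed
    ultimately show False using c by simp
  qed
  then obtain p where p: "p \<in> nabla" "\<rho> = dirac p" using zero_one_dirac[OF \<rho>(1)] by blast
  then have "\<mu> = point_law p" using \<rho>(2) mixture_dirac[OF p(1)] central_pfD(3)[OF pf] by simp
  then show "\<mu> \<in> point_law ` nabla" using p(1) by blast
next
  fix \<mu> assume "\<mu> \<in> point_law ` nabla"
  then obtain p where p: "p \<in> nabla" "\<mu> = point_law p" by blast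
  have pf: "\<mu> \<in> central_pf" unfolding p(2) by (rule law_pf(1)[OF psi_basis_pf[OF p(1)]])
  have "\<nu> = \<mu> \<and> \<kappa> = \<mu>" if n: "\<nu> \<in> central_pf" "\<kappa> \<in> central_pf" and c: "c \<in> {0<..<1}" and e: "\<mu> = mix c \<nu> \<kappa>" for \<nu> \<kappa> and c :: real
  proof -
    let ?a = "mixing (tree_density \<nu>)" and ?b = "mixing (tree_density \<kappa>)"
    note a = mixing[OF central_pfD(2)[OF n(1)]] and b = mixing[OF central_pfD(2)[OF n(2)]]
    have c01: "c \<in> {0..1}" using c by simp
    have "mixture (dirac p) = tree_density \<mu>" unfolding p(2) mixture_dirac[OF p(1)] law_pf(2)[OF psi_basis_pf[OF p(1)]] ..
    also have "\<dots> = mixture (mix c ?a ?b)"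
      unfolding e mixture_mix[OF a(1) b(1) c01] central_mix(2)[OF central_pfD(1)[OF n(1)] central_pfD(1)[OF n(2)] c01] a(2) b(2) ..
    finally have d: "dirac p = mix c ?a ?b" by (rule mixture_inj[OF dirac_prob[OF p(1)] mix_prob_measures[OF a(1) b(1) c01]])
    have ps: "{p} \<in> sets (restrict_space borel nabla)" by (rule singleton_nabla[OF p(1)])
    have "1 = measure (mix c ?a ?b) {p}" unfolding d[symmetric] using measure_dirac[OF p(1) ps] by simp
    also have "\<dots> = (1 - c) * measure ?a {p} + c * measure ?b {p}"
      using c ps nabla_probsD[OF a(1)] nabla_probsD[OF b(1)] by (intro measure_mix) auto
    \<comment> \<open>Both summands are nonnegative with positive coefficients, so both components
      give \<open>p\<close> full mass.\<close>
    finally have s: "(1 - c) * (1 - measure ?a {p}) + c * (1 - measure ?b {p}) = 0" by (simp add: algebra_simps)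
    have le: "measure ?a {p} \<le> 1" "measure ?b {p} \<le> 1"
      using prob_space.prob_le_1[OF nabla_probsD(1)[OF a(1)]] prob_space.prob_le_1[OF nabla_probsD(1)[OF b(1)]] by auto
    have "0 \<le> (1 - c) * (1 - measure ?a {p})" "0 \<le> c * (1 - measure ?b {p})" using le c by simp_all
    then have "(1 - c) * (1 - measure ?a {p}) = 0" "c * (1 - measure ?b {p}) = 0" using s by linarith+
    then have "measure ?a {p} = 1" "measure ?b {p} = 1" using c by auto
    then have "?a = dirac p" "?b = dirac p" using dirac_eqI a(1) b(1) p(1) by blast+
    then have "tree_density \<nu> = psi_basis p" "tree_density \<kappa> = psi_basis p" using a(2) b(2) mixture_dirac[OF p(1)] by simp_all
    then show ?thesis using central_pfD(3)[OF n(1)] central_pfD(3)[OF n(2)] p(2) by simp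
  qed
  then show "\<mu> \<in> extreme_laws central_pf" using pf by (auto simp: extreme_laws_def)
qed

section \<open>Barycentres\<close>

context
  fixes \<Phi> :: "(rtree \<Rightarrow> real) \<Rightarrow> real"
  assumes cont: "continuous_on pf_harmonics \<Phi>"
    and affine: "\<And>h h' c. h \<in> pf_harmonics \<Longrightarrow> h' \<in> pf_harmonics \<Longrightarrow> c \<in> {0..1} \<Longrightarrow>
      \<Phi> (\<lambda>t. (1 - c) * h t + c * h' t) = (1 - c) * \<Phi> h + c * \<Phi> h'"
begin

lemma continuous_on_psi: "continuous_on nabla psi_basis"
  by (intro continuous_on_coordinatewise_then_product continuous_on_psi_basis)

lemma continuous_on_affine_psi: "continuous_on nabla (\<lambda>p. \<Phi> (psi_basis p))"
  by (rule continuous_on_compose2[OF cont continuous_on_psi]) (auto simp: psi_basis_pf)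

text \<open>One atom is split off by conditioning, which leaves a smaller support; affinity and
  \<open>integral_mix\<close> recombine the two parts.\<close>

lemma integral_affine_finite:
  assumes "finite S" "S \<subseteq> nabla" "\<rho> \<in> nabla_probs" "measure \<rho> S = 1"
  shows "(\<integral>p. \<Phi> (psi_basis p) \<partial>\<rho>) = \<Phi> (mixture \<rho>)"
  using assms
proof (induction S arbitrary: \<rho> rule: finite_induct)
  case empty
  then show ?case by simp
next
  case (insert s S)
  note \<rho> = insert.prems(2)
  interpret prob_space \<rho> by (rule nabla_probsD(1)[OF \<rho>])
  note st = nabla_probsD(2)[OF \<rho>]
  have s: "s \<in> nabla" and S: "S \<subseteq> nabla" using insert.prems(1) by auto
  have point: "(\<integral>p. \<Phi> (psi_basis p) \<partial>\<sigma>) = \<Phi> (mixture \<sigma>)" if "\<sigma> \<in> nabla_probs" "measure \<sigma> {s} = 1" for \<sigma>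
    unfolding dirac_eqI[OF that(1) s that(2)] mixture_dirac[OF s] by (rule integral_dirac[OF s continuous_on_affine_psi])
  have sS: "{s} \<in> sets \<rho>" "S \<in> sets \<rho>"
  proof -
    show "{s} \<in> sets \<rho>" using singleton_nabla[OF s] st by simp
    have "(\<Union>x\<in>S. {x}) \<in> sets \<rho>" using S singleton_nabla st insert.hyps(1) by (intro sets.finite_UN) auto
    then show "S \<in> sets \<rho>" by simp
  qed
  have un: "measure \<rho> {s} + measure \<rho> S = 1"
    using finite_measure_Union[OF sS] insert.hyps(2) insert.prems(3) by simp
  let ?c = "measure \<rho> {s}"
  consider "?c = 0" | "?c = 1" | "0 < ?c" "?c < 1" using measure_nonneg[of \<rho> "{s}"] prob_le_1[of "{s}"] by linarith
  then show ?case
  proof cases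
    case 1
    then show ?thesis using un by (intro insert.IH S \<rho>) simp
  next
    case 2
    then show ?thesis by (rule point[OF \<rho>])
  next
    case 3
    let ?U = "uniform_measure \<rho> {s}" and ?V = "uniform_measure \<rho> (space \<rho> - {s})"
    note um = mix_uniform_measure[OF prob_space_axioms sS(1) 3]
    have c01: "?c \<in> {0..1}" using 3 by simp
    have U: "?U \<in> nabla_probs" "?V \<in> nabla_probs" using um(2,3) st by (simp_all add: prob_measures_nabla)
    have m: "measure (uniform_measure \<rho> A) B = measure \<rho> (A \<inter> B) / measure \<rho> A"
      if "measure \<rho> A > 0" "B \<in> sets \<rho>" for A B
    proof (rule measure_uniform_measure)
      show "emeasure \<rho> A \<noteq> 0" using that(1) by (auto simp: measure_def)
    qed (use that in auto)
    have "measure ?U {s} = 1" using m[of "{s}" "{s}"] 3 sS by simp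
    then have pU: "(\<integral>p. \<Phi> (psi_basis p) \<partial>?U) = \<Phi> (mixture ?U)" by (rule point[OF U(1)])
    have mc: "measure \<rho> (space \<rho> - {s}) = 1 - ?c" by (rule prob_compl[OF sS(1)])
    have "(space \<rho> - {s}) \<inter> S = S" using sets.sets_into_space[OF sS(2)] insert.hyps(2) by auto
    then have "measure ?V S = 1" using m[of "space \<rho> - {s}" S] 3 sS mc un by simp
    then have pV: "(\<integral>p. \<Phi> (psi_basis p) \<partial>?V) = \<Phi> (mixture ?V)" by (rule insert.IH[OF S U(2)])
    obtain B where B: "\<And>p. p \<in> nabla \<Longrightarrow> \<bar>\<Phi> (psi_basis p)\<bar> \<le> B"
      by (rule nabla_bounded[OF continuous_on_affine_psi]) (rule that)
    have "(\<integral>p. \<Phi> (psi_basis p) \<partial>mix ?c ?V ?U) = (1 - ?c) * (\<integral>p. \<Phi> (psi_basis p) \<partial>?V) + ?c * (\<integral>p. \<Phi> (psi_basis p) \<partial>?U)"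
    proof (rule integral_mix)
      show "\<bar>\<Phi> (psi_basis p)\<bar> \<le> B" if "p \<in> space ?V" for p using that B nabla_probsD(3)[OF U(2)] by simp
      show "(\<lambda>p. \<Phi> (psi_basis p)) \<in> borel_measurable ?V" by (rule nabla_measurable[OF U(2) continuous_on_affine_psi])
    qed (use um(2,3) 3 in auto)
    also have "\<dots> = \<Phi> (mixture (mix ?c ?V ?U))"
      unfolding pU pV mixture_mix[OF U(2,1) c01] by (rule affine[symmetric, OF mixture_pf_harmonic[OF U(2)] mixture_pf_harmonic[OF U(1)] c01])
    finally show ?thesis using um(1) by simp
  qed
qed

end

text \<open>Rounding the coordinates down to multiples of \<open>1/n\<close> leaves only finitely many points of
  \<open>nabla\<close>, because \<open>p\<^sub>i \<le> 1/(i+1)\<close>.\<close>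

definition trunc :: "nat \<Rightarrow> (nat \<Rightarrow> real) \<Rightarrow> nat \<Rightarrow> real" where
  "trunc n p i = real (nat \<lfloor>real n * p i\<rfloor>) / real n"

lemma trunc_bounds:
  assumes "n > 0" "0 \<le> p i" shows "0 \<le> trunc n p i" "trunc n p i \<le> p i" "p i - 1 / real n \<le> trunc n p i"
proof -
  have f: "real (nat \<lfloor>real n * p i\<rfloor>) = of_int \<lfloor>real n * p i\<rfloor>" using assms by simp
  show "0 \<le> trunc n p i" by (simp add: trunc_def)
  show "trunc n p i \<le> p i" unfolding trunc_def f using assms by (simp add: divide_le_eq mult.commute)
  have "real n * p i - 1 \<le> of_int \<lfloor>real n * p i\<rfloor>" by linarith
  then have "(real n * p i - 1) / real n \<le> trunc n p i" unfolding trunc_def f by (rule divide_right_mono) simp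
  then show "p i - 1 / real n \<le> trunc n p i" using assms by (simp add: diff_divide_distrib)
qed

lemma trunc_nabla:
  assumes n: "n > 0" and p: "p \<in> nabla" shows "trunc n p \<in> nabla"
proof -
  note b = trunc_bounds[OF n nabla_props(1)[OF p]]
  have sp: "summable p" "suminf p \<le> 1" using p by (auto simp: nabla_def)
  have s: "summable (trunc n p)"
    by (rule summable_comparison_test'[OF sp(1), of 0]) (use b in auto)
  have "suminf (trunc n p) \<le> suminf p" by (rule suminf_le[OF b(2) s sp(1)])
  moreover have "decseq (trunc n p)"
  proof (rule decseq_SucI)
    fix i
    have "\<lfloor>real n * p (Suc i)\<rfloor> \<le> \<lfloor>real n * p i\<rfloor>" using nabla_props(5)[OF p, of i "Suc i"] by (intro floor_mono mult_left_mono) auto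
    then show "trunc n p (Suc i) \<le> trunc n p i" unfolding trunc_def by (intro divide_right_mono) auto
  qed
  ultimately show ?thesis using s sp(2) b(1) by (simp add: nabla_def)
qed

lemma finite_trunc_range: assumes n: "n > 0" shows "finite (trunc n ` nabla)"
proof -
  let ?G = "\<lambda>f i. if i < n then real (f i) / real n else (0::real)"
  have "trunc n ` nabla \<subseteq> ?G ` ({..<n} \<rightarrow>\<^sub>E {..n})"
  proof
    fix q assume "q \<in> trunc n ` nabla"
    then obtain p where p: "p \<in> nabla" and q: "q = trunc n p" by blast
    let ?f = "\<lambda>i. nat \<lfloor>real n * p i\<rfloor>"
    have le: "?f i \<le> n" for i
    proof -
      have "real n * p i \<le> real n" using nabla_props(2)[OF p] by (simp add: mult_left_le)
      then show ?thesis by linarith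
    qed
    \<comment> \<open>For \<open>i \<ge> n\<close> the bound on \<open>p_i\<close> gives
      \<open>n p_i + p_i \<le> 1\<close>, which forces \<open>n p_i < 1\<close>, also when
      \<open>p_i = 0\<close>.\<close>
    have z: "?f i = 0" if "n \<le> i" for i
    proof -
      have "real n * p i \<le> real i * p i" using that nabla_props(1)[OF p] by (intro mult_right_mono) auto
      moreover have "real (Suc i) * p i \<le> 1" by (rule nabla_props(4)[OF p])
      moreover have "0 \<le> p i" by (rule nabla_props(1)[OF p])
      ultimately have "real n * p i + p i \<le> 1" "0 \<le> p i" by (simp_all add: algebra_simps)
      then have "real n * p i < 1" by (cases "p i = 0") auto
      then show ?thesis by linarith
    qed
    have "q = ?G (restrict ?f {..<n})" unfolding q by (rule ext) (use z in \<open>auto simp: trunc_def\<close>)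
    moreover have "restrict ?f {..<n} \<in> {..<n} \<rightarrow>\<^sub>E {..n}" using le by auto
    ultimately show "q \<in> ?G ` ({..<n} \<rightarrow>\<^sub>E {..n})" by blast
  qed
  then show ?thesis by (rule finite_subset) (intro finite_imageI finite_PiE, auto)
qed

lemma trunc_tendsto:
  assumes p: "p \<in> nabla" shows "(\<lambda>n. trunc (Suc n) p) \<longlonglongrightarrow> p"
proof (rule tendsto_functions)
  fix i
  have l: "(\<lambda>n. 1 / real (Suc n)) \<longlonglongrightarrow> 0" by (rule LIMSEQ_Suc[OF lim_1_over_n])
  have "(\<lambda>n. p i - 1 / real (Suc n)) \<longlonglongrightarrow> p i" using tendsto_diff[OF tendsto_const[of "p i"] l] by simp
  then show "(\<lambda>n. trunc (Suc n) p i) \<longlonglongrightarrow> p i"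
    by (rule real_tendsto_sandwich[rotated 2, OF _ tendsto_const])
      (use trunc_bounds[OF _ nabla_props(1)[OF p], of "Suc _"] in \<open>auto intro!: always_eventually\<close>)
qed

lemma trunc_measurable:
  assumes n: "n > 0" shows "trunc n \<in> measurable (restrict_space borel nabla) (restrict_space borel nabla)"
proof (rule measurable_restrict_space2)
  show "trunc n \<in> space (restrict_space borel nabla) \<rightarrow> nabla" using trunc_nabla[OF n] by (auto simp: space_restrict_space)
  have "(\<lambda>p. trunc n p i) \<in> borel_measurable (restrict_space borel nabla)" for i
  proof -
    have "(\<lambda>p::nat \<Rightarrow> real. p i) \<in> borel_measurable (restrict_space borel nabla)"
      by (intro measurable_restrict_space1 borel_measurable_continuous_onI continuous_on_coordinate)
    moreover have "(\<lambda>x::real. real (nat \<lfloor>real n * x\<rfloor>) / real n) \<in> borel_measurable borel" by measurable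
    ultimately show ?thesis unfolding trunc_def by (rule measurable_compose)
  qed
  then show "trunc n \<in> borel_measurable (restrict_space borel nabla)"
    by (rule measurable_coordinatewise_then_product)
qed

context
  fixes \<rho> assumes \<rho>: "\<rho> \<in> nabla_probs"
begin

definition trunc_law :: "nat \<Rightarrow> (nat \<Rightarrow> real) measure" where
  "trunc_law n = distr \<rho> (restrict_space borel nabla) (trunc n)"

lemma trunc_measurable_law: "n > 0 \<Longrightarrow> trunc n \<in> measurable \<rho> (restrict_space borel nabla)"
  using trunc_measurable measurable_cong_sets[OF nabla_probsD(2)[OF \<rho>] refl] by blast

lemma trunc_law_prob: assumes "n > 0" shows "trunc_law n \<in> nabla_probs"
proof -
  interpret prob_space \<rho> by (rule nabla_probsD(1)[OF \<rho>])
  show ?thesis using prob_space_distr[OF trunc_measurable_law[OF assms]] by (simp add: prob_measures_nabla trunc_law_def)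
qed

lemma integral_trunc_law:
  fixes f :: "(nat \<Rightarrow> real) \<Rightarrow> real"
  assumes "n > 0" "continuous_on nabla f" shows "(\<integral>p. f p \<partial>trunc_law n) = (\<integral>p. f (trunc n p) \<partial>\<rho>)"
  unfolding trunc_law_def
  by (rule integral_distr[OF trunc_measurable_law[OF assms(1)] borel_measurable_continuous_on_restrict[OF assms(2)]])

lemma trunc_law_tendsto:
  fixes f :: "(nat \<Rightarrow> real) \<Rightarrow> real"
  assumes f: "continuous_on nabla f" shows "(\<lambda>n. \<integral>p. f p \<partial>trunc_law (Suc n)) \<longlonglongrightarrow> (\<integral>p. f p \<partial>\<rho>)"
proof -
  interpret prob_space \<rho> by (rule nabla_probsD(1)[OF \<rho>])
  note sp = nabla_probsD(3)[OF \<rho>]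
  obtain B where B: "\<And>p. p \<in> nabla \<Longrightarrow> \<bar>f p\<bar> \<le> B" by (rule nabla_bounded[OF f]) (rule that)
  have "(\<lambda>n. \<integral>p. f (trunc (Suc n) p) \<partial>\<rho>) \<longlonglongrightarrow> (\<integral>p. f p \<partial>\<rho>)"
  proof (rule integral_dominated_convergence[where w="\<lambda>_. B"])
    show "(\<lambda>p. f p) \<in> borel_measurable \<rho>" by (rule nabla_measurable[OF \<rho> f])
    show "(\<lambda>p. f (trunc (Suc n) p)) \<in> borel_measurable \<rho>" for n
      by (rule measurable_compose[OF trunc_measurable_law borel_measurable_continuous_on_restrict[OF f]]) simp
    show "AE p in \<rho>. (\<lambda>n. f (trunc (Suc n) p)) \<longlonglongrightarrow> f p"
      by (rule AE_I2) (rule continuous_on_tendsto_compose[OF f trunc_tendsto], auto simp: sp trunc_nabla)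
    show "AE p in \<rho>. norm (f (trunc (Suc n) p)) \<le> B" for n
      by (rule AE_I2) (use B trunc_nabla[of "Suc n"] sp in auto)
  qed simp
  then show ?thesis by (simp add: integral_trunc_law f)
qed

lemma trunc_law_finite: assumes n: "n > 0" shows "measure (trunc_law n) (trunc n ` nabla) = 1"
proof -
  interpret prob_space \<rho> by (rule nabla_probsD(1)[OF \<rho>])
  have "(\<Union>q\<in>trunc n ` nabla. {q}) \<in> sets (restrict_space borel nabla)"
    using finite_trunc_range[OF n] singleton_nabla trunc_nabla[OF n] by (intro sets.finite_UN) auto
  then have s: "trunc n ` nabla \<in> sets (restrict_space borel nabla)" by simp
  have "trunc n -` trunc n ` nabla \<inter> space \<rho> = space \<rho>" using nabla_probsD(3)[OF \<rho>] by auto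
  then show ?thesis unfolding trunc_law_def measure_distr[OF trunc_measurable_law[OF n] s] using prob_space by simp
qed

text \<open>Truncation gives finitely supported laws, where \<open>integral_affine_finite\<close>
  applies. The left side passes to the limit by dominated convergence, the right one because the
  mixtures converge and \<Phi> is continuous.\<close>

lemma integral_affine:
  assumes cont: "continuous_on pf_harmonics \<Phi>"
    and affine: "\<And>h h' c. h \<in> pf_harmonics \<Longrightarrow> h' \<in> pf_harmonics \<Longrightarrow> c \<in> {0..1} \<Longrightarrow>
      \<Phi> (\<lambda>t. (1 - c) * h t + c * h' t) = (1 - c) * \<Phi> h + c * \<Phi> h'"
  shows "(\<integral>p. \<Phi> (psi_basis p) \<partial>\<rho>) = (\<Phi> (mixture \<rho>) :: real)"
proof (rule LIMSEQ_unique)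
  show "(\<lambda>n. \<integral>p. \<Phi> (psi_basis p) \<partial>trunc_law (Suc n)) \<longlonglongrightarrow> (\<integral>p. \<Phi> (psi_basis p) \<partial>\<rho>)"
    by (rule trunc_law_tendsto, rule continuous_on_affine_psi[OF cont]) (rule affine)
  have "(\<integral>p. \<Phi> (psi_basis p) \<partial>trunc_law (Suc n)) = \<Phi> (mixture (trunc_law (Suc n)))" for n
  proof (rule integral_affine_finite[OF cont])
    show "finite (trunc (Suc n) ` nabla)" by (rule finite_trunc_range) simp
    show "trunc (Suc n) ` nabla \<subseteq> nabla" using trunc_nabla by auto
    show "trunc_law (Suc n) \<in> nabla_probs" by (rule trunc_law_prob) simp
    show "measure (trunc_law (Suc n)) (trunc (Suc n) ` nabla) = 1" by (rule trunc_law_finite) simp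
  qed (rule affine)
  moreover have "(\<lambda>n. \<Phi> (mixture (trunc_law (Suc n)))) \<longlonglongrightarrow> \<Phi> (mixture \<rho>)"
  proof (rule continuous_on_tendsto_compose[OF cont])
    show "(\<lambda>n. mixture (trunc_law (Suc n))) \<longlonglongrightarrow> mixture \<rho>"
      by (rule tendsto_functions) (unfold mixture_def, rule trunc_law_tendsto[OF continuous_on_psi_basis])
  qed (simp_all add: mixture_pf_harmonic \<rho> trunc_law_prob)
  ultimately show "(\<lambda>n. \<integral>p. \<Phi> (psi_basis p) \<partial>trunc_law (Suc n)) \<longlonglongrightarrow> \<Phi> (mixture \<rho>)" by simp
qed

end

section \<open>The extreme boundary and representing measures\<close>

abbreviation law_topology :: "(nat \<Rightarrow> edge) measure topology" where
  "law_topology \<equiv> weak_topology path_topology"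

abbreviation extreme_topology :: "(nat \<Rightarrow> edge) measure topology" where
  "extreme_topology \<equiv> subtopology law_topology (extreme_laws central_pf)"

lemma extreme_laws_subset: "extreme_laws central_pf \<subseteq> central_pf"
  by (auto simp: extreme_laws_def)

lemma topspace_extreme: "topspace extreme_topology = extreme_laws central_pf"
  using extreme_laws_subset central_pfD(1) by (auto simp: central_measures_def)

lemma continuous_map_on_extreme:
  "continuous_map (subtopology law_topology central_pf) Y f \<Longrightarrow> continuous_map extreme_topology Y f"
  using continuous_map_from_subtopology_mono extreme_laws_subset by blast

lemma psi_basis_map: "continuous_map (top_of_set nabla) (top_of_set pf_harmonics) psi_basis"
  by (auto simp: psi_basis_pf continuous_on_psi_basis intro!: continuous_on_coordinatewise_then_product)

lemma point_law_map: "continuous_map (top_of_set nabla) extreme_topology point_law"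
proof (rule continuous_map_into_subtopology)
  have "continuous_map (top_of_set nabla) (subtopology law_topology central_pf) (law \<circ> psi_basis)"
    by (rule continuous_map_compose[OF psi_basis_map law_map])
  then show "continuous_map (top_of_set nabla) law_topology point_law"
    unfolding o_def by (rule continuous_map_into_fulltopology)
qed (auto simp: extreme_laws_pf)

text \<open>A continuous inverse of \<open>point_law\<close> on the extreme points: the mean of a
  point mass is the point itself.\<close>

definition location :: "(nat \<Rightarrow> edge) measure \<Rightarrow> nat \<Rightarrow> real" where
  "location \<mu> i = (\<integral>p. p i \<partial>mixing (tree_density \<mu>))"

lemma location_point_law:
  assumes p: "p \<in> nabla" shows "location (point_law p) = p"
proof
  fix i
  have "mixing (psi_basis p) = dirac p" using mixing_eq[OF dirac_prob[OF p]] mixture_dirac[OF p] by simp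
  then show "location (point_law p) i = p i"
    using integral_dirac[OF p continuous_on_coordinate[of nabla i]] by (simp add: location_def law_pf(2)[OF psi_basis_pf[OF p]])
qed

lemma location_map: "continuous_map extreme_topology (top_of_set nabla) location"
proof (rule continuous_map_into_subtopology)
  have "continuous_map (subtopology law_topology central_pf) euclidean location"
  proof (rule continuous_map_into_functions)
    fix i
    have "bounded ((\<lambda>p. p i) ` topspace (top_of_set nabla))"
      using compact_imp_bounded[OF compact_continuous_image[OF continuous_on_coordinate compact_nabla]] by simp
    then have "continuous_map (weak_topology (top_of_set nabla)) euclideanreal (\<lambda>\<rho>. \<integral>p. p i \<partial>\<rho>)"
      by (intro continuous_map_weak_integral) (simp_all add: continuous_on_coordinate)
    then have "continuous_map (subtopology law_topology central_pf) euclideanreal ((\<lambda>\<rho>. \<integral>p. p i \<partial>\<rho>) \<circ> (mixing \<circ> tree_density))"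
      by (rule continuous_map_compose[OF continuous_map_compose[OF tree_density_map continuous_map_mixing]])
    then show "continuous_map (subtopology law_topology central_pf) euclideanreal (\<lambda>\<mu>. location \<mu> i)"
      by (simp add: o_def location_def)
  qed
  then show "continuous_map extreme_topology euclidean location" by (rule continuous_map_on_extreme)
  show "location \<in> topspace extreme_topology \<rightarrow> nabla"
    unfolding topspace_extreme extreme_laws_pf by (auto simp: location_point_law)
qed

lemma point_law_measurable:
  assumes "\<rho> \<in> nabla_probs" shows "point_law \<in> measurable \<rho> (borel_of extreme_topology)"
  using measurable_borel_of_continuous_map[OF point_law_map]
  measurable_cong_sets[OF prob_measuresD(2)[OF assms] refl] by blast

lemma cont_affine_law:
  assumes "cont_affine path_topology central_pf \<phi>"
  shows "continuous_on pf_harmonics (\<lambda>h. \<phi> (law h))"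
    "h \<in> pf_harmonics \<Longrightarrow> h' \<in> pf_harmonics \<Longrightarrow> c \<in> {0..1} \<Longrightarrow>
      \<phi> (law (\<lambda>t. (1 - c) * h t + c * h' t)) = (1 - c) * \<phi> (law h) + c * \<phi> (law h')"
proof -
  have "continuous_map (top_of_set pf_harmonics) euclideanreal (\<phi> \<circ> law)"
    using assms unfolding cont_affine_def by (intro continuous_map_compose[OF law_map]) blast
  then show "continuous_on pf_harmonics (\<lambda>h. \<phi> (law h))" by (simp add: o_def)
  show "h \<in> pf_harmonics \<Longrightarrow> h' \<in> pf_harmonics \<Longrightarrow> c \<in> {0..1} \<Longrightarrow>
      \<phi> (law (\<lambda>t. (1 - c) * h t + c * h' t)) = (1 - c) * \<phi> (law h) + c * \<phi> (law h')"
    using assms law_pf(1) by (simp add: cont_affine_def law_mix)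
qed

lemma cont_affine_tree_density: "cont_affine path_topology central_pf (\<lambda>\<mu>. tree_density \<mu> t)"
  unfolding cont_affine_def
proof (intro conjI ballI)
  have "continuous_map euclidean euclideanreal (\<lambda>h::rtree \<Rightarrow> real. h t)" by (simp add: continuous_on_coordinate)
  from continuous_map_compose[OF continuous_map_tree_density this]
  show "continuous_map (subtopology law_topology central_pf) euclideanreal (\<lambda>\<mu>. tree_density \<mu> t)" by (simp add: o_def)
qed (simp add: central_mix(2) central_pfD(1))

text \<open>A continuous affine function of the law is one of its harmonic function, to which
  \<open>integral_affine\<close> applies; the transport by \<open>point_law\<close> is a change of
  variables.\<close>

lemma barycentre_distr:
  assumes \<mu>: "\<mu> \<in> central_pf"
  shows "barycentre path_topology central_pf (distr (mixing (tree_density \<mu>)) (borel_of extreme_topology) point_law) \<mu>"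
  unfolding barycentre_def
proof (intro allI impI)
  let ?\<rho> = "mixing (tree_density \<mu>)"
  note \<rho> = mixing[OF central_pfD(2)[OF \<mu>]]
  fix \<phi> assume \<phi>: "cont_affine path_topology central_pf \<phi>"
  note pm = point_law_measurable[OF \<rho>(1)] and c = cont_affine_law[OF \<phi>]
  have m: "\<phi> \<in> borel_measurable (borel_of extreme_topology)"
    using \<phi> unfolding cont_affine_def by (intro borel_measurable_continuous_map continuous_map_on_extreme) blast
  have "continuous_on nabla (\<lambda>p. \<phi> (law (psi_basis p)))" by (rule continuous_on_affine_psi[OF c(1)]) (rule c(2))
  then have "integrable ?\<rho> (\<lambda>p. \<phi> (point_law p))" by (rule nabla_integrable[OF \<rho>(1)])
  moreover have "(\<integral>p. \<phi> (point_law p) \<partial>?\<rho>) = \<phi> (law (mixture ?\<rho>))"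
    by (rule integral_affine[OF \<rho>(1) c(1)]) (rule c(2))
  ultimately show "has_bochner_integral (distr ?\<rho> (borel_of extreme_topology) point_law) \<phi> (\<phi> \<mu>)"
    unfolding has_bochner_integral_iff integrable_distr_eq[OF pm m] integral_distr[OF pm m] \<rho>(2) central_pfD(3)[OF \<mu>] by blast
qed

text \<open>Each tree density is a continuous affine test function. These alone force the image of
  \<open>Q\<close> under \<open>location\<close> to have the mixture
  \<open>tree_density \<mu>\<close>, which determines it, and \<open>point_law\<close> carries it
  back to \<open>Q\<close>.\<close>

lemma barycentre_unique:
  assumes \<mu>: "\<mu> \<in> central_pf" and Q: "Q \<in> prob_measures extreme_topology"
    and b: "barycentre path_topology central_pf Q \<mu>"
  shows "Q = distr (mixing (tree_density \<mu>)) (borel_of extreme_topology) point_law"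
proof -
  interpret prob_space Q by (rule prob_measuresD(1)[OF Q])
  note sQ = prob_measuresD(2)[OF Q]
  have spQ: "space Q = extreme_laws central_pf" using prob_measuresD(3)[OF Q] topspace_extreme by simp
  let ?\<rho> = "distr Q (borel_of (top_of_set nabla)) location"
  have lm: "location \<in> measurable Q (borel_of (top_of_set nabla))"
    using measurable_borel_of_continuous_map[OF location_map] measurable_cong_sets[OF sQ refl] by blast
  have \<rho>: "?\<rho> \<in> nabla_probs" using prob_space_distr[OF lm] by (simp add: prob_measures_def)
  have "mixture ?\<rho> t = tree_density \<mu> t" for t
  proof -
    have "(\<lambda>p. psi_basis p t) \<in> borel_measurable (borel_of (top_of_set nabla))"
      by (rule borel_measurable_continuous_map) (simp add: continuous_on_psi_basis)
    then have "mixture ?\<rho> t = (\<integral>\<nu>. psi_basis (location \<nu>) t \<partial>Q)"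
      unfolding mixture_def by (rule integral_distr[OF lm])
    also have "\<dots> = (\<integral>\<nu>. tree_density \<nu> t \<partial>Q)"
      by (rule Bochner_Integration.integral_cong)
        (auto simp: spQ extreme_laws_pf location_point_law law_pf(2) psi_basis_pf)
    also have "\<dots> = tree_density \<mu> t"
      by (rule has_bochner_integral_integral_eq[OF mp[OF spec[OF b[unfolded barycentre_def]] cont_affine_tree_density]])
    finally show ?thesis .
  qed
  then have e: "mixture ?\<rho> = tree_density \<mu>" by (rule ext)
  have "distr ?\<rho> (borel_of extreme_topology) point_law = distr Q (borel_of extreme_topology) (point_law \<circ> location)"
    by (rule distr_distr[OF measurable_borel_of_continuous_map[OF point_law_map] lm])
  also have "\<dots> = distr Q Q (\<lambda>\<nu>. \<nu>)"
    by (rule distr_cong) (auto simp: sQ spQ extreme_laws_pf location_point_law)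
  also have "\<dots> = Q" by (rule distr_id)
  finally show ?thesis unfolding mixing_eq[OF \<rho>, unfolded e] by (rule sym)
qed

lemma bauer_simplex_pf: "bauer_simplex path_topology central_pf"
  unfolding bauer_simplex_def
proof (intro conjI ballI)
  have img: "law ` pf_harmonics = central_pf"
  proof (intro equalityI subsetI)
    fix \<mu> assume "\<mu> \<in> central_pf"
    then show "\<mu> \<in> law ` pf_harmonics" using central_pfD(2,3) by (metis image_eqI)
  qed (auto simp: law_pf)
  have lc: "continuous_map (top_of_set pf_harmonics) law_topology law"
    by (rule continuous_map_into_fulltopology[OF law_map])
  have "compactin (top_of_set pf_harmonics) pf_harmonics"
    using compact_pf_harmonics by (simp add: compactin_subtopology)
  from image_compactin[OF this lc] show "compactin law_topology central_pf" unfolding img .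
  show "convex_laws central_pf" unfolding convex_laws_def using central_pf_mix by blast
  \<comment> \<open>The extreme laws are the preimage of a compact, hence closed, set of harmonic
    functions under a continuous map.\<close>
  have "Hausdorff_space (euclidean :: (rtree \<Rightarrow> real) topology)"
    by (subst euclidean_product_topology[symmetric]) (simp add: Hausdorff_space_product_topology)
  moreover have "compactin euclidean (psi_basis ` nabla)"
    using compact_continuous_image[OF _ compact_nabla, of psi_basis] psi_basis_map by simp
  ultimately have "closedin euclidean (psi_basis ` nabla)" by (rule compactin_imp_closedin)
  from closedin_continuous_map_preimage[OF continuous_map_tree_density this, of central_pf]
  have "closedin (subtopology law_topology central_pf) {\<mu> \<in> topspace (subtopology law_topology central_pf). tree_density \<mu> \<in> psi_basis ` nabla}" .
  moreover have "{\<mu> \<in> topspace (subtopology law_topology central_pf). tree_density \<mu> \<in> psi_basis ` nabla} = point_law ` nabla" (is "?A = ?B")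
  proof (intro equalityI subsetI)
    fix \<mu> assume "\<mu> \<in> ?A"
    then obtain p where p: "p \<in> nabla" "tree_density \<mu> = psi_basis p" "\<mu> \<in> central_pf" by auto
    then show "\<mu> \<in> ?B" using central_pfD(3)[OF p(3)] by auto
  next
    fix \<mu> assume "\<mu> \<in> ?B"
    then obtain p where p: "p \<in> nabla" "\<mu> = point_law p" by blast
    have "\<mu> \<in> central_pf" unfolding p(2) by (rule law_pf(1)[OF psi_basis_pf[OF p(1)]])
    then show "\<mu> \<in> ?A" using p central_pfD(1)[of \<mu>] law_pf(2)[OF psi_basis_pf[OF p(1)]] by (auto simp: central_measures_def)
  qed
  ultimately show "closedin (subtopology law_topology central_pf) (extreme_laws central_pf)" unfolding extreme_laws_pf by simp
  fix \<mu> assume \<mu>: "\<mu> \<in> central_pf"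
  note \<rho> = mixing[OF central_pfD(2)[OF \<mu>]]
  interpret prob_space "mixing (tree_density \<mu>)" by (rule nabla_probsD(1)[OF \<rho>(1)])
  show "\<exists>!Q. Q \<in> prob_measures extreme_topology \<and> barycentre path_topology central_pf Q \<mu>"
  proof (rule ex1I)
    show "distr (mixing (tree_density \<mu>)) (borel_of extreme_topology) point_law \<in> prob_measures extreme_topology \<and>
      barycentre path_topology central_pf (distr (mixing (tree_density \<mu>)) (borel_of extreme_topology) point_law) \<mu>"
      using prob_space_distr[OF point_law_measurable[OF \<rho>(1)]] barycentre_distr[OF \<mu>] by (simp add: prob_measures_def)
  qed (use barycentre_unique[OF \<mu>] in blast)
qed

lemma central_law_psi: "central_law (psi p) = point_law p"
  by (simp add: law_def psi_eq_lin_ext)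

theorem theoremB:
  shows "(\<forall>L. pieri_state L \<longrightarrow>
            ((\<forall>m\<ge>3. chain_identity L m) \<longleftrightarrow> (\<forall>x. L (x \<circledast> \<F> \<tau>) = L x)) \<and>
            ((\<forall>m\<ge>3. chain_identity L m) \<longleftrightarrow> (\<forall>x y. L (x \<circledast> y) = L (y \<circledast> x))) \<and>
            ((\<forall>m\<ge>3. chain_identity L m) \<longleftrightarrow> (\<forall>x\<in>I_pf. L x = 0)) \<and>
            ((\<forall>m\<ge>3. chain_identity L m) \<longleftrightarrow> (\<exists>!\<rho>. nabla_representing L \<rho>)))
       \<and> central_law ` {L. pieri_state L \<and> (\<forall>m\<ge>3. chain_identity L m)} = central_pf
       \<and> exposed_face path_topology central_measures central_pf
       \<and> central_pf \<subset> central_measures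
       \<and> bauer_simplex path_topology central_pf
       \<and> affinely_homeomorphic path_topology central_pf
            (top_of_set nabla) (prob_measures (top_of_set nabla))
       \<and> extreme_laws central_pf = (\<lambda>p. central_law (psi p)) ` nabla
       \<and> (\<exists>\<phi>. exposes path_topology central_measures \<phi> central_pf \<and>
            (\<forall>L. pieri_state L \<longrightarrow>
               ((\<lambda>m. (1 / 2) ^ m *
                   L (\<F> \<tau> \<circledast> \<F> (chain_tree m) - \<F> (chain_tree m) \<circledast> \<F> \<tau>))
                 has_sum \<phi> (central_law L)) {3..}))
       \<and> (\<forall>m\<ge>3. \<exists>L. pieri_state L \<and>
            (\<forall>k\<ge>3. k \<noteq> m \<longrightarrow> chain_identity L k) \<and> \<not> chain_identity L m)"
proof (intro conjI allI impI)
  show "exposed_face path_topology central_measures central_pf"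
    unfolding exposed_face_def using exposes_pf by blast
  show "extreme_laws central_pf = (\<lambda>p. central_law (psi p)) ` nabla"
    unfolding central_law_psi by (rule extreme_laws_pf)
  show "\<exists>\<phi>. exposes path_topology central_measures \<phi> central_pf \<and>
    (\<forall>L. pieri_state L \<longrightarrow> ((\<lambda>m. (1 / 2) ^ m * L (\<F> \<tau> \<circledast> \<F> (chain_tree m) - \<F> (chain_tree m) \<circledast> \<F> \<tau>))
      has_sum \<phi> (central_law L)) {3..})"
    using exposes_pf has_sum_total_defect by blast
  show "\<exists>L. pieri_state L \<and> (\<forall>k\<ge>3. k \<noteq> m \<longrightarrow> chain_identity L k) \<and> \<not> chain_identity L m" if "m \<ge> 3" for m
    using ex_single_chain_violation[OF that] .
qed (rule chain_identities_iff_right_pieri chain_identities_iff_tracial chain_identities_iff_vanish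
  chain_identities_iff_mixture central_laws_of_chain_identities central_pf_proper bauer_simplex_pf
  affinely_homeomorphic_pf | assumption)+

end
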